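(* Let $\Psi\in\mathcal B_0$ be strictly increasing and satisfy the weak lower scaling property with parameters $\underline\mu>0$, $\underline c\in(0,1]$, $\underline\theta\ge0$. Let $V\in L^\infty(\mathbb R^d)$ and let $\mathcal D\subset\mathbb R^d$ be a bounded domain with regular boundary for which there exists a decreasing sequence of bounded domains $(\mathcal D_n)_{n\ge1}$ with regular boundary such that $\overline{\mathcal D_{n+1}}\subset\mathcal D_n$ for all $n$ and $\bigcap_{n\ge1}\mathcal D_n=\overline{\mathcal D}$. Let $\Lambda(s)=\lambda^*_{sV}$ be the principal eigenvalue of $H^{\mathcal D,sV}$, and suppose that $\lambda^*=\Lambda(1)>0$. Let $\varrho^*=\inf\{s\ge1:\Lambda(s)\le0\}$ and $1<\varrho<\varrho^*$. Let $p\ge1$ with $p>\frac{d}{2\underline\mu}$ and $p^*=\frac{\varrho p}{\varrho-1}$. Then there exists a constant $C=C(p,\varrho,d,\Psi,\mathcal D,V)$ such that for every $f\in L^{p^*}(\mathcal D)$ and every bounded weak sub-solution $\varphi$ of $$H^{\mathcal D,V}\varphi\le f\ \text{ in }\mathcal D,\qquad\varphi=0\ \text{ in }\mathcal D^c,$$ we have $$\sup_{\mathcal D}\varphi^+\le C\,\|f\|_{L^{p^*}(\mathcal D)}.$$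
   Context: $\mathcal B_0$ is the set of Bernstein functions $\Psi\in C^\infty((0,\infty))$ with $\Psi\ge0$, $(-1)^n\Psi^{(n)}\le0$ for all integers $n\ge1$, and $\lim_{u\downarrow0}\Psi(u)=0$. Weak lower scaling with parameters $\underline\mu>0,\underline c\in(0,1],\underline\theta\ge0$: $\Psi(\gamma u)\ge\underline c\,\gamma^{\underline\mu}\Psi(u)$ for all $u>\underline\theta$, $\gamma\ge1$. $(X_t)_{t\ge0}$ is the subordinate Brownian motion $X_t=B_{S_t}$ in $\mathbb R^d$, where $B$ is $d$-dimensional Brownian motion with $\mathbb E[e^{i\xi\cdot B_t}]=e^{-t|\xi|^2}$ and $S$ is an independent subordinator with $\mathbb E[e^{-uS_t}]=e^{-t\Psi(u)}$; $X$ is a Lévy process with generator $-\Psi(-\Delta)$. $\mathbb P^x,\mathbb E^x$ refer to $X$ started at $x$. For a domain $\mathcal D$, $\tau_{\mathcal D}=\inf\{t>0: X_t\notin\mathcal D\}$; its boundary is regular if $\mathbb P^z(\tau_{\mathcal D}=0)=1$ for every $z\in\partial\mathcal D$. For bounded $W$, $H^{\mathcal D,W}=\Psi(-\Delta)+W$ on $\mathcal D$ with Dirichlet exterior condition: $-H^{\mathcal D,W}$ generates the self-adjoint, strongly continuous semigroup $T_t^{\mathcal D,W}f(x)=\mathbb E^x[e^{-\int_0^tW(X_s)ds}f(X_t)\mathbf 1_{\{t<\tau_{\mathcal D}\}}]$ on $L^2(\mathcal D)$, Hilbert–Schmidt for $t>0$. The principal eigenvalue $\lambda^*_W$ is the lowest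 eigenvalue of $H^{\mathcal D,W}$, i.e. $e^{-\lambda^*_Wt}=\max\{\langle T_t^{\mathcal D,W}\xi,\xi\rangle:\|\xi\|_{L^2(\mathcal D)}=1\}$. A weak sub-solution of $H^{\mathcal D,V}\varphi\le f$ in $\mathcal D$ is $\varphi\in C(\mathbb R^d)$ such that for every $t>0$, $x\in\mathcal D$, $$\varphi(x)\le\mathbb E^x\big[e^{-\int_0^{t\wedge\tau_{\mathcal D}}V(X_s)ds}\varphi(X_{t\wedge\tau_{\mathcal D}})\big]+\mathbb E^x\Big[\int_0^{t\wedge\tau_{\mathcal D}}e^{-\int_0^sV(X_r)dr}f(X_s)\,ds\Big].$$ $\varphi^+=\max(\varphi,0)$; $\mathcal D^c=\mathbb R^d\setminus\mathcal D$; $\inf\emptyset=\infty$. *)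

theory Defs
  imports "HOL-Probability.Probability"
begin

text \<open>
  The class of Bernstein functions vanishing at the origin. Only the values on
  \<open>(0, \<infinity>)\<close> matter.
\<close>

definition bernstein0 :: "(real \<Rightarrow> real) \<Rightarrow> bool" where
  "bernstein0 \<Psi> \<longleftrightarrow>
     (\<forall>n. \<forall>u>0. (deriv ^^ n) \<Psi> differentiable (at u)) \<and>
     (\<forall>u>0. \<Psi> u \<ge> 0) \<and>
     (\<forall>n\<ge>1. \<forall>u>0. (-1) ^ n * (deriv ^^ n) \<Psi> u \<le> 0) \<and>
     (\<Psi> \<longlongrightarrow> 0) (at_right 0)"

definition weak_lower_scaling :: "real \<Rightarrow> real \<Rightarrow> real \<Rightarrow> (real \<Rightarrow> real) \<Rightarrow> bool" where
  "weak_lower_scaling \<mu> c \<theta> \<Psi> \<longleftrightarrow>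
     (\<forall>u>\<theta>. \<forall>\<gamma>\<ge>1. \<Psi> (\<gamma> * u) \<ge> c * \<gamma> powr \<mu> * \<Psi> u)"

definition cadlag :: "(real \<Rightarrow> 'b::t2_space) \<Rightarrow> bool" where
  "cadlag w \<longleftrightarrow>
     (\<forall>t\<ge>0. continuous (at_right t) w) \<and> (\<forall>t>0. \<exists>l. (w \<longlongrightarrow> l) (at_left t))"

text \<open>Processes are indexed by \<open>real\<close>; only times \<open>t \<ge> 0\<close> are relevant.\<close>

definition (in prob_space) levy_process :: "(real \<Rightarrow> 'a \<Rightarrow> 'b::euclidean_space) \<Rightarrow> bool" where
  "levy_process X \<longleftrightarrow>
     (\<forall>t\<ge>0. random_variable borel (X t)) \<and>
     (AE \<omega> in M. X 0 \<omega> = 0) \<and>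
     (\<forall>n. \<forall>t::nat \<Rightarrow> real. 0 \<le> t 0 \<and> (\<forall>i<n. t i \<le> t (Suc i)) \<longrightarrow>
        indep_vars (\<lambda>_. borel) (\<lambda>i \<omega>. X (t (Suc i)) \<omega> - X (t i) \<omega>) {..<n}) \<and>
     (\<forall>s\<ge>0. \<forall>h\<ge>0. distr M borel (\<lambda>\<omega>. X (s + h) \<omega> - X s \<omega>) = distr M borel (X h)) \<and>
     (AE \<omega> in M. cadlag (\<lambda>t. X t \<omega>))"

text \<open>
  The Brownian motion runs at twice the usual speed (its generator is the Laplacian),
  as its characteristic function shows. The probability space is complete, as in the
  usual conditions, so that exit times are measurable.
\<close>

locale subordinate_brownian_motion =
  prob_space M + complete_measure M for M :: "'w measure" +
  fixes \<Psi> :: "real \<Rightarrow> real"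
    and B :: "real \<Rightarrow> 'w \<Rightarrow> 'a::euclidean_space"
    and S :: "real \<Rightarrow> 'w \<Rightarrow> real"
    and X :: "real \<Rightarrow> 'w \<Rightarrow> 'a"
  assumes levy_B: "levy_process B"
    and continuous_B: "AE \<omega> in M. continuous_on {0..} (\<lambda>t. B t \<omega>)"
    and char_B: "\<And>t \<xi>. 0 \<le> t \<Longrightarrow>
          (CLINT \<omega>|M. iexp (\<xi> \<bullet> B t \<omega>)) = complex_of_real (exp (- t * (norm \<xi>)\<^sup>2))"
    and levy_S: "levy_process S"
    and mono_S: "AE \<omega> in M. mono_on {0..} (\<lambda>t. S t \<omega>)"
    and laplace_S: "\<And>t u. 0 \<le> t \<Longrightarrow> 0 < u \<Longrightarrow>
          (LINT \<omega>|M. exp (- u * S t \<omega>)) = exp (- t * \<Psi> u)"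
    and indep_B_S: "indep_set
          (sets (vimage_algebra (space M) (\<lambda>\<omega>. \<lambda>t\<in>{0..}. B t \<omega>) (Pi\<^sub>M {0..} (\<lambda>_. borel))))
          (sets (vimage_algebra (space M) (\<lambda>\<omega>. \<lambda>t\<in>{0..}. S t \<omega>) (Pi\<^sub>M {0..} (\<lambda>_. borel))))"
    and subordination: "\<And>t \<omega>. 0 \<le> t \<Longrightarrow> X t \<omega> = B (S t \<omega>) \<omega>"

text \<open>
  The law \<open>\<P>\<^sup>x\<close> of the process started at \<open>x\<close> is realised by translation: the
  expectation of \<open>F\<close> under \<open>\<P>\<^sup>x\<close> is the integral of \<open>F (path_from X x \<omega>)\<close>
  over \<open>M\<close>.
\<close>

definition path_from :: "(real \<Rightarrow> 'w \<Rightarrow> 'a::euclidean_space) \<Rightarrow> 'a \<Rightarrow> 'w \<Rightarrow> real \<Rightarrow> 'a" where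
  "path_from X x \<omega> t = x + X t \<omega>"

definition exit_time :: "'a set \<Rightarrow> (real \<Rightarrow> 'a) \<Rightarrow> ereal" where
  "exit_time D w = Inf (ereal ` {t. 0 < t \<and> w t \<notin> D})"

definition stopped_time :: "'a set \<Rightarrow> (real \<Rightarrow> 'a) \<Rightarrow> real \<Rightarrow> real" where
  "stopped_time D w t = real_of_ereal (min (ereal t) (exit_time D w))"

definition bounded_domain :: "'a::euclidean_space set \<Rightarrow> bool" where
  "bounded_domain D \<longleftrightarrow> open D \<and> connected D \<and> D \<noteq> {} \<and> bounded D"

definition regular_boundary ::
  "'w measure \<Rightarrow> (real \<Rightarrow> 'w \<Rightarrow> 'a::euclidean_space) \<Rightarrow> 'a set \<Rightarrow> bool" where
  "regular_boundary M X D \<longleftrightarrow>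
     (\<forall>z\<in>frontier D. \<P>(\<omega> in M. exit_time D (path_from X z \<omega>) = 0) = 1)"

definition exterior_approximable ::
  "'w measure \<Rightarrow> (real \<Rightarrow> 'w \<Rightarrow> 'a::euclidean_space) \<Rightarrow> 'a set \<Rightarrow> bool" where
  "exterior_approximable M X D \<longleftrightarrow>
     (\<exists>Dn :: nat \<Rightarrow> 'a set.
        (\<forall>n\<ge>1. bounded_domain (Dn n) \<and> regular_boundary M X (Dn n) \<and>
               closure (Dn (Suc n)) \<subseteq> Dn n) \<and>
        (\<Inter>n\<in>{1..}. Dn n) = closure D)"

text \<open>
  Elements of \<open>L\<^sup>p\<close> are represented by Borel functions, which every equivalence class
  contains. When \<open>X\<^sub>t\<close> has a density for every \<open>t > 0\<close> (which the weak lower scaling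
  of a strictly increasing \<open>\<Psi>\<close> ensures), the notions below do not depend on the choice
  of the representative.
\<close>

definition Lp :: "real \<Rightarrow> 'a::euclidean_space set \<Rightarrow> ('a \<Rightarrow> real) set" where
  "Lp p D = {f. set_borel_measurable lborel D f \<and>
                set_integrable lborel D (\<lambda>x. \<bar>f x\<bar> powr p)}"

definition Lp_norm :: "real \<Rightarrow> 'a::euclidean_space set \<Rightarrow> ('a \<Rightarrow> real) \<Rightarrow> real" where
  "Lp_norm p D f = (LINT x:D|lborel. \<bar>f x\<bar> powr p) powr (1 / p)"

definition Linfty :: "('a::euclidean_space \<Rightarrow> real) set" where
  "Linfty = {f \<in> borel_measurable borel. \<exists>K. AE x in lborel. \<bar>f x\<bar> \<le> K}"

definition fk_weight :: "('a \<Rightarrow> real) \<Rightarrow> (real \<Rightarrow> 'a) \<Rightarrow> real \<Rightarrow> real" where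
  "fk_weight W w t = exp (- (LINT s:{0..t}|lborel. W (w s)))"

definition fk_semigroup ::
  "'w measure \<Rightarrow> (real \<Rightarrow> 'w \<Rightarrow> 'a::euclidean_space) \<Rightarrow> 'a set \<Rightarrow> ('a \<Rightarrow> real) \<Rightarrow>
    real \<Rightarrow> ('a \<Rightarrow> real) \<Rightarrow> 'a \<Rightarrow> real" where
  "fk_semigroup M X D W t f x =
     (LINT \<omega>|M. fk_weight W (path_from X x \<omega>) t * f (path_from X x \<omega> t) *
                of_bool (ereal t < exit_time D (path_from X x \<omega>)))"

text \<open>
  The graph of the operator \<open>H = \<Psi>(-\<Delta>) + W\<close> on \<open>D\<close> with Dirichlet exterior
  condition: \<open>-H\<close> is the \<open>L\<^sup>2\<close>-generator of the killed Feynman-Kac semigroup, so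
  \<open>H \<xi>\<close> is the \<open>L\<^sup>2\<close>-limit of \<open>(\<xi> - T\<^sub>t \<xi>) / t\<close> as \<open>t\<close> decreases to 0.
\<close>

definition schroedinger_graph ::
  "'w measure \<Rightarrow> (real \<Rightarrow> 'w \<Rightarrow> 'a::euclidean_space) \<Rightarrow> 'a set \<Rightarrow> ('a \<Rightarrow> real) \<Rightarrow>
    (('a \<Rightarrow> real) \<times> ('a \<Rightarrow> real)) set" where
  "schroedinger_graph M X D W =
     {(\<xi>, \<eta>). \<xi> \<in> Lp 2 D \<and> \<eta> \<in> Lp 2 D \<and>
        ((\<lambda>t. Lp_norm 2 D (\<lambda>x. (\<xi> x - fk_semigroup M X D W t \<xi> x) / t - \<eta> x))
           \<longlongrightarrow> 0) (at_right 0)}"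

text \<open>
  The operator is self-adjoint and maps real functions to real functions, so real
  eigenvalues with real eigenfunctions suffice.
\<close>

definition schroedinger_eigenvalue ::
  "'w measure \<Rightarrow> (real \<Rightarrow> 'w \<Rightarrow> 'a::euclidean_space) \<Rightarrow> 'a set \<Rightarrow> ('a \<Rightarrow> real) \<Rightarrow>
    real \<Rightarrow> bool" where
  "schroedinger_eigenvalue M X D W \<kappa> \<longleftrightarrow>
     (\<exists>\<xi>. (\<xi>, \<lambda>x. \<kappa> * \<xi> x) \<in> schroedinger_graph M X D W \<and>
          \<not> (AE x in lborel. x \<in> D \<longrightarrow> \<xi> x = 0))"

definition principal_eigenvalue ::
  "'w measure \<Rightarrow> (real \<Rightarrow> 'w \<Rightarrow> 'a::euclidean_space) \<Rightarrow> 'a set \<Rightarrow> ('a \<Rightarrow> real) \<Rightarrow> real" where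
  "principal_eigenvalue M X D W = (LEAST \<kappa>. schroedinger_eigenvalue M X D W \<kappa>)"

definition weak_subsolution ::
  "'w measure \<Rightarrow> (real \<Rightarrow> 'w \<Rightarrow> 'a::euclidean_space) \<Rightarrow> 'a set \<Rightarrow> ('a \<Rightarrow> real) \<Rightarrow>
    ('a \<Rightarrow> real) \<Rightarrow> ('a \<Rightarrow> real) \<Rightarrow> bool" where
  "weak_subsolution M X D V f \<phi> \<longleftrightarrow>
     continuous_on UNIV \<phi> \<and>
     (\<forall>t>0. \<forall>x\<in>D.
        \<phi> x \<le>
          (LINT \<omega>|M. (let w = path_from X x \<omega>; T = stopped_time D w t
                     in fk_weight V w T * \<phi> (w T)))
        + (LINT \<omega>|M. (let w = path_from X x \<omega>; T = stopped_time D w t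
                     in (LINT s:{0..T}|lborel. fk_weight V w s * f (w s)))))"

end

theory Submission
  imports Defs "HOL-Real_Asymp.Real_Asymp"
begin

text \<open>The scaling condition makes \<open>exp (- t \<Psi>(|\<xi>|\<^sup>2))\<close> integrable, so \<open>X\<^sub>t\<close> has a density bounded by a
  constant times \<open>1 + t\<^sup>-\<^sup>a\<close> with \<open>a = d / (2 \<mu>)\<close>. Hence the killed Feynman-Kac semigroup is symmetric and maps
  \<open>L\<^sup>1(D)\<close> to bounded functions, its principal eigenvalue \<open>\<Lambda>\<close> is the exponential decay rate of \<open>\<langle>1, T\<^sub>t 1\<rangle>\<close>, and
  \<open>T\<^sub>t 1 \<le> A exp (- \<Lambda> t)\<close> pointwise. A sub-solution vanishing off \<open>D\<close> therefore satisfies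
  \<open>\<phi> x \<le> T\<^sub>t \<phi> x + \<integral>\<^sub>0\<^sup>\<infinity> T\<^sub>s |f| x ds\<close>, where the first term tends to 0 since \<open>\<Lambda> 1 > 0\<close>. Hoelder's inequality with
  exponents \<open>\<rho>\<close> and \<open>q = \<rho> / (\<rho> - 1)\<close>, followed by Jensen's inequality for the power \<open>p\<close>, bounds \<open>T\<^sub>s |f| x\<close> by
  \<open>(T\<^sub>s\<^sup>\<rho>\<^sup>V 1 x)\<^sup>1\<^sup>/\<^sup>\<rho>\<close> times \<open>(E |f(x + X\<^sub>s)|\<^sup>p\<^sup>')\<^sup>1\<^sup>/\<^sup>p\<^sup>'\<close>. The first factor decays exponentially because
  \<open>\<Lambda> \<rho> > 0\<close>, the second is at most \<open>C (1 + s\<^sup>-\<^sup>a\<^sup>/\<^sup>p\<^sup>') \<parallel>f\<parallel>\<close>, and \<open>a < p \<le> p'\<close> makes the time integral converge.\<close>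

section \<open>Densities from characteristic functions\<close>

text \<open>Symmetry is visible only in discrete time, where multiplication by a weight alternates
  with a symmetric transition operator. A grid detects departure from a closed set, because a
  right-continuous path stays in the open complement for a while; it can miss a single instant
  outside the open set \<open>D\<close>. Hence the operators are first built for compact subsets of
  \<open>D\<close>. The passage to \<open>D\<close> needs a surviving path to stay in one of these
  compact sets, which is where quasi-left-continuity enters: otherwise the path would jump at a time
  announced by earlier exits.

  No spectral theorem is used. With \<open>T\<close> symmetric, Cauchy-Schwarz makes the form
  \<open>\<langle>f, T t f\<rangle>\<close> log-convex in \<open>t\<close>, which yields sharp
  constants; the bound from integrable to bounded functions takes the place of compactness in
  producing an eigenfunction.

  Hoelder and Jensen are applied pointwise, as one Young-type inequality between quantities
  normalised by their expected bounds, so that weight and cost can be integrated separately.\<close>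

lemma lborel_prod_Basis:
  fixes f :: "'a::euclidean_space \<Rightarrow> real \<Rightarrow> complex"
  assumes int: "\<And>b. b \<in> Basis \<Longrightarrow> integrable lborel (f b)"
  shows "(LINT z|lborel. (\<Prod>b\<in>Basis. f b (z \<bullet> b))) = (\<Prod>b\<in>(Basis::'a set). integral\<^sup>L lborel (f b))"
proof -
  interpret product_sigma_finite "\<lambda>_::'a. lborel :: real measure"
    by standard
  have [measurable]: "f b \<in> borel_measurable borel" if "b \<in> Basis" for b
    using borel_measurable_integrable[OF int[OF that]] by simp
  have "(LINT z|lborel. (\<Prod>b\<in>Basis. f b (z \<bullet> b))) =
      (LINT g|(\<Pi>\<^sub>M b\<in>(Basis::'a set). lborel). (\<Prod>b\<in>Basis. f b ((\<Sum>b\<in>Basis. g b *\<^sub>R b) \<bullet> b)))"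
    by (subst lborel_eq, subst integral_distr) measurable
  also have "\<dots> = (LINT g|(\<Pi>\<^sub>M b\<in>(Basis::'a set). lborel). (\<Prod>b\<in>Basis. f b (g b)))"
    by (intro Bochner_Integration.integral_cong refl prod.cong) (simp_all add: inner_sum_left_Basis)
  also have "\<dots> = (\<Prod>b\<in>(Basis::'a set). integral\<^sup>L lborel (f b))"
    by (rule product_integral_prod) (use int in auto)
  finally show ?thesis .
qed

lemma nn_integral_lborel_affine:
  fixes f :: "'a::euclidean_space \<Rightarrow> ennreal" and t :: 'a
  assumes [measurable]: "f \<in> borel_measurable borel" and c: "c \<noteq> 0"
  shows "(\<integral>\<^sup>+x. f x \<partial>lborel) = ennreal (\<bar>c\<bar> ^ DIM('a)) * (\<integral>\<^sup>+x. f (t + c *\<^sub>R x) \<partial>lborel)"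
  by (subst lborel_affine[OF c, of t])
     (simp add: nn_integral_density nn_integral_distr nn_integral_cmult)

section \<open>Gaussian smoothing and characteristic functions\<close>

definition gauss_density :: "'a::euclidean_space \<Rightarrow> real" where
  "gauss_density z = (\<Prod>b\<in>Basis. std_normal_density (z \<bullet> b))"

definition gauss :: "'a::euclidean_space measure" where
  "gauss = density lborel (\<lambda>z. ennreal (gauss_density z))"

lemma gauss_density_eq:
  "gauss_density (z::'a::euclidean_space) = (1 / sqrt (2 * pi)) ^ DIM('a) * exp (- (norm z)\<^sup>2 / 2)"
proof -
  have "gauss_density z = (\<Prod>b\<in>(Basis::'a set). 1 / sqrt (2 * pi)) * (\<Prod>b\<in>(Basis::'a set). exp (- (z \<bullet> b)\<^sup>2 / 2))"
    unfolding gauss_density_def std_normal_density_def by (rule prod.distrib)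
  also have "(\<Prod>b\<in>(Basis::'a set). exp (- (z \<bullet> b)\<^sup>2 / 2)) = exp (\<Sum>b\<in>Basis. - (z \<bullet> b)\<^sup>2 / 2)"
    by (simp add: exp_sum)
  also have "(\<Sum>b\<in>Basis. - (z \<bullet> b)\<^sup>2 / 2) = - (norm z)\<^sup>2 / 2"
    by (simp add: norm_eq_sqrt_inner euclidean_inner[of z z] sum_divide_distrib[symmetric]
        sum_negf power2_eq_square sum_nonneg)
  finally show ?thesis by simp
qed

lemma gauss_density_nonneg: "0 \<le> gauss_density z"
  by (simp add: gauss_density_eq)

text \<open>A bound by 1 is crude but enough: in the inversion integral the Gaussian factor is
  simply discarded.\<close>

lemma gauss_density_le_1: "gauss_density (z::'a::euclidean_space) \<le> 1"
proof -
  have "1 \<le> sqrt (2 * pi)" using pi_ge_two by (simp add: real_le_rsqrt)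
  then have "(1 / sqrt (2 * pi)) ^ DIM('a) \<le> 1" by (intro power_le_one) auto
  moreover have "exp (- (norm z)\<^sup>2 / 2) \<le> 1" by simp
  ultimately show ?thesis unfolding gauss_density_eq by (intro mult_le_one) auto
qed

lemma gauss_density_measurable [measurable]: "gauss_density \<in> borel_measurable borel"
  unfolding gauss_density_def[abs_def] by measurable

lemma sets_gauss [measurable_cong, simp]: "sets gauss = sets borel" "space gauss = UNIV"
  by (auto simp: gauss_def)

lemma gauss_prob: "prob_space (gauss :: 'a::euclidean_space measure)"
proof
  have "emeasure (gauss :: 'a measure) UNIV = (\<integral>\<^sup>+z. (\<Prod>b\<in>(Basis::'a set). ennreal (std_normal_density (z \<bullet> b))) \<partial>lborel)"
    unfolding gauss_def by (subst emeasure_density) (auto simp: gauss_density_def prod_ennreal)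
  also have "\<dots> = (\<Prod>b\<in>(Basis::'a set). (\<integral>\<^sup>+x. ennreal (std_normal_density x) \<partial>lborel))"
    by (rule nn_integral_lborel_prod) auto
  also have "(\<integral>\<^sup>+x. ennreal (std_normal_density x) \<partial>lborel) = 1"
    using prob_space.emeasure_space_1[OF prob_space_normal_density[of 1 0]]
    by (simp add: emeasure_density)
  finally show "emeasure (gauss :: 'a measure) (space gauss) = 1" by simp
qed

lemma emeasure_gauss_UNIV: "emeasure (gauss :: 'a::euclidean_space measure) UNIV = 1"
  using prob_space.emeasure_space_1[OF gauss_prob[where 'a = 'a]] by simp

text \<open>Both sides factor over the basis, which reduces the claim to the characteristic function
  of the standard normal law on the line.\<close>

lemma gauss_char:
  fixes y :: "'a::euclidean_space"
  shows "(CLINT z|gauss. iexp (y \<bullet> z)) = complex_of_real (exp (- (norm y)\<^sup>2 / 2))"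
proof -
  have int: "integrable lborel (\<lambda>x. complex_of_real (std_normal_density x) * iexp ((y \<bullet> b) * x))" for b
    by (rule Bochner_Integration.integrable_bound[of _ std_normal_density])
       (auto simp: norm_mult)
  have one: "(CLINT x|lborel. complex_of_real (std_normal_density x) * iexp ((y \<bullet> b) * x)) = complex_of_real (exp (- (y \<bullet> b)\<^sup>2 / 2))" for b
  proof -
    have "char std_normal_distribution (y \<bullet> b) = complex_of_real (exp (- (y \<bullet> b)\<^sup>2 / 2))"
      by (simp add: char_std_normal_distribution)
    moreover have "char std_normal_distribution (y \<bullet> b) = (CLINT x|lborel. complex_of_real (std_normal_density x) * iexp ((y \<bullet> b) * x))"
      unfolding char_def by (subst integral_density) (auto simp: scaleR_conv_of_real)
    ultimately show ?thesis by simp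
  qed
  have "(CLINT z|gauss. iexp (y \<bullet> z)) = (CLINT z|lborel. complex_of_real (gauss_density z) * iexp (y \<bullet> z))"
    unfolding gauss_def by (subst integral_density) (auto simp: scaleR_conv_of_real gauss_density_nonneg)
  also have "\<dots> = (CLINT z|lborel. (\<Prod>b\<in>Basis. complex_of_real (std_normal_density (z \<bullet> b)) * iexp ((y \<bullet> b) * (z \<bullet> b))))"
  proof (intro Bochner_Integration.integral_cong refl)
    fix z :: 'a
    have "iexp (y \<bullet> z) = (\<Prod>b\<in>Basis. iexp ((y \<bullet> b) * (z \<bullet> b)))"
      by (subst exp_sum[symmetric]) (auto simp: euclidean_inner[of y z] sum_distrib_left)
    then show "complex_of_real (gauss_density z) * iexp (y \<bullet> z) =
        (\<Prod>b\<in>Basis. complex_of_real (std_normal_density (z \<bullet> b)) * iexp ((y \<bullet> b) * (z \<bullet> b)))"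
      by (simp add: gauss_density_def prod.distrib)
  qed
  also have "\<dots> = (\<Prod>b\<in>Basis. complex_of_real (exp (- (y \<bullet> b)\<^sup>2 / 2)))"
    unfolding lborel_prod_Basis[OF int] one ..
  also have "\<dots> = complex_of_real (exp (\<Sum>b\<in>Basis. - (y \<bullet> b)\<^sup>2 / 2))"
    by (simp only: exp_sum[OF finite_Basis] of_real_prod)
  also have "(\<Sum>b\<in>Basis. - (y \<bullet> b)\<^sup>2 / 2) = - (norm y)\<^sup>2 / 2"
    by (simp add: norm_eq_sqrt_inner euclidean_inner[of y y] sum_divide_distrib[symmetric]
        sum_negf power2_eq_square sum_nonneg)
  finally show ?thesis .
qed

text \<open>Parseval's relation: the Gaussian kernel is itself the characteristic function of
  \<open>gauss\<close>, evaluated at \<open>s *\<^sub>R (y - x)\<close>. Exchanging the integrals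
  leaves an expression in which \<open>\<mu>\<close> occurs only through its characteristic
  function.\<close>

lemma gauss_smoothing:
  fixes \<mu> :: "'a::euclidean_space measure"
  assumes "prob_space \<mu>" and [measurable_cong]: "sets \<mu> = sets borel"
  shows "complex_of_real (LINT x|\<mu>. exp (- (norm (s *\<^sub>R (y - x)))\<^sup>2 / 2)) =
     (CLINT z|gauss. iexp (s * (y \<bullet> z)) * (CLINT x|\<mu>. iexp ((- s *\<^sub>R z) \<bullet> x)))"
proof -
  interpret \<mu>: prob_space \<mu> by fact
  interpret g: prob_space "gauss :: 'a measure" by (rule gauss_prob)
  interpret P: pair_prob_space \<mu> "gauss :: 'a measure" ..
  have int: "integrable (\<mu> \<Otimes>\<^sub>M gauss) (\<lambda>(x, z). iexp ((s *\<^sub>R (y - x)) \<bullet> z))"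
    by (rule P.integrable_const_bound[where B = 1]) (auto simp: case_prod_beta)
  have "complex_of_real (LINT x|\<mu>. exp (- (norm (s *\<^sub>R (y - x)))\<^sup>2 / 2)) = (CLINT x|\<mu>. CLINT z|gauss. iexp ((s *\<^sub>R (y - x)) \<bullet> z))"
    by (simp only: gauss_char integral_complex_of_real)
  also have "\<dots> = (CLINT z|gauss. CLINT x|\<mu>. iexp ((s *\<^sub>R (y - x)) \<bullet> z))"
    using P.Fubini_integral[OF int] by simp
  also have "\<dots> = (CLINT z|gauss. iexp (s * (y \<bullet> z)) * (CLINT x|\<mu>. iexp ((- s *\<^sub>R z) \<bullet> x)))"
  proof (intro Bochner_Integration.integral_cong refl)
    fix z
    have "iexp ((s *\<^sub>R (y - x)) \<bullet> z) = iexp (s * (y \<bullet> z)) * iexp ((- s *\<^sub>R z) \<bullet> x)" for x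
      by (simp add: exp_add[symmetric] algebra_simps inner_commute)
    then show "(CLINT x|\<mu>. iexp ((s *\<^sub>R (y - x)) \<bullet> z)) = iexp (s * (y \<bullet> z)) * (CLINT x|\<mu>. iexp ((- s *\<^sub>R z) \<bullet> x))"
      by simp
  qed
  finally show ?thesis .
qed

text \<open>The left side is an expectation under the law \<open>\<mu>\<close> perturbed by an
  independent Gaussian of scale \<open>1 / s\<close>. The substitution
  \<open>y = x + z /\<^sub>R s\<close> reveals the Lebesgue density of the perturbed law, whose
  essential part is the integral computed in \<open>gauss_smoothing\<close>.\<close>

lemma gauss_convolution:
  fixes \<mu> :: "'a::euclidean_space measure" and f :: "'a \<Rightarrow> ennreal"
  assumes "prob_space \<mu>" and [measurable_cong]: "sets \<mu> = sets borel"
    and [measurable]: "f \<in> borel_measurable borel" and s: "s > 0"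
  shows "(\<integral>\<^sup>+x. \<integral>\<^sup>+z. f (x + z /\<^sub>R s) \<partial>gauss \<partial>\<mu>) =
    ennreal ((s / sqrt (2 * pi)) ^ DIM('a)) * (\<integral>\<^sup>+y. f y * ennreal (LINT x|\<mu>. exp (- (norm (s *\<^sub>R (y - x)))\<^sup>2 / 2)) \<partial>lborel)"
proof -
  interpret \<mu>: prob_space \<mu> by fact
  interpret P: pair_sigma_finite "lborel :: 'a measure" \<mu> ..
  let ?c = "(1 / sqrt (2 * pi)) ^ DIM('a)"
  let ?e = "\<lambda>x y. ennreal (exp (- (norm (s *\<^sub>R (y - x)))\<^sup>2 / 2))"
  have inner: "(\<integral>\<^sup>+z. f (x + z /\<^sub>R s) \<partial>gauss) =
     ennreal (s ^ DIM('a)) * (\<integral>\<^sup>+y. f y * ennreal (gauss_density (s *\<^sub>R (y - x))) \<partial>lborel)" for x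
  proof -
    have "(\<integral>\<^sup>+z. f (x + z /\<^sub>R s) \<partial>gauss) = (\<integral>\<^sup>+z. f (x + z /\<^sub>R s) * ennreal (gauss_density z) \<partial>lborel)"
      unfolding gauss_def by (subst nn_integral_density) (auto simp: mult.commute)
    also have "\<dots> = ennreal (\<bar>s\<bar> ^ DIM('a)) * (\<integral>\<^sup>+y. f (x + (- s *\<^sub>R x + s *\<^sub>R y) /\<^sub>R s) * ennreal (gauss_density (- s *\<^sub>R x + s *\<^sub>R y)) \<partial>lborel)"
      using s by (intro nn_integral_lborel_affine) auto
    also have "\<dots> = ennreal (s ^ DIM('a)) * (\<integral>\<^sup>+y. f y * ennreal (gauss_density (s *\<^sub>R (y - x))) \<partial>lborel)"
      using s by (simp add: algebra_simps)
    finally show ?thesis .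
  qed
  have gd: "ennreal (gauss_density (s *\<^sub>R (y - x))) = ennreal ?c * ?e x y" for x y :: 'a
    by (simp add: gauss_density_eq ennreal_mult')
  have "(\<integral>\<^sup>+x. \<integral>\<^sup>+z. f (x + z /\<^sub>R s) \<partial>gauss \<partial>\<mu>) =
     ennreal (s ^ DIM('a)) * (\<integral>\<^sup>+x. \<integral>\<^sup>+y. ennreal ?c * (f y * ?e x y) \<partial>lborel \<partial>\<mu>)"
    unfolding inner gd by (subst nn_integral_cmult) (auto simp: mult_ac)
  also have "(\<integral>\<^sup>+x. \<integral>\<^sup>+y. ennreal ?c * (f y * ?e x y) \<partial>lborel \<partial>\<mu>) = ennreal ?c * (\<integral>\<^sup>+x. \<integral>\<^sup>+y. (f y * ?e x y) \<partial>lborel \<partial>\<mu>)"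
    by (subst nn_integral_cmult, simp)+ simp
  also have "(\<integral>\<^sup>+x. \<integral>\<^sup>+y. (f y * ?e x y) \<partial>lborel \<partial>\<mu>) = (\<integral>\<^sup>+y. \<integral>\<^sup>+x. (f y * ?e x y) \<partial>\<mu> \<partial>lborel)"
    by (rule P.Fubini') simp
  also have "\<dots> = (\<integral>\<^sup>+y. f y * ennreal (LINT x|\<mu>. exp (- (norm (s *\<^sub>R (y - x)))\<^sup>2 / 2)) \<partial>lborel)"
  proof (intro nn_integral_cong)
    fix y
    have "(\<integral>\<^sup>+x. ?e x y \<partial>\<mu>) = ennreal (LINT x|\<mu>. exp (- (norm (s *\<^sub>R (y - x)))\<^sup>2 / 2))"
      by (intro nn_integral_eq_integral \<mu>.integrable_const_bound[where B = 1]) auto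
    then show "(\<integral>\<^sup>+x. (f y * ?e x y) \<partial>\<mu>) = f y * ennreal (LINT x|\<mu>. exp (- (norm (s *\<^sub>R (y - x)))\<^sup>2 / 2))"
      by (subst nn_integral_cmult) auto
  qed
  also have "ennreal (s ^ DIM('a)) * (ennreal ?c * (\<integral>\<^sup>+y. f y * ennreal (LINT x|\<mu>. exp (- (norm (s *\<^sub>R (y - x)))\<^sup>2 / 2)) \<partial>lborel))
      = ennreal ((s / sqrt (2 * pi)) ^ DIM('a)) * (\<integral>\<^sup>+y. f y * ennreal (LINT x|\<mu>. exp (- (norm (s *\<^sub>R (y - x)))\<^sup>2 / 2)) \<partial>lborel)"
    using s by (simp add: mult.assoc[symmetric] ennreal_mult'[symmetric] power_mult_distrib[symmetric])
  finally show ?thesis .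
qed

text \<open>By \<open>gauss_smoothing\<close> and \<open>gauss_convolution\<close> the Gaussian
  perturbations of the two measures coincide at every scale. Letting the perturbation shrink gives
  equal integrals of continuous functions with values in \<open>[0, 1]\<close>, and these increase
  to the indicators of open sets.\<close>

lemma char_eq_imp_measure_eq:
  fixes \<mu> \<nu> :: "'a::euclidean_space measure"
  assumes "prob_space \<mu>" "prob_space \<nu>" and [measurable_cong]: "sets \<mu> = sets borel" "sets \<nu> = sets borel"
    and char: "\<And>\<xi>. (CLINT x|\<mu>. iexp (\<xi> \<bullet> x)) = (CLINT x|\<nu>. iexp (\<xi> \<bullet> x))"
  shows "\<mu> = \<nu>"
proof -
  interpret \<mu>: prob_space \<mu> by fact
  interpret \<nu>: prob_space \<nu> by fact
  interpret g: prob_space "gauss :: 'a measure" by (rule gauss_prob)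
  have sp: "space \<mu> = UNIV" "space \<nu> = UNIV"
    using assms(3,4)[THEN sets_eq_imp_space_eq] by auto
  have lim: "(\<lambda>n. \<integral>\<^sup>+x. \<integral>\<^sup>+z. f (x + z /\<^sub>R real (Suc n)) \<partial>gauss \<partial>\<mu>) \<longlonglongrightarrow> (\<integral>\<^sup>+x. f x \<partial>\<mu>)"
    if mu: "prob_space \<mu>" "sets \<mu> = sets borel" and f: "continuous_on UNIV f" "\<And>x. f x \<le> 1"
    for \<mu> :: "'a measure" and f :: "'a \<Rightarrow> ennreal"
  proof -
    interpret m: prob_space \<mu> by fact
    note [measurable_cong] = mu(2)
    have [measurable]: "f \<in> borel_measurable borel" using f(1) by (rule borel_measurable_continuous_onI)
    have ptw: "(\<lambda>n. f (x + z /\<^sub>R real (Suc n))) \<longlonglongrightarrow> f x" for x z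
    proof (rule continuous_on_tendsto_compose[OF f(1)])
      have "(\<lambda>n. x + (1 / real (Suc n)) *\<^sub>R z) \<longlonglongrightarrow> x + 0 *\<^sub>R z"
        by (intro tendsto_intros LIMSEQ_Suc lim_1_over_n)
      then show "(\<lambda>n. x + z /\<^sub>R real (Suc n)) \<longlonglongrightarrow> x" by (simp add: divide_inverse)
    qed auto
    have "(\<lambda>n. \<integral>\<^sup>+z. f (x + z /\<^sub>R real (Suc n)) \<partial>gauss) \<longlonglongrightarrow> (\<integral>\<^sup>+z. f x \<partial>(gauss::'a measure))" for x
      by (rule nn_integral_dominated_convergence[where w = "\<lambda>_. 1"]) (auto simp: f emeasure_gauss_UNIV simp del: of_nat_Suc intro: ptw)
    then have *: "(\<lambda>n. \<integral>\<^sup>+z. f (x + z /\<^sub>R real (Suc n)) \<partial>gauss) \<longlonglongrightarrow> f x" for x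
      by (simp add: emeasure_gauss_UNIV del: of_nat_Suc)
    show ?thesis
    proof (rule nn_integral_dominated_convergence[where w = "\<lambda>_. 1"])
      show "AE x in \<mu>. (\<integral>\<^sup>+z. f (x + z /\<^sub>R real (Suc n)) \<partial>gauss) \<le> 1" for n
      proof (rule AE_I2)
        fix x
        have "(\<integral>\<^sup>+z. f (x + z /\<^sub>R real (Suc n)) \<partial>gauss) \<le> (\<integral>\<^sup>+z. 1 \<partial>(gauss::'a measure))"
          by (intro nn_integral_mono f(2))
        then show "(\<integral>\<^sup>+z. f (x + z /\<^sub>R real (Suc n)) \<partial>gauss) \<le> 1"
          by (simp add: emeasure_gauss_UNIV)
      qed
    qed (auto simp: m.emeasure_space_1 simp del: of_nat_Suc intro: *)
  qed
  have h: "(LINT x|\<mu>. exp (- (norm (s *\<^sub>R (y - x)))\<^sup>2 / 2)) = (LINT x|\<nu>. exp (- (norm (s *\<^sub>R (y - x)))\<^sup>2 / 2))" for s y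
  proof -
    have "complex_of_real (LINT x|\<mu>. exp (- (norm (s *\<^sub>R (y - x)))\<^sup>2 / 2)) =
        complex_of_real (LINT x|\<nu>. exp (- (norm (s *\<^sub>R (y - x)))\<^sup>2 / 2))"
      by (rule trans[OF gauss_smoothing[OF assms(1,3), of s y, unfolded char]
          gauss_smoothing[OF assms(2,4), of s y, symmetric]])
    then show ?thesis by (simp only: of_real_eq_iff)
  qed
  have cont: "(\<integral>\<^sup>+x. f x \<partial>\<mu>) = (\<integral>\<^sup>+x. f x \<partial>\<nu>)"
    if f: "continuous_on UNIV f" "\<And>x. f x \<le> 1" for f :: "'a \<Rightarrow> ennreal"
  proof (rule LIMSEQ_unique[OF lim[OF assms(1,3) f]])
    have [measurable]: "f \<in> borel_measurable borel" using f(1) by (rule borel_measurable_continuous_onI)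
    have "(\<integral>\<^sup>+x. \<integral>\<^sup>+z. f (x + z /\<^sub>R real (Suc n)) \<partial>gauss \<partial>\<nu>) = (\<integral>\<^sup>+x. \<integral>\<^sup>+z. f (x + z /\<^sub>R real (Suc n)) \<partial>gauss \<partial>\<mu>)" for n
    proof -
      have pos: "real (Suc n) > 0" by simp
      show ?thesis
        unfolding gauss_convolution[OF assms(1,3) \<open>f \<in> borel_measurable borel\<close> pos]
          gauss_convolution[OF assms(2,4) \<open>f \<in> borel_measurable borel\<close> pos] h ..
    qed
    then show "(\<lambda>n. \<integral>\<^sup>+x. \<integral>\<^sup>+z. f (x + z /\<^sub>R real (Suc n)) \<partial>gauss \<partial>\<mu>) \<longlonglongrightarrow> (\<integral>\<^sup>+x. f x \<partial>\<nu>)"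
      using lim[OF assms(2,4) f] by simp
  qed
  have openeq: "emeasure \<mu> U = emeasure \<nu> U" if U: "open U" for U
  \<comment> \<open>\<open>infdist\<close> to the empty set is 0, so the approximation
    \<open>F\<close> below would vanish identically for \<open>U = UNIV\<close>.\<close>
  proof (cases "U = UNIV")
    case True
    then show ?thesis using \<mu>.emeasure_space_1 \<nu>.emeasure_space_1 unfolding sp by simp
  next
    case False
    define F where "F k x = ennreal (min 1 (real k * infdist x (- U)))" for k x
    have F: "continuous_on UNIV (F k)" "F k x \<le> 1" for k x
      unfolding F_def by (auto intro!: continuous_intros continuous_on_ennreal)
    have [measurable]: "F k \<in> borel_measurable borel" for k using F(1) by (rule borel_measurable_continuous_onI)
    have lim1: "(\<lambda>k. F k x) \<longlonglongrightarrow> indicator U x" for x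
    proof (cases "x \<in> U")
      case True
      then have pos: "infdist x (- U) > 0"
        using U False by (subst infdist_pos_not_in_closed) auto
      obtain k0 :: nat where k0: "1 / infdist x (- U) < real k0" using reals_Archimedean2 by auto
      have "F k x = 1" if "k \<ge> k0" for k
      proof -
        have "1 < real k0 * infdist x (- U)" using k0 pos by (simp add: field_simps)
        also have "\<dots> \<le> real k * infdist x (- U)" using that pos by (intro mult_right_mono) auto
        finally show ?thesis by (simp add: F_def)
      qed
      then have "\<forall>\<^sub>F k in sequentially. F k x = indicator U x"
        using True by (auto simp: eventually_sequentially)
      then show ?thesis by (rule tendsto_eventually)
    next
      case False
      then have "F k x = 0" for k by (simp add: F_def)
      then show ?thesis using False by simp
    qed
    have E: "(\<lambda>k. \<integral>\<^sup>+x. F k x \<partial>\<mu>) \<longlonglongrightarrow> emeasure \<mu> U" if mu: "prob_space \<mu>" "sets \<mu> = sets borel" for \<mu> :: "'a measure"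
    proof -
      interpret m: prob_space \<mu> by fact
      note [measurable_cong] = mu(2)
      have [measurable]: "U \<in> sets \<mu>" using U mu by auto
      have "(\<lambda>k. \<integral>\<^sup>+x. F k x \<partial>\<mu>) \<longlonglongrightarrow> (\<integral>\<^sup>+x. indicator U x \<partial>\<mu>)"
        by (rule nn_integral_dominated_convergence[where w = "\<lambda>_. 1"]) (auto simp: F lim1 m.emeasure_space_1)
      then show ?thesis by simp
    qed
    show ?thesis
      by (rule LIMSEQ_unique[OF E[OF assms(1,3)]]) (unfold cont[OF F], rule E[OF assms(2,4)])
  qed
  show ?thesis
  proof (rule measure_eqI_generator_eq[where E = "Collect open" and \<Omega> = UNIV and A = "\<lambda>_. UNIV"])
    show "Int_stable (Collect (open :: 'a set \<Rightarrow> bool))" by (auto simp: Int_stable_def)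
    show "sets \<mu> = sigma_sets UNIV (Collect open)" "sets \<nu> = sigma_sets UNIV (Collect open)"
      using assms(3,4) by (auto simp: borel_def)
  qed (use openeq \<mu>.emeasure_finite in auto)
qed

text \<open>Smoothing with a Gaussian bounds the density by the integral of the characteristic
  function; lower semicontinuity of indicators of open sets removes the smoothing.\<close>

lemma char_integrable_imp_bounded_density:
  fixes \<mu> :: "'a::euclidean_space measure" and \<phi> :: "'a \<Rightarrow> real"
  assumes "prob_space \<mu>" and [measurable_cong]: "sets \<mu> = sets borel"
    and char: "\<And>\<xi>. (CLINT x|\<mu>. iexp (\<xi> \<bullet> x)) = complex_of_real (\<phi> \<xi>)"
    and phi: "\<And>\<xi>. 0 \<le> \<phi> \<xi>" and [measurable]: "\<phi> \<in> borel_measurable borel"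
    and I: "(\<integral>\<^sup>+\<xi>. ennreal (\<phi> \<xi>) \<partial>lborel) \<le> ennreal I" "0 \<le> I"
    and A: "A \<in> sets borel"
  shows "emeasure \<mu> A \<le> ennreal I * emeasure lborel A"
proof -
  interpret \<mu>: prob_space \<mu> by fact
  interpret g: prob_space "gauss :: 'a measure" by (rule gauss_prob)
  interpret P: pair_prob_space \<mu> "gauss :: 'a measure" ..
  have sp: "space \<mu> = UNIV" using assms(2)[THEN sets_eq_imp_space_eq] by auto
  have h: "ennreal ((s / sqrt (2 * pi)) ^ DIM('a)) * ennreal (LINT x|\<mu>. exp (- (norm (s *\<^sub>R (y - x)))\<^sup>2 / 2)) \<le> ennreal I" if s: "s > 0" for s y
  proof -
    let ?h = "LINT x|\<mu>. exp (- (norm (s *\<^sub>R (y - x)))\<^sup>2 / 2)"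
    have "?h = norm (complex_of_real ?h)" by simp
    also have "\<dots> = norm (CLINT z|gauss. iexp (s * (y \<bullet> z)) * complex_of_real (\<phi> (- s *\<^sub>R z)))"
      unfolding gauss_smoothing[OF assms(1,2), of s y] char ..
    finally have he: "?h = norm (CLINT z|gauss. iexp (s * (y \<bullet> z)) * complex_of_real (\<phi> (- s *\<^sub>R z)))" .
    have "ennreal ?h \<le> (\<integral>\<^sup>+z. norm (iexp (s * (y \<bullet> z)) * complex_of_real (\<phi> (- s *\<^sub>R z))) \<partial>gauss)"
    \<comment> \<open>Without integrability the Bochner integral is 0 by convention, and the bound
      is trivial.\<close>
    proof (cases "integrable gauss (\<lambda>z. iexp (s * (y \<bullet> z)) * complex_of_real (\<phi> (- s *\<^sub>R z)))")
      case True
      then show ?thesis unfolding he by (rule integral_norm_bound_ennreal)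
    next
      case False
      then show ?thesis unfolding he by (simp add: not_integrable_integral_eq)
    qed
    also have "\<dots> = (\<integral>\<^sup>+z. ennreal (\<phi> (- s *\<^sub>R z)) \<partial>gauss)"
      using phi by (simp add: norm_mult)
    also have "\<dots> = (\<integral>\<^sup>+z. ennreal (gauss_density z) * ennreal (\<phi> (- s *\<^sub>R z)) \<partial>lborel)"
      unfolding gauss_def by (subst nn_integral_density) auto
    also have "\<dots> \<le> (\<integral>\<^sup>+z. 1 * ennreal (\<phi> (- s *\<^sub>R z)) \<partial>lborel)"
      by (intro nn_integral_mono mult_right_mono) (auto simp: gauss_density_le_1)
    finally have "ennreal (s ^ DIM('a)) * ennreal ?h \<le> ennreal (s ^ DIM('a)) * (\<integral>\<^sup>+z. ennreal (\<phi> (0 + (- s) *\<^sub>R z)) \<partial>lborel)"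
      by (intro mult_left_mono) auto
    also have "\<dots> = (\<integral>\<^sup>+\<xi>. ennreal (\<phi> \<xi>) \<partial>lborel)"
      using s by (subst nn_integral_lborel_affine[where c = "-s" and t = 0]) auto
    also note I(1)
    finally have 1: "ennreal (s ^ DIM('a)) * ennreal ?h \<le> ennreal I" .
    \<comment> \<open>The exact normalisation of the Gaussian is replaced by the larger factor
      \<open>s ^ DIM('a)\<close>, which is the Jacobian that cancelled in the substitution
      above.\<close>
    have "1 \<le> sqrt (2 * pi)" using pi_ge_two by (simp add: real_le_rsqrt)
    then have "s / sqrt (2 * pi) \<le> s" using s by (simp add: field_simps)
    then have "(s / sqrt (2 * pi)) ^ DIM('a) \<le> s ^ DIM('a)" using s by (intro power_mono) auto
    then have "ennreal ((s / sqrt (2 * pi)) ^ DIM('a)) * ennreal ?h \<le> ennreal (s ^ DIM('a)) * ennreal ?h"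
      by (intro mult_right_mono ennreal_leI) auto
    with 1 show ?thesis by (rule order_trans[rotated])
  qed
  have openle: "emeasure \<mu> U \<le> ennreal I * emeasure lborel U" if U: "open U" for U
  proof -
    have [measurable]: "U \<in> sets borel" using U by auto
    have le: "(\<integral>\<^sup>+x. \<integral>\<^sup>+z. indicator U (x + z /\<^sub>R s) \<partial>gauss \<partial>\<mu>) \<le> ennreal I * emeasure lborel U" if s: "s > 0" for s
    proof -
      have "(\<integral>\<^sup>+x. \<integral>\<^sup>+z. indicator U (x + z /\<^sub>R s) \<partial>gauss \<partial>\<mu>) =
          (\<integral>\<^sup>+y. ennreal ((s / sqrt (2 * pi)) ^ DIM('a)) * (indicator U y * ennreal (LINT x|\<mu>. exp (- (norm (s *\<^sub>R (y - x)))\<^sup>2 / 2))) \<partial>lborel)"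
        by (subst gauss_convolution[OF assms(1,2) _ s]) (auto simp: nn_integral_cmult)
      also have "\<dots> \<le> (\<integral>\<^sup>+y. ennreal I * indicator U y \<partial>lborel)"
        using h[OF s] by (intro nn_integral_mono) (auto simp: indicator_def)
      finally show ?thesis by (simp add: nn_integral_cmult)
    qed
    \<comment> \<open>A dummy Gaussian variable is introduced so that Fatou's lemma can be applied
      to the inner and then to the outer integral; openness of \<open>U\<close> supplies the
      pointwise inequality.\<close>
    have "emeasure \<mu> U = (\<integral>\<^sup>+x. \<integral>\<^sup>+z. indicator U x \<partial>(gauss :: 'a measure) \<partial>\<mu>)"
      by (simp add: emeasure_gauss_UNIV sp)
    also have "\<dots> \<le> (\<integral>\<^sup>+x. \<integral>\<^sup>+z. liminf (\<lambda>n. indicator U (x + z /\<^sub>R real (Suc n))) \<partial>gauss \<partial>\<mu>)"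
    proof (intro nn_integral_mono)
      fix x z :: 'a
      show "(indicator U x :: ennreal) \<le> liminf (\<lambda>n. indicator U (x + z /\<^sub>R real (Suc n)))"
      proof (cases "x \<in> U")
        case True
        have "(\<lambda>n. x + (1 / real (Suc n)) *\<^sub>R z) \<longlonglongrightarrow> x + 0 *\<^sub>R z"
          by (intro tendsto_intros LIMSEQ_Suc lim_1_over_n)
        then have "(\<lambda>n. x + z /\<^sub>R real (Suc n)) \<longlonglongrightarrow> x" by (simp add: divide_inverse)
        then have "\<forall>\<^sub>F n in sequentially. x + z /\<^sub>R real (Suc n) \<in> U"
          using U True by (rule topological_tendstoD)
        then have "\<forall>\<^sub>F n in sequentially. (1::ennreal) \<le> indicator U (x + z /\<^sub>R real (Suc n))"
          by eventually_elim simp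
        then show ?thesis using True by (simp add: Liminf_bounded)
      qed simp
    qed
    also have "\<dots> \<le> (\<integral>\<^sup>+x. liminf (\<lambda>n. \<integral>\<^sup>+z. indicator U (x + z /\<^sub>R real (Suc n)) \<partial>gauss) \<partial>\<mu>)"
      by (intro nn_integral_mono nn_integral_liminf) auto
    also have "\<dots> \<le> liminf (\<lambda>n. \<integral>\<^sup>+x. \<integral>\<^sup>+z. indicator U (x + z /\<^sub>R real (Suc n)) \<partial>gauss \<partial>\<mu>)"
      by (intro nn_integral_liminf) auto
    also have "\<dots> \<le> limsup (\<lambda>n. \<integral>\<^sup>+x. \<integral>\<^sup>+z. indicator U (x + z /\<^sub>R real (Suc n)) \<partial>gauss \<partial>\<mu>)"
      by (intro Liminf_le_Limsup) auto
    also have "\<dots> \<le> ennreal I * emeasure lborel U"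
      by (intro Limsup_bounded always_eventually allI le) auto
    finally show ?thesis .
  qed
  show ?thesis
  proof (rule ennreal_le_epsilon)
    fix e :: real assume e: "0 < e"
    \<comment> \<open>The denominator \<open>I + 1\<close> absorbs the factor \<open>I\<close> at
      the end and avoids division by 0 when \<open>I = 0\<close>.\<close>
    obtain U where U: "open U" "A \<subseteq> U" "emeasure lborel (U - A) < ennreal (e / (I + 1))"
      using outer_regular_lborel[OF A, of "e / (I + 1)"] e I by auto
    have "emeasure \<mu> A \<le> emeasure \<mu> U" using U A assms(2) by (intro emeasure_mono) auto
    also have "\<dots> \<le> ennreal I * emeasure lborel U" by (rule openle) fact
    also have "emeasure lborel U \<le> emeasure lborel A + emeasure lborel (U - A)"
      using emeasure_subadditive[of A lborel "U - A"] U A by (simp add: Un_absorb1)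
    also have "\<dots> \<le> emeasure lborel A + ennreal (e / (I + 1))"
      using U by (intro add_left_mono) auto
    finally have "emeasure \<mu> A \<le> ennreal I * emeasure lborel A + ennreal I * ennreal (e / (I + 1))"
      by (simp add: distrib_left mult_left_mono)
    also have "ennreal I * ennreal (e / (I + 1)) \<le> ennreal e"
      using e I by (simp add: ennreal_mult'[symmetric] field_simps)
    finally show "emeasure \<mu> A \<le> ennreal I * emeasure lborel A + ennreal e"
      by (simp add: add_left_mono)
  qed
qed


section \<open>Integrability of the characteristic function under lower scaling\<close>

lemma nn_integral_exp_powr_finite:
  assumes c: "0 < c" and \<mu>: "0 < \<mu>"
  shows "(\<integral>\<^sup>+\<xi>. ennreal (exp (- c * norm (\<xi>::'a::euclidean_space) powr (2 * \<mu>))) \<partial>lborel) < \<infinity>"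
proof -
  let ?d = "DIM('a)" and ?w = "unit_ball_vol (real DIM('a))"
  let ?g = "\<lambda>n. exp (- c * real n powr (2 * \<mu>))"
  \<comment> \<open>Comparison on the shell \<open>n \<le> norm \<xi> < n + 1\<close>. The whole
    ball of radius \<open>n + 1\<close> replaces the shell, since its volume is explicit and the
    overcount is harmless.\<close>
  have bound: "ennreal (exp (- c * norm \<xi> powr (2 * \<mu>))) \<le>
      (\<Sum>n. ennreal (?g n) * indicator (ball 0 (real n + 1)) \<xi>)" for \<xi> :: 'a
  proof -
    define n where "n = nat \<lfloor>norm \<xi>\<rfloor>"
    have n: "real n \<le> norm \<xi>" "norm \<xi> < real n + 1" 
    proof -
      have "real n = of_int \<lfloor>norm \<xi>\<rfloor>" by (simp add: n_def)
      then show "real n \<le> norm \<xi>" "norm \<xi> < real n + 1" by linarith+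
    qed
    define F where "F m = ennreal (?g m) * indicator (ball 0 (real m + 1)) \<xi>" for m
    have "ennreal (exp (- c * norm \<xi> powr (2 * \<mu>))) \<le> ennreal (?g n)"
      using n c \<mu> by (intro ennreal_leI) (auto intro!: powr_mono2)
    also have "\<dots> = (\<Sum>m\<in>{n}. F m)"
      using n by (simp add: F_def dist_norm)
    also have "\<dots> \<le> (\<Sum>n. F n)"
      by (rule sum_le_suminf) auto
    finally show ?thesis unfolding F_def .
  qed
  have "(\<integral>\<^sup>+\<xi>. ennreal (exp (- c * norm \<xi> powr (2 * \<mu>))) \<partial>(lborel :: 'a measure)) \<le>
      (\<integral>\<^sup>+\<xi>. (\<Sum>n. ennreal (?g n) * indicator (ball 0 (real n + 1)) \<xi>) \<partial>(lborel :: 'a measure))"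
    by (intro nn_integral_mono bound)
  also have "\<dots> = (\<Sum>n. ennreal (?g n) * emeasure lborel (ball (0::'a) (real n + 1)))"
  proof (subst nn_integral_suminf)
    show "(\<Sum>n. \<integral>\<^sup>+\<xi>. ennreal (?g n) * indicator (ball (0::'a) (real n + 1)) \<xi> \<partial>lborel) =
        (\<Sum>n. ennreal (?g n) * emeasure lborel (ball (0::'a) (real n + 1)))"
      by (intro suminf_cong nn_integral_cmult_indicator) simp
  qed (intro borel_measurable_times_ennreal borel_measurable_const borel_measurable_indicator, simp)
  also have "\<dots> = (\<Sum>n. ennreal (?g n * (?w * (real n + 1) ^ ?d)))"
  proof (rule suminf_cong)
    fix n
    have e: "emeasure lborel (ball (0::'a) (real n + 1)) = ennreal (?w * (real n + 1) ^ ?d)"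
      by (rule emeasure_ball) simp
    show "ennreal (?g n) * emeasure lborel (ball (0::'a) (real n + 1)) = ennreal (?g n * (?w * (real n + 1) ^ ?d))"
      unfolding e by (rule ennreal_mult'[symmetric]) simp
  qed
  also have "\<dots> < \<infinity>"
  proof -
    \<comment> \<open>Exponential decay beats the volume growth; the additional factor
      \<open>n powr 2\<close> leaves a comparison with the summable sequence
      \<open>1 / n ^ 2\<close>.\<close>
    have lim: "(\<lambda>n. exp (- c * real n powr (2 * \<mu>)) * ((real n + 1) powr real ?d) * (real n) powr 2) \<longlonglongrightarrow> 0"
      using c \<mu> by real_asymp
    then have "\<forall>\<^sub>F n in sequentially. exp (- c * real n powr (2 * \<mu>)) * ((real n + 1) powr real ?d) * (real n) powr 2 < 1"
      by (rule order_tendstoD) simp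
    then have ev: "\<forall>\<^sub>F n in sequentially. norm (?g n * (?w * (real n + 1) ^ ?d)) \<le> ?w * (inverse (real n ^ 2))"
      using eventually_gt_at_top[of 0]
    proof eventually_elim
      case (elim n)
      have "?g n * (real n + 1) ^ ?d \<le> inverse (real n ^ 2)"
        using elim by (simp add: powr_realpow field_simps)
      then have "?w * (?g n * (real n + 1) ^ ?d) \<le> ?w * inverse (real n ^ 2)"
        by (intro mult_left_mono) (auto simp: unit_ball_vol_nonneg)
      then show ?case by (simp add: mult_ac unit_ball_vol_nonneg abs_mult)
    qed
    have "summable (\<lambda>n. ?w * (inverse (real n ^ 2)))"
      by (intro summable_mult inverse_power_summable) auto
    then have "summable (\<lambda>n. ?g n * (?w * (real n + 1) ^ ?d))"
      using ev by (rule summable_comparison_test_ev[rotated])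
    then have "(\<Sum>n. ennreal (?g n * (?w * (real n + 1) ^ ?d))) = ennreal (\<Sum>n. ?g n * (?w * (real n + 1) ^ ?d))"
      by (rule suminf_ennreal2[rotated]) (intro mult_nonneg_nonneg; simp add: unit_ball_vol_nonneg)
    then show ?thesis by simp
  qed
  finally show ?thesis .
qed

text \<open>Scaling is anchored at a single point \<open>u0\<close> beyond \<open>\<theta>\<close>,
  with the factor \<open>\<gamma> = u / u0\<close>. Strict monotonicity makes
  \<open>\<Psi> u0\<close> positive, without which the lower bound would be empty.\<close>

lemma bernstein_scaling_growth:
  assumes mono: "strict_mono_on {0<..} \<Psi>" and nonneg: "\<And>u. 0 < u \<Longrightarrow> 0 \<le> \<Psi> u"
    and scaling: "0 < \<mu>" "c \<in> {0<..1}" "0 \<le> \<theta>" "weak_lower_scaling \<mu> c \<theta> \<Psi>"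
  shows "\<exists>c0>0. \<exists>u0>0. \<forall>u\<ge>u0. c0 * u powr \<mu> \<le> \<Psi> u"
proof (intro exI conjI allI impI)
  define u0 where "u0 = \<theta> + 1"
  have u0: "0 < u0" "\<theta> < u0" using scaling by (auto simp: u0_def)
  have "\<Psi> (u0 / 2) < \<Psi> u0"
    using u0 by (intro strict_mono_onD[OF mono]) auto
  then have pos: "\<Psi> u0 > 0" using nonneg[of "u0 / 2"] u0 by auto
  show "c * \<Psi> u0 * u0 powr (- \<mu>) > 0" using scaling pos u0 by auto
  show "u0 > 0" by fact
  fix u assume u: "u0 \<le> u"
  have "c * (u / u0) powr \<mu> * \<Psi> u0 \<le> \<Psi> ((u / u0) * u0)"
  proof -
    have "1 \<le> u / u0" using u u0 by simp
    then show ?thesis using scaling(4) u0(2) unfolding weak_lower_scaling_def by blast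
  qed
  then show "c * \<Psi> u0 * u0 powr (- \<mu>) * u powr \<mu> \<le> \<Psi> u"
    using u u0 by (simp add: powr_divide powr_minus field_simps)
qed

text \<open>On the ball of radius \<open>sqrt u0\<close> the integrand is at most 1, which costs a
  constant. Outside, the growth of \<open>\<Psi>\<close> makes the integrand a dilation of a fixed
  integrable function. \<open>\<psi>\<close> is a Borel version of \<open>\<Psi>\<close> with a
  controlled value at 0.\<close>

lemma nn_integral_exp_growth:
  fixes \<Psi> :: "real \<Rightarrow> real"
  assumes nonneg: "\<And>u. 0 < u \<Longrightarrow> 0 \<le> \<Psi> u" and \<mu>: "0 < \<mu>"
    and growth: "0 < c0" "0 < u0" "\<And>u. u0 \<le> u \<Longrightarrow> c0 * u powr \<mu> \<le> \<Psi> u"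
    and [measurable]: "\<psi> \<in> borel_measurable borel"
    and psi: "\<And>u. 0 < u \<Longrightarrow> \<psi> u = \<Psi> u" "0 \<le> \<psi> 0"
  shows "\<exists>A\<ge>0. \<forall>t>0. (\<integral>\<^sup>+\<xi>. ennreal (exp (- t * \<psi> ((norm (\<xi>::'a::euclidean_space))\<^sup>2))) \<partial>lborel)
      \<le> ennreal (A * (1 + t powr (- (real DIM('a) / (2 * \<mu>)))))"
proof -
  let ?d = "DIM('a)"
  define J where "J = (\<integral>\<^sup>+\<xi>. ennreal (exp (- c0 * norm (\<xi>::'a) powr (2 * \<mu>))) \<partial>lborel)"
  define b where "b = emeasure lborel (ball (0::'a) (sqrt u0))"
  have fin: "J < \<infinity>" "b < \<infinity>"
    unfolding J_def b_def using nn_integral_exp_powr_finite[OF growth(1) \<mu>] emeasure_lborel_ball_finite by auto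
  obtain j where j: "J = ennreal j" "0 \<le> j" using fin(1) by (cases J) auto
  obtain b' where b': "b = ennreal b'" "0 \<le> b'" using fin(2) by (cases b) auto
  define A where "A = j + b'"
  have psi0: "0 \<le> \<psi> ((norm \<xi>)\<^sup>2)" for \<xi> :: 'a
    using psi nonneg by (cases "\<xi> = 0") auto
  show ?thesis
  proof (intro exI[of _ A] conjI allI impI)
    show "0 \<le> A" using j b' by (simp add: A_def)
    fix t :: real assume t: "0 < t"
    \<comment> \<open>The dilation for which \<open>a powr (2 * \<mu>) = 1 / t\<close>; its Jacobian
      produces the exponent \<open>DIM('a) / (2 * \<mu>)\<close>.\<close>
    define a where "a = t powr (- (1 / (2 * \<mu>)))"
    have a: "a > 0" using t by (simp add: a_def)
    have "(\<integral>\<^sup>+\<xi>. ennreal (exp (- t * \<psi> ((norm (\<xi>::'a))\<^sup>2))) \<partial>lborel)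
      \<le> (\<integral>\<^sup>+\<xi>. indicator (ball 0 (sqrt u0)) \<xi> + ennreal (exp (- (t * c0) * norm (\<xi>::'a) powr (2 * \<mu>))) \<partial>lborel)"
    proof (intro nn_integral_mono)
      fix \<xi> :: 'a
      show "ennreal (exp (- t * \<psi> ((norm \<xi>)\<^sup>2))) \<le> indicator (ball 0 (sqrt u0)) \<xi> + ennreal (exp (- (t * c0) * norm \<xi> powr (2 * \<mu>)))"
      proof (cases "norm \<xi> < sqrt u0")
        case True
        have "ennreal (exp (- t * \<psi> ((norm \<xi>)\<^sup>2))) \<le> 1"
          using t psi0[of \<xi>] by (simp add: ennreal_le_1)
        also have "1 \<le> indicator (ball 0 (sqrt u0)) \<xi> + ennreal (exp (- (t * c0) * norm \<xi> powr (2 * \<mu>)))"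
          using True by (simp add: add_increasing2)
        finally show ?thesis .
      next
        case False
        then have "u0 \<le> (norm \<xi>)\<^sup>2"
          using growth(2) by (metis not_less real_le_rsqrt real_sqrt_le_iff real_sqrt_abs abs_norm_cancel sqrt_le_D)
        moreover have n: "0 < norm \<xi>" using False growth(2) by (metis not_less order_less_le_trans real_sqrt_gt_zero)
        ultimately have "c0 * ((norm \<xi>)\<^sup>2) powr \<mu> \<le> \<psi> ((norm \<xi>)\<^sup>2)"
          using growth(3) psi(1)[of "(norm \<xi>)\<^sup>2"] by simp
        moreover have "((norm \<xi>)\<^sup>2) powr \<mu> = norm \<xi> powr (2 * \<mu>)"
          using n by (simp add: powr_powr[symmetric] powr_realpow)
        ultimately have "c0 * norm \<xi> powr (2 * \<mu>) \<le> \<psi> ((norm \<xi>)\<^sup>2)" by simp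
        then have "t * (c0 * norm \<xi> powr (2 * \<mu>)) \<le> t * \<psi> ((norm \<xi>)\<^sup>2)"
          using t by (simp only: mult_left_mono less_imp_le)
        then have "ennreal (exp (- t * \<psi> ((norm \<xi>)\<^sup>2))) \<le> ennreal (exp (- (t * c0) * norm \<xi> powr (2 * \<mu>)))"
          by (intro ennreal_leI) (simp add: mult.assoc)
        then show ?thesis by (simp add: add_increasing)
      qed
    qed
    also have "\<dots> = b + (\<integral>\<^sup>+\<xi>. ennreal (exp (- (t * c0) * norm (\<xi>::'a) powr (2 * \<mu>))) \<partial>lborel)"
      unfolding b_def by (subst nn_integral_add) (auto intro!: borel_measurable_indicator)
    also have "(\<integral>\<^sup>+\<xi>. ennreal (exp (- (t * c0) * norm (\<xi>::'a) powr (2 * \<mu>))) \<partial>lborel)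
       = ennreal (\<bar>a\<bar> ^ ?d) * (\<integral>\<^sup>+\<xi>. ennreal (exp (- (t * c0) * norm (0 + a *\<^sub>R (\<xi>::'a)) powr (2 * \<mu>))) \<partial>lborel)"
      using a by (intro nn_integral_lborel_affine) auto
    also have "(\<integral>\<^sup>+\<xi>. ennreal (exp (- (t * c0) * norm (0 + a *\<^sub>R (\<xi>::'a)) powr (2 * \<mu>))) \<partial>lborel) = J"
      unfolding J_def
    proof (intro nn_integral_cong arg_cong[where f = ennreal] arg_cong[where f = exp])
      fix \<xi> :: 'a
      have "a powr (2 * \<mu>) = t powr (- (1 / (2 * \<mu>)) * (2 * \<mu>))"
        unfolding a_def by (rule powr_powr)
      also have "- (1 / (2 * \<mu>)) * (2 * \<mu>) = - 1" using \<mu> by simp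
      also have "t powr - 1 = 1 / t" using t by (simp add: powr_minus_divide)
      finally have "a powr (2 * \<mu>) = 1 / t" .
      then show "- (t * c0) * norm (0 + a *\<^sub>R \<xi>) powr (2 * \<mu>) = - c0 * norm \<xi> powr (2 * \<mu>)"
        using a t by (simp add: powr_mult)
    qed
    also have "\<bar>a\<bar> ^ ?d = t powr (- (real ?d / (2 * \<mu>)))"
      using a t by (simp add: a_def powr_realpow[symmetric] powr_powr)
    also have "b + ennreal (t powr (- (real ?d / (2 * \<mu>)))) * J
       = ennreal (b' + t powr (- (real ?d / (2 * \<mu>))) * j)"
      using j b' by (simp add: ennreal_mult' ennreal_plus)
    also have "\<dots> \<le> ennreal (A * (1 + t powr (- (real ?d / (2 * \<mu>)))))"
      using j b' by (intro ennreal_leI) (simp add: A_def algebra_simps)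
    finally show "(\<integral>\<^sup>+\<xi>. ennreal (exp (- t * \<psi> ((norm (\<xi>::'a))\<^sup>2))) \<partial>lborel)
      \<le> ennreal (A * (1 + t powr (- (real ?d / (2 * \<mu>)))))" .
  qed
qed

section \<open>Markov increments and subordination\<close>

abbreviation vecM :: "nat \<Rightarrow> (nat \<Rightarrow> 'b::euclidean_space) measure" where
  "vecM n \<equiv> Pi\<^sub>M {..n} (\<lambda>_. borel)"

context prob_space
begin

text \<open>Past and future in one statement: the values up to time \<open>u n\<close> are independent of the
  increments after it, and the latter are distributed like the process itself.\<close>

definition markov_increments :: "(real \<Rightarrow> 'a \<Rightarrow> 'b::euclidean_space) \<Rightarrow> bool" where
  "markov_increments Z \<longleftrightarrow>
     (\<forall>n m. \<forall>u v :: nat \<Rightarrow> real. u 0 = 0 \<longrightarrow> (\<forall>i<n. u i \<le> u (Suc i)) \<longrightarrow> v 0 = 0 \<longrightarrow> (\<forall>j<m. v j \<le> v (Suc j)) \<longrightarrow>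
       distr M (vecM n \<Otimes>\<^sub>M vecM m)
         (\<lambda>\<omega>. (\<lambda>i\<in>{..n}. Z (u i) \<omega>, \<lambda>j\<in>{..m}. Z (u n + v j) \<omega> - Z (u n) \<omega>)) =
       distr M (vecM n) (\<lambda>\<omega>. \<lambda>i\<in>{..n}. Z (u i) \<omega>) \<Otimes>\<^sub>M distr M (vecM m) (\<lambda>\<omega>. \<lambda>j\<in>{..m}. Z (v j) \<omega>))"

lemma markov_incrementsD:
  fixes Z :: "real \<Rightarrow> 'a \<Rightarrow> 'b::euclidean_space"
  assumes mk: "markov_increments Z"
    and u: "u 0 = 0" "\<And>i. i < n \<Longrightarrow> u i \<le> u (Suc i)" and v: "v 0 = 0" "\<And>j. j < m \<Longrightarrow> v j \<le> v (Suc j)"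
  shows "distr M (vecM n \<Otimes>\<^sub>M vecM m)
         (\<lambda>\<omega>. (\<lambda>i\<in>{..n}. Z (u i) \<omega>, \<lambda>j\<in>{..m}. Z (u n + v j) \<omega> - Z (u n) \<omega>)) =
       distr M (vecM n) (\<lambda>\<omega>. \<lambda>i\<in>{..n}. Z (u i) \<omega>) \<Otimes>\<^sub>M distr M (vecM m) (\<lambda>\<omega>. \<lambda>j\<in>{..m}. Z (v j) \<omega>)"
  by (rule mk[unfolded markov_increments_def, rule_format]) (fact u v)+

lemma distr_AE_cong:
  assumes "f \<in> measurable M N" "g \<in> measurable M N" "AE x in M. f x = g x"
  shows "distr M N f = distr M N g"
proof (rule measure_eqI)
  fix A assume A: "A \<in> sets (distr M N f)"
  have "emeasure M (f -` A \<inter> space M) = emeasure M (g -` A \<inter> space M)"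
    using assms A by (intro emeasure_eq_AE) (auto elim: AE_mp)
  then show "emeasure (distr M N f) A = emeasure (distr M N g) A"
    using assms A by (simp add: emeasure_distr)
qed simp

lemma mono_seq_nonneg:
  fixes u :: "nat \<Rightarrow> real"
  assumes "u 0 = 0" "\<And>i. i < n \<Longrightarrow> u i \<le> u (Suc i)" "i \<le> n"
  shows "0 \<le> u i"
  using assms(3)
proof (induction i)
  case (Suc i)
  then show ?case using assms(2)[of i] by simp
qed (use assms in simp)

text \<open>Concatenating the two time lists yields a single family of independent increments. Past
  and future are partial sums over disjoint blocks of it, hence independent; stationarity turns the
  law of the second block into that of the process started afresh.\<close>

lemma levy_process_markov:
  fixes Z :: "real \<Rightarrow> 'a \<Rightarrow> 'b::euclidean_space"
  assumes "levy_process Z"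
  shows "markov_increments Z"
  unfolding markov_increments_def
proof (intro allI impI)
  fix n m :: nat and u v :: "nat \<Rightarrow> real"
  assume u: "u 0 = 0" "\<forall>i<n. u i \<le> u (Suc i)" and v: "v 0 = 0" "\<forall>j<m. v j \<le> v (Suc j)"
  have rv: "\<And>t. 0 \<le> t \<Longrightarrow> random_variable borel (Z t)"
    and zero: "AE \<omega> in M. Z 0 \<omega> = 0"
    and ind: "\<And>n t. 0 \<le> t 0 \<Longrightarrow> (\<And>i. i < n \<Longrightarrow> t i \<le> t (Suc i)) \<Longrightarrow>
        indep_vars (\<lambda>_. borel) (\<lambda>i \<omega>. Z (t (Suc i)) \<omega> - Z (t i) \<omega>) {..<n}"
    and stat: "\<And>s h. 0 \<le> s \<Longrightarrow> 0 \<le> h \<Longrightarrow> distr M borel (\<lambda>\<omega>. Z (s + h) \<omega> - Z s \<omega>) = distr M borel (Z h)"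
    using assms unfolding levy_process_def by auto
  have u0: "0 \<le> u i" if "i \<le> n" for i using mono_seq_nonneg[of u n i] u that by auto
  have v0: "0 \<le> v i" if "i \<le> m" for i using mono_seq_nonneg[of v m i] v that by auto
  \<comment> \<open>At index \<open>n\<close> both branches would give \<open>u n\<close>, because
    \<open>v 0 = 0\<close>; from there on the increments are those of \<open>v\<close>.\<close>
  define t where "t i = (if i \<le> n then u i else u n + v (i - n))" for i
  have t_mono: "t i \<le> t (Suc i)" if "i < n + m" for i
  proof (cases "i < n")
    case True
    then show ?thesis using u by (simp add: t_def)
  next
    case False
    then have "i = n + (i - n)" "i - n < m" using that by auto
    then show ?thesis using v u by (cases "i = n") (auto simp: t_def Suc_diff_le)
  qed
  define \<xi> where "\<xi> i \<omega> = Z (t (Suc i)) \<omega> - Z (t i) \<omega>" for i \<omega>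
  define \<eta> where "\<eta> i \<omega> = Z (v (Suc i)) \<omega> - Z (v i) \<omega>" for i \<omega>
  have t0: "0 \<le> t 0" by (simp add: t_def u)
  have xi: "indep_vars (\<lambda>_. borel) \<xi> {..<n + m}"
    unfolding \<xi>_def[abs_def] by (rule ind) (use t0 t_mono in auto)
  have eta: "indep_vars (\<lambda>_. borel) \<eta> {..<m}"
    unfolding \<eta>_def[abs_def] by (rule ind) (use v in auto)
  define P :: "(nat \<Rightarrow> 'b) \<Rightarrow> nat \<Rightarrow> 'b" where "P x = (\<lambda>i\<in>{..n}. \<Sum>k<i. x k)" for x
  define R :: "(nat \<Rightarrow> 'b) \<Rightarrow> nat \<Rightarrow> 'b" where "R x = (\<lambda>j\<in>{..m}. \<Sum>k<j. x k)" for x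
  define Q :: "(nat \<Rightarrow> 'b) \<Rightarrow> nat \<Rightarrow> 'b" where "Q x = (\<lambda>j\<in>{..m}. \<Sum>k<j. x (n + k))" for x
  have P: "P \<in> measurable (Pi\<^sub>M {..<n} (\<lambda>_. borel)) (vecM n)"
    unfolding P_def by (intro measurable_restrict borel_measurable_sum measurable_component_singleton) auto
  have R: "R \<in> measurable (Pi\<^sub>M {..<m} (\<lambda>_. borel)) (vecM m)"
    unfolding R_def by (intro measurable_restrict borel_measurable_sum measurable_component_singleton) auto
  have Q: "Q \<in> measurable (Pi\<^sub>M {n..<n + m} (\<lambda>_. borel)) (vecM m)"
    unfolding Q_def by (intro measurable_restrict borel_measurable_sum measurable_component_singleton) auto
  let ?x1 = "\<lambda>\<omega>. restrict (\<lambda>i. \<xi> i \<omega>) {..<n}" and ?x2 = "\<lambda>\<omega>. restrict (\<lambda>i. \<xi> i \<omega>) {n..<n + m}"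
  have "indep_var (Pi\<^sub>M {..<n} (\<lambda>_. borel)) ?x1 (Pi\<^sub>M {n..<n + m} (\<lambda>_. borel)) ?x2"
    by (rule indep_var_restrict[OF xi]) auto
  then have "indep_var (vecM n) (P \<circ> ?x1) (vecM m) (Q \<circ> ?x2)"
    by (rule indep_var_compose[OF _ P Q])
  then have rvs: "random_variable (vecM n) (P \<circ> ?x1)" "random_variable (vecM m) (Q \<circ> ?x2)"
    and joint: "distr M (vecM n) (P \<circ> ?x1) \<Otimes>\<^sub>M distr M (vecM m) (Q \<circ> ?x2) =
      distr M (vecM n \<Otimes>\<^sub>M vecM m) (\<lambda>\<omega>. ((P \<circ> ?x1) \<omega>, (Q \<circ> ?x2) \<omega>))"
    by (auto simp: indep_var_distribution_eq)
  have past: "AE \<omega> in M. (P \<circ> ?x1) \<omega> = (\<lambda>i\<in>{..n}. Z (u i) \<omega>)"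
    using zero
  proof eventually_elim
    case (elim \<omega>)
    have "(\<Sum>k<i. \<xi> k \<omega>) = Z (u i) \<omega>" if "i \<le> n" for i
      unfolding \<xi>_def using that elim u
      by (subst sum_lessThan_telescope) (auto simp: t_def)
    then show ?case by (auto simp: P_def fun_eq_iff)
  qed
  have fut: "(Q \<circ> ?x2) \<omega> = (\<lambda>j\<in>{..m}. Z (u n + v j) \<omega> - Z (u n) \<omega>)" for \<omega>
  proof -
    have "(\<Sum>k<j. \<xi> (n + k) \<omega>) = Z (u n + v j) \<omega> - Z (u n) \<omega>" if "j \<le> m" for j
      unfolding \<xi>_def using sum_lessThan_telescope[of "\<lambda>k. Z (t (n + k)) \<omega>" j] v
      by (cases j) (auto simp: t_def)
    then show ?thesis by (auto simp: Q_def fun_eq_iff)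
  qed
  have fut_law: "distr M (vecM m) (Q \<circ> ?x2) = distr M (vecM m) (\<lambda>\<omega>. \<lambda>j\<in>{..m}. Z (v j) \<omega>)"
  proof -
    have xirv: "random_variable borel (\<xi> i)" if "i < n + m" for i
      using xi that by (auto simp: indep_vars_def)
    have etarv: "random_variable borel (\<eta> i)" if "i < m" for i
      using eta that by (auto simp: indep_vars_def)
    have e1: "Q \<circ> ?x2 = (\<lambda>\<omega>. R (\<lambda>k\<in>{..<m}. \<xi> (n + k) \<omega>))"
      by (auto simp: Q_def R_def fun_eq_iff)
    have m1: "random_variable (Pi\<^sub>M {..<m} (\<lambda>_. borel)) (\<lambda>\<omega>. \<lambda>k\<in>{..<m}. \<xi> (n + k) \<omega>)"
      by (intro measurable_restrict xirv) auto
    have m2: "random_variable (Pi\<^sub>M {..<m} (\<lambda>_. borel)) (\<lambda>\<omega>. \<lambda>k\<in>{..<m}. \<eta> k \<omega>)"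
      by (intro measurable_restrict etarv) auto
    have eq: "distr M (Pi\<^sub>M {..<m} (\<lambda>_. borel)) (\<lambda>\<omega>. \<lambda>k\<in>{..<m}. \<xi> (n + k) \<omega>) =
        distr M (Pi\<^sub>M {..<m} (\<lambda>_. borel)) (\<lambda>\<omega>. \<lambda>k\<in>{..<m}. \<eta> k \<omega>)"
    \<comment> \<open>The characterisation of independence by a product law is applied to a nonempty
      index set.\<close>
    proof (cases "m = 0")
      case True then show ?thesis by (simp add: restrict_def)
    next
      case False
      define t' where "t' k = u n + v k" for k
      have "indep_vars (\<lambda>_. borel) (\<lambda>k \<omega>. Z (t' (Suc k)) \<omega> - Z (t' k) \<omega>) {..<m}"
        by (rule ind) (use u0[of n] v in \<open>auto simp: t'_def\<close>)
      moreover have "(\<lambda>k \<omega>. Z (t' (Suc k)) \<omega> - Z (t' k) \<omega>) = (\<lambda>k. \<xi> (n + k))"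
        using v by (auto simp: t'_def \<xi>_def t_def fun_eq_iff)
      ultimately have xi': "indep_vars (\<lambda>_. borel) (\<lambda>k. \<xi> (n + k)) {..<m}" by simp
      have "distr M borel (\<xi> (n + k)) = distr M borel (\<eta> k)" if k: "k < m" for k
      proof -
        have h: "0 \<le> v (Suc k) - v k" using v k by auto
        have "distr M borel (\<xi> (n + k)) = distr M borel (Z (v (Suc k) - v k))"
          using stat[of "u n + v k" "v (Suc k) - v k"] u0[of n] v0[of k] h k v
          by (auto simp: \<xi>_def[abs_def] t_def)
        moreover have "distr M borel (\<eta> k) = distr M borel (Z (v (Suc k) - v k))"
          using stat[of "v k" "v (Suc k) - v k"] v0[of k] h k
          by (auto simp: \<eta>_def[abs_def])
        ultimately show ?thesis by simp
      qed
      then have "Pi\<^sub>M {..<m} (\<lambda>k. distr M borel (\<xi> (n + k))) = Pi\<^sub>M {..<m} (\<lambda>k. distr M borel (\<eta> k))"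
        by (intro PiM_cong) auto
      moreover have "{..<m} \<noteq> {}" using False by auto
      ultimately show ?thesis
        using indep_vars_iff_distr_eq_PiM'[where I = "{..<m}" and M' = "\<lambda>_. borel" and X = "\<lambda>k. \<xi> (n + k)"]
          indep_vars_iff_distr_eq_PiM'[where I = "{..<m}" and M' = "\<lambda>_. borel" and X = \<eta>] xi' eta xirv etarv
        by auto
    qed
    have "distr M (vecM m) (Q \<circ> ?x2) = distr (distr M (Pi\<^sub>M {..<m} (\<lambda>_. borel)) (\<lambda>\<omega>. \<lambda>k\<in>{..<m}. \<xi> (n + k) \<omega>)) (vecM m) R"
      unfolding e1 by (subst distr_distr[OF R m1]) (simp add: comp_def)
    also have "\<dots> = distr M (vecM m) (\<lambda>\<omega>. R (\<lambda>k\<in>{..<m}. \<eta> k \<omega>))"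
      unfolding eq by (subst distr_distr[OF R m2]) (simp add: comp_def)
    also have "\<dots> = distr M (vecM m) (\<lambda>\<omega>. \<lambda>j\<in>{..m}. Z (v j) \<omega>)"
    proof (rule distr_AE_cong)
      show "random_variable (vecM m) (\<lambda>\<omega>. R (\<lambda>k\<in>{..<m}. \<eta> k \<omega>))"
        by (rule measurable_compose[OF m2 R])
      show "random_variable (vecM m) (\<lambda>\<omega>. \<lambda>j\<in>{..m}. Z (v j) \<omega>)"
        by (intro measurable_restrict rv v0) auto
      show "AE \<omega> in M. R (\<lambda>k\<in>{..<m}. \<eta> k \<omega>) = (\<lambda>j\<in>{..m}. Z (v j) \<omega>)"
        using zero
      proof eventually_elim
        case (elim \<omega>)
        have "(\<Sum>k<j. (\<lambda>k\<in>{..<m}. \<eta> k \<omega>) k) = Z (v j) \<omega>" if "j \<le> m" for j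
        proof -
          have "(\<Sum>k<j. (\<lambda>k\<in>{..<m}. \<eta> k \<omega>) k) = (\<Sum>k<j. \<eta> k \<omega>)"
            using that by (intro sum.cong) auto
          also have "\<dots> = Z (v j) \<omega>" unfolding \<eta>_def using elim v by (subst sum_lessThan_telescope) auto
          finally show ?thesis .
        qed
        then show ?case by (auto simp: R_def fun_eq_iff)
      qed
    qed
    finally show ?thesis .
  qed
  have rvp: "random_variable (vecM n) (\<lambda>\<omega>. \<lambda>i\<in>{..n}. Z (u i) \<omega>)"
    by (intro measurable_restrict rv u0) auto
  have past_law: "distr M (vecM n) (P \<circ> ?x1) = distr M (vecM n) (\<lambda>\<omega>. \<lambda>i\<in>{..n}. Z (u i) \<omega>)"
    by (rule distr_AE_cong[OF rvs(1) rvp past])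
  have "distr M (vecM n \<Otimes>\<^sub>M vecM m) (\<lambda>\<omega>. ((P \<circ> ?x1) \<omega>, (Q \<circ> ?x2) \<omega>)) =
     distr M (vecM n \<Otimes>\<^sub>M vecM m) (\<lambda>\<omega>. (\<lambda>i\<in>{..n}. Z (u i) \<omega>, (Q \<circ> ?x2) \<omega>))"
  proof (rule distr_AE_cong)
    show "AE \<omega> in M. ((P \<circ> ?x1) \<omega>, (Q \<circ> ?x2) \<omega>) = (\<lambda>i\<in>{..n}. Z (u i) \<omega>, (Q \<circ> ?x2) \<omega>)"
      using past by eventually_elim (simp only:)
  qed (rule measurable_Pair[OF rvs], rule measurable_Pair[OF rvp rvs(2)])
  then show "distr M (vecM n \<Otimes>\<^sub>M vecM m)
         (\<lambda>\<omega>. (\<lambda>i\<in>{..n}. Z (u i) \<omega>, \<lambda>j\<in>{..m}. Z (u n + v j) \<omega> - Z (u n) \<omega>)) =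
       distr M (vecM n) (\<lambda>\<omega>. \<lambda>i\<in>{..n}. Z (u i) \<omega>) \<Otimes>\<^sub>M distr M (vecM m) (\<lambda>\<omega>. \<lambda>j\<in>{..m}. Z (v j) \<omega>)"
    using joint unfolding past_law fut_law fut by simp
qed

text \<open>Only finite-dimensional laws occur in \<open>markov_increments\<close>, so it passes to
  modifications. This allows processes all of whose paths are regular to replace \<open>B\<close>
  and \<open>S\<close>.\<close>

lemma markov_increments_AE:
  fixes Z Z' :: "real \<Rightarrow> 'a \<Rightarrow> 'b::euclidean_space"
  assumes mk: "markov_increments Z" and rv: "\<And>t. 0 \<le> t \<Longrightarrow> random_variable borel (Z t)"
    and rv': "\<And>t. 0 \<le> t \<Longrightarrow> random_variable borel (Z' t)"
    and ae: "AE \<omega> in M. \<forall>t\<ge>0. Z t \<omega> = Z' t \<omega>"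
  shows "markov_increments Z'"
  unfolding markov_increments_def
proof (intro allI impI)
  fix n m :: nat and u v :: "nat \<Rightarrow> real"
  assume u: "u 0 = 0" "\<forall>i<n. u i \<le> u (Suc i)" and v: "v 0 = 0" "\<forall>j<m. v j \<le> v (Suc j)"
  have u0: "0 \<le> u i" if "i \<le> n" for i using mono_seq_nonneg[of u n i] u that by auto
  have v0: "0 \<le> v i" if "i \<le> m" for i using mono_seq_nonneg[of v m i] v that by auto
  have m1: "random_variable (vecM n) (\<lambda>\<omega>. \<lambda>i\<in>{..n}. Y (u i) \<omega>)"
    and m2: "random_variable (vecM m) (\<lambda>\<omega>. \<lambda>j\<in>{..m}. Y (v j) \<omega>)"
    and m3: "random_variable (vecM n \<Otimes>\<^sub>M vecM m) (\<lambda>\<omega>. (\<lambda>i\<in>{..n}. Y (u i) \<omega>, \<lambda>j\<in>{..m}. Y (u n + v j) \<omega> - Y (u n) \<omega>))"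
    if "\<And>t. 0 \<le> t \<Longrightarrow> random_variable borel (Y t)" for Y :: "real \<Rightarrow> 'a \<Rightarrow> 'b"
  proof -
    show 1: "random_variable (vecM n) (\<lambda>\<omega>. \<lambda>i\<in>{..n}. Y (u i) \<omega>)"
      by (rule measurable_restrict) (auto intro!: that u0)
    show "random_variable (vecM m) (\<lambda>\<omega>. \<lambda>j\<in>{..m}. Y (v j) \<omega>)"
      by (rule measurable_restrict) (auto intro!: that v0)
    have "random_variable (vecM m) (\<lambda>\<omega>. \<lambda>j\<in>{..m}. Y (u n + v j) \<omega> - Y (u n) \<omega>)"
    proof (rule measurable_restrict)
      fix j assume "j \<in> {..m}"
      then have "0 \<le> u n + v j" "0 \<le> u n" using u0[of n] v0[of j] by auto
      then show "random_variable borel (\<lambda>\<omega>. Y (u n + v j) \<omega> - Y (u n) \<omega>)"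
        using borel_measurable_diff[OF that[of "u n + v j"] that[of "u n"]] by blast
    qed
    with 1 show "random_variable (vecM n \<Otimes>\<^sub>M vecM m) (\<lambda>\<omega>. (\<lambda>i\<in>{..n}. Y (u i) \<omega>, \<lambda>j\<in>{..m}. Y (u n + v j) \<omega> - Y (u n) \<omega>))"
      by (rule measurable_Pair)
  qed
  have e: "AE \<omega> in M. (\<lambda>i\<in>{..n}. Z (u i) \<omega>) = (\<lambda>i\<in>{..n}. Z' (u i) \<omega>)"
    "AE \<omega> in M. (\<lambda>j\<in>{..m}. Z (v j) \<omega>) = (\<lambda>j\<in>{..m}. Z' (v j) \<omega>)"
    "AE \<omega> in M. (\<lambda>i\<in>{..n}. Z (u i) \<omega>, \<lambda>j\<in>{..m}. Z (u n + v j) \<omega> - Z (u n) \<omega>) = (\<lambda>i\<in>{..n}. Z' (u i) \<omega>, \<lambda>j\<in>{..m}. Z' (u n + v j) \<omega> - Z' (u n) \<omega>)"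
    using ae u0 v0 by (auto intro!: restrict_ext elim!: AE_mp)
  have d1: "distr M (vecM n) (\<lambda>\<omega>. \<lambda>i\<in>{..n}. Z (u i) \<omega>) = distr M (vecM n) (\<lambda>\<omega>. \<lambda>i\<in>{..n}. Z' (u i) \<omega>)"
    by (rule distr_AE_cong[OF m1 m1 e(1)]) (auto intro: rv rv')
  have d2: "distr M (vecM m) (\<lambda>\<omega>. \<lambda>j\<in>{..m}. Z (v j) \<omega>) = distr M (vecM m) (\<lambda>\<omega>. \<lambda>j\<in>{..m}. Z' (v j) \<omega>)"
    by (rule distr_AE_cong[OF m2 m2 e(2)]) (auto intro: rv rv')
  have d3: "distr M (vecM n \<Otimes>\<^sub>M vecM m) (\<lambda>\<omega>. (\<lambda>i\<in>{..n}. Z (u i) \<omega>, \<lambda>j\<in>{..m}. Z (u n + v j) \<omega> - Z (u n) \<omega>)) =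
      distr M (vecM n \<Otimes>\<^sub>M vecM m) (\<lambda>\<omega>. (\<lambda>i\<in>{..n}. Z' (u i) \<omega>, \<lambda>j\<in>{..m}. Z' (u n + v j) \<omega> - Z' (u n) \<omega>))"
    by (rule distr_AE_cong[OF m3 m3 e(3)]) (auto intro: rv rv')
  show "distr M (vecM n \<Otimes>\<^sub>M vecM m)
         (\<lambda>\<omega>. (\<lambda>i\<in>{..n}. Z' (u i) \<omega>, \<lambda>j\<in>{..m}. Z' (u n + v j) \<omega> - Z' (u n) \<omega>)) =
       distr M (vecM n) (\<lambda>\<omega>. \<lambda>i\<in>{..n}. Z' (u i) \<omega>) \<Otimes>\<^sub>M distr M (vecM m) (\<lambda>\<omega>. \<lambda>j\<in>{..m}. Z' (v j) \<omega>)"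
    unfolding d1[symmetric] d2[symmetric] d3[symmetric]
    by (rule markov_incrementsD[OF mk]) (use u v in auto)
qed

text \<open>The working form of the Markov property: future increments may be replaced by an
  independent copy, living on a second sample \<open>\<omega>'\<close>.\<close>

lemma markov_increments_nn_integral:
  fixes Z :: "real \<Rightarrow> 'a \<Rightarrow> 'b::euclidean_space"
  assumes mk: "markov_increments Z" and rv: "\<And>t. 0 \<le> t \<Longrightarrow> random_variable borel (Z t)"
    and u: "u 0 = 0" "\<And>i. i < n \<Longrightarrow> u i \<le> u (Suc i)" and v: "v 0 = 0" "\<And>j. j < m \<Longrightarrow> v j \<le> v (Suc j)"
    and H: "H \<in> borel_measurable (vecM n \<Otimes>\<^sub>M vecM m)"
  shows "(\<integral>\<^sup>+\<omega>. H (\<lambda>i\<in>{..n}. Z (u i) \<omega>, \<lambda>j\<in>{..m}. Z (u n + v j) \<omega> - Z (u n) \<omega>) \<partial>M) =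
    (\<integral>\<^sup>+\<omega>. \<integral>\<^sup>+\<omega>'. H (\<lambda>i\<in>{..n}. Z (u i) \<omega>, \<lambda>j\<in>{..m}. Z (v j) \<omega>') \<partial>M \<partial>M)"
proof -
  have u0: "0 \<le> u i" if "i \<le> n" for i using mono_seq_nonneg[of u n i] u that by auto
  have v0: "0 \<le> v i" if "i \<le> m" for i using mono_seq_nonneg[of v m i] v that by auto
  have m1: "random_variable (vecM n) (\<lambda>\<omega>. \<lambda>i\<in>{..n}. Z (u i) \<omega>)"
    and m2: "random_variable (vecM m) (\<lambda>\<omega>. \<lambda>j\<in>{..m}. Z (v j) \<omega>)"
    and m3: "random_variable (vecM n \<Otimes>\<^sub>M vecM m) (\<lambda>\<omega>. (\<lambda>i\<in>{..n}. Z (u i) \<omega>, \<lambda>j\<in>{..m}. Z (u n + v j) \<omega> - Z (u n) \<omega>))"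
  proof -
    show 1: "random_variable (vecM n) (\<lambda>\<omega>. \<lambda>i\<in>{..n}. Z (u i) \<omega>)"
      by (rule measurable_restrict) (auto intro!: rv u0)
    show "random_variable (vecM m) (\<lambda>\<omega>. \<lambda>j\<in>{..m}. Z (v j) \<omega>)"
      by (rule measurable_restrict) (auto intro!: rv v0)
    have "random_variable (vecM m) (\<lambda>\<omega>. \<lambda>j\<in>{..m}. Z (u n + v j) \<omega> - Z (u n) \<omega>)"
    proof (rule measurable_restrict)
      fix j assume "j \<in> {..m}"
      then have "0 \<le> u n + v j" "0 \<le> u n" using u0[of n] v0[of j] by auto
      then show "random_variable borel (\<lambda>\<omega>. Z (u n + v j) \<omega> - Z (u n) \<omega>)"
        using borel_measurable_diff[OF rv[of "u n + v j"] rv[of "u n"]] by blast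
    qed
    with 1 show "random_variable (vecM n \<Otimes>\<^sub>M vecM m) (\<lambda>\<omega>. (\<lambda>i\<in>{..n}. Z (u i) \<omega>, \<lambda>j\<in>{..m}. Z (u n + v j) \<omega> - Z (u n) \<omega>))"
      by (rule measurable_Pair)
  qed
  interpret D2: prob_space "distr M (vecM m) (\<lambda>\<omega>. \<lambda>j\<in>{..m}. Z (v j) \<omega>)" by (rule prob_space_distr[OF m2])
  have H': "H \<in> borel_measurable (distr M (vecM n) (\<lambda>\<omega>. \<lambda>i\<in>{..n}. Z (u i) \<omega>) \<Otimes>\<^sub>M distr M (vecM m) (\<lambda>\<omega>. \<lambda>j\<in>{..m}. Z (v j) \<omega>))"
    using H by (simp cong: measurable_cong_sets sets_pair_measure_cong)
  have "(\<integral>\<^sup>+\<omega>. H (\<lambda>i\<in>{..n}. Z (u i) \<omega>, \<lambda>j\<in>{..m}. Z (u n + v j) \<omega> - Z (u n) \<omega>) \<partial>M) =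
     (\<integral>\<^sup>+x. H x \<partial>distr M (vecM n \<Otimes>\<^sub>M vecM m)
         (\<lambda>\<omega>. (\<lambda>i\<in>{..n}. Z (u i) \<omega>, \<lambda>j\<in>{..m}. Z (u n + v j) \<omega> - Z (u n) \<omega>)))"
    by (subst nn_integral_distr[OF m3]) (use H in auto)
  also have "\<dots> = (\<integral>\<^sup>+x. H x \<partial>(distr M (vecM n) (\<lambda>\<omega>. \<lambda>i\<in>{..n}. Z (u i) \<omega>) \<Otimes>\<^sub>M distr M (vecM m) (\<lambda>\<omega>. \<lambda>j\<in>{..m}. Z (v j) \<omega>)))"
    by (subst markov_incrementsD[OF mk u v]) auto
  also have "\<dots> = (\<integral>\<^sup>+a. \<integral>\<^sup>+b. H (a, b) \<partial>distr M (vecM m) (\<lambda>\<omega>. \<lambda>j\<in>{..m}. Z (v j) \<omega>) \<partial>distr M (vecM n) (\<lambda>\<omega>. \<lambda>i\<in>{..n}. Z (u i) \<omega>))"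
    by (rule D2.nn_integral_fst[OF H', symmetric])
  also have "\<dots> = (\<integral>\<^sup>+\<omega>. \<integral>\<^sup>+b. H (\<lambda>i\<in>{..n}. Z (u i) \<omega>, b) \<partial>distr M (vecM m) (\<lambda>\<omega>. \<lambda>j\<in>{..m}. Z (v j) \<omega>) \<partial>M)"
    by (rule nn_integral_distr[OF m1 D2.borel_measurable_nn_integral_fst[OF H']])
  also have "\<dots> = (\<integral>\<^sup>+\<omega>. \<integral>\<^sup>+\<omega>'. H (\<lambda>i\<in>{..n}. Z (u i) \<omega>, \<lambda>j\<in>{..m}. Z (v j) \<omega>') \<partial>M \<partial>M)"
  proof (intro nn_integral_cong)
    fix \<omega> assume "\<omega> \<in> space M"
    then have "(\<lambda>i\<in>{..n}. Z (u i) \<omega>) \<in> space (vecM n)" using m1 by (rule measurable_space[rotated])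
    then have "(\<lambda>b. H (\<lambda>i\<in>{..n}. Z (u i) \<omega>, b)) \<in> borel_measurable (vecM m)"
      by (intro measurable_compose[OF _ H] measurable_Pair1')
    then show "(\<integral>\<^sup>+b. H (\<lambda>i\<in>{..n}. Z (u i) \<omega>, b) \<partial>distr M (vecM m) (\<lambda>\<omega>. \<lambda>j\<in>{..m}. Z (v j) \<omega>)) =
        (\<integral>\<^sup>+\<omega>'. H (\<lambda>i\<in>{..n}. Z (u i) \<omega>, \<lambda>j\<in>{..m}. Z (v j) \<omega>') \<partial>M)"
      by (intro nn_integral_distr[OF m2]) simp
  qed
  finally show ?thesis .
qed


end

text \<open>A continuous path is a measurable function of its values on the countable set of dyadics,
  which makes \<open>B\<close> and \<open>S\<close> independent as random elements of standard product spaces.\<close>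

definition dyadics :: "real set" where
  "dyadics = range (\<lambda>(i::int, N::nat). of_int i / 2 ^ N)"

lemma dyadics_floor: "of_int i / 2 ^ N \<in> dyadics"
  unfolding dyadics_def by (rule range_eqI[of _ _ "(i, N)"]) simp

lemma dyadic_floor_tendsto: "(\<lambda>N. of_int \<lfloor>2 ^ N * a\<rfloor> / 2 ^ N) \<longlonglongrightarrow> (a::real)"
proof (rule LIMSEQ_I)
  have lim: "(\<lambda>N. a - 1 / 2 ^ N) \<longlonglongrightarrow> a - 0"
    by (intro tendsto_intros LIMSEQ_inverse_realpow_zero[of 2, unfolded inverse_eq_divide]) auto
  have "(\<lambda>N. of_int \<lfloor>2 ^ N * a\<rfloor> / 2 ^ N) \<longlonglongrightarrow> a"
  proof (rule tendsto_sandwich[OF _ _ lim[simplified] tendsto_const])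
    show "\<forall>\<^sub>F N in sequentially. a - 1 / 2 ^ N \<le> of_int \<lfloor>2 ^ N * a\<rfloor> / 2 ^ N"
    proof (intro always_eventually allI)
      fix N :: nat
      have "2 ^ N * a - 1 \<le> of_int \<lfloor>2 ^ N * a\<rfloor>" by linarith
      then have "(2 ^ N * a - 1) / 2 ^ N \<le> of_int \<lfloor>2 ^ N * a\<rfloor> / 2 ^ N" by (intro divide_right_mono) auto
      then show "a - 1 / 2 ^ N \<le> of_int \<lfloor>2 ^ N * a\<rfloor> / 2 ^ N" by (simp add: diff_divide_distrib)
    qed
    show "\<forall>\<^sub>F N in sequentially. of_int \<lfloor>2 ^ N * a\<rfloor> / 2 ^ N \<le> a"
      by (intro always_eventually allI) (simp add: divide_le_eq mult.commute)
  qed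
  then show "\<And>r. 0 < r \<Longrightarrow> \<exists>no. \<forall>n\<ge>no. norm (of_int \<lfloor>2 ^ n * a\<rfloor> / 2 ^ n - a) < r"
    by (rule LIMSEQ_D)
qed

text \<open>\<open>lim\<close> gives a value to every map on the dyadics, continuous or not, and
  this value is a jointly measurable function of the map and the argument.\<close>

definition dyadic_extension :: "(real \<Rightarrow> 'b::euclidean_space) \<Rightarrow> real \<Rightarrow> 'b" where
  "dyadic_extension b a = lim (\<lambda>N. b (of_int \<lfloor>2 ^ N * a\<rfloor> / 2 ^ N))"

lemma dyadic_extension_measurable [measurable]:
  "(\<lambda>(b, a). dyadic_extension b a) \<in> borel_measurable (Pi\<^sub>M dyadics (\<lambda>_. borel :: 'b::euclidean_space measure) \<Otimes>\<^sub>M borel)"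
proof -
  have 1: "(\<lambda>x. fst x (of_int \<lfloor>2 ^ N * (snd x :: real)\<rfloor> / 2 ^ N)) \<in> borel_measurable (Pi\<^sub>M dyadics (\<lambda>_. borel :: 'b measure) \<Otimes>\<^sub>M borel)" for N :: nat
  proof (rule measurable_compose_countable'[where I = "UNIV :: int set" and g = "\<lambda>x. \<lfloor>2 ^ N * (snd x :: real)\<rfloor>"
        and f = "\<lambda>i x. fst x (of_int i / 2 ^ N)"])
    fix i :: int
    show "(\<lambda>x. fst x (of_int i / 2 ^ N)) \<in> borel_measurable (Pi\<^sub>M dyadics (\<lambda>_. borel :: 'b measure) \<Otimes>\<^sub>M borel)"
      by (rule measurable_compose[OF measurable_fst measurable_component_singleton]) (rule dyadics_floor)
  qed auto
  show ?thesis
    unfolding dyadic_extension_def case_prod_beta by (rule borel_measurable_lim_metric) (rule 1)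
qed

lemma dyadic_extension_continuous:
  assumes "isCont f a" and "\<And>q. q \<in> dyadics \<Longrightarrow> b q = f q"
  shows "dyadic_extension b a = f a"
proof -
  have "(\<lambda>N. f (of_int \<lfloor>2 ^ N * a\<rfloor> / 2 ^ N)) \<longlonglongrightarrow> f a"
    by (rule isCont_tendsto_compose[OF assms(1) dyadic_floor_tendsto])
  then show ?thesis unfolding dyadic_extension_def by (simp add: assms(2) dyadics_floor limI)
qed

section \<open>Regular modification of the subordinated process\<close>

context subordinate_brownian_motion
begin

definition regular_paths :: "'w \<Rightarrow> bool" where
  "regular_paths \<omega> \<longleftrightarrow> B 0 \<omega> = 0 \<and> S 0 \<omega> = 0 \<and> continuous_on {0..} (\<lambda>t. B t \<omega>) \<and>
     mono_on {0..} (\<lambda>t. S t \<omega>) \<and> cadlag (\<lambda>t. S t \<omega>)"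

definition good :: "'w set" where
  "good = (SOME G. G \<in> sets M \<and> (AE \<omega> in M. \<omega> \<in> G) \<and> (\<forall>\<omega>\<in>G. regular_paths \<omega>))"

lemma good: "good \<in> sets M" "AE \<omega> in M. \<omega> \<in> good" "\<And>\<omega>. \<omega> \<in> good \<Longrightarrow> regular_paths \<omega>"
proof -
  have "AE \<omega> in M. regular_paths \<omega>"
    using levy_B levy_S continuous_B mono_S unfolding regular_paths_def levy_process_def by auto
  then obtain N where N: "{\<omega>\<in>space M. \<not> regular_paths \<omega>} \<subseteq> N" "emeasure M N = 0" "N \<in> sets M"
    by (rule AE_E)
  have "space M - N \<in> sets M \<and> (AE \<omega> in M. \<omega> \<in> space M - N) \<and> (\<forall>\<omega>\<in>space M - N. regular_paths \<omega>)"
    using N by (auto intro!: AE_I[where N = N])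
  then have "good \<in> sets M \<and> (AE \<omega> in M. \<omega> \<in> good) \<and> (\<forall>\<omega>\<in>good. regular_paths \<omega>)"
    unfolding good_def by (rule someI)
  then show "good \<in> sets M" "AE \<omega> in M. \<omega> \<in> good" "\<And>\<omega>. \<omega> \<in> good \<Longrightarrow> regular_paths \<omega>" by auto
qed

text \<open>Modifications all of whose paths are regular; \<open>Bn\<close> is frozen at negative times to make it
  continuous on the whole line.\<close>

definition Bn :: "real \<Rightarrow> 'w \<Rightarrow> 'a" where
  "Bn a \<omega> = (if \<omega> \<in> good then B (max a 0) \<omega> else 0)"

definition Sn :: "real \<Rightarrow> 'w \<Rightarrow> real" where
  "Sn t \<omega> = (if \<omega> \<in> good then S (max t 0) \<omega> else 0)"

definition Xn :: "real \<Rightarrow> 'w \<Rightarrow> 'a" where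
  "Xn t \<omega> = Bn (Sn t \<omega>) \<omega>"

lemma B_rv: "0 \<le> t \<Longrightarrow> random_variable borel (B t)" and S_rv: "0 \<le> t \<Longrightarrow> random_variable borel (S t)"
  using levy_B levy_S by (auto simp: levy_process_def)

lemma Bn_rv [measurable]: "random_variable borel (Bn a)" and Sn_rv [measurable]: "random_variable borel (Sn a)"
  unfolding Bn_def[abs_def] Sn_def[abs_def] using good(1)
  by (auto intro!: measurable_If_set B_rv S_rv)

lemma Bn_0 [simp]: "Bn 0 \<omega> = 0" and Sn_0 [simp]: "Sn 0 \<omega> = 0"
  using good(3)[of \<omega>] by (auto simp: Bn_def Sn_def regular_paths_def)

lemma Bn_isCont: "isCont (\<lambda>a. Bn a \<omega>) a"
proof (cases "\<omega> \<in> good")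
  case True
  have "continuous_on {0..} (\<lambda>t. B t \<omega>)" using good(3)[OF True] by (simp add: regular_paths_def)
  then have "continuous_on UNIV (\<lambda>a. B (max a 0) \<omega>)"
    by (rule continuous_on_compose2) (auto intro!: continuous_intros)
  then show ?thesis using True by (simp add: Bn_def continuous_on_eq_continuous_at)
qed (simp add: Bn_def)

lemma Sn_mono: "s \<le> t \<Longrightarrow> Sn s \<omega> \<le> Sn t \<omega>"
  using good(3)[of \<omega>] by (auto simp: Sn_def regular_paths_def mono_on_def)

lemma Sn_nonneg: "0 \<le> t \<Longrightarrow> 0 \<le> Sn t \<omega>"
  using Sn_mono[of 0 t] by simp

lemma Sn_right: "0 \<le> t \<Longrightarrow> ((\<lambda>s. Sn s \<omega>) \<longlongrightarrow> Sn t \<omega>) (at_right t)"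
proof (cases "\<omega> \<in> good")
  case True
  assume t: "0 \<le> t"
  have "((\<lambda>s. S s \<omega>) \<longlongrightarrow> S t \<omega>) (at_right t)"
    using good(3)[OF True] t by (auto simp: regular_paths_def cadlag_def continuous_within)
  moreover have "\<forall>\<^sub>F s in at_right t. S s \<omega> = Sn s \<omega>"
    using True t by (auto simp: eventually_at_right_field Sn_def max_def intro!: exI[of _ "t + 1"])
  ultimately show ?thesis
    using True t by (auto simp: Sn_def[of t] max_def elim: Lim_transform_eventually)
qed (simp add: Sn_def)

lemma Sn_left: "0 < t \<Longrightarrow> \<exists>l. ((\<lambda>s. Sn s \<omega>) \<longlongrightarrow> l) (at_left t)"
proof (cases "\<omega> \<in> good")
  case True
  assume t: "0 < t"
  obtain l where "((\<lambda>s. S s \<omega>) \<longlongrightarrow> l) (at_left t)"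
    using good(3)[OF True] t by (auto simp: regular_paths_def cadlag_def)
  moreover have "\<forall>\<^sub>F s in at_left t. S s \<omega> = Sn s \<omega>"
    using True t by (auto simp: eventually_at_left_field Sn_def max_def intro!: exI[of _ 0])
  ultimately show ?thesis by (blast intro: Lim_transform_eventually)
qed (auto simp: Sn_def)

lemma Xn_0 [simp]: "Xn 0 \<omega> = 0"
  by (simp add: Xn_def)

lemma Xn_right: "0 \<le> t \<Longrightarrow> ((\<lambda>s. Xn s \<omega>) \<longlongrightarrow> Xn t \<omega>) (at_right t)"
  unfolding Xn_def by (rule isCont_tendsto_compose[OF Bn_isCont Sn_right])

lemma Xn_left: "0 < t \<Longrightarrow> \<exists>l. ((\<lambda>s. Xn s \<omega>) \<longlongrightarrow> l) (at_left t)"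
  unfolding Xn_def using Sn_left[of t \<omega>] isCont_tendsto_compose[OF Bn_isCont] by blast

lemma Xn_eq: "\<omega> \<in> good \<Longrightarrow> 0 \<le> t \<Longrightarrow> Xn t \<omega> = X t \<omega>"
  using Sn_nonneg[of t \<omega>] by (auto simp: Xn_def Bn_def Sn_def subordination max_def)

lemma Bn_markov: "markov_increments Bn" and Sn_markov: "markov_increments Sn"
proof -
  have "AE \<omega> in M. \<forall>t\<ge>0. B t \<omega> = Bn t \<omega>" "AE \<omega> in M. \<forall>t\<ge>0. S t \<omega> = Sn t \<omega>"
    using good(2) by (auto simp: Bn_def Sn_def max_def)
  then show "markov_increments Bn" "markov_increments Sn"
    using markov_increments_AE[OF levy_process_markov[OF levy_B], of Bn]
      markov_increments_AE[OF levy_process_markov[OF levy_S], of Sn] B_rv S_rv Bn_rv Sn_rv by blast+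
qed

definition Bpath :: "'w \<Rightarrow> real \<Rightarrow> 'a" where
  "Bpath \<omega> = (\<lambda>q\<in>dyadics. Bn q \<omega>)"

lemma Bpath_measurable [measurable]: "Bpath \<in> measurable M (Pi\<^sub>M dyadics (\<lambda>_. borel))"
  unfolding Bpath_def by (intro measurable_restrict Bn_rv)

lemma dyadic_extension_Bpath: "dyadic_extension (Bpath \<omega>) a = Bn a \<omega>"
  by (rule dyadic_extension_continuous[OF Bn_isCont]) (simp add: Bpath_def)

text \<open>Joint measurability in time and sample is what permits evaluation at the random time
  \<open>Sn t \<omega>\<close>.\<close>

lemma Bn_joint [measurable]: "(\<lambda>(a, \<omega>). Bn a \<omega>) \<in> borel_measurable (borel \<Otimes>\<^sub>M M)"
proof -
  have "(\<lambda>x. (\<lambda>(b, a). dyadic_extension b a) (Bpath (snd x), fst x)) \<in> borel_measurable (borel \<Otimes>\<^sub>M M)"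
    by measurable
  then show ?thesis by (simp add: dyadic_extension_Bpath case_prod_beta)
qed

lemma Xn_rv [measurable]: "random_variable borel (Xn t)"
proof -
  have "(\<lambda>\<omega>. (\<lambda>(a, \<omega>). Bn a \<omega>) (Sn t \<omega>, \<omega>)) \<in> borel_measurable M" by measurable
  then show ?thesis by (simp add: Xn_def[abs_def])
qed

text \<open>The assumed independence concerns the paths over all of \<open>{0..}\<close>. Values of
  \<open>B\<close> at dyadic times and finitely many values of \<open>S\<close> are measurable for
  these path algebras, which gives a product law on manageable spaces; the modifications change it
  only on a null set.\<close>

lemma joint_law:
  fixes w :: "nat \<Rightarrow> real"
  assumes w: "\<And>i. i \<le> n \<Longrightarrow> 0 \<le> w i"
  shows "distr M (Pi\<^sub>M dyadics (\<lambda>_. borel) \<Otimes>\<^sub>M vecM n) (\<lambda>\<omega>. (Bpath \<omega>, \<lambda>i\<in>{..n}. Sn (w i) \<omega>)) =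
    distr M (Pi\<^sub>M dyadics (\<lambda>_. borel)) Bpath \<Otimes>\<^sub>M distr M (vecM n) (\<lambda>\<omega>. \<lambda>i\<in>{..n}. Sn (w i) \<omega>)"
proof -
  let ?PB = "Pi\<^sub>M {0..} (\<lambda>_::real. borel :: 'a measure)" and ?PS = "Pi\<^sub>M {0..} (\<lambda>_::real. borel :: real measure)"
  let ?VB = "vimage_algebra (space M) (\<lambda>\<omega>. \<lambda>t\<in>{0..}. B t \<omega>) ?PB"
  let ?VS = "vimage_algebra (space M) (\<lambda>\<omega>. \<lambda>t\<in>{0..}. S t \<omega>) ?PS"
  define b where "b \<omega> = (\<lambda>q\<in>dyadics. B (max q 0) \<omega>)" for \<omega>
  define \<sigma> where "\<sigma> \<omega> = (\<lambda>i\<in>{..n}. S (w i) \<omega>)" for \<omega>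
  have brv: "b \<in> measurable M (Pi\<^sub>M dyadics (\<lambda>_. borel))"
    unfolding b_def by (intro measurable_restrict B_rv) auto
  have srv: "\<sigma> \<in> measurable M (vecM n)"
    unfolding \<sigma>_def by (intro measurable_restrict S_rv w) auto
  have bV: "b \<in> measurable ?VB (Pi\<^sub>M dyadics (\<lambda>_. borel))"
  proof -
    have 1: "(\<lambda>\<omega>. \<lambda>t\<in>{0..}. B t \<omega>) \<in> measurable ?VB ?PB"
      by (rule measurable_vimage_algebra1) (auto simp: space_PiM)
    have 2: "(\<lambda>x. \<lambda>q\<in>dyadics. x (max q 0)) \<in> measurable ?PB (Pi\<^sub>M dyadics (\<lambda>_. borel))"
      by (intro measurable_restrict measurable_component_singleton) auto
    show ?thesis using measurable_compose[OF 1 2] by (simp add: b_def[abs_def] cong: restrict_cong)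
  qed
  have sV: "\<sigma> \<in> measurable ?VS (vecM n)"
  proof -
    have 1: "(\<lambda>\<omega>. \<lambda>t\<in>{0..}. S t \<omega>) \<in> measurable ?VS ?PS"
      by (rule measurable_vimage_algebra1) (auto simp: space_PiM)
    have 2: "(\<lambda>x. \<lambda>i\<in>{..n}. x (w i)) \<in> measurable ?PS (vecM n)"
      by (intro measurable_restrict measurable_component_singleton) (use w in auto)
    show ?thesis using measurable_compose[OF 1 2] w by (simp add: \<sigma>_def[abs_def] cong: restrict_cong)
  qed
  interpret D1: prob_space "distr M (Pi\<^sub>M dyadics (\<lambda>_. borel)) b" by (rule prob_space_distr[OF brv])
  interpret D2: prob_space "distr M (vecM n) \<sigma>" by (rule prob_space_distr[OF srv])
  have bs: "(\<lambda>\<omega>. (b \<omega>, \<sigma> \<omega>)) \<in> measurable M (Pi\<^sub>M dyadics (\<lambda>_. borel) \<Otimes>\<^sub>M vecM n)"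
    by (rule measurable_Pair[OF brv srv])
  have joint: "distr M (Pi\<^sub>M dyadics (\<lambda>_. borel)) b \<Otimes>\<^sub>M distr M (vecM n) \<sigma> =
      distr M (Pi\<^sub>M dyadics (\<lambda>_. borel) \<Otimes>\<^sub>M vecM n) (\<lambda>\<omega>. (b \<omega>, \<sigma> \<omega>))"
  proof (rule pair_measure_eqI)
    fix A1 A2 assume "A1 \<in> sets (distr M (Pi\<^sub>M dyadics (\<lambda>_. borel)) b)" "A2 \<in> sets (distr M (vecM n) \<sigma>)"
    then have A: "A1 \<in> sets (Pi\<^sub>M dyadics (\<lambda>_. borel))" "A2 \<in> sets (vecM n)" by auto
    have "prob ((b -` A1 \<inter> space M) \<inter> (\<sigma> -` A2 \<inter> space M)) = prob (b -` A1 \<inter> space M) * prob (\<sigma> -` A2 \<inter> space M)"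
      using measurable_sets[OF bV A(1)] measurable_sets[OF sV A(2)]
      by (intro indep_setD[OF indep_B_S]) auto
    moreover have "(\<lambda>\<omega>. (b \<omega>, \<sigma> \<omega>)) -` (A1 \<times> A2) \<inter> space M = (b -` A1 \<inter> space M) \<inter> (\<sigma> -` A2 \<inter> space M)"
      by auto
    ultimately show "emeasure (distr M (Pi\<^sub>M dyadics (\<lambda>_. borel)) b) A1 * emeasure (distr M (vecM n) \<sigma>) A2 =
        emeasure (distr M (Pi\<^sub>M dyadics (\<lambda>_. borel) \<Otimes>\<^sub>M vecM n) (\<lambda>\<omega>. (b \<omega>, \<sigma> \<omega>))) (A1 \<times> A2)"
      using A by (simp add: emeasure_distr[OF brv] emeasure_distr[OF srv] emeasure_distr[OF bs]
          emeasure_eq_measure ennreal_mult'[symmetric])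
  qed (unfold_locales, simp cong: sets_pair_measure_cong)
  have Srv: "(\<lambda>\<omega>. \<lambda>i\<in>{..n}. Sn (w i) \<omega>) \<in> measurable M (vecM n)"
    by (intro measurable_restrict Sn_rv)
  have ae1: "AE \<omega> in M. b \<omega> = Bpath \<omega>"
    using good(2) by eventually_elim (auto simp: b_def Bpath_def Bn_def)
  have ae2: "AE \<omega> in M. \<sigma> \<omega> = (\<lambda>i\<in>{..n}. Sn (w i) \<omega>)"
    using good(2) by eventually_elim (use w in \<open>auto simp: \<sigma>_def Sn_def max_absorb1 fun_eq_iff\<close>)
  have "distr M (Pi\<^sub>M dyadics (\<lambda>_. borel) \<Otimes>\<^sub>M vecM n) (\<lambda>\<omega>. (b \<omega>, \<sigma> \<omega>)) =
      distr M (Pi\<^sub>M dyadics (\<lambda>_. borel) \<Otimes>\<^sub>M vecM n) (\<lambda>\<omega>. (Bpath \<omega>, \<lambda>i\<in>{..n}. Sn (w i) \<omega>))"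
  proof (rule distr_AE_cong)
    show "AE \<omega> in M. (b \<omega>, \<sigma> \<omega>) = (Bpath \<omega>, \<lambda>i\<in>{..n}. Sn (w i) \<omega>)"
      using ae1 ae2 by eventually_elim simp
  qed (rule measurable_Pair[OF brv srv], rule measurable_Pair[OF Bpath_measurable Srv])
  then show ?thesis
    using joint distr_AE_cong[OF brv Bpath_measurable ae1] distr_AE_cong[OF srv Srv ae2] by simp
qed

text \<open>Conditioning on the subordinator: by independence the random times may be read off a
  second sample \<open>\<omega>'\<close>, so that the inner integral is over Brownian motion at
  deterministic times.\<close>

lemma subordinated_nn_integral:
  fixes w :: "nat \<Rightarrow> real"
  assumes w: "\<And>i. i \<le> n \<Longrightarrow> 0 \<le> w i" and F: "F \<in> borel_measurable (vecM n)"
  shows "(\<integral>\<^sup>+\<omega>. F (\<lambda>i\<in>{..n}. Xn (w i) \<omega>) \<partial>M) =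
    (\<integral>\<^sup>+\<omega>'. \<integral>\<^sup>+\<omega>. F (\<lambda>i\<in>{..n}. Bn (Sn (w i) \<omega>') \<omega>) \<partial>M \<partial>M)"
proof -
  define \<Phi> where "\<Phi> x = F (\<lambda>i\<in>{..n}. dyadic_extension (fst x) (snd x i))" for x :: "(real \<Rightarrow> 'a) \<times> (nat \<Rightarrow> real)"
  let ?P = "Pi\<^sub>M dyadics (\<lambda>_. borel :: 'a measure)"
  let ?s = "\<lambda>\<omega>. \<lambda>i\<in>{..n}. Sn (w i) \<omega>"
  have \<Phi>: "\<Phi> \<in> borel_measurable (?P \<Otimes>\<^sub>M vecM n)"
    unfolding \<Phi>_def
  proof (rule measurable_compose[OF _ F], intro measurable_restrict)
    fix i assume i: "i \<in> {..n}"
    have "(\<lambda>x. (fst x, snd x i)) \<in> measurable (?P \<Otimes>\<^sub>M vecM n) (?P \<Otimes>\<^sub>M borel)"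
      by (intro measurable_Pair measurable_fst measurable_compose[OF measurable_snd measurable_component_singleton] i)
    then show "(\<lambda>x. dyadic_extension (fst x) (snd x i)) \<in> borel_measurable (?P \<Otimes>\<^sub>M vecM n)"
      using measurable_compose[OF _ dyadic_extension_measurable, of "\<lambda>x. (fst x, snd x i)"] by simp
  qed
  have Srv: "?s \<in> measurable M (vecM n)" by (intro measurable_restrict Sn_rv)
  interpret D1: prob_space "distr M ?P Bpath" by (rule prob_space_distr) measurable
  interpret D2: prob_space "distr M (vecM n) ?s" by (rule prob_space_distr[OF Srv])
  interpret PP: pair_prob_space "distr M ?P Bpath" "distr M (vecM n) ?s" ..
  have \<Phi>': "\<Phi> \<in> borel_measurable (distr M ?P Bpath \<Otimes>\<^sub>M distr M (vecM n) ?s)"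
    using \<Phi> by (simp cong: measurable_cong_sets sets_pair_measure_cong)
  have eq: "\<Phi> (Bpath \<omega>, ?s \<omega>') = F (\<lambda>i\<in>{..n}. Bn (Sn (w i) \<omega>') \<omega>)" for \<omega> \<omega>'
    unfolding \<Phi>_def by (intro arg_cong[where f = F]) (auto simp: dyadic_extension_Bpath)
  have "(\<integral>\<^sup>+\<omega>. F (\<lambda>i\<in>{..n}. Xn (w i) \<omega>) \<partial>M) = (\<integral>\<^sup>+\<omega>. \<Phi> (Bpath \<omega>, ?s \<omega>) \<partial>M)"
    by (simp only: eq Xn_def)
  also have "\<dots> = (\<integral>\<^sup>+x. \<Phi> x \<partial>distr M (?P \<Otimes>\<^sub>M vecM n) (\<lambda>\<omega>. (Bpath \<omega>, ?s \<omega>)))"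
    by (rule nn_integral_distr[symmetric]) (use \<Phi> measurable_Pair[OF Bpath_measurable Srv] in auto)
  also have "\<dots> = (\<integral>\<^sup>+x. \<Phi> x \<partial>(distr M ?P Bpath \<Otimes>\<^sub>M distr M (vecM n) ?s))"
    by (subst joint_law[OF w]) auto
  also have "\<dots> = (\<integral>\<^sup>+s. \<integral>\<^sup>+b. \<Phi> (b, s) \<partial>distr M ?P Bpath \<partial>distr M (vecM n) ?s)"
    by (rule PP.nn_integral_snd[OF \<Phi>', symmetric])
  also have "\<dots> = (\<integral>\<^sup>+\<omega>'. \<integral>\<^sup>+b. \<Phi> (b, ?s \<omega>') \<partial>distr M ?P Bpath \<partial>M)"
  proof (rule nn_integral_distr[OF Srv])
    have "(\<lambda>(s, b). \<Phi> (b, s)) \<in> borel_measurable (distr M (vecM n) ?s \<Otimes>\<^sub>M distr M ?P Bpath)"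
      using measurable_pair_swap[OF \<Phi>'] by simp
    then show "(\<lambda>s. \<integral>\<^sup>+b. \<Phi> (b, s) \<partial>distr M ?P Bpath) \<in> borel_measurable (distr M (vecM n) ?s)"
      by (rule D1.borel_measurable_nn_integral)
  qed
  also have "\<dots> = (\<integral>\<^sup>+\<omega>'. \<integral>\<^sup>+\<omega>. \<Phi> (Bpath \<omega>, ?s \<omega>') \<partial>M \<partial>M)"
  proof (intro nn_integral_cong nn_integral_distr Bpath_measurable)
    fix \<omega>' assume "\<omega>' \<in> space M"
    then have "?s \<omega>' \<in> space (vecM n)" using Srv by (rule measurable_space[rotated])
    then have "(\<lambda>b. \<Phi> (b, ?s \<omega>')) \<in> borel_measurable ?P"
      by (intro measurable_compose[OF _ \<Phi>] measurable_Pair2')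
    then show "(\<lambda>b. \<Phi> (b, ?s \<omega>')) \<in> borel_measurable (distr M ?P Bpath)" by simp
  qed
  also have "\<dots> = (\<integral>\<^sup>+\<omega>'. \<integral>\<^sup>+\<omega>. F (\<lambda>i\<in>{..n}. Bn (Sn (w i) \<omega>') \<omega>) \<partial>M \<partial>M)"
    by (simp only: eq)
  finally show ?thesis .
qed

text \<open>With the subordinator fixed, the Markov property of Brownian motion splits the inner
  integral at the time \<open>Sn (u n)\<close>; the Markov property of the subordinator then splits
  the outer one. The four resulting independent samples are regrouped in pairs, each pair forming
  one copy of the subordinated process.\<close>

lemma Xn_markov: "markov_increments Xn"
  unfolding markov_increments_def
proof (intro allI impI)
  fix n m :: nat and u v :: "nat \<Rightarrow> real"
  assume u: "u 0 = 0" "\<forall>i<n. u i \<le> u (Suc i)" and v: "v 0 = 0" "\<forall>j<m. v j \<le> v (Suc j)"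
  have u0: "0 \<le> u i" if "i \<le> n" for i using mono_seq_nonneg[of u n i] u that by auto
  have v0: "0 \<le> v i" if "i \<le> m" for i using mono_seq_nonneg[of v m i] v that by auto
  define pX where "pX = (\<lambda>\<omega>. \<lambda>i\<in>{..n}. Xn (u i) \<omega>)"
  define fX where "fX = (\<lambda>\<omega>. \<lambda>j\<in>{..m}. Xn (u n + v j) \<omega> - Xn (u n) \<omega>)"
  define vX where "vX = (\<lambda>\<omega>. \<lambda>j\<in>{..m}. Xn (v j) \<omega>)"
  have pX: "pX \<in> measurable M (vecM n)" and vX [measurable]: "vX \<in> measurable M (vecM m)"
    unfolding pX_def vX_def by (intro measurable_restrict Xn_rv)+
  have fX: "fX \<in> measurable M (vecM m)"
    unfolding fX_def by (intro measurable_restrict borel_measurable_diff Xn_rv)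
  define bp where "bp = (\<lambda>(s, \<omega>). \<lambda>i\<in>{..n}. Bn (s i) \<omega>)"
  define bv where "bv = (\<lambda>(s, \<omega>). \<lambda>j\<in>{..m}. Bn (s j) \<omega>)"
  have Bcomp: "(\<lambda>x. Bn (fst x i) (snd x)) \<in> borel_measurable (vecM k \<Otimes>\<^sub>M M)" if "i \<le> k" for i k
  proof -
    have "(\<lambda>x. (fst x i, snd x)) \<in> measurable (vecM k \<Otimes>\<^sub>M M) (borel \<Otimes>\<^sub>M M)"
      using that by (intro measurable_Pair measurable_snd measurable_compose[OF measurable_fst measurable_component_singleton]) auto
    from measurable_compose[OF this Bn_joint] show ?thesis by simp
  qed
  have bp [measurable]: "bp \<in> measurable (vecM n \<Otimes>\<^sub>M M) (vecM n)"
    unfolding bp_def case_prod_beta by (intro measurable_restrict Bcomp) auto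
  have bv [measurable]: "bv \<in> measurable (vecM m \<Otimes>\<^sub>M M) (vecM m)"
    unfolding bv_def case_prod_beta by (intro measurable_restrict Bcomp) auto
  define sp where "sp = (\<lambda>\<omega>. \<lambda>i\<in>{..n}. Sn (u i) \<omega>)"
  define sf where "sf = (\<lambda>\<omega>. \<lambda>j\<in>{..m}. Sn (u n + v j) \<omega> - Sn (u n) \<omega>)"
  define sv where "sv = (\<lambda>\<omega>. \<lambda>j\<in>{..m}. Sn (v j) \<omega>)"
  have sp [measurable]: "sp \<in> measurable M (vecM n)" and sv [measurable]: "sv \<in> measurable M (vecM m)"
    unfolding sp_def sv_def by (intro measurable_restrict Sn_rv)+
  have "distr M (vecM n \<Otimes>\<^sub>M vecM m) (\<lambda>\<omega>. (pX \<omega>, fX \<omega>)) = distr M (vecM n) pX \<Otimes>\<^sub>M distr M (vecM m) vX"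
  proof (rule measure_eqI)
    fix C assume "C \<in> sets (distr M (vecM n \<Otimes>\<^sub>M vecM m) (\<lambda>\<omega>. (pX \<omega>, fX \<omega>)))"
    then have C [measurable]: "C \<in> sets (vecM n \<Otimes>\<^sub>M vecM m)" by simp
    define I where "I = (indicator C :: _ \<Rightarrow> ennreal)"
    have I [measurable]: "I \<in> borel_measurable (vecM n \<Otimes>\<^sub>M vecM m)" unfolding I_def by measurable
    interpret DV: prob_space "distr M (vecM m) vX" by (rule prob_space_distr[OF vX])
    \<comment> \<open>One list of \<open>n + m + 2\<close> times: the past in the positions up to
      \<open>n\<close>, then the future in the positions \<open>Suc n + j\<close>. The time
      \<open>u n\<close> occurs twice, since \<open>v 0 = 0\<close>.\<close>
    let ?w = "\<lambda>k. if k \<le> n then u k else u n + v (k - Suc n)"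
    define F where "F x = I (\<lambda>i\<in>{..n}. x i, \<lambda>j\<in>{..m}. x (Suc n + j) - x n)" for x :: "nat \<Rightarrow> 'a"
    have Fm: "F \<in> borel_measurable (vecM (Suc n + m))"
      unfolding F_def
      by (intro measurable_compose[OF _ I] measurable_Pair measurable_restrict borel_measurable_diff measurable_component_singleton) auto
    have w0: "0 \<le> ?w k" if "k \<le> Suc n + m" for k
      using u0[of k] u0[of n] v0[of "k - Suc n"] that by auto
    \<comment> \<open>The Brownian expectation, seen as a function of the past values of the
      subordinator and of its later increments.\<close>
    define \<Theta> where "\<Theta> x = (\<integral>\<^sup>+\<omega>. \<integral>\<^sup>+\<omega>2. I (bp (fst x, \<omega>), bv (snd x, \<omega>2)) \<partial>M \<partial>M)" for x
    have \<Theta>: "\<Theta> \<in> borel_measurable (vecM n \<Otimes>\<^sub>M vecM m)"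
      unfolding \<Theta>_def by measurable
    have "emeasure (distr M (vecM n \<Otimes>\<^sub>M vecM m) (\<lambda>\<omega>. (pX \<omega>, fX \<omega>))) C
       = (\<integral>\<^sup>+x. I x \<partial>distr M (vecM n \<Otimes>\<^sub>M vecM m) (\<lambda>\<omega>. (pX \<omega>, fX \<omega>)))"
      unfolding I_def by simp
    also have "\<dots> = (\<integral>\<^sup>+\<omega>. I (pX \<omega>, fX \<omega>) \<partial>M)"
      by (rule nn_integral_distr) (use pX fX in simp_all)
    also have "\<dots> = (\<integral>\<^sup>+\<omega>. F (\<lambda>k\<in>{..Suc n + m}. Xn (?w k) \<omega>) \<partial>M)"
      unfolding F_def pX_def fX_def
      by (intro nn_integral_cong arg_cong[where f = I]) (auto simp: fun_eq_iff)
    also have "\<dots> = (\<integral>\<^sup>+\<omega>'. \<integral>\<^sup>+\<omega>. F (\<lambda>k\<in>{..Suc n + m}. Bn (Sn (?w k) \<omega>') \<omega>) \<partial>M \<partial>M)"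
      by (rule subordinated_nn_integral[OF w0 Fm])
    also have "\<dots> = (\<integral>\<^sup>+\<omega>'. \<Theta> (sp \<omega>', sf \<omega>') \<partial>M)"
    proof (intro nn_integral_cong)
      fix \<omega>'
      \<comment> \<open>For fixed \<open>\<omega>'\<close> the subordinator is increasing from 0, so
        \<open>?a\<close> and \<open>?b\<close> are ordered deterministic times starting at 0, as
        the Markov property of \<open>Bn\<close> requires.\<close>
      let ?a = "\<lambda>i. Sn (u i) \<omega>'" and ?b = "\<lambda>j. Sn (u n + v j) \<omega>' - Sn (u n) \<omega>'"
      have "(\<integral>\<^sup>+\<omega>. F (\<lambda>k\<in>{..Suc n + m}. Bn (Sn (?w k) \<omega>') \<omega>) \<partial>M) =
         (\<integral>\<^sup>+\<omega>. I (\<lambda>i\<in>{..n}. Bn (?a i) \<omega>, \<lambda>j\<in>{..m}. Bn (?a n + ?b j) \<omega> - Bn (?a n) \<omega>) \<partial>M)"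
        unfolding F_def by (intro nn_integral_cong arg_cong[where f = I]) (auto simp: fun_eq_iff)
      also have "\<dots> = (\<integral>\<^sup>+\<omega>. \<integral>\<^sup>+\<omega>2. I (\<lambda>i\<in>{..n}. Bn (?a i) \<omega>, \<lambda>j\<in>{..m}. Bn (?b j) \<omega>2) \<partial>M \<partial>M)"
        by (rule markov_increments_nn_integral[OF Bn_markov Bn_rv]) (use u v in \<open>auto intro: Sn_mono\<close>)
      also have "\<dots> = \<Theta> (sp \<omega>', sf \<omega>')"
        unfolding \<Theta>_def bp_def bv_def sp_def sf_def
        by (intro nn_integral_cong arg_cong[where f = I]) (auto simp: fun_eq_iff)
      finally show "(\<integral>\<^sup>+\<omega>. F (\<lambda>k\<in>{..Suc n + m}. Bn (Sn (?w k) \<omega>') \<omega>) \<partial>M) = \<Theta> (sp \<omega>', sf \<omega>')" .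
    qed
    also have "\<dots> = (\<integral>\<^sup>+\<omega>'. \<integral>\<^sup>+\<omega>3. \<Theta> (sp \<omega>', sv \<omega>3) \<partial>M \<partial>M)"
      unfolding sp_def sf_def sv_def
      by (rule markov_increments_nn_integral[OF Sn_markov Sn_rv]) (use u v \<Theta> in auto)
    \<comment> \<open>Exchanging the two middle integrals places the Brownian past next to the
      subordinator past, and likewise for the futures.\<close>
    also have "\<dots> = (\<integral>\<^sup>+\<omega>'. \<integral>\<^sup>+\<omega>. \<integral>\<^sup>+\<omega>3. \<integral>\<^sup>+\<omega>2. I (bp (sp \<omega>', \<omega>), bv (sv \<omega>3, \<omega>2)) \<partial>M \<partial>M \<partial>M \<partial>M)"
    proof (rule nn_integral_cong)
      interpret PP: pair_sigma_finite M M ..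
      fix \<omega>' assume [measurable]: "\<omega>' \<in> space M"
      show "(\<integral>\<^sup>+\<omega>3. \<Theta> (sp \<omega>', sv \<omega>3) \<partial>M) = (\<integral>\<^sup>+\<omega>. \<integral>\<^sup>+\<omega>3. \<integral>\<^sup>+\<omega>2. I (bp (sp \<omega>', \<omega>), bv (sv \<omega>3, \<omega>2)) \<partial>M \<partial>M \<partial>M)"
        unfolding \<Theta>_def fst_conv snd_conv by (rule PP.Fubini') measurable
    qed
    also have "\<dots> = (\<integral>\<^sup>+\<omega>'. \<integral>\<^sup>+\<omega>. (\<integral>\<^sup>+z. I (bp (sp \<omega>', \<omega>), vX z) \<partial>M) \<partial>M \<partial>M)"
    proof (rule nn_integral_cong, rule nn_integral_cong)
      fix \<omega>' \<omega> assume [measurable]: "\<omega>' \<in> space M" "\<omega> \<in> space M"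
      have "bp (sp \<omega>', \<omega>) \<in> space (vecM n)"
        using measurable_space[OF bp] measurable_space[OF sp] \<open>\<omega>' \<in> space M\<close> \<open>\<omega> \<in> space M\<close> by (simp add: space_pair_measure)
      then have m: "(\<lambda>y. I (bp (sp \<omega>', \<omega>), y)) \<in> borel_measurable (vecM m)"
        by (intro measurable_compose[OF _ I] measurable_Pair1')
      have "(\<integral>\<^sup>+z. I (bp (sp \<omega>', \<omega>), vX z) \<partial>M) = (\<integral>\<^sup>+\<omega>3. \<integral>\<^sup>+\<omega>2. I (bp (sp \<omega>', \<omega>), (\<lambda>j\<in>{..m}. Bn (Sn (v j) \<omega>3) \<omega>2)) \<partial>M \<partial>M)"
        unfolding vX_def by (rule subordinated_nn_integral[OF v0 m])
      also have "\<dots> = (\<integral>\<^sup>+\<omega>3. \<integral>\<^sup>+\<omega>2. I (bp (sp \<omega>', \<omega>), bv (sv \<omega>3, \<omega>2)) \<partial>M \<partial>M)"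
        unfolding bv_def sv_def by (intro nn_integral_cong arg_cong[where f = I]) (auto simp: fun_eq_iff)
      finally show "(\<integral>\<^sup>+\<omega>3. \<integral>\<^sup>+\<omega>2. I (bp (sp \<omega>', \<omega>), bv (sv \<omega>3, \<omega>2)) \<partial>M \<partial>M) = (\<integral>\<^sup>+z. I (bp (sp \<omega>', \<omega>), vX z) \<partial>M)" ..
    qed
    also have "\<dots> = (\<integral>\<^sup>+\<omega>. (\<integral>\<^sup>+z. I (pX \<omega>, vX z) \<partial>M) \<partial>M)"
    proof -
      have m: "(\<lambda>x. \<integral>\<^sup>+z. I (x, vX z) \<partial>M) \<in> borel_measurable (vecM n)" by measurable
      have "(\<integral>\<^sup>+\<omega>. (\<integral>\<^sup>+z. I (pX \<omega>, vX z) \<partial>M) \<partial>M) =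
          (\<integral>\<^sup>+\<omega>'. \<integral>\<^sup>+\<omega>. (\<integral>\<^sup>+z. I ((\<lambda>i\<in>{..n}. Bn (Sn (u i) \<omega>') \<omega>), vX z) \<partial>M) \<partial>M \<partial>M)"
        unfolding pX_def by (rule subordinated_nn_integral[OF u0 m])
      also have "\<dots> = (\<integral>\<^sup>+\<omega>'. \<integral>\<^sup>+\<omega>. (\<integral>\<^sup>+z. I (bp (sp \<omega>', \<omega>), vX z) \<partial>M) \<partial>M \<partial>M)"
        unfolding bp_def sp_def by (intro nn_integral_cong arg_cong[where f = I]) (auto simp: fun_eq_iff)
      finally show ?thesis ..
    qed
    also have "\<dots> = (\<integral>\<^sup>+x. \<integral>\<^sup>+y. I (x, y) \<partial>distr M (vecM m) vX \<partial>distr M (vecM n) pX)"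
    proof -
      have m: "I \<in> borel_measurable (distr M (vecM n) pX \<Otimes>\<^sub>M distr M (vecM m) vX)"
        using I by (simp cong: measurable_cong_sets sets_pair_measure_cong)
      have "(\<integral>\<^sup>+x. \<integral>\<^sup>+y. I (x, y) \<partial>distr M (vecM m) vX \<partial>distr M (vecM n) pX) = (\<integral>\<^sup>+\<omega>. \<integral>\<^sup>+y. I (pX \<omega>, y) \<partial>distr M (vecM m) vX \<partial>M)"
        by (rule nn_integral_distr[OF pX DV.borel_measurable_nn_integral_fst[OF m]])
      also have "\<dots> = (\<integral>\<^sup>+\<omega>. (\<integral>\<^sup>+z. I (pX \<omega>, vX z) \<partial>M) \<partial>M)"
      proof (intro nn_integral_cong nn_integral_distr[OF vX])
        fix \<omega> assume "\<omega> \<in> space M"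
        then have "pX \<omega> \<in> space (vecM n)" using pX by (rule measurable_space[rotated])
        then have "(\<lambda>y. I (pX \<omega>, y)) \<in> borel_measurable (vecM m)"
          by (intro measurable_compose[OF _ I] measurable_Pair1')
        then show "(\<lambda>y. I (pX \<omega>, y)) \<in> borel_measurable (distr M (vecM m) vX)" by simp
      qed
      finally show ?thesis ..
    qed
    also have "\<dots> = emeasure (distr M (vecM n) pX \<Otimes>\<^sub>M distr M (vecM m) vX) C"
      unfolding I_def using C by (intro DV.emeasure_pair_measure[symmetric]) (simp cong: sets_pair_measure_cong)
    finally show "emeasure (distr M (vecM n \<Otimes>\<^sub>M vecM m) (\<lambda>\<omega>. (pX \<omega>, fX \<omega>))) C
       = emeasure (distr M (vecM n) pX \<Otimes>\<^sub>M distr M (vecM m) vX) C" .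
  qed (simp cong: sets_pair_measure_cong)
  then show "distr M (vecM n \<Otimes>\<^sub>M vecM m)
         (\<lambda>\<omega>. (\<lambda>i\<in>{..n}. Xn (u i) \<omega>, \<lambda>j\<in>{..m}. Xn (u n + v j) \<omega> - Xn (u n) \<omega>)) =
       distr M (vecM n) (\<lambda>\<omega>. \<lambda>i\<in>{..n}. Xn (u i) \<omega>) \<Otimes>\<^sub>M distr M (vecM m) (\<lambda>\<omega>. \<lambda>j\<in>{..m}. Xn (v j) \<omega>)"
    unfolding pX_def fX_def vX_def .
qed

text \<open>Conditioning on the subordinator turns the Brownian characteristic function into the
  Laplace transform of \<open>Sn t\<close> at \<open>(norm \<xi>)\<^sup>2\<close>. That transform is
  given for positive arguments, whence \<open>\<xi> \<noteq> 0\<close>.\<close>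

lemma Xn_char:
  assumes t: "0 \<le> t" and \<xi>: "\<xi> \<noteq> 0"
  shows "(CLINT \<omega>|M. iexp (\<xi> \<bullet> Xn t \<omega>)) = complex_of_real (exp (- t * \<Psi> ((norm \<xi>)\<^sup>2)))"
proof -
  interpret PP: pair_prob_space M M ..
  have J [measurable]: "(\<lambda>(\<omega>', \<omega>). Bn (Sn t \<omega>') \<omega>) \<in> borel_measurable (M \<Otimes>\<^sub>M M)"
  proof -
    have "(\<lambda>x. (Sn t (fst x), snd x)) \<in> measurable (M \<Otimes>\<^sub>M M) (borel \<Otimes>\<^sub>M M)" by measurable
    from measurable_compose[OF this Bn_joint] show ?thesis by (simp add: case_prod_beta)
  qed
  have law: "distr M borel (Xn t) = distr (M \<Otimes>\<^sub>M M) borel (\<lambda>(\<omega>', \<omega>). Bn (Sn t \<omega>') \<omega>)"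
  proof (rule measure_eqI)
    fix A assume "A \<in> sets (distr M borel (Xn t))"
    then have A [measurable]: "A \<in> sets borel" by simp
    have m: "(\<lambda>x. indicator A (x 0) :: ennreal) \<in> borel_measurable (vecM 0)" by measurable
    have "emeasure (distr M borel (Xn t)) A = (\<integral>\<^sup>+\<omega>. indicator A (Xn t \<omega>) \<partial>M)"
      by (subst nn_integral_indicator[symmetric], simp, subst nn_integral_distr) auto
    also have "\<dots> = (\<integral>\<^sup>+\<omega>'. \<integral>\<^sup>+\<omega>. indicator A (Bn (Sn t \<omega>') \<omega>) \<partial>M \<partial>M)"
      using subordinated_nn_integral[of 0 "\<lambda>_. t", OF _ m] t by simp
    also have "\<dots> = (\<integral>\<^sup>+x. indicator A ((\<lambda>(\<omega>', \<omega>). Bn (Sn t \<omega>') \<omega>) x) \<partial>(M \<Otimes>\<^sub>M M))"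
      by (subst nn_integral_fst[symmetric]) auto
    also have "\<dots> = emeasure (distr (M \<Otimes>\<^sub>M M) borel (\<lambda>(\<omega>', \<omega>). Bn (Sn t \<omega>') \<omega>)) A"
      by (subst nn_integral_indicator[symmetric], simp, subst nn_integral_distr) auto
    finally show "emeasure (distr M borel (Xn t)) A = emeasure (distr (M \<Otimes>\<^sub>M M) borel (\<lambda>(\<omega>', \<omega>). Bn (Sn t \<omega>') \<omega>)) A" .
  qed simp
  have charB: "(CLINT \<omega>|M. iexp (\<xi> \<bullet> Bn a \<omega>)) = complex_of_real (exp (- a * (norm \<xi>)\<^sup>2))" if a: "0 \<le> a" for a
  proof -
    have "(CLINT \<omega>|M. iexp (\<xi> \<bullet> Bn a \<omega>)) = (CLINT \<omega>|M. iexp (\<xi> \<bullet> B a \<omega>))"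
    proof (rule integral_cong_AE)
      show "AE \<omega> in M. iexp (\<xi> \<bullet> Bn a \<omega>) = iexp (\<xi> \<bullet> B a \<omega>)"
        using good(2) by eventually_elim (use a in \<open>simp add: Bn_def max_absorb1\<close>)
    qed (use B_rv[OF a] in measurable)
    then show ?thesis using char_B[OF a] by simp
  qed
  have "(CLINT \<omega>|M. iexp (\<xi> \<bullet> Xn t \<omega>)) = (CLINT x|distr M borel (Xn t). iexp (\<xi> \<bullet> x))"
    by (subst integral_distr) auto
  also have "\<dots> = (CLINT x|M \<Otimes>\<^sub>M M. iexp (\<xi> \<bullet> Bn (Sn t (fst x)) (snd x)))"
    unfolding law by (subst integral_distr) (auto simp: case_prod_beta)
  also have "\<dots> = (CLINT \<omega>'|M. CLINT \<omega>|M. iexp (\<xi> \<bullet> Bn (Sn t \<omega>') \<omega>))"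
  proof -
    have m: "(\<lambda>x. iexp (\<xi> \<bullet> Bn (Sn t (fst x)) (snd x))) \<in> borel_measurable (M \<Otimes>\<^sub>M M)"
      using J unfolding case_prod_beta by measurable
    show ?thesis
      by (subst PP.integral_fst'[symmetric]) (auto intro!: PP.integrable_const_bound[where B = 1] m)
  qed
  also have "\<dots> = (CLINT \<omega>'|M. complex_of_real (exp (- (norm \<xi>)\<^sup>2 * Sn t \<omega>')))"
    using t by (intro Bochner_Integration.integral_cong refl) (simp add: charB Sn_nonneg mult.commute)
  also have "\<dots> = complex_of_real (LINT \<omega>'|M. exp (- (norm \<xi>)\<^sup>2 * Sn t \<omega>'))"
    by simp
  also have "(LINT \<omega>'|M. exp (- (norm \<xi>)\<^sup>2 * Sn t \<omega>')) = (LINT \<omega>'|M. exp (- (norm \<xi>)\<^sup>2 * S t \<omega>'))"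
  proof (rule integral_cong_AE)
    show "AE \<omega> in M. exp (- (norm \<xi>)\<^sup>2 * Sn t \<omega>) = exp (- (norm \<xi>)\<^sup>2 * S t \<omega>)"
      using good(2) by eventually_elim (use t in \<open>simp add: Sn_def max_absorb1\<close>)
  qed (use S_rv[OF t] in measurable)
  also have "\<dots> = exp (- t * \<Psi> ((norm \<xi>)\<^sup>2))"
    using laplace_S[OF t, of "(norm \<xi>)\<^sup>2"] \<xi> by simp
  finally show ?thesis .
qed

end

section \<open>Processes with regular paths and symmetric laws of bounded density\<close>

locale levy_paths = prob_space M + complete_measure M for M :: "'w measure" +
  fixes X :: "real \<Rightarrow> 'w \<Rightarrow> 'a::euclidean_space" and \<kappa> :: "real \<Rightarrow> real"
  assumes X_rv [measurable]: "\<And>t. random_variable borel (X t)"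
    and X_0 [simp]: "\<And>\<omega>. X 0 \<omega> = 0"
    and X_right: "\<And>t \<omega>. 0 \<le> t \<Longrightarrow> ((\<lambda>s. X s \<omega>) \<longlongrightarrow> X t \<omega>) (at_right t)"
    and X_left: "\<And>t \<omega>. 0 < t \<Longrightarrow> \<exists>l. ((\<lambda>s. X s \<omega>) \<longlongrightarrow> l) (at_left t)"
    and X_markov: "markov_increments X"
    and X_sym: "\<And>t. 0 \<le> t \<Longrightarrow> distr M borel (\<lambda>\<omega>. - X t \<omega>) = distr M borel (X t)"
    and X_density: "\<And>t A. 0 < t \<Longrightarrow> A \<in> sets borel \<Longrightarrow>
          emeasure (distr M borel (X t)) A \<le> ennreal (\<kappa> t) * emeasure lborel A"
    and \<kappa>_nonneg: "\<And>t. 0 \<le> \<kappa> t"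

text \<open>The characteristic function is even, which gives symmetry by uniqueness; its
  integrability, quantified through the scaling condition, gives the density bound.\<close>

theorem (in subordinate_brownian_motion) levy_paths_Xn:
  assumes Psi: "bernstein0 \<Psi>" "strict_mono_on {0<..} \<Psi>"
    and scaling: "\<mu> > 0" "c \<in> {0<..1}" "\<theta> \<ge> 0" "weak_lower_scaling \<mu> c \<theta> \<Psi>"
  shows "\<exists>A\<ge>0. levy_paths M Xn (\<lambda>t. A * (1 + t powr (- (real DIM('a) / (2 * \<mu>)))))"
proof -
  have nonneg: "0 \<le> \<Psi> u" if "0 < u" for u
    using Psi(1) that by (auto simp: bernstein0_def)
  have isCont: "isCont \<Psi> u" if "0 < u" for u
  proof -
    have "(deriv ^^ 0) \<Psi> differentiable at u" using Psi(1) that unfolding bernstein0_def by blast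
    then show ?thesis by (simp add: differentiable_imp_continuous_within)
  qed
  \<comment> \<open>The value of \<open>\<Psi>\<close> at 0 is unconstrained. Setting it to 0 yields
    a Borel function on the line and the correct value 1 of the characteristic function at
    \<open>\<xi> = 0\<close>.\<close>
  define \<psi> where "\<psi> u = (if 0 < u then \<Psi> u else 0)" for u
  have \<psi>m [measurable]: "\<psi> \<in> borel_measurable borel"
  proof -
    have "continuous_on {0<..} \<Psi>"
      using isCont by (auto intro!: continuous_at_imp_continuous_on)
    then have "(\<lambda>u. if u \<in> {0<..} then \<Psi> u else 0) \<in> borel_measurable borel"
      by (intro borel_measurable_continuous_on_if) auto
    then show ?thesis by (simp add: \<psi>_def[abs_def])
  qed
  have char: "(CLINT x|distr M borel (Xn t). iexp (\<xi> \<bullet> x)) = complex_of_real (exp (- t * \<psi> ((norm \<xi>)\<^sup>2)))"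
    if "0 \<le> t" for t \<xi>
  proof (cases "\<xi> = 0")
    case True
    then show ?thesis
      by (subst integral_distr) (auto simp: \<psi>_def prob_space)
  next
    case False
    then show ?thesis
      using Xn_char[OF that False] by (subst integral_distr) (auto simp: \<psi>_def)
  qed
  obtain c0 u0 where g: "0 < c0" "0 < u0" "\<And>u. u0 \<le> u \<Longrightarrow> c0 * u powr \<mu> \<le> \<Psi> u"
    using bernstein_scaling_growth[OF Psi(2) nonneg scaling] by auto
  obtain A where A: "A \<ge> 0" "\<And>t. 0 < t \<Longrightarrow> (\<integral>\<^sup>+\<xi>. ennreal (exp (- t * \<psi> ((norm (\<xi>::'a))\<^sup>2))) \<partial>lborel)
      \<le> ennreal (A * (1 + t powr (- (real DIM('a) / (2 * \<mu>)))))"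
    using nn_integral_exp_growth[OF nonneg scaling(1) g \<psi>m, where 'a = 'a] by (auto simp: \<psi>_def)
  have "levy_paths M Xn (\<lambda>t. A * (1 + t powr (- (real DIM('a) / (2 * \<mu>)))))"
  proof unfold_locales
    fix t :: real assume t: "0 \<le> t"
    show "distr M borel (\<lambda>\<omega>. - Xn t \<omega>) = distr M borel (Xn t)"
    proof (rule char_eq_imp_measure_eq)
      fix \<xi> :: 'a
      have "(CLINT x|distr M borel (\<lambda>\<omega>. - Xn t \<omega>). iexp (\<xi> \<bullet> x)) = (CLINT x|distr M borel (Xn t). iexp ((- \<xi>) \<bullet> x))"
        by (subst (1 2) integral_distr) auto
      then show "(CLINT x|distr M borel (\<lambda>\<omega>. - Xn t \<omega>). iexp (\<xi> \<bullet> x)) = (CLINT x|distr M borel (Xn t). iexp (\<xi> \<bullet> x))"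
        unfolding char[OF t] by simp
    qed (auto intro!: prob_space_distr)
  next
    fix t :: real and E :: "'a set" assume t: "0 < t" and E: "E \<in> sets borel"
    show "emeasure (distr M borel (Xn t)) E \<le> ennreal (A * (1 + t powr (- (real DIM('a) / (2 * \<mu>))))) * emeasure lborel E"
      using t A char[of t] E
      by (intro char_integrable_imp_bounded_density[where \<phi> = "\<lambda>\<xi>. exp (- t * \<psi> ((norm \<xi>)\<^sup>2))"])
         (auto intro!: prob_space_distr)
  qed (use A Xn_right Xn_left Xn_markov in auto)
  with A show ?thesis by blast
qed

section \<open>Positive symmetric semigroups\<close>

definition square_integrable :: "'a measure \<Rightarrow> ('a \<Rightarrow> real) \<Rightarrow> bool" where
  "square_integrable N f \<longleftrightarrow> f \<in> borel_measurable N \<and> integrable N (\<lambda>x. (f x)\<^sup>2)"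

lemma square_integrable_mult:
  assumes "square_integrable N f" "square_integrable N g"
  shows "integrable N (\<lambda>x. f x * g x)"
proof (rule Bochner_Integration.integrable_bound)
  show "integrable N (\<lambda>x. (f x)\<^sup>2 + (g x)\<^sup>2)"
    using assms by (auto simp: square_integrable_def)
  show "(\<lambda>x. f x * g x) \<in> borel_measurable N"
    using assms by (auto simp: square_integrable_def)
  have "\<bar>a * b\<bar> \<le> a\<^sup>2 + b\<^sup>2" for a b :: real
  proof -
    have "0 \<le> (\<bar>a\<bar> - \<bar>b\<bar>)\<^sup>2" by simp
    then have "2 * (\<bar>a\<bar> * \<bar>b\<bar>) \<le> a\<^sup>2 + b\<^sup>2"
      by (simp add: power2_eq_square algebra_simps)
    then show ?thesis
      unfolding abs_mult using mult_nonneg_nonneg[of "\<bar>a\<bar>" "\<bar>b\<bar>"] by linarith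
  qed
  then show "AE x in N. norm (f x * g x) \<le> norm ((f x)\<^sup>2 + (g x)\<^sup>2)"
    by simp
qed

lemma square_integrable_scale:
  "square_integrable N f \<Longrightarrow> square_integrable N (\<lambda>x. c * f x)"
  by (auto simp: square_integrable_def power_mult_distrib)

lemma square_integrable_add:
  assumes "square_integrable N f" "square_integrable N g"
  shows "square_integrable N (\<lambda>x. f x + g x)"
proof -
  have "integrable N (\<lambda>x. (f x)\<^sup>2 + (g x)\<^sup>2 + 2 * (f x * g x))"
    using assms square_integrable_mult[OF assms] by (auto simp: square_integrable_def)
  then show ?thesis
    using assms by (auto simp: square_integrable_def power2_sum algebra_simps)
qed

lemma square_integrable_diff:
  assumes "square_integrable N f" "square_integrable N g"
  shows "square_integrable N (\<lambda>x. f x - g x)"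
  using square_integrable_add[OF assms(1) square_integrable_scale[OF assms(2), of "-1"]] by simp

lemma square_integrable_abs:
  "square_integrable N f \<Longrightarrow> square_integrable N (\<lambda>x. \<bar>f x\<bar>)"
  by (auto simp: square_integrable_def)

lemma Cauchy_Schwarz_integral:
  fixes f g :: "'a \<Rightarrow> real"
  assumes f: "square_integrable N f" and g: "square_integrable N g"
  shows "(LINT x|N. f x * g x)\<^sup>2 \<le> (LINT x|N. (f x)\<^sup>2) * (LINT x|N. (g x)\<^sup>2)"
proof -
  let ?A = "LINT x|N. (f x)\<^sup>2" and ?B = "LINT x|N. f x * g x" and ?G = "LINT x|N. (g x)\<^sup>2"
  have I: "integrable N (\<lambda>x. (f x)\<^sup>2)" "integrable N (\<lambda>x. (g x)\<^sup>2)" "integrable N (\<lambda>x. f x * g x)"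
    using f g square_integrable_mult[OF f g] by (auto simp: square_integrable_def)
  have quad: "0 \<le> ?A + 2 * c * ?B + c\<^sup>2 * ?G" for c
  proof -
    have "0 \<le> (LINT x|N. (f x + c * g x)\<^sup>2)" by simp
    also have "\<dots> = (LINT x|N. (f x)\<^sup>2 + 2 * c * (f x * g x) + c\<^sup>2 * (g x)\<^sup>2)"
      by (intro Bochner_Integration.integral_cong) (auto simp: power2_eq_square algebra_simps)
    also have "\<dots> = ?A + 2 * c * ?B + c\<^sup>2 * ?G"
      using I by simp
    finally show ?thesis .
  qed
  show ?thesis
  proof (cases "?G = 0")
    case True
    have "?B = 0"
    proof (rule ccontr)
      assume "?B \<noteq> 0"
      \<comment> \<open>The quadratic in \<open>c\<close> has degenerated to a linear function; at
        this \<open>c\<close> its value is -1.\<close>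
      with quad[of "- (?A + 1) / (2 * ?B)"] True show False by (simp add: field_simps)
    qed
    then show ?thesis using True by simp
  next
    case False
    then have G: "?G > 0" by (simp add: less_le)
    \<comment> \<open>The minimiser of the quadratic in \<open>c\<close>.\<close>
    have "0 \<le> ?A + 2 * (- ?B / ?G) * ?B + (- ?B / ?G)\<^sup>2 * ?G" by (rule quad)
    also have "\<dots> = ?A - ?B\<^sup>2 / ?G"
      using G by (simp add: power2_eq_square field_simps)
    finally show ?thesis using G by (simp add: field_simps)
  qed
qed

context finite_measure
begin

lemma square_integrable_bounded:
  assumes "f \<in> borel_measurable M" "\<And>x. x \<in> space M \<Longrightarrow> \<bar>f x\<bar> \<le> B"
  shows "square_integrable M f"
proof -
  have "integrable M (\<lambda>x. (f x)\<^sup>2)"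
  proof (rule integrable_const_bound[where B = "B\<^sup>2"])
    show "AE x in M. norm ((f x)\<^sup>2) \<le> B\<^sup>2"
      using assms(2) by (intro AE_I2) (auto intro: abs_le_square_iff[THEN iffD1] simp: abs_le_square_iff[symmetric]
        intro: order_trans[OF _ abs_ge_self])
  qed (use assms in measurable)
  then show ?thesis using assms by (auto simp: square_integrable_def)
qed

lemma square_integrable_integrable:
  assumes "square_integrable M f"
  shows "integrable M f"
  using square_integrable_mult[OF assms square_integrable_bounded[of "\<lambda>_. 1" 1]] by simp

lemma integral_abs_le_L2:
  assumes "square_integrable M f"
  shows "(LINT x|M. \<bar>f x\<bar>) \<le> sqrt (measure M (space M) * (LINT x|M. (f x)\<^sup>2))"
proof -
  have "(LINT x|M. \<bar>f x\<bar> * 1)\<^sup>2 \<le> (LINT x|M. \<bar>f x\<bar>\<^sup>2) * (LINT x|M. 1\<^sup>2)"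
    by (rule Cauchy_Schwarz_integral)
       (use assms square_integrable_abs square_integrable_bounded[of "\<lambda>_. 1" 1] in auto)
  then have "(LINT x|M. \<bar>f x\<bar>)\<^sup>2 \<le> measure M (space M) * (LINT x|M. (f x)\<^sup>2)"
    by (simp add: mult.commute)
  then show ?thesis by (rule real_le_rsqrt)
qed

end

text \<open>\<open>C t\<close> bounds \<open>T t\<close> from integrable to bounded functions and
  \<open>K\<close> is a growth rate of \<open>T t 1\<close>. The algebraic laws hold at every point
  of the space, not only almost everywhere, because the final estimate is pointwise.
  \<open>T 0\<close> is left unspecified.\<close>

locale symmetric_semigroup = finite_measure N for N :: "'a measure" +
  fixes T :: "real \<Rightarrow> ('a \<Rightarrow> real) \<Rightarrow> 'a \<Rightarrow> real" and K :: real and C :: "real \<Rightarrow> real"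
  assumes T_measurable: "\<And>t f. 0 < t \<Longrightarrow> square_integrable N f \<Longrightarrow> T t f \<in> borel_measurable N"
    and T_add: "\<And>t f g x. 0 < t \<Longrightarrow> square_integrable N f \<Longrightarrow> square_integrable N g \<Longrightarrow> x \<in> space N \<Longrightarrow>
          T t (\<lambda>y. f y + g y) x = T t f x + T t g x"
    and T_scale: "\<And>t f c x. 0 < t \<Longrightarrow> square_integrable N f \<Longrightarrow> x \<in> space N \<Longrightarrow>
          T t (\<lambda>y. c * f y) x = c * T t f x"
    and T_nonneg: "\<And>t f x. 0 < t \<Longrightarrow> square_integrable N f \<Longrightarrow> (\<And>y. y \<in> space N \<Longrightarrow> 0 \<le> f y) \<Longrightarrow>
          x \<in> space N \<Longrightarrow> 0 \<le> T t f x"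
    and T_bound: "\<And>t f x. 0 < t \<Longrightarrow> square_integrable N f \<Longrightarrow> x \<in> space N \<Longrightarrow>
          \<bar>T t f x\<bar> \<le> C t * (LINT y|N. \<bar>f y\<bar>)"
    and T_one: "\<And>t x. 0 < t \<Longrightarrow> x \<in> space N \<Longrightarrow> T t (\<lambda>_. 1) x \<le> exp (K * t)"
    and T_sym: "\<And>t f g. 0 < t \<Longrightarrow> square_integrable N f \<Longrightarrow> square_integrable N g \<Longrightarrow>
          (LINT x|N. g x * T t f x) = (LINT x|N. f x * T t g x)"
    and T_semigroup: "\<And>s t f x. 0 < s \<Longrightarrow> 0 < t \<Longrightarrow> square_integrable N f \<Longrightarrow> x \<in> space N \<Longrightarrow>
          T (s + t) f x = T s (T t f) x"
    and T_nontrivial: "\<exists>t>0. (LINT x|N. T t (\<lambda>_. 1) x) > 0"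
    and C_nonneg: "\<And>t. 0 \<le> C t" and K_nonneg: "0 \<le> K"
begin

abbreviation L2 :: "('a \<Rightarrow> real) \<Rightarrow> bool" where "L2 \<equiv> square_integrable N"

definition ip :: "('a \<Rightarrow> real) \<Rightarrow> ('a \<Rightarrow> real) \<Rightarrow> real" where
  "ip f g = (LINT x|N. f x * g x)"

abbreviation u1 :: "'a \<Rightarrow> real" where "u1 \<equiv> \<lambda>_. 1"

definition mass :: "real \<Rightarrow> real" where "mass t = ip u1 (T t u1)"

lemma L2_one [simp]: "L2 (\<lambda>_. c)"
  by (rule square_integrable_bounded[where B = "\<bar>c\<bar>"]) auto

lemma L2_T [simp]: "0 < t \<Longrightarrow> L2 f \<Longrightarrow> L2 (T t f)"
  by (rule square_integrable_bounded[OF T_measurable T_bound])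

lemma T_diff:
  assumes "0 < t" "L2 f" "L2 g" "x \<in> space N"
  shows "T t (\<lambda>y. f y - g y) x = T t f x - T t g x"
  using T_add[OF assms(1,2) square_integrable_scale[OF assms(3), of "-1"] assms(4)]
    T_scale[OF assms(1,3,4), of "-1"] by simp

lemma T_mono:
  assumes "0 < t" "L2 f" "L2 g" "\<And>y. y \<in> space N \<Longrightarrow> f y \<le> g y" "x \<in> space N"
  shows "T t f x \<le> T t g x"
  using T_nonneg[OF assms(1) square_integrable_diff[OF assms(3,2)] _ assms(5)] assms
    T_diff[OF assms(1,3,2,5)] by auto

lemma ip_commute: "ip f g = ip g f"
  unfolding ip_def by (simp add: mult.commute)

lemma ip_sym: "0 < t \<Longrightarrow> L2 f \<Longrightarrow> L2 g \<Longrightarrow> ip g (T t f) = ip f (T t g)"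
  unfolding ip_def by (rule T_sym)

lemma ip_T_split:
  assumes "0 < s" "0 < t" "L2 f" "L2 g"
  shows "ip g (T (s + t) f) = ip (T s g) (T t f)"
proof -
  have "ip g (T (s + t) f) = ip g (T s (T t f))"
    unfolding ip_def using assms by (intro Bochner_Integration.integral_cong) (auto simp: T_semigroup)
  also have "\<dots> = ip (T t f) (T s g)"
    using assms by (intro ip_sym) auto
  finally show ?thesis by (simp add: ip_commute)
qed

lemma ip_CS: "L2 f \<Longrightarrow> L2 g \<Longrightarrow> (ip f g)\<^sup>2 \<le> ip f f * ip g g"
  using Cauchy_Schwarz_integral[of N f g] by (simp add: ip_def power2_eq_square)

lemma ip_self_nonneg: "0 \<le> ip f f"
  unfolding ip_def by (intro Bochner_Integration.integral_nonneg) auto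

text \<open>The quadratic form of \<open>T t\<close>, completed at time 0 by the identity; no
  continuity at 0 is involved.\<close>

definition qf :: "('a \<Rightarrow> real) \<Rightarrow> real \<Rightarrow> real" where
  "qf f t = ip f (if t = 0 then f else T t f)"

lemma qf_double: "0 \<le> t \<Longrightarrow> L2 f \<Longrightarrow> qf f (2 * t) = ip (if t = 0 then f else T t f) (if t = 0 then f else T t f)"
  using ip_T_split[of t t f f] by (auto simp: qf_def)

text \<open>By symmetry the form is the squared norm of \<open>T (t / 2) f\<close>.\<close>

lemma qf_nonneg: "0 \<le> t \<Longrightarrow> L2 f \<Longrightarrow> 0 \<le> qf f t"
  using qf_double[of "t/2" f] ip_self_nonneg by simp

text \<open>Cauchy-Schwarz for \<open>T s f\<close> and \<open>T t f\<close>: their inner product is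
  the form at \<open>s + t\<close>, their squared norms are the form at \<open>2 * s\<close> and
  \<open>2 * t\<close>.\<close>

lemma qf_logconvex:
  assumes "0 \<le> s" "0 \<le> t" "L2 f"
  shows "(qf f (s + t))\<^sup>2 \<le> qf f (2 * s) * qf f (2 * t)"
proof -
  have "qf f (s + t) = ip (if s = 0 then f else T s f) (if t = 0 then f else T t f)"
    using assms ip_T_split[of s t f f] by (auto simp: qf_def ip_commute)
  then show ?thesis
    using assms qf_double[of s f] qf_double[of t f] ip_CS by auto
qed

lemma mass_qf: "0 < t \<Longrightarrow> mass t = qf u1 t"
  by (simp add: mass_def qf_def)

lemma T_one_nonneg: "0 < t \<Longrightarrow> x \<in> space N \<Longrightarrow> 0 \<le> T t u1 x"
  by (rule T_nonneg) auto

lemma mass_integral_abs: "0 < t \<Longrightarrow> (LINT x|N. \<bar>T t u1 x\<bar>) = mass t"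
  unfolding mass_def ip_def
  by (intro Bochner_Integration.integral_cong) (auto simp: T_one_nonneg)

text \<open>Log-convexity against time 0 carries positivity from \<open>s\<close> to
  \<open>2 * s\<close>, hence to arbitrarily late times. A zero of \<open>mass\<close> at
  \<open>t\<close> would, by \<open>T_bound\<close>, make \<open>T\<close> vanish on 1 at all times
  after \<open>t\<close>.\<close>

lemma mass_pos:
  assumes t: "0 < t" shows "0 < mass t"
proof -
  obtain s where s: "s > 0" "mass s > 0"
    using T_nontrivial by (auto simp: mass_def ip_def)
  have pow: "mass (2 ^ j * s) > 0" for j
  proof (induction j)
    case (Suc j)
    have "(qf u1 (0 + 2 ^ j * s))\<^sup>2 \<le> qf u1 (2 * 0) * qf u1 (2 * (2 ^ j * s))"
      using s by (intro qf_logconvex) auto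
    moreover have "qf u1 (2 ^ j * s) > 0" using Suc s by (simp add: mass_qf)
    ultimately have "0 < qf u1 (2 * 0) * qf u1 (2 * (2 ^ j * s))"
      by (metis add_0 less_le_trans zero_less_power)
    moreover have "0 \<le> qf u1 (2 * 0)" by (intro qf_nonneg) auto
    ultimately have "qf u1 (2 * (2 ^ j * s)) > 0"
      by (metis less_eq_real_def mult_zero_left less_irrefl zero_less_mult_pos)
    then show ?case using s by (simp add: mass_qf mult.assoc)
  qed (use s in simp)
  have "mass t \<ge> 0" unfolding mass_integral_abs[OF t, symmetric] by simp
  moreover have "mass t \<noteq> 0"
  proof
    assume z: "mass t = 0"
    obtain j :: nat where "t / s < 2 ^ j" using real_arch_pow[of 2 "t/s"] by auto
    then have j: "t < 2 ^ j * s" using s by (simp add: field_simps)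
    define v where "v = 2 ^ j * s - t"
    have v: "v > 0" using j by (simp add: v_def)
    have "T (v + t) u1 x = 0" if "x \<in> space N" for x
    proof -
      have "\<bar>T v (T t u1) x\<bar> \<le> C v * (LINT y|N. \<bar>T t u1 y\<bar>)"
        using v t that by (intro T_bound) auto
      then show ?thesis using z t v that by (simp add: mass_integral_abs T_semigroup)
    qed
    then have "mass (v + t) = 0"
      unfolding mass_def ip_def by (subst Bochner_Integration.integral_cong[OF refl, where g = "\<lambda>_. 0"]) auto
    then show False using pow[of j] by (simp add: v_def)
  qed
  ultimately show ?thesis by simp
qed

text \<open>The intermediate step of length \<open>e\<close> smooths: it maps \<open>T t 1\<close>,
  whose integral is \<open>mass t\<close>, to a function bounded by \<open>C e * mass t\<close>.
  This submultiplicativity is what excludes a vanishing limit of \<open>scaled_mass\<close>.\<close>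

lemma mass_submult:
  assumes "0 < s" "0 < t" "0 < e"
  shows "mass (s + e + t) \<le> C e * mass s * mass t"
proof -
  have "mass (s + e + t) = ip (T s u1) (T (e + t) u1)"
    unfolding mass_def using ip_T_split[of s "e + t" u1 u1] assms by (simp add: algebra_simps)
  also have "\<dots> = (LINT x|N. T s u1 x * T e (T t u1) x)"
    unfolding ip_def using assms by (intro Bochner_Integration.integral_cong) (auto simp: T_semigroup)
  also have "\<dots> \<le> (LINT x|N. T s u1 x * (C e * mass t))"
  proof (rule integral_mono)
    show "integrable N (\<lambda>x. T s u1 x * T e (T t u1) x)"
      using assms by (intro square_integrable_mult) auto
    show "integrable N (\<lambda>x. T s u1 x * (C e * mass t))"
      using assms square_integrable_integrable[of "T s u1"] by auto
    fix x assume x: "x \<in> space N"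
    have "T e (T t u1) x \<le> C e * mass t"
      using T_bound[of e "T t u1" x] assms x by (simp add: mass_integral_abs)
    then show "T s u1 x * T e (T t u1) x \<le> T s u1 x * (C e * mass t)"
      using T_one_nonneg[of s x] assms x by (intro mult_left_mono) auto
  qed
  also have "\<dots> = C e * mass s * mass t"
    by (simp add: mass_def ip_def)
  finally show ?thesis .
qed

lemma mass_growth:
  assumes "0 < s" "0 < t" shows "mass (s + t) \<le> exp (K * s) * mass t"
proof -
  have "mass (s + t) = ip (T s u1) (T t u1)"
    unfolding mass_def using ip_T_split[of s t u1 u1] assms by simp
  also have "\<dots> \<le> (LINT x|N. exp (K * s) * T t u1 x)"
    unfolding ip_def
  proof (rule integral_mono)
    show "integrable N (\<lambda>x. T s u1 x * T t u1 x)"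
      using assms by (intro square_integrable_mult) auto
    show "integrable N (\<lambda>x. exp (K * s) * T t u1 x)"
      using assms square_integrable_integrable[of "T t u1"] by auto
    fix x assume x: "x \<in> space N"
    show "T s u1 x * T t u1 x \<le> exp (K * s) * T t u1 x"
      using T_one_nonneg[of t x] T_one[of s x] assms x by (intro mult_right_mono) auto
  qed
  also have "\<dots> = exp (K * s) * mass t" by (simp add: mass_def ip_def)
  finally show ?thesis .
qed

text \<open>Log-convexity makes the ratios increase; their limit is the spectral radius of \<open>T 1\<close>.\<close>

definition ratio :: "nat \<Rightarrow> real" where
  "ratio n = mass (real n + 2) / mass (real n + 1)"

lemma ratio_pos: "0 < ratio n"
  unfolding ratio_def by (intro divide_pos_pos mass_pos) auto

lemma ratio_mono: "incseq ratio"
proof (rule incseq_SucI)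
  fix n
  have e: "(real n + 1)/2 + (real n + 3)/2 = real n + 2" "2 * ((real n + 1)/2) = real n + 1"
      "2 * ((real n + 3)/2) = real n + 3" by (simp_all add: field_simps)
  have "(qf u1 (real n + 2))\<^sup>2 \<le> qf u1 (real n + 1) * qf u1 (real n + 3)"
    using qf_logconvex[of "(real n + 1)/2" "(real n + 3)/2" u1] unfolding e by simp
  then have "(mass (real n + 2))\<^sup>2 \<le> mass (real n + 1) * mass (real n + 3)"
    by (simp add: mass_qf)
  then show "ratio n \<le> ratio (Suc n)"
    unfolding ratio_def using mass_pos[of "real n + 1"] mass_pos[of "real n + 2"] mass_pos[of "real n + 3"]
    by (simp add: field_simps power2_eq_square)
qed

lemma ratio_le: "ratio n \<le> exp K"
proof -
  have "mass (1 + (real n + 1)) \<le> exp (K * 1) * mass (real n + 1)" by (rule mass_growth) auto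
  then show ?thesis unfolding ratio_def using mass_pos[of "real n + 1"] by (simp add: field_simps)
qed

definition growth :: real where "growth = (SUP n. ratio n)"

lemma ratio_tendsto: "ratio \<longlonglongrightarrow> growth"
  unfolding growth_def
  by (rule LIMSEQ_incseq_SUP) (use ratio_mono ratio_le in \<open>auto simp: bdd_above_def\<close>)

lemma ratio_le_growth: "ratio n \<le> growth"
  using incseq_le[OF ratio_mono ratio_tendsto] .

lemma growth_pos: "0 < growth"
  using ratio_le_growth[of 0] ratio_pos[of 0] by simp

definition top_rate :: real where "top_rate = - ln growth"

lemma exp_top_rate: "exp (- top_rate) = growth"
  using growth_pos by (simp add: top_rate_def)

text \<open>In spectral terms the limit of this sequence is proportional to the mass that the
  spectral measure of 1 has at the bottom of the spectrum. Its positivity is what produces an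
  eigenfunction.\<close>

definition scaled_mass :: "nat \<Rightarrow> real" where "scaled_mass n = mass (real n + 1) / growth ^ n"

lemma scaled_mass_pos: "0 < scaled_mass n"
  unfolding scaled_mass_def using growth_pos by (intro divide_pos_pos mass_pos) auto

lemma scaled_mass_decseq: "decseq scaled_mass"
proof (rule decseq_SucI)
  fix n
  have "mass (real n + 2) \<le> growth * mass (real n + 1)"
    using ratio_le_growth[of n] mass_pos[of "real n + 1"] by (simp add: ratio_def field_simps)
  then show "scaled_mass (Suc n) \<le> scaled_mass n"
    unfolding scaled_mass_def using growth_pos by (simp add: field_simps add.commute)
qed

text \<open>If the limit were 0, \<open>mass_submult\<close> would give a fixed lag over which
  \<open>scaled_mass\<close> at least halves from every starting index. The quotient over a fixed
  lag is however a product of factors \<open>ratio (m + i) / growth\<close>, each tending to 1 as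
  \<open>m\<close> grows.\<close>

lemma scaled_mass_convergent: "\<exists>b>0. scaled_mass \<longlonglongrightarrow> b"
proof -
  obtain b where b: "scaled_mass \<longlonglongrightarrow> b" "\<And>i. b \<le> scaled_mass i"
    using decseq_convergent[OF scaled_mass_decseq, of 0] scaled_mass_pos by (metis less_imp_le)
  have "b \<noteq> 0"
  proof
    assume "b = 0"
    then have lim0: "(\<lambda>n. C 1 * scaled_mass n / growth) \<longlonglongrightarrow> C 1 * 0 / growth"
      using b growth_pos by (intro tendsto_intros) auto
    have "\<forall>\<^sub>F n in sequentially. C 1 * scaled_mass n / growth < growth / 2"
      using lim0 growth_pos by (intro order_tendstoD(2)[OF lim0]) auto
    then obtain n where n: "C 1 * scaled_mass n / growth < growth / 2" by (auto simp: eventually_sequentially)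
    have half: "scaled_mass (m + (n + 2)) \<le> scaled_mass m / 2" for m
    proof -
      have "mass (real m + 1 + 1 + (real n + 1)) \<le> C 1 * mass (real m + 1) * mass (real n + 1)"
        by (rule mass_submult) auto
      moreover have "real m + 1 + 1 + (real n + 1) = real (m + (n + 2)) + 1" by simp
      ultimately have "mass (real (m + (n + 2)) + 1) \<le> C 1 * mass (real m + 1) * mass (real n + 1)"
        by metis
      then have "scaled_mass (m + (n + 2)) \<le> C 1 * mass (real m + 1) * mass (real n + 1) / growth ^ (m + (n + 2))"
        unfolding scaled_mass_def using growth_pos by (intro divide_right_mono) auto
      also have "\<dots> = scaled_mass m * (C 1 * scaled_mass n / growth) / growth"
        unfolding scaled_mass_def using growth_pos by (simp add: power_add field_simps power2_eq_square)
      also have "\<dots> \<le> scaled_mass m * (growth / 2) / growth"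
        using n scaled_mass_pos[of m] growth_pos by (intro divide_right_mono mult_left_mono) auto
      finally show ?thesis using growth_pos by simp
    qed
    have prod: "scaled_mass (m + k) = scaled_mass m * (\<Prod>i<k. ratio (m + i) / growth)" for m k
    proof (induction k)
      case (Suc k)
      have "scaled_mass (m + Suc k) = scaled_mass (m + k) * (ratio (m + k) / growth)"
        unfolding scaled_mass_def ratio_def using growth_pos mass_pos[of "real m + real k + 1"]
        by (simp add: field_simps)
      then show ?case using Suc by simp
    qed simp
    have "(\<lambda>m. \<Prod>i<n + 2. ratio (m + i) / growth) \<longlonglongrightarrow> (\<Prod>i<n + 2. growth / growth)"
      using growth_pos LIMSEQ_ignore_initial_segment[OF ratio_tendsto]
      by (intro tendsto_prod tendsto_divide tendsto_const) auto
    then have "(\<lambda>m. \<Prod>i<n + 2. ratio (m + i) / growth) \<longlonglongrightarrow> 1"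
      using growth_pos by simp
    moreover have "(\<Prod>i<n + 2. ratio (m + i) / growth) \<le> 1/2" for m
    proof -
      have cancel: "a * P \<le> a / 2 \<Longrightarrow> 0 < a \<Longrightarrow> P \<le> 1/2" for a P :: real
        by (simp add: field_simps)
      show ?thesis
        by (rule cancel[OF half[unfolded prod] scaled_mass_pos])
    qed
    ultimately show False
      using LIMSEQ_le_const2[of "\<lambda>m. \<Prod>i<n + 2. ratio (m + i) / growth" 1 "1/2"] by auto
  qed
  then show ?thesis using b LIMSEQ_le_const[OF b(1), of 0] scaled_mass_pos by (intro exI[of _ b]) (auto simp: less_le intro: less_imp_le)
qed

lemma scaled_mass_le: "scaled_mass n \<le> mass 1"
  using decseqD[OF scaled_mass_decseq, of 0 n] by (simp add: scaled_mass_def)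

text \<open>The bound at integer times is interpolated by \<open>mass_growth\<close>. The rate may
  be negative, whence the absolute value in the constant.\<close>

lemma mass_upper: "\<exists>A\<ge>0. \<forall>s\<ge>1. mass s \<le> A * exp (- top_rate * s)"
proof (intro exI[of _ "exp K * mass 1 * exp (\<bar>top_rate\<bar> + top_rate)"] conjI allI impI)
  show "0 \<le> exp K * mass 1 * exp (\<bar>top_rate\<bar> + top_rate)" using mass_pos[of 1] by simp
  fix s :: real assume s: "1 \<le> s"
  \<comment> \<open>With this choice \<open>s - n\<close> lies between 1 and 2.\<close>
  define n where "n = nat \<lfloor>s - 1\<rfloor>"
  have n: "real n + 1 \<le> s" "s \<le> real n + 2" using s unfolding n_def by linarith+
  have A: "mass (real n + 1) \<le> mass 1 * growth ^ n"
    using scaled_mass_le[of n] growth_pos by (simp add: scaled_mass_def field_simps)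
  have "mass s \<le> exp K * mass (real n + 1)"
  proof (cases "s = real n + 1")
    case True
    then show ?thesis using mass_pos[of "real n + 1"] K_nonneg by simp
  next
    case False
    then have "mass ((s - (real n + 1)) + (real n + 1)) \<le> exp (K * (s - (real n + 1))) * mass (real n + 1)"
      using n by (intro mass_growth) auto
    also have "\<dots> \<le> exp K * mass (real n + 1)"
      using n mass_pos[of "real n + 1"] K_nonneg by (intro mult_right_mono) (auto intro: mult_left_le)
    finally show ?thesis by simp
  qed
  also have "\<dots> \<le> exp K * (mass 1 * growth ^ n)" using A by simp
  also have "growth ^ n = exp (- top_rate * s) * exp (top_rate * (s - real n))"
    by (simp add: exp_top_rate[symmetric] exp_of_nat_mult[symmetric] exp_add[symmetric] algebra_simps)
  also have "exp K * (mass 1 * (exp (- top_rate * s) * exp (top_rate * (s - real n))))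
      \<le> exp K * (mass 1 * (exp (- top_rate * s) * exp (\<bar>top_rate\<bar> + top_rate)))"
  proof -
    have "top_rate * (s - real n) = top_rate * (s - real n - 1) + top_rate" by (simp add: algebra_simps)
    also have "\<dots> \<le> \<bar>top_rate\<bar> * (s - real n - 1) + top_rate"
      using n by (intro add_right_mono mult_right_mono) auto
    also have "\<dots> \<le> \<bar>top_rate\<bar> * 1 + top_rate"
      using n by (intro add_right_mono mult_left_mono) auto
    finally have "top_rate * (s - real n) \<le> \<bar>top_rate\<bar> + top_rate" by simp
    then show ?thesis using mass_pos[of 1] by (intro mult_left_mono) auto
  qed
  finally show "mass s \<le> exp K * mass 1 * exp (\<bar>top_rate\<bar> + top_rate) * exp (- top_rate * s)"
    by (simp add: mult_ac)
qed

text \<open>One unit of time converts the integral bound \<open>mass_upper\<close> into a pointwise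
  one. As that bound starts at time 1, this covers \<open>t \<ge> 2\<close>; earlier times are left
  to \<open>T_one\<close>.\<close>

lemma T_one_decay:
  "\<exists>A\<ge>0. \<forall>t>0. \<forall>x\<in>space N. T t u1 x \<le> A * exp (- top_rate * t)"
proof -
  obtain A where A: "A \<ge> 0" "\<And>s. s \<ge> 1 \<Longrightarrow> mass s \<le> A * exp (- top_rate * s)"
    using mass_upper by blast
  \<comment> \<open>The second entry dominates \<open>exp (K * t) * exp (top_rate * t)\<close> for
    all \<open>t < 2\<close>, whatever the sign of the rate.\<close>
  define A' where "A' = max (C 1 * A * exp top_rate) (exp (2 * K + 2 * \<bar>top_rate\<bar>))"
  have "T t u1 x \<le> A' * exp (- top_rate * t)" if t: "t > 0" and x: "x \<in> space N" for t x
  proof (cases "t \<ge> 2")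
    case True
    have "T t u1 x = T 1 (T (t - 1) u1) x" using T_semigroup[of 1 "t - 1" u1 x] True x by simp
    also have "\<dots> \<le> C 1 * mass (t - 1)"
      using T_bound[of 1 "T (t - 1) u1" x] True x by (simp add: mass_integral_abs)
    also have "\<dots> \<le> C 1 * (A * exp (- top_rate * (t - 1)))"
      using True C_nonneg by (intro mult_left_mono A) auto
    also have "\<dots> = C 1 * A * exp top_rate * exp (- top_rate * t)"
      by (simp add: algebra_simps exp_add[symmetric])
    also have "\<dots> \<le> A' * exp (- top_rate * t)"
      by (intro mult_right_mono) (auto simp: A'_def)
    finally show ?thesis .
  next
    case False
    have "T t u1 x \<le> exp (K * t)" using T_one[OF t x] .
    also have "\<dots> \<le> exp (2 * K + 2 * \<bar>top_rate\<bar> - top_rate * t)"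
    proof -
      have "K * t \<le> K * 2" using False K_nonneg by (intro mult_left_mono) auto
      moreover have "top_rate * t \<le> \<bar>top_rate\<bar> * 2"
        using False t by (intro mult_mono) auto
      ultimately show ?thesis by simp
    qed
    also have "\<dots> = exp (2 * K + 2 * \<bar>top_rate\<bar>) * exp (- top_rate * t)"
      by (simp add: exp_add[symmetric])
    also have "\<dots> \<le> A' * exp (- top_rate * t)"
      by (intro mult_right_mono) (auto simp: A'_def)
    finally show ?thesis .
  qed
  moreover have "A' \<ge> 0" by (simp add: A'_def le_max_iff_disj)
  ultimately show ?thesis by blast
qed

text \<open>Smoothing for one unit of time on each side replaces \<open>f\<close> by the bounded
  function \<open>T 1 f\<close>, which positivity compares with a constant. So the rate found from
  the constant 1 bounds every form, for now with a factor depending on \<open>f\<close>. The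
  threshold 3 keeps \<open>s - 2 \<ge> 1\<close>.\<close>

lemma qf_upper:
  assumes f: "L2 f" shows "\<exists>A\<ge>0. \<forall>s\<ge>3. qf f s \<le> A * exp (- top_rate * s)"
proof -
  obtain A where A: "A \<ge> 0" "\<And>s. s \<ge> 1 \<Longrightarrow> mass s \<le> A * exp (- top_rate * s)"
    using mass_upper by blast
  define c where "c = C 1 * (LINT y|N. \<bar>f y\<bar>)"
  have c: "c \<ge> 0" "\<And>x. x \<in> space N \<Longrightarrow> \<bar>T 1 f x\<bar> \<le> c"
    using C_nonneg T_bound[of 1 f] f by (auto simp: c_def)
  have "qf f s \<le> c * c * (A * exp (2 * top_rate)) * exp (- top_rate * s)" if s: "s \<ge> 3" for s
  proof -
    let ?g = "T 1 f"
    have g: "L2 ?g" using f by simp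
    have "qf f s = ip f (T (1 + (s - 1)) f)" using s by (simp add: qf_def)
    also have "\<dots> = ip ?g (T (s - 1) f)" using s f by (intro ip_T_split) auto
    also have "\<dots> = ip ?g (T ((s - 2) + 1) f)" using s by simp
    also have "\<dots> = ip ?g (T (s - 2) ?g)"
      unfolding ip_def using s f
      by (intro Bochner_Integration.integral_cong refl arg_cong2[where f = "(*)"] T_semigroup) auto
    also have "\<dots> \<le> (LINT x|N. c * (c * T (s - 2) u1 x))"
      unfolding ip_def
    proof (rule integral_mono)
      show "integrable N (\<lambda>x. ?g x * T (s - 2) ?g x)"
        using s g by (intro square_integrable_mult) auto
      show "integrable N (\<lambda>x. c * (c * T (s - 2) u1 x))"
        using s square_integrable_integrable[of "T (s-2) u1"] by auto
      fix x assume x: "x \<in> space N"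
      have "T (s - 2) ?g x \<le> T (s - 2) (\<lambda>_. c) x"
        using c s g x by (intro T_mono) (auto simp: abs_le_iff)
      moreover have "T (s - 2) ?g x \<ge> T (s - 2) (\<lambda>_. - c) x"
        using c s g x by (intro T_mono) (auto simp: abs_le_iff minus_le_iff)
      ultimately have "\<bar>T (s - 2) ?g x\<bar> \<le> c * T (s - 2) u1 x"
        using T_scale[of "s - 2" u1 x c] T_scale[of "s - 2" u1 x "-c"] s x by auto
      then have "\<bar>?g x\<bar> * \<bar>T (s - 2) ?g x\<bar> \<le> c * (c * T (s - 2) u1 x)"
        using c x by (intro mult_mono) auto
      then show "?g x * T (s - 2) ?g x \<le> c * (c * T (s - 2) u1 x)"
        by (simp add: abs_mult[symmetric])
    qed
    also have "\<dots> = c * c * mass (s - 2)" by (simp add: mass_def ip_def)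
    also have "\<dots> \<le> c * c * (A * exp (- top_rate * (s - 2)))"
      using s c by (intro mult_left_mono A) auto
    also have "\<dots> = c * c * (A * exp (2 * top_rate)) * exp (- top_rate * s)"
      by (simp add: algebra_simps exp_add[symmetric])
    finally show ?thesis .
  qed
  then show ?thesis using A c by (intro exI[of _ "c * c * (A * exp (2 * top_rate))"]) auto
qed

text \<open>The factor in \<open>qf_upper\<close> is removed by doubling: an excess
  \<open>r > 1\<close> at time \<open>t\<close> grows to at least \<open>r ^ (2 ^ j)\<close> at time
  \<open>2 ^ j * t\<close> by log-convexity, which no fixed factor can bound.\<close>

lemma qf_decay:
  assumes f: "L2 f" and t: "0 < t"
  shows "qf f t \<le> exp (- top_rate * t) * qf f 0"
proof (rule ccontr)
  assume neg: "\<not> ?thesis"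
  obtain A where A: "A \<ge> 0" "\<And>s. s \<ge> 3 \<Longrightarrow> qf f s \<le> A * exp (- top_rate * s)"
    using qf_upper[OF f] by blast
  have q0: "qf f 0 \<ge> 0" using f by (intro qf_nonneg) auto
  have "0 \<le> exp (- top_rate * t) * qf f 0" using q0 by simp
  then have qt: "qf f t > 0" using neg by linarith
  have "(qf f (0 + t))\<^sup>2 \<le> qf f (2 * 0) * qf f (2 * t)" using f t by (intro qf_logconvex) auto
  then have q0': "qf f 0 > 0" using qt q0 by (cases "qf f 0 = 0") auto
  define r where "r = qf f t / (exp (- top_rate * t) * qf f 0)"
  have r: "r > 1" using neg q0' by (simp add: r_def field_simps)
  have pow: "r ^ (2 ^ j) \<le> qf f (2 ^ j * t) / (exp (- top_rate * (2 ^ j * t)) * qf f 0)" for j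
  proof (induction j)
    case 0 then show ?case by (simp add: r_def)
  next
    case (Suc j)
    have "r ^ (2 ^ Suc j) = (r ^ (2 ^ j))\<^sup>2" by (simp add: power_mult[symmetric] mult.commute)
    also have "\<dots> \<le> (qf f (2 ^ j * t) / (exp (- top_rate * (2 ^ j * t)) * qf f 0))\<^sup>2"
      using Suc r by (intro power_mono) auto
    also have "\<dots> = (qf f (2 ^ j * t))\<^sup>2 / (exp (- top_rate * (2 ^ Suc j * t)) * (qf f 0)\<^sup>2)"
      by (simp add: power_divide power_mult_distrib exp_double[symmetric] algebra_simps)
    also have "\<dots> \<le> (qf f 0 * qf f (2 ^ Suc j * t)) / (exp (- top_rate * (2 ^ Suc j * t)) * (qf f 0)\<^sup>2)"
    proof (rule divide_right_mono)
      have "(qf f (0 + 2 ^ j * t))\<^sup>2 \<le> qf f (2 * 0) * qf f (2 * (2 ^ j * t))"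
        using f t by (intro qf_logconvex) auto
      then show "(qf f (2 ^ j * t))\<^sup>2 \<le> qf f 0 * qf f (2 ^ Suc j * t)"
        by (simp add: mult.assoc)
    qed simp
    also have "\<dots> = qf f (2 ^ Suc j * t) / (exp (- top_rate * (2 ^ Suc j * t)) * qf f 0)"
      using q0' by (simp add: power2_eq_square field_simps)
    finally show ?case .
  qed
  obtain i :: nat where i: "A / qf f 0 < r ^ i" using real_arch_pow[OF r] by auto
  obtain j0 :: nat where j0: "3 / t < 2 ^ j0" using real_arch_pow[of 2 "3/t"] by auto
  \<comment> \<open>\<open>i\<close> makes the power exceed the constant, \<open>j0\<close> carries
    the time beyond the threshold 3.\<close>
  define j where "j = max i j0"
  have "(2::real) ^ j0 \<le> 2 ^ j" unfolding j_def by (intro power_increasing) auto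
  then have "3 / t < 2 ^ j" using j0 by linarith
  then have j3: "3 \<le> 2 ^ j * t" using t by (simp add: field_simps)
  have "r ^ i \<le> r ^ (2 ^ j)"
  proof (rule power_increasing)
    have "i < 2 ^ i" by (rule less_exp)
    also have "(2::nat) ^ i \<le> 2 ^ j" unfolding j_def by (intro power_increasing) auto
    finally show "i \<le> 2 ^ j" by simp
  qed (use r in auto)
  also have "\<dots> \<le> qf f (2 ^ j * t) / (exp (- top_rate * (2 ^ j * t)) * qf f 0)" by (rule pow)
  also have "\<dots> \<le> A * exp (- top_rate * (2 ^ j * t)) / (exp (- top_rate * (2 ^ j * t)) * qf f 0)"
    using q0' by (intro divide_right_mono A j3) auto
  also have "\<dots> = A / qf f 0" by simp
  finally show False using i by simp
qed

lemma top_rate_quadratic_form: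
  assumes "L2 f" "0 < t"
  shows "(LINT x|N. f x * T t f x) \<le> exp (- top_rate * t) * (LINT x|N. (f x)\<^sup>2)"
  using qf_decay[OF assms] assms by (simp add: qf_def ip_def power2_eq_square)

text \<open>Power iteration started from the constant 1; the limit is the top eigenfunction.\<close>

definition iterate :: "nat \<Rightarrow> 'a \<Rightarrow> real" where
  "iterate n x = (1 / growth ^ n) * T (real n + 1) u1 x"

lemma L2_iterate [simp]: "L2 (iterate n)"
  unfolding iterate_def[abs_def] by (intro square_integrable_scale L2_T) auto

text \<open>The inner product depends on \<open>n + m\<close> alone, so convergence of
  \<open>scaled_mass\<close> makes the iterates a Cauchy sequence in mean square.\<close>

lemma ip_iterate: "ip (iterate n) (iterate m) = growth * scaled_mass (n + m + 1)"
proof -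
  have "ip (iterate n) (iterate m) = 1 / growth ^ n * (1 / growth ^ m) * ip (T (real n + 1) u1) (T (real m + 1) u1)"
    unfolding iterate_def[abs_def] ip_def by (simp add: mult_ac)
  also have "ip (T (real n + 1) u1) (T (real m + 1) u1) = mass (real (n + m + 1) + 1)"
    unfolding mass_def using ip_T_split[of "real n + 1" "real m + 1" u1 u1]
    by (simp add: algebra_simps)
  finally show ?thesis
    using growth_pos by (simp add: scaled_mass_def power_add)
qed

lemma T_iterate: "x \<in> space N \<Longrightarrow> T 1 (iterate n) x = growth * iterate (Suc n) x"
  unfolding iterate_def[abs_def]
  using T_scale[of 1 "T (real n + 1) u1" x "1 / growth ^ n"] T_semigroup[of 1 "real n + 1" u1 x] growth_pos
  by (simp add: add.commute add.left_commute field_simps)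

text \<open>One application of \<open>T 1\<close> turns mean-square distance into pointwise
  distance, at the price of advancing both indices.\<close>

lemma iterate_dist:
  assumes "x \<in> space N"
  shows "\<bar>iterate (Suc n) x - iterate (Suc m) x\<bar> \<le> C 1 / growth * sqrt (measure N (space N) *
    (growth * (scaled_mass (n + n + 1) - 2 * scaled_mass (n + m + 1) + scaled_mass (m + m + 1))))"
proof -
  let ?d = "\<lambda>x. iterate n x - iterate m x"
  have d: "L2 ?d" by (intro square_integrable_diff) auto
  have I: "integrable N (\<lambda>x. iterate i x * iterate j x)" for i j
    by (intro square_integrable_mult) auto
  have "(LINT x|N. (?d x)\<^sup>2) = (LINT x|N. iterate n x * iterate n x - 2 * (iterate n x * iterate m x) + iterate m x * iterate m x)"
    by (intro Bochner_Integration.integral_cong) (auto simp: power2_eq_square algebra_simps)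
  also have "\<dots> = ip (iterate n) (iterate n) - 2 * ip (iterate n) (iterate m) + ip (iterate m) (iterate m)"
    using I by (simp add: ip_def)
  also have "\<dots> = growth * (scaled_mass (n + n + 1) - 2 * scaled_mass (n + m + 1) + scaled_mass (m + m + 1))"
    by (simp add: ip_iterate algebra_simps)
  finally have e: "(LINT x|N. (?d x)\<^sup>2) = growth * (scaled_mass (n + n + 1) - 2 * scaled_mass (n + m + 1) + scaled_mass (m + m + 1))" .
  have "\<bar>T 1 ?d x\<bar> \<le> C 1 * (LINT y|N. \<bar>?d y\<bar>)"
    using d assms by (intro T_bound) auto
  also have "\<dots> \<le> C 1 * sqrt (measure N (space N) * (LINT x|N. (?d x)\<^sup>2))"
    using C_nonneg d by (intro mult_left_mono integral_abs_le_L2) auto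
  finally have "\<bar>growth * iterate (Suc n) x - growth * iterate (Suc m) x\<bar> \<le> C 1 * sqrt (measure N (space N) * (LINT x|N. (?d x)\<^sup>2))"
    using assms T_diff[of 1 "iterate n" "iterate m" x] by (simp add: T_iterate)
  moreover have "\<bar>growth * iterate (Suc n) x - growth * iterate (Suc m) x\<bar> = growth * \<bar>iterate (Suc n) x - iterate (Suc m) x\<bar>"
    using growth_pos by (simp add: right_diff_distrib[symmetric] abs_mult)
  ultimately show ?thesis
    using growth_pos by (simp add: e field_simps)
qed

lemma iterate_bound: "x \<in> space N \<Longrightarrow> \<bar>iterate (Suc n) x\<bar> \<le> C 1 * mass 1 / growth"
proof -
  assume x: "x \<in> space N"
  have "\<bar>T 1 (iterate n) x\<bar> \<le> C 1 * (LINT y|N. \<bar>iterate n y\<bar>)"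
    using x by (intro T_bound) auto
  also have "(LINT y|N. \<bar>iterate n y\<bar>) = scaled_mass n"
    unfolding iterate_def scaled_mass_def using growth_pos
    by (simp add: abs_mult mass_integral_abs divide_inverse)
  finally have "growth * \<bar>iterate (Suc n) x\<bar> \<le> C 1 * scaled_mass n"
    using x growth_pos by (simp add: T_iterate abs_mult)
  also have "\<dots> \<le> C 1 * mass 1" using scaled_mass_le C_nonneg by (intro mult_left_mono) auto
  finally show ?thesis using growth_pos by (simp add: field_simps)
qed

lemma iterate_convergent:
  assumes x: "x \<in> space N" shows "convergent (\<lambda>n. iterate n x)"
proof -
  obtain b where b: "scaled_mass \<longlonglongrightarrow> b" using scaled_mass_convergent by blast
  define g where "g n = 2 * (C 1 / growth * sqrt (measure N (space N) * (growth * (scaled_mass n - b))))" for n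
  have g: "g \<longlonglongrightarrow> 2 * (C 1 / growth * sqrt (measure N (space N) * (growth * (b - b))))"
    unfolding g_def by (intro tendsto_intros b)
  have b_le: "b \<le> scaled_mass i" for i using decseq_ge[OF scaled_mass_decseq b] .
  have le: "\<bar>iterate (Suc n) x - iterate (Suc m) x\<bar> \<le> g k" if "k \<le> n" "k \<le> m" for n m k
  proof -
    have "scaled_mass (n + n + 1) - 2 * scaled_mass (n + m + 1) + scaled_mass (m + m + 1) \<le> 2 * (scaled_mass k - b)"
      using decseqD[OF scaled_mass_decseq, of k "n+n+1"] decseqD[OF scaled_mass_decseq, of k "m+m+1"]
        b_le[of "n + m + 1"] that by simp
    \<comment> \<open>Enlarging 2 to 4 lets the square root come out as the factor 2 in
      \<open>g\<close>.\<close>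
    also have "\<dots> \<le> 4 * (scaled_mass k - b)" using b_le[of k] by simp
    finally have "sqrt (measure N (space N) * (growth * (scaled_mass (n + n + 1) - 2 * scaled_mass (n + m + 1) + scaled_mass (m + m + 1))))
       \<le> sqrt (measure N (space N) * (growth * (4 * (scaled_mass k - b))))"
      using growth_pos by (intro real_sqrt_le_mono mult_left_mono) auto
    also have "\<dots> = sqrt (2\<^sup>2 * (measure N (space N) * (growth * (scaled_mass k - b))))"
      by (simp add: mult_ac)
    also have "\<dots> = 2 * sqrt (measure N (space N) * (growth * (scaled_mass k - b)))"
      by (subst real_sqrt_mult) simp
    finally have s: "sqrt (measure N (space N) * (growth * (scaled_mass (n + n + 1) - 2 * scaled_mass (n + m + 1) + scaled_mass (m + m + 1))))
       \<le> 2 * sqrt (measure N (space N) * (growth * (scaled_mass k - b)))" .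
    have "\<bar>iterate (Suc n) x - iterate (Suc m) x\<bar> \<le> C 1 / growth * (2 * sqrt (measure N (space N) * (growth * (scaled_mass k - b))))"
      using iterate_dist[OF x, of n m] mult_left_mono[OF s, of "C 1 / growth"] C_nonneg[of 1] growth_pos by simp
    then show ?thesis by (simp add: g_def mult_ac)
  qed
  have "Cauchy (\<lambda>n. iterate (Suc n) x)"
  proof (rule CauchyI')
    fix e :: real assume e: "0 < e"
    have "g \<longlonglongrightarrow> 0" using g by simp
    then obtain k where "g k < e"
      using order_tendstoD(2)[of g 0 sequentially e] e by (auto simp: eventually_sequentially)
    then show "\<exists>M. \<forall>m\<ge>M. \<forall>n>m. dist (iterate (Suc m) x) (iterate (Suc n) x) < e"
      by (intro exI[of _ k]) (auto simp: dist_real_def intro!: le_less_trans[OF le])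
  qed
  then have "convergent (\<lambda>n. iterate (Suc n) x)" by (rule Cauchy_convergent)
  then show ?thesis using convergent_Suc_iff[of "\<lambda>n. iterate n x"] by simp
qed

text \<open>Nontriviality rests on the positive limit of \<open>scaled_mass\<close>, which is the
  squared norm of the limit up to the factor \<open>growth\<close>. The eigenvalue equation for
  \<open>T 1\<close> is a limit of \<open>T_iterate\<close>. For smaller times it follows because
  the decay bound is attained at time 1, which leaves no slack in log-convexity.\<close>

theorem top_eigenfunction:
  "\<exists>\<phi> B. \<phi> \<in> borel_measurable N \<and> (\<forall>x\<in>space N. \<bar>\<phi> x\<bar> \<le> B) \<and> (LINT x|N. (\<phi> x)\<^sup>2) > 0 \<and>
     (\<forall>t. 0 < t \<longrightarrow> t \<le> 1 \<longrightarrow> (AE x in N. T t \<phi> x = exp (- top_rate * t) * \<phi> x))"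
proof -
  define \<phi> where "\<phi> x = lim (\<lambda>n. iterate (Suc n) x)" for x
  define B where "B = C 1 * mass 1 / growth"
  have lim: "(\<lambda>n. iterate (Suc n) x) \<longlonglongrightarrow> \<phi> x" if "x \<in> space N" for x
    unfolding \<phi>_def using iterate_convergent[OF that] convergent_Suc_iff[of "\<lambda>n. iterate n x"]
    by (simp add: convergent_LIMSEQ_iff)
  have iterate_meas: "iterate n \<in> borel_measurable N" for n using L2_iterate[of n] by (simp add: square_integrable_def)
  have meas: "\<phi> \<in> borel_measurable N"
    by (rule borel_measurable_LIMSEQ_real[where u = "\<lambda>n. iterate (Suc n)"]) (use lim iterate_meas in auto)
  have bnd: "\<bar>\<phi> x\<bar> \<le> B" if "x \<in> space N" for x
    using LIMSEQ_le_const2[OF tendsto_rabs[OF lim[OF that]], of B] iterate_bound[OF that] by (auto simp: B_def)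
  have phi: "L2 \<phi>" by (rule square_integrable_bounded[OF meas bnd])
  have L1: "(\<lambda>n. LINT x|N. \<bar>iterate (Suc n) x - \<phi> x\<bar>) \<longlonglongrightarrow> (LINT x|N. 0)"
  proof (rule integral_dominated_convergence[where w = "\<lambda>_. 2 * B"])
    show "AE x in N. (\<lambda>n. \<bar>iterate (Suc n) x - \<phi> x\<bar>) \<longlonglongrightarrow> 0"
      using lim by (intro AE_I2 tendsto_rabs_zero) (simp add: LIM_zero)
    show "AE x in N. norm \<bar>iterate (Suc n) x - \<phi> x\<bar> \<le> 2 * B" for n
      using bnd iterate_bound[of _ n] by (intro AE_I2) (fastforce simp: B_def)
  qed (use meas iterate_meas in auto)
  have Tlim: "(\<lambda>n. T t (iterate (Suc n)) x) \<longlonglongrightarrow> T t \<phi> x" if t: "0 < t" and x: "x \<in> space N" for t x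
  proof -
    have "(\<lambda>n. T t (iterate (Suc n)) x - T t \<phi> x) \<longlonglongrightarrow> 0"
    proof (rule Lim_null_comparison)
      show "\<forall>\<^sub>F n in sequentially. norm (T t (iterate (Suc n)) x - T t \<phi> x) \<le> C t * (LINT x|N. \<bar>iterate (Suc n) x - \<phi> x\<bar>)"
        using T_bound[OF t square_integrable_diff[OF L2_iterate phi] x] T_diff[OF t L2_iterate phi x] by simp
      show "(\<lambda>n. C t * (LINT x|N. \<bar>iterate (Suc n) x - \<phi> x\<bar>)) \<longlonglongrightarrow> 0"
        using tendsto_mult_right_zero[of _ _ "C t"] L1 by simp
    qed
    then show ?thesis by (simp add: LIM_zero_iff)
  qed
  have T1: "T 1 \<phi> x = growth * \<phi> x" if x: "x \<in> space N" for x
  proof -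
    have "(\<lambda>n. growth * iterate (Suc (Suc n)) x) \<longlonglongrightarrow> growth * \<phi> x"
      by (intro tendsto_mult tendsto_const LIMSEQ_Suc[OF lim[OF x]])
    then have "(\<lambda>n. T 1 (iterate (Suc n)) x) \<longlonglongrightarrow> growth * \<phi> x" using x by (simp add: T_iterate)
    then show ?thesis by (rule LIMSEQ_unique[OF Tlim[OF _ x], rotated]) simp
  qed
  have norm: "0 < (LINT x|N. (\<phi> x)\<^sup>2)"
  proof -
    obtain b where b: "0 < b" "scaled_mass \<longlonglongrightarrow> b" using scaled_mass_convergent by blast
    have "(\<lambda>n. LINT x|N. (iterate (Suc n) x)\<^sup>2) \<longlonglongrightarrow> (LINT x|N. (\<phi> x)\<^sup>2)"
    proof (rule integral_dominated_convergence[where w = "\<lambda>_. B\<^sup>2"])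
      show "AE x in N. (\<lambda>n. (iterate (Suc n) x)\<^sup>2) \<longlonglongrightarrow> (\<phi> x)\<^sup>2"
        using lim by (intro AE_I2 tendsto_power) auto
      show "AE x in N. norm ((iterate (Suc n) x)\<^sup>2) \<le> B\<^sup>2" for n
        using iterate_bound[of _ n] unfolding B_def[symmetric]
        by (intro AE_I2) (auto simp: abs_le_square_iff[symmetric] intro: order_trans[OF _ abs_ge_self])
    qed (use meas iterate_meas in auto)
    moreover have "(\<lambda>n. LINT x|N. (iterate (Suc n) x)\<^sup>2) \<longlonglongrightarrow> growth * b"
    proof -
      have "(LINT x|N. (iterate (Suc n) x)\<^sup>2) = growth * scaled_mass (n + n + 3)" for n
        using ip_iterate[of "Suc n" "Suc n"] by (simp add: ip_def power2_eq_square numeral_eq_Suc)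
      moreover have "(\<lambda>n. growth * scaled_mass (n + n + 3)) \<longlonglongrightarrow> growth * b"
        using LIMSEQ_subseq_LIMSEQ[OF b(2), of "\<lambda>n. n + n + 3"]
        by (intro tendsto_intros) (auto simp: strict_mono_def o_def)
      ultimately show ?thesis by simp
    qed
    ultimately have "(LINT x|N. (\<phi> x)\<^sup>2) = growth * b" by (rule LIMSEQ_unique)
    then show ?thesis using b growth_pos by simp
  qed
  have q0: "qf \<phi> 0 = (LINT x|N. (\<phi> x)\<^sup>2)" by (simp add: qf_def ip_def power2_eq_square)
  have q1: "qf \<phi> 1 = growth * qf \<phi> 0"
  proof -
    have "qf \<phi> 1 = (LINT x|N. \<phi> x * T 1 \<phi> x)" by (simp add: qf_def ip_def)
    also have "\<dots> = (LINT x|N. growth * (\<phi> x * \<phi> x))"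
      by (intro Bochner_Integration.integral_cong) (auto simp: T1)
    finally show ?thesis by (simp add: qf_def ip_def)
  qed
  \<comment> \<open>The times \<open>t\<close> and \<open>2 - t\<close> have midpoint 1, where the
    form is known exactly. Log-convexity and the decay bound at \<open>2 - t\<close> force the form
    at \<open>t\<close> to be at least as large as its upper bound.\<close>
  have "AE x in N. T t \<phi> x = exp (- top_rate * t) * \<phi> x" if t: "0 < t" "t \<le> 1" for t
  proof -
    let ?e = "exp (- top_rate * t)"
    have "(qf \<phi> ((1 - t/2) + t/2))\<^sup>2 \<le> qf \<phi> (2 * (1 - t/2)) * qf \<phi> (2 * (t/2))"
      using t phi by (intro qf_logconvex) auto
    then have "(growth * qf \<phi> 0)\<^sup>2 \<le> qf \<phi> (2 - t) * qf \<phi> t"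
      by (simp add: q1 right_diff_distrib)
    also have "\<dots> \<le> exp (- top_rate * (2 - t)) * qf \<phi> 0 * qf \<phi> t"
      using t phi by (intro mult_right_mono qf_decay qf_nonneg) auto
    also have "exp (- top_rate * (2 - t)) = growth\<^sup>2 / ?e"
      by (simp add: exp_top_rate[symmetric] exp_double[symmetric] exp_diff[symmetric] algebra_simps)
    finally have "growth\<^sup>2 * (qf \<phi> 0 * (?e * qf \<phi> 0)) \<le> growth\<^sup>2 * (qf \<phi> 0 * qf \<phi> t)"
      by (simp add: field_simps power2_eq_square)
    then have low: "?e * qf \<phi> 0 \<le> qf \<phi> t"
      using growth_pos norm q0 by simp
    have I: "integrable N (\<lambda>x. (T t \<phi> x)\<^sup>2)" "integrable N (\<lambda>x. (\<phi> x)\<^sup>2)" "integrable N (\<lambda>x. \<phi> x * T t \<phi> x)"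
      using phi t L2_T[of t \<phi>] square_integrable_mult[OF phi L2_T[of t \<phi>]] unfolding square_integrable_def by auto
    \<comment> \<open>In the expanded square the upper bound at \<open>2 * t\<close> and the lower
      bound at \<open>t\<close> make the three terms cancel.\<close>
    have "(LINT x|N. (T t \<phi> x - ?e * \<phi> x)\<^sup>2) =
        (LINT x|N. (T t \<phi> x)\<^sup>2 - 2 * ?e * (\<phi> x * T t \<phi> x) + ?e\<^sup>2 * (\<phi> x)\<^sup>2)"
      by (intro Bochner_Integration.integral_cong) (auto simp: power2_eq_square algebra_simps)
    also have "\<dots> = (LINT x|N. (T t \<phi> x)\<^sup>2) - 2 * ?e * qf \<phi> t + ?e\<^sup>2 * qf \<phi> 0"
      using I t by (simp add: qf_def ip_def q0 power2_eq_square)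
    also have "(LINT x|N. (T t \<phi> x)\<^sup>2) = qf \<phi> (2 * t)"
      using t phi by (subst qf_double) (auto simp: ip_def power2_eq_square)
    also have "\<dots> - 2 * ?e * qf \<phi> t + ?e\<^sup>2 * qf \<phi> 0 \<le> ?e\<^sup>2 * qf \<phi> 0 - 2 * ?e * (?e * qf \<phi> 0) + ?e\<^sup>2 * qf \<phi> 0"
    proof -
      have "qf \<phi> (2 * t) \<le> exp (- top_rate * (2 * t)) * qf \<phi> 0"
        using t phi by (intro qf_decay) auto
      also have "exp (- top_rate * (2 * t)) = ?e\<^sup>2" by (simp add: exp_double[symmetric] algebra_simps)
      finally have A: "qf \<phi> (2 * t) \<le> ?e\<^sup>2 * qf \<phi> 0" .
      have "2 * ?e * (?e * qf \<phi> 0) \<le> 2 * ?e * qf \<phi> t" by (intro mult_left_mono low) auto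
      then show ?thesis using A by linarith
    qed
    also have "\<dots> = 0" by (simp add: power2_eq_square)
    finally have "(LINT x|N. (T t \<phi> x - ?e * \<phi> x)\<^sup>2) = 0"
      by (intro antisym Bochner_Integration.integral_nonneg) auto
    moreover have "integrable N (\<lambda>x. (T t \<phi> x - ?e * \<phi> x)\<^sup>2)"
      using square_integrable_diff[OF L2_T[OF t(1) phi] square_integrable_scale[OF phi, of ?e]]
      by (simp add: square_integrable_def)
    ultimately have "AE x in N. (T t \<phi> x - ?e * \<phi> x)\<^sup>2 = 0"
      by (subst (asm) integral_nonneg_eq_0_iff_AE) auto
    then show ?thesis by eventually_elim simp
  qed
  then show ?thesis using meas bnd norm by blast
qed

end

section \<open>Quasi-left-continuity at the exit time\<close>

definition right_cont :: "(real \<Rightarrow> 'b::metric_space) \<Rightarrow> bool" where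
  "right_cont w \<longleftrightarrow> (\<forall>t\<ge>0. (w \<longlongrightarrow> w t) (at_right t))"

lemma right_contD:
  assumes "right_cont w" "0 \<le> s" "open U" "w s \<in> U"
  shows "\<exists>b>s. \<forall>y. s \<le> y \<longrightarrow> y < b \<longrightarrow> w y \<in> U"
proof -
  have "\<forall>\<^sub>F y in at_right s. w y \<in> U"
    using assms by (auto simp: right_cont_def intro: topological_tendstoD)
  then obtain b where "b > s" "\<And>y. s < y \<Longrightarrow> y < b \<Longrightarrow> w y \<in> U"
    by (auto simp: eventually_at_right_field)
  then show ?thesis using assms(4) by (intro exI[of _ b]) (auto simp: le_less)
qed

lemma right_cont_seq:
  assumes "right_cont w" "0 \<le> s" "c \<longlonglongrightarrow> s" "\<And>N. s \<le> c N"
  shows "(\<lambda>N. w (c N)) \<longlonglongrightarrow> w s"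
proof (rule topological_tendstoI)
  fix U assume "open U" "w s \<in> U"
  then obtain b where b: "b > s" "\<And>y. s \<le> y \<Longrightarrow> y < b \<Longrightarrow> w y \<in> U"
    using right_contD[OF assms(1,2)] by blast
  have "\<forall>\<^sub>F N in sequentially. c N < b" using assms(3) b(1) by (rule order_tendstoD)
  then show "\<forall>\<^sub>F N in sequentially. w (c N) \<in> U"
    by eventually_elim (use b assms(4) in auto)
qed

text \<open>Openness and right-continuity carry a path that is in \<open>D\<close> at time
  \<open>t\<close> a little further, so the infimum of the later bad times is strictly greater than
  \<open>t\<close>.\<close>

lemma less_exit_time_iff:
  assumes w: "right_cont w" and D: "open D" and t: "0 < t"
  shows "ereal t < exit_time D w \<longleftrightarrow> (\<forall>s\<in>{0<..t}. w s \<in> D)"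
proof
  assume lt: "ereal t < exit_time D w"
  show "\<forall>s\<in>{0<..t}. w s \<in> D"
  proof (rule ballI, rule ccontr)
    fix s assume s: "s \<in> {0<..t}" "w s \<notin> D"
    then have "exit_time D w \<le> ereal s" unfolding exit_time_def by (intro Inf_lower) auto
    also have "\<dots> \<le> ereal t" using s by simp
    finally show False using lt by simp
  qed
next
  assume in_D: "\<forall>s\<in>{0<..t}. w s \<in> D"
  then obtain b where b: "b > t" "\<And>y. t \<le> y \<Longrightarrow> y < b \<Longrightarrow> w y \<in> D"
    using right_contD[OF w _ D, of t] t by auto
  have "ereal b \<le> exit_time D w" unfolding exit_time_def
  proof (rule Inf_greatest)
    fix z assume "z \<in> ereal ` {t. 0 < t \<and> w t \<notin> D}"
    then obtain s where "z = ereal s" "0 < s" "w s \<notin> D" by auto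
    moreover have "b \<le> s"
      using \<open>0 < s\<close> \<open>w s \<notin> D\<close> b(2)[of s] in_D by (cases "s \<le> t") force+
    ultimately show "ereal b \<le> z" by simp
  qed
  then show "ereal t < exit_time D w" using b(1) less_le_trans[of "ereal t" "ereal b"] by simp
qed

lemma grid_point:
  fixes s :: real
  assumes "0 \<le> s"
  shows "\<exists>j::nat. s \<le> real j / 2 ^ N \<and> real j / 2 ^ N < s + 1 / 2 ^ N"
proof (intro exI conjI)
  let ?j = "nat \<lceil>s * 2 ^ N\<rceil>"
  have r: "real ?j = of_int \<lceil>s * 2 ^ N\<rceil>" using assms by simp
  have "s * 2 ^ N \<le> real ?j" "real ?j < s * 2 ^ N + 1" unfolding r by linarith+
  then show "s \<le> real ?j / 2 ^ N" "real ?j / 2 ^ N < s + 1 / 2 ^ N" by (auto simp: field_simps)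
qed

lemma small_mesh:
  assumes "(0::real) < e" shows "\<exists>N0. \<forall>N\<ge>N0. 1 / 2 ^ N < e"
proof -
  have "(\<lambda>N. inverse ((2::real) ^ N)) \<longlonglongrightarrow> 0" by (rule LIMSEQ_inverse_realpow_zero) simp
  then have "\<forall>\<^sub>F N in sequentially. inverse ((2::real) ^ N) < e" using assms by (rule order_tendstoD)
  then show ?thesis by (auto simp: eventually_sequentially inverse_eq_divide)
qed

text \<open>A right-continuous path with left limits that stays in \<open>D\<close> on \<open>(0, t]\<close> but leaves every
  member of a compact exhaustion of \<open>D\<close> jumps at the limit of the exit times, which the first grid
  points outside \<open>K k\<close> announce.\<close>

lemma announced_jump:
  fixes w :: "real \<Rightarrow> 'b::metric_space"
  assumes w: "right_cont w" and left: "\<And>s. 0 < s \<Longrightarrow> \<exists>l. (w \<longlongrightarrow> l) (at_left s)"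
    and K: "\<And>n. closed (K n)" "\<And>n. K n \<subseteq> interior (K (Suc n))" "(\<Union>n. K n) = D"
    and w0: "w 0 \<in> D" and stay: "\<And>s. 0 < s \<Longrightarrow> s \<le> t \<Longrightarrow> w s \<in> D"
    and leave: "\<And>k. \<exists>s. 0 < s \<and> s \<le> t \<and> w s \<notin> K k"
  shows "\<exists>q::nat. \<forall>\<delta>>0. \<exists>k0. \<forall>k\<ge>k0. \<exists>N0. \<forall>N\<ge>N0. \<exists>j i::nat.
     (\<forall>i'<j. w (real i' / 2 ^ N) \<in> K k) \<and> w (real j / 2 ^ N) \<notin> K k \<and> real i / 2 ^ N \<le> \<delta> \<and>
     dist (w (real (j + i) / 2 ^ N)) (w (real j / 2 ^ N)) > 1 / real (Suc q)"
proof -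
  have K_mono: "K m \<subseteq> K n" if "m \<le> n" for m n
    using K(2) interior_subset by (intro lift_Suc_mono_le[OF _ that]) blast
  define A where "A k = {s. 0 < s \<and> w s \<notin> K k}" for k
  define \<sigma> where "\<sigma> k = Inf (A k)" for k
  have A_ne: "A k \<noteq> {}" for k using leave[of k] by (auto simp: A_def)
  have A_bdd: "bdd_below (A k)" for k by (rule bdd_belowI[of _ 0]) (auto simp: A_def)
  have \<sigma>0: "0 \<le> \<sigma> k" for k unfolding \<sigma>_def by (rule cInf_greatest[OF A_ne]) (auto simp: A_def)
  have \<sigma>_le: "\<sigma> k \<le> s" if "s \<in> A k" for k s unfolding \<sigma>_def by (rule cInf_lower[OF that A_bdd])
  have \<sigma>t: "\<sigma> k \<le> t" for k using leave[of k] \<sigma>_le[of _ k] by (fastforce simp: A_def)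
  have \<sigma>_mono: "\<sigma> m \<le> \<sigma> n" if "m \<le> n" for m n
    unfolding \<sigma>_def using A_ne A_bdd K_mono[OF that] by (intro cInf_superset_mono) (auto simp: A_def)
  define S where "S = (SUP k. \<sigma> k)"
  have bdd: "bdd_above (range \<sigma>)" using \<sigma>t by (auto simp: bdd_above_def)
  have \<sigma>S: "\<sigma> k \<le> S" for k unfolding S_def by (rule cSUP_upper[OF _ bdd]) simp
  have St: "S \<le> t" unfolding S_def by (rule cSUP_least) (auto simp: \<sigma>t)
  have S0: "0 \<le> S" using \<sigma>0 \<sigma>S order_trans by blast
  have near_S: "\<exists>k. \<forall>m\<ge>k. a < \<sigma> m" if aS: "a < S" for a
  proof -
    obtain k where "a < \<sigma> k" using aS bdd unfolding S_def by (subst (asm) less_cSUP_iff) auto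
    then show ?thesis using \<sigma>_mono by (intro exI[of _ k]) (auto intro: less_le_trans)
  qed
  have eventually_K: "\<exists>k b. b > s \<and> (\<forall>y. s \<le> y \<longrightarrow> y < b \<longrightarrow> (\<forall>m\<ge>k. w y \<in> K m))" if s: "0 \<le> s" "w s \<in> D" for s
  proof -
    obtain k where "w s \<in> K k" using s K(3) by auto
    then have "w s \<in> interior (K (Suc k))" using K(2) by auto
    then obtain b where b: "b > s" "\<And>y. s \<le> y \<Longrightarrow> y < b \<Longrightarrow> w y \<in> interior (K (Suc k))"
      using right_contD[OF w s(1) open_interior] by blast
    show ?thesis
      by (intro exI[of _ "Suc k"] exI[of _ b]) (use b interior_subset K_mono in blast)
  qed
  have wS: "w S \<in> D" using stay[of S] S0 St w0 by (cases "S = 0") auto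
  \<comment> \<open>If some exit time equalled the limit \<open>S\<close>, all later ones would too.
    But \<open>w S\<close> lies in the interior of some member, so the path stays in all larger
    members up to a time beyond \<open>S\<close>.\<close>
  have strict: "\<sigma> k < S" for k
  proof (rule ccontr)
    assume "\<not> \<sigma> k < S"
    then have eq: "\<sigma> k = S" using \<sigma>S[of k] by simp
    obtain k1 b where b: "b > S" "\<And>y m. S \<le> y \<Longrightarrow> y < b \<Longrightarrow> m \<ge> k1 \<Longrightarrow> w y \<in> K m"
      using eventually_K[OF S0 wS] by blast
    let ?k = "max k k1"
    have "b \<le> \<sigma> ?k" unfolding \<sigma>_def
    proof (rule cInf_greatest[OF A_ne])
      fix s assume s: "s \<in> A ?k"
      show "b \<le> s"
      proof (rule ccontr)
        assume "\<not> b \<le> s"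
        moreover have "S \<le> s" using \<sigma>_le[OF s] \<sigma>_mono[of k ?k] eq by simp
        ultimately have "w s \<in> K ?k" using b(2)[of s ?k] by simp
        then show False using s by (simp add: A_def)
      qed
    qed
    then show False using b(1) \<sigma>S[of ?k] by simp
  qed
  have Spos: "0 < S" using strict[of 0] \<sigma>0[of 0] by simp
  obtain l where l: "(w \<longlongrightarrow> l) (at_left S)" using left[OF Spos] by blast
  have nearleft: "\<exists>a<S. \<forall>y. a < y \<longrightarrow> y < S \<longrightarrow> w y \<in> U" if "open U" "l \<in> U" for U
    using topological_tendstoD[OF l that] by (auto simp: eventually_at_left_field)
  \<comment> \<open>A left limit in \<open>D\<close> would keep the path in one fixed member just
    before \<open>S\<close>, while exits from every later member occur arbitrarily close before
    \<open>S\<close>.\<close>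
  have lD: "l \<notin> D"
  proof
    assume "l \<in> D"
    then obtain k where "l \<in> K k" using K(3) by auto
    then have "l \<in> interior (K (Suc k))" using K(2) by auto
    then obtain a where a: "a < S" "\<And>y. a < y \<Longrightarrow> y < S \<Longrightarrow> w y \<in> interior (K (Suc k))"
      using nearleft[OF open_interior] by blast
    obtain k1 where k1: "\<And>m. m \<ge> k1 \<Longrightarrow> a < \<sigma> m" using near_S[OF a(1)] by blast
    let ?k = "max (Suc k) k1"
    obtain s where s: "s \<in> A ?k" "s < S"
      using cInf_lessD[OF A_ne, of ?k S] strict[of ?k] unfolding \<sigma>_def by blast
    have "a < s" using k1[of ?k] \<sigma>_le[OF s(1)] by simp
    then have "w s \<in> K ?k" using a(2)[OF _ s(2)] interior_subset[of "K (Suc k)"] K_mono[of "Suc k" ?k] by auto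
    then show False using s(1) by (simp add: A_def)
  qed
  define d where "d = dist l (w S)"
  have d: "d > 0" using lD wS by (auto simp: d_def)
  \<comment> \<open>Before \<open>S\<close> the path is within \<open>d / 4\<close> of
    \<open>l\<close>, after \<open>S\<close> within \<open>d / 4\<close> of \<open>w S\<close>;
    points on the two sides are then more than \<open>d / 2\<close> apart.\<close>
  obtain q :: nat where q: "1 / real (Suc q) < d / 2"
    using reals_Archimedean[of "d / 2"] d by (auto simp: inverse_eq_divide)
  obtain a where a: "a < S" "\<And>y. a < y \<Longrightarrow> y < S \<Longrightarrow> w y \<in> ball l (d / 4)"
    using nearleft[of "ball l (d / 4)"] d by auto
  obtain b where b: "b > S" "\<And>y. S \<le> y \<Longrightarrow> y < b \<Longrightarrow> w y \<in> ball (w S) (d / 4)"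
    using right_contD[OF w S0, of "ball (w S) (d / 4)"] d by auto
  have far: "dist (w y') (w y) > 1 / real (Suc q)" if "a < y" "y < S" "S \<le> y'" "y' < b" for y y'
  proof -
    have "d \<le> dist l (w y) + dist (w y) (w y') + dist (w y') (w S)"
      unfolding d_def using dist_triangle[of l "w S" "w y"] dist_triangle[of "w y" "w S" "w y'"] by simp
    moreover have "dist l (w y) < d / 4" "dist (w y') (w S) < d / 4"
      using a(2)[of y] b(2)[of y'] that by (auto simp: dist_commute)
    ultimately show ?thesis using q by (simp add: dist_commute)
  qed
  \<comment> \<open>For large \<open>k\<close> the starting point belongs to \<open>K k\<close>, so
    the first grid exit does not occur at index 0 and is a genuine element of
    \<open>A k\<close>.\<close>
  obtain kk bb where kk: "\<And>m. m \<ge> kk \<Longrightarrow> w 0 \<in> K m" using eventually_K[of 0] w0 by blast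
  show ?thesis
  proof (rule exI[of _ q], intro allI impI)
    fix \<delta> :: real assume \<delta>: "0 < \<delta>"
    define a' where "a' = max (max a (S - \<delta> / 2)) 0"
    define b' where "b' = min b (S + \<delta> / 2)"
    have a': "a' < S" "a \<le> a'" "S - \<delta> / 2 \<le> a'" "0 \<le> a'" using a Spos \<delta> by (auto simp: a'_def)
    have b': "S < b'" "b' \<le> b" "b' \<le> S + \<delta> / 2" using b \<delta> by (auto simp: b'_def)
    obtain k1 where k1: "\<And>m. m \<ge> k1 \<Longrightarrow> a' < \<sigma> m" using near_S[OF a'(1)] by blast
    show "\<exists>k0. \<forall>k\<ge>k0. \<exists>N0. \<forall>N\<ge>N0. \<exists>j i::nat.
     (\<forall>i'<j. w (real i' / 2 ^ N) \<in> K k) \<and> w (real j / 2 ^ N) \<notin> K k \<and> real i / 2 ^ N \<le> \<delta> \<and>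
     dist (w (real (j + i) / 2 ^ N)) (w (real j / 2 ^ N)) > 1 / real (Suc q)"
    proof (rule exI[of _ "max k1 kk"], intro allI impI)
      fix k assume k: "max k1 kk \<le> k"
      obtain s where s: "s \<in> A k" "s < S"
        using cInf_lessD[OF A_ne, of k S] strict[of k] unfolding \<sigma>_def by blast
      have s0: "0 \<le> s" "w s \<in> - K k" using s by (auto simp: A_def)
      obtain c where c: "c > s" "\<And>y. s \<le> y \<Longrightarrow> y < c \<Longrightarrow> w y \<in> - K k"
        using right_contD[OF w s0(1) _ s0(2)] K(1) by blast
      \<comment> \<open>The mesh must be fine enough that the grid point following \<open>s\<close>
        is still outside \<open>K k\<close> and before \<open>S\<close>, and that the one following
        \<open>S\<close> is before \<open>b'\<close>.\<close>
      define e where "e = min (min c S - s) (b' - S)"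
      have "e > 0" using c s b' by (simp add: e_def)
      then obtain N0 where N0: "\<And>N. N \<ge> N0 \<Longrightarrow> 1 / 2 ^ N < e" using small_mesh by blast
      show "\<exists>N0. \<forall>N\<ge>N0. \<exists>j i::nat.
         (\<forall>i'<j. w (real i' / 2 ^ N) \<in> K k) \<and> w (real j / 2 ^ N) \<notin> K k \<and> real i / 2 ^ N \<le> \<delta> \<and>
         dist (w (real (j + i) / 2 ^ N)) (w (real j / 2 ^ N)) > 1 / real (Suc q)"
      proof (rule exI[of _ N0], intro allI impI)
        fix N assume N: "N0 \<le> N"
        obtain jp where jp: "s \<le> real jp / 2 ^ N" "real jp / 2 ^ N < s + 1 / 2 ^ N"
          using grid_point[OF s0(1)] by blast
        have jp': "real jp / 2 ^ N < c" "real jp / 2 ^ N < S"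
          using jp N0[OF N] by (auto simp: e_def)
        \<comment> \<open>The first grid exit. It comes after \<open>a'\<close> because it belongs
          to \<open>A k\<close>, and before \<open>S\<close> because it is at most
          \<open>jp\<close>.\<close>
        define j where "j = (LEAST j. w (real j / 2 ^ N) \<notin> K k)"
        have ex: "w (real jp / 2 ^ N) \<notin> K k" using c(2)[of "real jp / 2 ^ N"] jp jp' by auto
        have j: "w (real j / 2 ^ N) \<notin> K k" unfolding j_def by (rule LeastI[of "\<lambda>j. w (real j / 2 ^ N) \<notin> K k", OF ex])
        have j_le: "j \<le> jp" unfolding j_def by (rule Least_le[of "\<lambda>j. w (real j / 2 ^ N) \<notin> K k", OF ex])
        have before: "\<forall>i'<j. w (real i' / 2 ^ N) \<in> K k" unfolding j_def by (auto dest: not_less_Least)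
        have "j \<noteq> 0" using j kk[of k] k by (intro notI) auto
        then have jA: "real j / 2 ^ N \<in> A k" using j by (simp add: A_def)
        have j1: "a' < real j / 2 ^ N" using \<sigma>_le[OF jA] k1[of k] k by simp
        have "real j / 2 ^ N \<le> real jp / 2 ^ N" using j_le by (intro divide_right_mono) auto
        then have j2: "real j / 2 ^ N < S" using jp' by simp
        obtain p where p: "S \<le> real p / 2 ^ N" "real p / 2 ^ N < S + 1 / 2 ^ N"
          using grid_point[OF S0] by blast
        have p': "real p / 2 ^ N < b'" using p N0[OF N] by (auto simp: e_def)
        have "real j / 2 ^ N < real p / 2 ^ N" using j2 p by simp
        then have jp_le: "j \<le> p" by (simp add: divide_less_cancel)
        have "real (p - j) / 2 ^ N = real p / 2 ^ N - real j / 2 ^ N"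
          using jp_le by (simp add: of_nat_diff diff_divide_distrib)
        also have "\<dots> \<le> \<delta>" using p' b' j1 a' by simp
        finally have small: "real (p - j) / 2 ^ N \<le> \<delta>" .
        have "dist (w (real p / 2 ^ N)) (w (real j / 2 ^ N)) > 1 / real (Suc q)"
          using j1 j2 a' b' p p' by (intro far) auto
        then have "dist (w (real (j + (p - j)) / 2 ^ N)) (w (real j / 2 ^ N)) > 1 / real (Suc q)"
          using jp_le by simp
        then show "\<exists>j i::nat.
           (\<forall>i'<j. w (real i' / 2 ^ N) \<in> K k) \<and> w (real j / 2 ^ N) \<notin> K k \<and> real i / 2 ^ N \<le> \<delta> \<and>
           dist (w (real (j + i) / 2 ^ N)) (w (real j / 2 ^ N)) > 1 / real (Suc q)"
          using before j small by blast
      qed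
    qed
  qed
qed

text \<open>Fatou's lemma for events, in the form of a uniform bound.\<close>

lemma emeasure_liminf_le:
  assumes E: "\<And>k. E k \<in> sets M" and le: "\<And>k. emeasure M (E k) \<le> c"
  shows "emeasure M (\<Union>i. \<Inter>k\<in>{i::nat..}. E k) \<le> c"
proof -
  have m: "(\<Inter>k\<in>{i..}. E k) \<in> sets M" for i using E by (intro sets.countable_INT') auto
  have "emeasure M (\<Union>i. \<Inter>k\<in>{i..}. E k) = (SUP i. emeasure M (\<Inter>k\<in>{i..}. E k))"
    using m by (intro SUP_emeasure_incseq[symmetric]) (auto simp: incseq_def)
  also have "\<dots> \<le> c"
  proof (rule SUP_least)
    fix i
    have "emeasure M (\<Inter>k\<in>{i..}. E k) \<le> emeasure M (E i)" using E by (intro emeasure_mono) auto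
    also have "\<dots> \<le> c" by (rule le)
    finally show "emeasure M (\<Inter>k\<in>{i..}. E k) \<le> c" .
  qed
  finally show ?thesis .
qed

section \<open>Jumps right after an exit are improbable\<close>

context levy_paths
begin

lemma X_right_cont: "right_cont (\<lambda>s. x + X s \<omega>)"
  unfolding right_cont_def by (auto intro!: tendsto_intros X_right)

text \<open>\<open>j\<close> is the first exit from \<open>K\<close> on the grid, a stopping time
  with countably many values; the event asks for a large displacement within the time
  \<open>\<delta>\<close> after it.\<close>

definition exit_jump :: "'a \<Rightarrow> 'a set \<Rightarrow> nat \<Rightarrow> real \<Rightarrow> nat \<Rightarrow> 'w set" where
  "exit_jump x K q \<delta> N = {\<omega>\<in>space M. \<exists>j i::nat.
     (\<forall>i'<j. x + X (real i' / 2 ^ N) \<omega> \<in> K) \<and> x + X (real j / 2 ^ N) \<omega> \<notin> K \<and> real i / 2 ^ N \<le> \<delta> \<and>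
     norm (X (real (j + i) / 2 ^ N) \<omega> - X (real j / 2 ^ N) \<omega>) > 1 / real (Suc q)}"

text \<open>All meshes are united, so that the bound derived from this event does not depend on
  \<open>N\<close>.\<close>

definition early_jump :: "nat \<Rightarrow> real \<Rightarrow> 'w set" where
  "early_jump q \<delta> = {\<omega>\<in>space M. \<exists>N i::nat. real i / 2 ^ N \<le> \<delta> \<and> norm (X (real i / 2 ^ N) \<omega>) > 1 / real (Suc q)}"

lemma sets_exit_jump [measurable]: "closed K \<Longrightarrow> exit_jump x K q \<delta> N \<in> sets M"
proof -
  assume "closed K"
  then have [measurable]: "K \<in> sets borel" by simp
  show ?thesis unfolding exit_jump_def by measurable
qed

lemma sets_early_jump [measurable]: "early_jump q \<delta> \<in> sets M"
  unfolding early_jump_def by measurable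

text \<open>The strong Markov property at a discrete stopping time: the sample space is partitioned
  by the value of the first grid exit, and on each part the displacement afterwards is independent
  of the past and distributed as from time 0.\<close>

lemma emeasure_exit_jump_le:
  assumes K: "closed K"
  shows "emeasure M (exit_jump x K q \<delta> N) \<le> emeasure M (early_jump q \<delta>)"
proof -
  have [measurable]: "K \<in> sets borel" using K by simp
  define h where "h = 1 / (2::real) ^ N"
  have h: "h \<ge> 0" "\<And>i::nat. real i / 2 ^ N = real i * h" by (auto simp: h_def)
  \<comment> \<open>Bounds the number of grid steps that fit into the time \<open>\<delta>\<close>,
    so that finitely many coordinates describe the future.\<close>
  define m where "m = nat \<lfloor>\<delta> * 2 ^ N\<rfloor>"
  define P where "P j = {\<omega>\<in>space M. (\<forall>i'<j. x + X (real i' * h) \<omega> \<in> K) \<and> x + X (real j * h) \<omega> \<notin> K}" for j :: nat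
  have P [measurable]: "P j \<in> sets M" for j unfolding P_def by measurable
  define F where "F j = {\<omega>\<in>space M. \<exists>i::nat. i \<le> m \<and> real i * h \<le> \<delta> \<and> norm (X (real j * h + real i * h) \<omega> - X (real j * h) \<omega>) > 1 / real (Suc q)}" for j :: nat
  have F [measurable]: "F j \<in> sets M" for j unfolding F_def by measurable
  have F0: "F 0 \<subseteq> early_jump q \<delta>"
  proof
    fix \<omega> assume "\<omega> \<in> F 0"
    then obtain i :: nat where "\<omega> \<in> space M" "real i / 2 ^ N \<le> \<delta>" "norm (X (real i / 2 ^ N) \<omega>) > 1 / real (Suc q)"
      unfolding F_def h(2)[symmetric] by (auto simp: h(2) simp del: of_nat_Suc)
    then show "\<omega> \<in> early_jump q \<delta>" unfolding early_jump_def by blast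
  qed
  have indep: "emeasure M (P j \<inter> F j) = emeasure M (P j) * emeasure M (F 0)" for j
  proof -
    define H where "H = (\<lambda>(a, b). indicator {a\<in>space (vecM j). (\<forall>i'<j. x + a i' \<in> K) \<and> x + a j \<notin> K} a *
       (indicator {b\<in>space (vecM m). \<exists>i\<le>m. real i * h \<le> \<delta> \<and> norm (b i) > 1 / real (Suc q)} (b :: nat \<Rightarrow> 'a) :: ennreal))"
    have Hm: "H \<in> borel_measurable (vecM j \<Otimes>\<^sub>M vecM m)"
    proof -
      have [measurable]: "(\<lambda>a. a i :: 'a) \<in> borel_measurable (vecM k)" if "i \<le> k" for i k :: nat
        using that by (intro measurable_component_singleton) auto
      have "{a\<in>space (vecM j). (\<forall>i'<j. x + a i' \<in> K) \<and> x + a j \<notin> K} \<in> sets (vecM j)"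
      proof -
        have "{a\<in>space (vecM j). (\<forall>i'\<in>{..<j}. x + a i' \<in> K) \<and> x + a j \<notin> K} \<in> sets (vecM j)"
          by (intro sets.sets_Collect_conj sets.sets_Collect_finite_All sets.sets_Collect_neg) auto
        then show ?thesis by simp
      qed
      moreover have "{b\<in>space (vecM m). \<exists>i\<le>m. real i * h \<le> \<delta> \<and> norm ((b :: nat \<Rightarrow> 'a) i) > 1 / real (Suc q)} \<in> sets (vecM m)"
      proof -
        have "{b\<in>space (vecM m). \<exists>i\<in>{..m}. real i * h \<le> \<delta> \<and> norm ((b :: nat \<Rightarrow> 'a) i) > 1 / real (Suc q)} \<in> sets (vecM m)"
          by (intro sets.sets_Collect_finite_Ex sets.sets_Collect_conj) auto
        then show ?thesis by simp
      qed
      ultimately show ?thesis unfolding H_def by measurable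
    qed
    have sp: "(\<lambda>i\<in>{..k}. g i) \<in> space (vecM k)" for k and g :: "nat \<Rightarrow> 'a"
      by (simp add: space_PiM)
    have "emeasure M (P j \<inter> F j) = (\<integral>\<^sup>+\<omega>. indicator (P j \<inter> F j) \<omega> \<partial>M)" by simp
    also have "\<dots> = (\<integral>\<^sup>+\<omega>. H (\<lambda>i\<in>{..j}. X (real i * h) \<omega>, \<lambda>i\<in>{..m}. X (real j * h + real i * h) \<omega> - X (real j * h) \<omega>) \<partial>M)"
      by (intro nn_integral_cong) (auto simp: H_def P_def F_def indicator_def sp space_PiM)
    also have "\<dots> = (\<integral>\<^sup>+\<omega>. \<integral>\<^sup>+\<omega>'. H (\<lambda>i\<in>{..j}. X (real i * h) \<omega>, \<lambda>i\<in>{..m}. X (real i * h) \<omega>') \<partial>M \<partial>M)"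
      by (rule markov_increments_nn_integral[OF X_markov X_rv _ _ _ _ Hm]) (use h in \<open>auto intro!: mult_right_mono\<close>)
    also have "\<dots> = (\<integral>\<^sup>+\<omega>. \<integral>\<^sup>+\<omega>'. indicator (P j) \<omega> * indicator (F 0) \<omega>' \<partial>M \<partial>M)"
      by (intro nn_integral_cong) (auto simp: H_def P_def F_def indicator_def sp space_PiM)
    also have "\<dots> = emeasure M (P j) * emeasure M (F 0)"
      by (simp add: nn_integral_cmult nn_integral_multc)
    finally show ?thesis .
  qed
  have disj: "disjoint_family P"
    unfolding disjoint_family_on_def P_def by (auto, metis linorder_neqE_nat)+
  have "exit_jump x K q \<delta> N \<subseteq> (\<Union>j. P j \<inter> F j)"
  proof
    fix \<omega> assume "\<omega> \<in> exit_jump x K q \<delta> N"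
    then obtain j i :: nat where *: "\<omega> \<in> space M" "\<forall>i'<j. x + X (real i' * h) \<omega> \<in> K" "x + X (real j * h) \<omega> \<notin> K"
       "real i * h \<le> \<delta>" "norm (X (real (j + i) * h) \<omega> - X (real j * h) \<omega>) > 1 / real (Suc q)"
      unfolding exit_jump_def h(2) by auto
    have "real i \<le> \<delta> * 2 ^ N" using *(4) by (simp add: h_def field_simps)
    then have "i \<le> m" unfolding m_def by (simp add: le_nat_floor)
    then show "\<omega> \<in> (\<Union>j. P j \<inter> F j)" using * by (auto simp: P_def F_def distrib_right)
  qed
  then have "emeasure M (exit_jump x K q \<delta> N) \<le> emeasure M (\<Union>j. P j \<inter> F j)"
    by (intro emeasure_mono) auto
  also have "\<dots> = (\<Sum>j. emeasure M (P j \<inter> F j))"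
    using disj by (intro suminf_emeasure[symmetric]) (auto simp: disjoint_family_on_def)
  also have "\<dots> = (\<Sum>j. emeasure M (P j)) * emeasure M (F 0)"
    unfolding indep by (rule ennreal_suminf_multc)
  also have "(\<Sum>j. emeasure M (P j)) = emeasure M (\<Union>j. P j)"
    using disj by (intro suminf_emeasure) auto
  also have "\<dots> * emeasure M (F 0) \<le> 1 * emeasure M (F 0)"
    by (intro mult_right_mono emeasure_le_1) auto
  also have "\<dots> \<le> emeasure M (early_jump q \<delta>)" using F0 by (simp add: emeasure_mono)
  finally show ?thesis .
qed

text \<open>Right-continuity at time 0, where every path starts at 0, excludes displacements of
  fixed size in arbitrarily short time.\<close>

lemma early_jump_null: "emeasure M (\<Inter>r::nat. early_jump q (1 / real (Suc r))) = 0"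
proof -
  have "(\<Inter>r::nat. early_jump q (1 / real (Suc r))) = {}"
  proof (rule ccontr)
    assume "(\<Inter>r::nat. early_jump q (1 / real (Suc r))) \<noteq> {}"
    then obtain \<omega> where \<omega>: "\<And>r::nat. \<omega> \<in> early_jump q (1 / real (Suc r))" by auto
    have "X 0 \<omega> \<in> ball 0 (1 / real (Suc q))" by simp
    then obtain b where b: "b > 0" "\<And>y. 0 \<le> y \<Longrightarrow> y < b \<Longrightarrow> X y \<omega> \<in> ball 0 (1 / real (Suc q))"
      using right_contD[OF X_right_cont[of 0 \<omega>], of 0 "ball 0 (1 / real (Suc q))"] by auto
    obtain r :: nat where r: "1 / real (Suc r) < b" using reals_Archimedean[OF b(1)] by (auto simp: inverse_eq_divide)
    obtain N i :: nat where "real i / 2 ^ N \<le> 1 / real (Suc r)" "norm (X (real i / 2 ^ N) \<omega>) > 1 / real (Suc q)"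
      using \<omega>[of r] by (auto simp: early_jump_def)
    then show False using b(2)[of "real i / 2 ^ N"] r by auto
  qed
  then show ?thesis by simp
qed

text \<open>A path that stays in \<open>D\<close> but in no single \<open>K n\<close> has, by
  \<open>announced_jump\<close>, a displacement of fixed size shortly after its grid exit from
  \<open>K k\<close>, for all large \<open>k\<close> and \<open>N\<close> and for every time window.
  The probability of such an event is at most that of an early jump, uniformly in \<open>k\<close>
  and \<open>N\<close>, and tends to 0 with the window.\<close>

theorem quasi_left_continuity:
  assumes K: "\<And>n. compact (K n)" "\<And>n. K n \<subseteq> interior (K (Suc n))" "(\<Union>n. K n) = D" and x: "x \<in> D"
  shows "AE \<omega> in M. (\<forall>s\<in>{0<..t}. x + X s \<omega> \<in> D) \<longrightarrow> (\<exists>n. \<forall>s\<in>{0<..t}. x + X s \<omega> \<in> K n)"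
proof -
  have cl: "closed (K n)" for n using K(1) by (rule compact_imp_closed)
  \<comment> \<open>The iterated lower limit mirrors the quantifiers in
    \<open>announced_jump\<close>: all large \<open>k\<close>, then all large \<open>N\<close>
    depending on \<open>k\<close>.\<close>
  define L where "L q \<delta> = (\<Union>k0. \<Inter>k\<in>{k0..}. \<Union>N0. \<Inter>N\<in>{N0..}. exit_jump x (K k) q \<delta> N)" for q \<delta>
  have m1 [measurable]: "(\<Union>N0. \<Inter>N\<in>{N0..}. exit_jump x (K k) q \<delta> N) \<in> sets M" for k q \<delta>
  proof -
    have "(\<Inter>N\<in>{N0..}. exit_jump x (K k) q \<delta> N) \<in> sets M" for N0
      by (intro sets.countable_INT' image_subsetI sets_exit_jump[OF cl]) auto
    then show ?thesis by blast
  qed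
  have Lm [measurable]: "L q \<delta> \<in> sets M" for q \<delta>
  proof -
    have "(\<Inter>k\<in>{k0..}. \<Union>N0. \<Inter>N\<in>{N0..}. exit_jump x (K k) q \<delta> N) \<in> sets M" for k0
      by (intro sets.countable_INT' image_subsetI m1) auto
    then show ?thesis unfolding L_def by blast
  qed
  have L_le: "emeasure M (L q \<delta>) \<le> emeasure M (early_jump q \<delta>)" for q \<delta>
    unfolding L_def
    by (intro emeasure_liminf_le m1 emeasure_exit_jump_le cl sets_exit_jump)
  have lim: "(\<lambda>r. emeasure M (early_jump q (1 / real (Suc r)))) \<longlonglongrightarrow> emeasure M (\<Inter>r. early_jump q (1 / real (Suc r)))" for q
  proof (rule Lim_emeasure_decseq)
    show "decseq (\<lambda>r. early_jump q (1 / real (Suc r)))"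
      by (rule decseq_SucI) (force simp: early_jump_def intro: order_trans[OF _ frac_le])
  qed (auto simp: emeasure_eq_measure)
  have L0: "emeasure M (\<Inter>r. L q (1 / real (Suc r))) = 0" for q
  proof -
    have "emeasure M (\<Inter>r. L q (1 / real (Suc r))) \<le> emeasure M (early_jump q (1 / real (Suc r)))" for r
      by (rule order_trans[OF emeasure_mono L_le[of q "1 / real (Suc r)"]]) auto
    then have "emeasure M (\<Inter>r. L q (1 / real (Suc r))) \<le> 0"
      using lim[of q] unfolding early_jump_null by (intro LIMSEQ_le_const) auto
    then show ?thesis by simp
  qed
  have "AE \<omega> in M. \<forall>q. \<omega> \<notin> (\<Inter>r. L q (1 / real (Suc r)))"
    unfolding AE_all_countable
    using L0 by (intro allI AE_I'[of "\<Inter>r. L _ (1 / real (Suc r))"]) (auto simp: null_sets_def)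
  then show ?thesis
    using AE_space
  proof eventually_elim
    case (elim \<omega>)
    show ?case
    proof (intro impI, rule ccontr)
      assume stay: "\<forall>s\<in>{0<..t}. x + X s \<omega> \<in> D" and leave: "\<not> (\<exists>n. \<forall>s\<in>{0<..t}. x + X s \<omega> \<in> K n)"
      have left: "\<exists>l. ((\<lambda>s. x + X s \<omega>) \<longlongrightarrow> l) (at_left s)" if s: "0 < s" for s
      proof -
        obtain l where "((\<lambda>s. X s \<omega>) \<longlongrightarrow> l) (at_left s)" using X_left[OF s] by blast
        then have "((\<lambda>s. x + X s \<omega>) \<longlongrightarrow> x + l) (at_left s)" by (intro tendsto_intros)
        then show ?thesis by blast
      qed
      have "\<exists>q::nat. \<forall>\<delta>>0. \<exists>k0. \<forall>k\<ge>k0. \<exists>N0. \<forall>N\<ge>N0. \<exists>j i::nat.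
         (\<forall>i'<j. x + X (real i' / 2 ^ N) \<omega> \<in> K k) \<and> x + X (real j / 2 ^ N) \<omega> \<notin> K k \<and> real i / 2 ^ N \<le> \<delta> \<and>
         dist (x + X (real (j + i) / 2 ^ N) \<omega>) (x + X (real j / 2 ^ N) \<omega>) > 1 / real (Suc q)"
      proof (rule announced_jump[OF X_right_cont left cl K(2,3)])
        show "\<exists>s. 0 < s \<and> s \<le> t \<and> x + X s \<omega> \<notin> K k" for k using leave by force
      qed (use x stay in auto)
      then obtain q :: nat where q: "\<And>\<delta>. \<delta> > 0 \<Longrightarrow> \<exists>k0. \<forall>k\<ge>k0. \<exists>N0. \<forall>N\<ge>N0. \<exists>j i::nat.
         (\<forall>i'<j. x + X (real i' / 2 ^ N) \<omega> \<in> K k) \<and> x + X (real j / 2 ^ N) \<omega> \<notin> K k \<and> real i / 2 ^ N \<le> \<delta> \<and>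
         dist (x + X (real (j + i) / 2 ^ N) \<omega>) (x + X (real j / 2 ^ N) \<omega>) > 1 / real (Suc q)"
        by blast
      have "\<omega> \<in> L q (1 / real (Suc r))" for r
      proof -
        have "0 < 1 / real (Suc r)" by simp
        from q[OF this] obtain k0 where k0: "\<And>k. k \<ge> k0 \<Longrightarrow> \<exists>N0. \<forall>N\<ge>N0. \<omega> \<in> exit_jump x (K k) q (1 / real (Suc r)) N"
          using \<open>\<omega> \<in> space M\<close> unfolding exit_jump_def by (auto simp: dist_norm)
        have "\<omega> \<in> (\<Union>N0. \<Inter>N\<in>{N0..}. exit_jump x (K k) q (1 / real (Suc r)) N)" if "k \<ge> k0" for k
          using k0[OF that] by auto
        then show ?thesis unfolding L_def by - (rule UN_I[of k0], simp, rule INT_I, simp)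
      qed
      then show False using elim by auto
    qed
  qed
qed

end

section \<open>Discretisation of the Feynman-Kac functional\<close>

lemma integrable_indicator_Ioc: "integrable lborel (indicator {a<..b} :: real \<Rightarrow> real)"
  by (intro integrable_real_indicator emeasure_bounded_finite) auto

text \<open>The ceiling selects the right end of each grid cell, the side from which paths are
  continuous.\<close>

lemma step_integral:
  fixes F :: "real \<Rightarrow> real"
  assumes h: "0 < h"
  shows "set_integrable lborel {a<..a + real n * h} (\<lambda>s. F (a + h * of_int \<lceil>(s - a) / h\<rceil>)) \<and>
    (LINT s:{a<..a + real n * h}|lborel. F (a + h * of_int \<lceil>(s - a) / h\<rceil>)) = (\<Sum>i<n. h * F (a + real (Suc i) * h))"
proof (induction n)
  case 0
  show ?case by (simp add: set_integrable_def set_lebesgue_integral_def)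
next
  case (Suc n)
  let ?A = "{a<..a + real n * h}" and ?B = "{a + real n * h<..a + real (Suc n) * h}"
  let ?G = "\<lambda>s. F (a + h * of_int \<lceil>(s - a) / h\<rceil>)"
  have split: "{a<..a + real (Suc n) * h} = ?A \<union> ?B" 
  proof -
    have "a \<le> a + real n * h" "a + real n * h \<le> a + real (Suc n) * h" using h by (simp_all add: distrib_right)
    then show ?thesis by (metis ivl_disj_un_two(6))
  qed
  have G: "?G s = F (a + real (Suc n) * h)" if "s \<in> ?B" for s
  proof -
    have "real n < (s - a) / h" "(s - a) / h \<le> real n + 1" using that h by (auto simp: field_simps)
    then have "\<lceil>(s - a) / h\<rceil> = int n + 1" by (intro ceiling_unique) auto
    then show ?thesis by (simp add: algebra_simps)
  qed
  have iB: "set_integrable lborel ?B ?G \<longleftrightarrow> set_integrable lborel ?B (\<lambda>_. F (a + real (Suc n) * h))"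
    by (rule set_integrable_cong) (auto simp: G)
  have iB': "set_integrable lborel ?B ?G" unfolding iB
    using integrable_indicator_Ioc[of "a + real n * h" "a + real (Suc n) * h"] by (simp add: set_integrable_def)
  have "(LINT s:?B|lborel. ?G s) = (LINT s:?B|lborel. F (a + real (Suc n) * h))"
    by (rule set_lebesgue_integral_cong) (auto simp: G)
  also have "\<dots> = h * F (a + real (Suc n) * h)"
    using h by (simp add: set_lebesgue_integral_def algebra_simps)
  finally have vB: "(LINT s:?B|lborel. ?G s) = h * F (a + real (Suc n) * h)" .
  have "set_integrable lborel (?A \<union> ?B) ?G"
    using Suc iB' by (intro set_integrable_Un) auto
  moreover have "(LINT s:?A \<union> ?B|lborel. ?G s) = (LINT s:?A|lborel. ?G s) + (LINT s:?B|lborel. ?G s)"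
    using Suc iB' by (intro set_integral_Un) auto
  ultimately show ?case unfolding split using Suc vB by simp
qed

text \<open>Right end points approach each time from the right, so right-continuity gives pointwise
  convergence and the bound on \<open>W\<close> dominates. Measurability of the integrand along the
  path is a by-product of the limit.\<close>

lemma riemann_limit:
  fixes w :: "real \<Rightarrow> 'b::metric_space" and W :: "'b \<Rightarrow> real"
  assumes w: "right_cont w" and W: "continuous_on UNIV W" "\<And>y. \<bar>W y\<bar> \<le> c" and a: "0 \<le> a" and t: "0 < t"
  shows "set_integrable lborel {a<..a + t} (\<lambda>s. W (w s)) \<and>
    (\<lambda>N. \<Sum>i<2 ^ N. (t / 2 ^ N) * W (w (a + real (Suc i) * (t / 2 ^ N)))) \<longlonglongrightarrow> (LINT s:{a<..a + t}|lborel. W (w s))"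
proof -
  define g where "g N s = indicator {a<..a + t} s *\<^sub>R W (w (a + (t / 2 ^ N) * of_int \<lceil>(s - a) / (t / 2 ^ N)\<rceil>))" for N :: nat and s :: real
  have step: "integrable lborel (g N) \<and> integral\<^sup>L lborel (g N) = (\<Sum>i<2 ^ N. (t / 2 ^ N) * W (w (a + real (Suc i) * (t / 2 ^ N))))" for N
    using step_integral[of "t / 2 ^ N" a "2 ^ N" "\<lambda>s. W (w s)"] t
    unfolding g_def set_integrable_def set_lebesgue_integral_def by simp
  have gm [measurable]: "g N \<in> borel_measurable borel" for N
    using borel_measurable_integrable[of lborel "g N"] step[of N] by simp
  have lim: "(\<lambda>N. g N s) \<longlonglongrightarrow> indicator {a<..a + t} s *\<^sub>R W (w s)" for s
  proof (cases "s \<in> {a<..a + t}")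
    case True
    define c where "c N = a + (t / 2 ^ N) * of_int \<lceil>(s - a) / (t / 2 ^ N)\<rceil>" for N :: nat
    have c: "s \<le> c N" "c N \<le> s + t / 2 ^ N" for N
    proof -
      have h: "t / 2 ^ N > 0" using t by simp
      have "(s - a) / (t / 2 ^ N) \<le> of_int \<lceil>(s - a) / (t / 2 ^ N)\<rceil>" by linarith
      then have "(t / 2 ^ N) * ((s - a) / (t / 2 ^ N)) \<le> (t / 2 ^ N) * of_int \<lceil>(s - a) / (t / 2 ^ N)\<rceil>"
        using h by (intro mult_left_mono) auto
      then show "s \<le> c N" using h t by (simp add: c_def)
      have "of_int \<lceil>(s - a) / (t / 2 ^ N)\<rceil> \<le> (s - a) / (t / 2 ^ N) + 1" by linarith
      then have "(t / 2 ^ N) * of_int \<lceil>(s - a) / (t / 2 ^ N)\<rceil> \<le> (t / 2 ^ N) * ((s - a) / (t / 2 ^ N) + 1)"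
        using h by (intro mult_left_mono) auto
      then show "c N \<le> s + t / 2 ^ N" using h t by (simp add: c_def distrib_left)
    qed
    have "(\<lambda>N. s + t * (1 / 2) ^ N) \<longlonglongrightarrow> s + t * 0"
      by (intro tendsto_intros LIMSEQ_realpow_zero) auto
    then have "(\<lambda>N. s + t / 2 ^ N) \<longlonglongrightarrow> s" by (simp add: power_divide)
    then have "c \<longlonglongrightarrow> s"
      by (rule tendsto_sandwich[OF _ _ tendsto_const, rotated 2]) (use c in auto)
    then have "(\<lambda>N. w (c N)) \<longlonglongrightarrow> w s" using True a c by (intro right_cont_seq[OF w]) auto
    then have "(\<lambda>N. W (w (c N))) \<longlonglongrightarrow> W (w s)"
      by (intro continuous_on_tendsto_compose[OF W(1)]) auto
    then show ?thesis using True by (simp add: g_def c_def)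
  qed (simp add: g_def)
  have int: "integrable lborel (\<lambda>s. indicator {a<..a + t} s * c)"
    using integrable_indicator_Ioc by simp
  have bnd: "\<bar>g N s\<bar> \<le> indicator {a<..a + t} s * c" for N s
    using W(2) by (auto simp: g_def indicator_def)
  have m: "(\<lambda>s. indicator {a<..a + t} s *\<^sub>R W (w s)) \<in> borel_measurable lborel"
    by (rule borel_measurable_LIMSEQ_real[OF lim]) simp
  have "(\<lambda>N. integral\<^sup>L lborel (g N)) \<longlonglongrightarrow> (LINT s|lborel. indicator {a<..a + t} s *\<^sub>R W (w s))"
    by (rule integral_dominated_convergence[OF m _ int]) (use lim bnd in auto)
  moreover have "integrable lborel (\<lambda>s. indicator {a<..a + t} s *\<^sub>R W (w s))"
    by (rule Bochner_Integration.integrable_bound[OF int m]) (use W(2) in \<open>auto simp: indicator_def intro: order_trans[OF _ abs_ge_self]\<close>)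
  ultimately show ?thesis
    unfolding set_integrable_def set_lebesgue_integral_def using step by simp
qed

definition mult_op :: "('b \<Rightarrow> real) \<Rightarrow> 'b set \<Rightarrow> real \<Rightarrow> 'b \<Rightarrow> real" where
  "mult_op W K h y = exp (- (h * W y)) * indicator K y"

text \<open>Closedness of \<open>K\<close> makes a grid sufficient: an exit puts the path into the
  open complement for a whole interval to the right, which every sufficiently fine grid
  meets.\<close>

lemma path_product_limit:
  fixes w :: "real \<Rightarrow> 'b::metric_space" and W :: "'b \<Rightarrow> real"
  assumes w: "right_cont w" and W: "continuous_on UNIV W" "\<And>y. \<bar>W y\<bar> \<le> c" and K: "closed K" and a: "0 \<le> a" and t: "0 < t"
  shows "(\<lambda>N. \<Prod>i<2 ^ N. mult_op W K (t / 2 ^ N) (w (a + real (Suc i) * (t / 2 ^ N)))) \<longlonglongrightarrow>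
     exp (- (LINT s:{a<..a + t}|lborel. W (w s))) * of_bool (\<forall>s\<in>{a<..a + t}. w s \<in> K)"
proof -
  let ?g = "\<lambda>N i. a + real (Suc i) * (t / 2 ^ N)"
  have eq: "(\<Prod>i<2 ^ N. mult_op W K (t / 2 ^ N) (w (?g N i))) =
     exp (- (\<Sum>i<2 ^ N. (t / 2 ^ N) * W (w (?g N i)))) * of_bool (\<forall>i<2 ^ N. w (?g N i) \<in> K)" for N
  proof -
    have "(\<Prod>i<n. indicator K (w (?g N i)) :: real) = of_bool (\<forall>i<n. w (?g N i) \<in> K)" for n
      by (induction n) (auto simp: indicator_def less_Suc_eq)
    then show ?thesis
      unfolding mult_op_def prod.distrib by (simp add: exp_sum sum_negf[symmetric])
  qed
  have "(\<lambda>N. of_bool (\<forall>i<2 ^ N. w (?g N i) \<in> K) :: real) \<longlonglongrightarrow> of_bool (\<forall>s\<in>{a<..a + t}. w s \<in> K)"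
  proof (cases "\<forall>s\<in>{a<..a + t}. w s \<in> K")
    case True
    have "w (?g N i) \<in> K" if "i < 2 ^ N" for N i
    proof -
      have "real (Suc i) \<le> 2 ^ N" using that by (metis Suc_leI of_nat_le_iff of_nat_numeral of_nat_power)
      then have "real (Suc i) * (t / 2 ^ N) \<le> 2 ^ N * (t / 2 ^ N)" using t by (intro mult_right_mono) auto
      then have "real (Suc i) * (t / 2 ^ N) \<le> t" by simp
      moreover have "0 < real (Suc i) * (t / 2 ^ N)" using t by simp
      ultimately show ?thesis using True by auto
    qed
    then show ?thesis using True by simp
  next
    case False
    then obtain s where s: "a < s" "s \<le> a + t" "w s \<in> - K" by auto
    obtain b where b: "b > s" "\<And>y. s \<le> y \<Longrightarrow> y < b \<Longrightarrow> w y \<in> - K"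
      using right_contD[OF w, of s "- K"] s a K by auto
    have "(b - s) / t > 0" using b t by simp
    then obtain N0 where N0: "\<And>N. N \<ge> N0 \<Longrightarrow> 1 / 2 ^ N < (b - s) / t" using small_mesh by blast
    have "of_bool (\<forall>i<2 ^ N. w (?g N i) \<in> K) = (0::real)" if N: "N \<ge> N0" for N
    proof -
      define h where "h = t / 2 ^ N"
      have h: "h > 0" "h < b - s" using N0[OF N] t by (auto simp: h_def field_simps)
      \<comment> \<open>The first grid point not before \<open>s\<close> has number
        \<open>z\<close>; the product counts from \<open>Suc i\<close>, hence
        \<open>i = z - 1\<close>. The mesh is finer than \<open>b - s\<close>, so this point is
        still outside \<open>K\<close>.\<close>
      define z where "z = \<lceil>(s - a) / h\<rceil>"
      have z: "(s - a) / h \<le> of_int z" "of_int z < (s - a) / h + 1" unfolding z_def by linarith+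
      have "0 < (s - a) / h" using s h by simp
      then have z1: "1 \<le> z" using z by linarith
      have "(s - a) / h \<le> t / h" using s h by (intro divide_right_mono) auto
      then have zt: "of_int z < (t / h) + 1" using z(2) by linarith
      have th: "t / h = 2 ^ N" using t by (simp add: h_def)
      define i where "i = nat (z - 1)"
      have ri: "real (Suc i) = of_int z" using z1 by (simp add: i_def)
      have "of_int z < (of_int (2 ^ N + 1) :: real)" using zt th by simp
      then have "z < 2 ^ N + 1" by (simp only: of_int_less_iff)
      then have "z - 1 < 2 ^ N" by simp
      then have i: "i < 2 ^ N" using z1 unfolding i_def by (simp add: nat_less_iff)
      have "s - a \<le> of_int z * h" "of_int z * h < s - a + h" using z h by (auto simp: field_simps)
      then have "s \<le> ?g N i" "?g N i < b" unfolding ri h_def[symmetric] using h by auto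
      then have "w (?g N i) \<notin> K" using b(2) by auto
      then show ?thesis using i by auto
    qed
    then have "\<forall>\<^sub>F N in sequentially. of_bool (\<forall>i<2 ^ N. w (?g N i) \<in> K) = (0::real)"
      by (auto simp: eventually_sequentially)
    then have "(\<lambda>N. of_bool (\<forall>i<2 ^ N. w (?g N i) \<in> K) :: real) \<longlonglongrightarrow> 0" by (rule tendsto_eventually)
    moreover have "of_bool (\<forall>s\<in>{a<..a + t}. w s \<in> K) = (0::real)" using False by simp
    ultimately show ?thesis by (simp only:)
  qed
  then show ?thesis
    unfolding eq using riemann_limit[OF w W a t] by (intro tendsto_mult tendsto_exp tendsto_minus) auto
qed

definition bounded_borel :: "('b::topological_space \<Rightarrow> real) \<Rightarrow> bool" where
  "bounded_borel f \<longleftrightarrow> f \<in> borel_measurable borel \<and> (\<exists>B\<ge>0. \<forall>x. \<bar>f x\<bar> \<le> B)"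

lemma bounded_borelI:
  assumes "f \<in> borel_measurable borel" "\<And>x. \<bar>f x\<bar> \<le> B" shows "bounded_borel f"
proof -
  have "0 \<le> B" using assms(2)[of undefined] by linarith
  then show ?thesis using assms by (auto simp: bounded_borel_def)
qed

lemma bounded_borel_mult:
  assumes "bounded_borel f" "bounded_borel g" shows "bounded_borel (\<lambda>x. f x * g x)"
proof -
  obtain A where A: "0 \<le> A" "\<And>x. \<bar>f x\<bar> \<le> A" "f \<in> borel_measurable borel" using assms(1) unfolding bounded_borel_def by auto
  obtain B where B: "0 \<le> B" "\<And>x. \<bar>g x\<bar> \<le> B" "g \<in> borel_measurable borel" using assms(2) unfolding bounded_borel_def by auto
  have "\<bar>f x * g x\<bar> \<le> A * B" for x unfolding abs_mult using A B by (intro mult_mono) auto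
  then show ?thesis using A B by (intro bounded_borelI[where B = "A * B"]) auto
qed

lemma prod_abs_le_power:
  fixes F :: "nat \<Rightarrow> real"
  assumes "\<And>i. \<bar>F i\<bar> \<le> B" shows "\<bar>\<Prod>i<N. F i\<bar> \<le> B ^ N"
proof -
  have "\<bar>\<Prod>i<N. F i\<bar> = (\<Prod>i<N. \<bar>F i\<bar>)" by (rule abs_prod)
  also have "\<dots> \<le> (\<Prod>i<N. B)" using assms by (intro prod_mono) auto
  finally show ?thesis by simp
qed

lemma (in prob_space) markov_increments_integral:
  fixes Z :: "real \<Rightarrow> 'a \<Rightarrow> 'b::euclidean_space" and H :: "_ \<Rightarrow> real"
  assumes mk: "markov_increments Z" and rv: "\<And>t. random_variable borel (Z t)"
    and u: "u 0 = 0" "\<And>i. i < n \<Longrightarrow> u i \<le> u (Suc i)" and v: "v 0 = 0" "\<And>j. j < m \<Longrightarrow> v j \<le> v (Suc j)"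
    and H: "H \<in> borel_measurable (vecM n \<Otimes>\<^sub>M vecM m)" and B: "\<And>x. \<bar>H x\<bar> \<le> B"
  shows "(LINT \<omega>|M. H (\<lambda>i\<in>{..n}. Z (u i) \<omega>, \<lambda>j\<in>{..m}. Z (u n + v j) \<omega> - Z (u n) \<omega>)) =
    (LINT \<omega>|M. LINT \<omega>'|M. H (\<lambda>i\<in>{..n}. Z (u i) \<omega>, \<lambda>j\<in>{..m}. Z (v j) \<omega>'))"
proof -
  let ?p = "\<lambda>\<omega>. \<lambda>i\<in>{..n}. Z (u i) \<omega>" and ?v = "\<lambda>\<omega>. \<lambda>j\<in>{..m}. Z (v j) \<omega>"
  let ?f = "\<lambda>\<omega>. \<lambda>j\<in>{..m}. Z (u n + v j) \<omega> - Z (u n) \<omega>"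
  have m1: "random_variable (vecM n) ?p" and m2: "random_variable (vecM m) ?v"
    by (intro measurable_restrict rv)+
  have "random_variable (vecM m) ?f" by (intro measurable_restrict borel_measurable_diff rv)
  then have m3: "random_variable (vecM n \<Otimes>\<^sub>M vecM m) (\<lambda>\<omega>. (?p \<omega>, ?f \<omega>))" by (intro measurable_Pair m1)
  interpret D1: prob_space "distr M (vecM n) ?p" by (rule prob_space_distr[OF m1])
  interpret D2: prob_space "distr M (vecM m) ?v" by (rule prob_space_distr[OF m2])
  interpret PP: pair_prob_space "distr M (vecM n) ?p" "distr M (vecM m) ?v" ..
  have H': "H \<in> borel_measurable (distr M (vecM n) ?p \<Otimes>\<^sub>M distr M (vecM m) ?v)"
    using H by (simp cong: measurable_cong_sets sets_pair_measure_cong)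
  have int: "integrable (distr M (vecM n) ?p \<Otimes>\<^sub>M distr M (vecM m) ?v) H"
    by (rule PP.integrable_const_bound[where B = B]) (use H' B in auto)
  have "(LINT \<omega>|M. H (?p \<omega>, ?f \<omega>)) = integral\<^sup>L (distr M (vecM n \<Otimes>\<^sub>M vecM m) (\<lambda>\<omega>. (?p \<omega>, ?f \<omega>))) H"
    by (rule integral_distr[OF m3 H, symmetric])
  also have "\<dots> = integral\<^sup>L (distr M (vecM n) ?p \<Otimes>\<^sub>M distr M (vecM m) ?v) H"
    by (subst markov_incrementsD[OF mk u v]) auto
  also have "\<dots> = (LINT x|distr M (vecM n) ?p. LINT y|distr M (vecM m) ?v. H (x, y))"
    by (rule PP.integral_fst'[OF int, symmetric])
  also have "\<dots> = (LINT \<omega>|M. LINT y|distr M (vecM m) ?v. H (?p \<omega>, y))"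
  proof (rule integral_distr[OF m1])
    show "(\<lambda>x. LINT y|distr M (vecM m) ?v. H (x, y)) \<in> borel_measurable (vecM n)"
      using D2.borel_measurable_lebesgue_integral[of "\<lambda>x y. H (x, y)" "vecM n"] H
      by (simp cong: measurable_cong_sets sets_pair_measure_cong)
  qed
  also have "\<dots> = (LINT \<omega>|M. LINT \<omega>'|M. H (?p \<omega>, ?v \<omega>'))"
  proof (rule Bochner_Integration.integral_cong[OF refl])
    fix \<omega> assume "\<omega> \<in> space M"
    then have "?p \<omega> \<in> space (vecM n)" using m1 by (rule measurable_space[rotated])
    then have "(\<lambda>b. H (?p \<omega>, b)) \<in> borel_measurable (vecM m)"
      by (intro measurable_compose[OF _ H] measurable_Pair1')
    then show "(LINT y|distr M (vecM m) ?v. H (?p \<omega>, y)) = (LINT \<omega>'|M. H (?p \<omega>, ?v \<omega>'))"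
      by (rule integral_distr[OF m2])
  qed
  finally show ?thesis .
qed

section \<open>Discrete operators for compact sets and their limits\<close>

context levy_paths
begin

text \<open>Discretised killed Feynman-Kac operator: the multiplier \<open>m\<close> acts at the times \<open>h, 2 h, \<dots>, N h\<close>.\<close>

definition Q :: "('a \<Rightarrow> real) \<Rightarrow> real \<Rightarrow> nat \<Rightarrow> ('a \<Rightarrow> real) \<Rightarrow> 'a \<Rightarrow> real" where
  "Q m h N f x = (LINT \<omega>|M. (\<Prod>i<N. m (x + X (real (Suc i) * h) \<omega>)) * f (x + X (real N * h) \<omega>))"

lemma Q_bounded_borel:
  assumes m: "bounded_borel m" and f: "bounded_borel f"
  shows "bounded_borel (Q m h N f)"
proof -
  obtain A where A: "0 \<le> A" "\<And>x. \<bar>m x\<bar> \<le> A" and [measurable]: "m \<in> borel_measurable borel" using m unfolding bounded_borel_def by auto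
  obtain B where B: "0 \<le> B" "\<And>x. \<bar>f x\<bar> \<le> B" and [measurable]: "f \<in> borel_measurable borel" using f unfolding bounded_borel_def by auto
  have "\<bar>(\<Prod>i<N. m (x + X (real (Suc i) * h) \<omega>)) * f (x + X (real N * h) \<omega>)\<bar> \<le> A ^ N * B" for x \<omega>
    unfolding abs_mult using A B by (intro mult_mono prod_abs_le_power) auto
  then have "\<bar>Q m h N f x\<bar> \<le> A ^ N * B" for x
    unfolding Q_def real_norm_def[symmetric]
    by (intro order_trans[OF integral_norm_bound integral_le_const] integrable_norm integrable_const_bound[where B = "A ^ N * B"]) auto
  moreover have "Q m h N f \<in> borel_measurable borel"
    unfolding Q_def[abs_def] by measurable
  ultimately show ?thesis by (intro bounded_borelI)
qed

text \<open>The Markov property at time \<open>N * h\<close> between two blocks. Different steps and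
  multipliers are allowed because the semigroup law for \<open>t + s\<close> combines the meshes
  \<open>t / 2 ^ N\<close> and \<open>s / 2 ^ N\<close>.\<close>

lemma Q_concat:
  assumes m: "bounded_borel m" and m': "bounded_borel m'" and f: "bounded_borel f" and h: "0 \<le> h" "0 \<le> h'"
  shows "(LINT \<omega>|M. (\<Prod>i<N. m (x + X (real (Suc i) * h) \<omega>)) *
      ((\<Prod>i<N'. m' (x + X (real N * h + real (Suc i) * h') \<omega>)) * f (x + X (real N * h + real N' * h') \<omega>))) =
    Q m h N (Q m' h' N' f) x"
proof -
  obtain A where A: "0 \<le> A" "\<And>x. \<bar>m x\<bar> \<le> A" and [measurable]: "m \<in> borel_measurable borel" using m unfolding bounded_borel_def by auto
  obtain A' where A': "0 \<le> A'" "\<And>x. \<bar>m' x\<bar> \<le> A'" and [measurable]: "m' \<in> borel_measurable borel" using m' unfolding bounded_borel_def by auto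
  obtain B where B: "0 \<le> B" "\<And>x. \<bar>f x\<bar> \<le> B" and [measurable]: "f \<in> borel_measurable borel" using f unfolding bounded_borel_def by auto
  define H where "H z = (\<Prod>i<N. m (x + fst z (Suc i))) * ((\<Prod>i<N'. m' (x + fst z N + snd z (Suc i))) * f (x + fst z N + snd z N'))"
    for z :: "(nat \<Rightarrow> 'a) \<times> (nat \<Rightarrow> 'a)"
  have Hb: "\<bar>H z\<bar> \<le> A ^ N * (A' ^ N' * B)" for z
    unfolding H_def abs_mult using A A' B by (intro mult_mono prod_abs_le_power mult_nonneg_nonneg) auto
  have [measurable]: "(\<lambda>z. fst z i) \<in> borel_measurable (vecM N \<Otimes>\<^sub>M vecM N')" if "i \<le> N" for i
    by (rule measurable_compose[OF measurable_fst measurable_component_singleton]) (use that in auto)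
  have [measurable]: "(\<lambda>z. snd z i) \<in> borel_measurable (vecM N \<Otimes>\<^sub>M vecM N')" if "i \<le> N'" for i
    by (rule measurable_compose[OF measurable_snd measurable_component_singleton]) (use that in auto)
  have Hm: "H \<in> borel_measurable (vecM N \<Otimes>\<^sub>M vecM N')"
    unfolding H_def by measurable
  let ?p = "\<lambda>\<omega>. \<lambda>i\<in>{..N}. X (real i * h) \<omega>"
  have "(LINT \<omega>|M. (\<Prod>i<N. m (x + X (real (Suc i) * h) \<omega>)) *
      ((\<Prod>i<N'. m' (x + X (real N * h + real (Suc i) * h') \<omega>)) * f (x + X (real N * h + real N' * h') \<omega>))) =
    (LINT \<omega>|M. H (?p \<omega>, \<lambda>j\<in>{..N'}. X (real N * h + real j * h') \<omega> - X (real N * h) \<omega>))"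
    by (intro Bochner_Integration.integral_cong refl) (auto simp: H_def intro!: prod.cong arg_cong2[where f = "(*)"])
  also have "\<dots> = (LINT \<omega>|M. LINT \<omega>'|M. H (?p \<omega>, \<lambda>j\<in>{..N'}. X (real j * h') \<omega>'))"
    by (rule markov_increments_integral[OF X_markov X_rv _ _ _ _ Hm Hb]) (use h in \<open>auto intro!: mult_right_mono\<close>)
  also have "\<dots> = Q m h N (Q m' h' N' f) x"
    unfolding Q_def[of m] Q_def[of m']
  proof (intro Bochner_Integration.integral_cong refl)
    fix \<omega>
    have "H (?p \<omega>, \<lambda>j\<in>{..N'}. X (real j * h') \<omega>') = (\<Prod>i<N. m (x + X (real (Suc i) * h) \<omega>)) *
      ((\<Prod>i<N'. m' (x + X (real N * h) \<omega> + X (real (Suc i) * h') \<omega>')) * f (x + X (real N * h) \<omega> + X (real N' * h') \<omega>'))" for \<omega>'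
      by (auto simp: H_def intro!: prod.cong arg_cong2[where f = "(*)"])
    then show "(LINT \<omega>'|M. H (?p \<omega>, \<lambda>j\<in>{..N'}. X (real j * h') \<omega>')) = (\<Prod>i<N. m (x + X (real (Suc i) * h) \<omega>)) *
      (LINT \<omega>'|M. (\<Prod>i<N'. m' (x + X (real N * h) \<omega> + X (real (Suc i) * h') \<omega>')) * f (x + X (real N * h) \<omega> + X (real N' * h') \<omega>'))"
      by simp
  qed
  finally show ?thesis .
qed

lemma prod_lessThan_add:
  fixes F :: "nat \<Rightarrow> real"
  shows "(\<Prod>i<N + k. F i) = (\<Prod>i<N. F i) * (\<Prod>i<k. F (N + i))"
  by (induction k) (auto simp: mult_ac)

lemma Q_add:
  assumes m: "bounded_borel m" and f: "bounded_borel f" and h: "0 \<le> h"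
  shows "Q m h (N + k) f x = Q m h N (Q m h k f) x"
proof -
  have "Q m h (N + k) f x = (LINT \<omega>|M. (\<Prod>i<N. m (x + X (real (Suc i) * h) \<omega>)) *
      ((\<Prod>i<k. m (x + X (real N * h + real (Suc i) * h) \<omega>)) * f (x + X (real N * h + real k * h) \<omega>)))"
    unfolding Q_def prod_lessThan_add by (simp add: mult.assoc distrib_right add.assoc algebra_simps)
  then show ?thesis using Q_concat[OF m m f h h] by simp
qed

text \<open>Translation invariance of Lebesgue measure moves the increment to the other function
  with reversed sign, and the symmetry of its law removes the sign. Bounded support makes Fubini
  applicable.\<close>

lemma translation_symmetric:
  assumes a: "bounded_borel a" and b: "bounded_borel b" and K: "K \<in> sets borel" "bounded K"
    and supp: "\<And>y. y \<notin> K \<Longrightarrow> a y = 0" "\<And>y. y \<notin> K \<Longrightarrow> b y = 0" and h: "0 \<le> h"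
  shows "(LINT y|lborel. a y * (LINT \<omega>|M. b (y + X h \<omega>))) = (LINT y|lborel. b y * (LINT \<omega>|M. a (y + X h \<omega>)))"
proof -
  obtain A where A: "0 \<le> A" "\<And>x. \<bar>a x\<bar> \<le> A" and [measurable]: "a \<in> borel_measurable borel" using a unfolding bounded_borel_def by auto
  obtain B where B: "0 \<le> B" "\<And>x. \<bar>b x\<bar> \<le> B" and [measurable]: "b \<in> borel_measurable borel" using b unfolding bounded_borel_def by auto
  note [measurable] = K(1)
  interpret PP: pair_sigma_finite "lborel :: 'a measure" M ..
  have fin: "emeasure (lborel \<Otimes>\<^sub>M M) (K \<times> space M) < \<infinity>"
    using emeasure_bounded_finite[OF K(2)] by (subst emeasure_pair_measure_Times) (auto simp: emeasure_space_1)
  have I: "integrable (lborel \<Otimes>\<^sub>M M) (\<lambda>(y, \<omega>). f y * g (y + Z \<omega>))"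
    if f: "\<And>y. y \<notin> K \<Longrightarrow> f y = 0" "\<And>x. \<bar>f x\<bar> \<le> F" "0 \<le> F" and [measurable]: "f \<in> borel_measurable borel"
      and g: "\<And>x. \<bar>g x\<bar> \<le> G" and [measurable]: "g \<in> borel_measurable borel" "Z \<in> borel_measurable M"
    for f g :: "'a \<Rightarrow> real" and F G :: real and Z :: "'w \<Rightarrow> 'a"
  proof (rule integrableI_bounded_set[where A = "K \<times> space M" and B = "F * G"])
    have le: "\<bar>f y * g z\<bar> \<le> F * G" for y z unfolding abs_mult using f g by (intro mult_mono) auto
    show "AE x\<in>K \<times> space M in lborel \<Otimes>\<^sub>M M. norm (case x of (y, \<omega>) \<Rightarrow> f y * g (y + Z \<omega>)) \<le> F * G"
      using le by (intro AE_I2) (auto split: prod.split)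
    have "f y = 0" if "y \<notin> K" for y using f(1) that by blast
    then show "AE x in lborel \<Otimes>\<^sub>M M. x \<notin> K \<times> space M \<longrightarrow> (case x of (y, \<omega>) \<Rightarrow> f y * g (y + Z \<omega>)) = 0"
      by (intro AE_I2 impI) (auto simp: space_pair_measure split: prod.split)
    show "K \<times> space M \<in> sets (lborel \<Otimes>\<^sub>M M)" using K(1) by (intro pair_measureI) auto
    show "emeasure (lborel \<Otimes>\<^sub>M M) (K \<times> space M) < \<infinity>" by (rule fin)
    show "(\<lambda>(y, \<omega>). f y * g (y + Z \<omega>)) \<in> borel_measurable (lborel \<Otimes>\<^sub>M M)" by measurable
  qed
  have law: "(LINT \<omega>|M. a (y - X h \<omega>)) = (LINT \<omega>|M. a (y + X h \<omega>))" for y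
  proof -
    have "(LINT \<omega>|M. a (y - X h \<omega>)) = (LINT z|distr M borel (\<lambda>\<omega>. - X h \<omega>). a (y + z))"
      by (subst integral_distr) auto
    also have "\<dots> = (LINT \<omega>|M. a (y + X h \<omega>))"
      unfolding X_sym[OF h] by (subst integral_distr) auto
    finally show ?thesis .
  qed
  have shift: "(LINT y|lborel. a y * b (y + z)) = (LINT y|lborel. a (y - z) * b y)" for z
    by (subst lborel_distr_plus[of "- z", symmetric], subst integral_distr) (auto simp: algebra_simps)
  have "(LINT y|lborel. a y * (LINT \<omega>|M. b (y + X h \<omega>))) = (LINT y|lborel. LINT \<omega>|M. a y * b (y + X h \<omega>))"
    by simp
  also have "\<dots> = (LINT \<omega>|M. LINT y|lborel. a y * b (y + X h \<omega>))"
    by (rule PP.Fubini_integral[symmetric]) (rule I[OF _ A(2,1) _ B(2)], use supp in auto)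
  also have "\<dots> = (LINT \<omega>|M. LINT y|lborel. b y * a (y + (- X h \<omega>)))"
    unfolding shift by (simp add: mult.commute)
  also have "\<dots> = (LINT y|lborel. LINT \<omega>|M. b y * a (y + (- X h \<omega>)))"
    by (rule PP.Fubini_integral) (rule I[OF _ B(2,1) _ A(2)], use supp in auto)
  also have "\<dots> = (LINT y|lborel. b y * (LINT \<omega>|M. a (y + X h \<omega>)))"
    by (simp add: law)
  finally show ?thesis .
qed

text \<open>\<open>Q\<close> is an alternating product of the transition and the multiplier,
  beginning with the transition. One more multiplier in front makes this product palindromic, and
  each induction step moves one transition across the integral.\<close>

lemma Q_symmetric:
  assumes m: "bounded_borel m" and K: "K \<in> sets borel" "bounded K" "\<And>y. y \<notin> K \<Longrightarrow> m y = 0" and h: "0 \<le> h"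
    and f: "bounded_borel f" and g: "bounded_borel g"
  shows "(LINT x|lborel. g x * (m x * Q m h N f x)) = (LINT x|lborel. f x * (m x * Q m h N g x))"
  using f g
proof (induction N arbitrary: f g)
  case 0
  then show ?case by (simp add: Q_def prob_space mult_ac)
next
  case (Suc N)
  have one: "Q m h 1 u y = (LINT \<omega>|M. m (y + X h \<omega>) * u (y + X h \<omega>))" for u y
    by (simp add: Q_def)
  have Qf: "bounded_borel (Q m h 1 f)" and Qg: "bounded_borel (Q m h N g)"
    by (intro Q_bounded_borel m Suc.prems)+
  have "(LINT x|lborel. g x * (m x * Q m h (Suc N) f x)) = (LINT x|lborel. g x * (m x * Q m h N (Q m h 1 f) x))"
    using Q_add[OF m Suc.prems(1) h, of N 1] by simp
  also have "\<dots> = (LINT x|lborel. Q m h 1 f x * (m x * Q m h N g x))"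
    by (rule Suc.IH[OF Qf Suc.prems(2)])
  also have "\<dots> = (LINT x|lborel. (m x * Q m h N g x) * (LINT \<omega>|M. m (x + X h \<omega>) * f (x + X h \<omega>)))"
    unfolding one by (simp add: mult_ac)
  also have "\<dots> = (LINT x|lborel. (m x * f x) * (LINT \<omega>|M. m (x + X h \<omega>) * Q m h N g (x + X h \<omega>)))"
    by (rule translation_symmetric[of "\<lambda>x. m x * Q m h N g x" "\<lambda>x. m x * f x", OF _ _ K(1,2)])
       (use K(3) h in \<open>auto intro!: bounded_borel_mult m Qg Suc.prems\<close>)
  also have "\<dots> = (LINT x|lborel. f x * (m x * Q m h 1 (Q m h N g) x))"
    unfolding one by (simp add: mult_ac)
  also have "\<dots> = (LINT x|lborel. f x * (m x * Q m h (Suc N) g x))"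
    using Q_add[OF m Suc.prems(2) h, of 1 N] by simp
  finally show ?case .
qed

text \<open>The starting time \<open>a\<close> allows the weight to be factored over consecutive
  intervals. These are open on the left, in keeping with the exit time, which ignores time
  0.\<close>

definition fk_kill :: "('a \<Rightarrow> real) \<Rightarrow> 'a set \<Rightarrow> real \<Rightarrow> real \<Rightarrow> 'a \<Rightarrow> 'w \<Rightarrow> real" where
  "fk_kill W K a t x \<omega> = exp (- (LINT s:{a<..a + t}|lborel. W (x + X s \<omega>))) * of_bool (\<forall>s\<in>{a<..a + t}. x + X s \<omega> \<in> K)"

definition TK :: "('a \<Rightarrow> real) \<Rightarrow> 'a set \<Rightarrow> real \<Rightarrow> ('a \<Rightarrow> real) \<Rightarrow> 'a \<Rightarrow> real" where
  "TK W K t f x = (LINT \<omega>|M. fk_kill W K 0 t x \<omega> * f (x + X t \<omega>))"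

lemma mult_op_bounds:
  assumes "\<And>y. \<bar>W y\<bar> \<le> c" "0 \<le> h"
  shows "0 \<le> mult_op W K h y" "mult_op W K h y \<le> exp (h * c)" "\<bar>mult_op W K h y\<bar> \<le> exp (h * c)"
proof -
  have "- (h * W y) \<le> h * c"
    using mult_left_mono[of "- W y" c h] assms(1)[of y] assms(2) by simp
  then show "0 \<le> mult_op W K h y" "mult_op W K h y \<le> exp (h * c)" "\<bar>mult_op W K h y\<bar> \<le> exp (h * c)"
    by (auto simp: mult_op_def indicator_def)
qed

lemma mult_op_bounded_borel:
  assumes "continuous_on UNIV W" "\<And>y. \<bar>W y\<bar> \<le> c" "0 \<le> h" "closed (K :: 'a set)"
  shows "bounded_borel (mult_op W K h)"
proof (rule bounded_borelI[OF _ mult_op_bounds(3)[OF assms(2,3)]])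
  have [measurable]: "W \<in> borel_measurable borel" "K \<in> sets borel"
    using assms by (auto intro: borel_measurable_continuous_onI)
  show "mult_op W K h \<in> borel_measurable borel" unfolding mult_op_def[abs_def] by measurable
qed

lemma fk_kill_limit:
  assumes "continuous_on UNIV W" "\<And>y. \<bar>W y\<bar> \<le> c" "closed K" "0 \<le> a" "0 < t"
  shows "(\<lambda>N. \<Prod>i<2 ^ N. mult_op W K (t / 2 ^ N) (x + X (a + real (Suc i) * (t / 2 ^ N)) \<omega>)) \<longlonglongrightarrow> fk_kill W K a t x \<omega>"
  unfolding fk_kill_def by (rule path_product_limit[OF X_right_cont assms])

lemma mult_prod_bounds:
  assumes "\<And>y. \<bar>W y\<bar> \<le> c" "0 < t"
  shows "0 \<le> (\<Prod>i<(2::nat) ^ N. mult_op W K (t / 2 ^ N) (z i))" "(\<Prod>i<(2::nat) ^ N. mult_op W K (t / 2 ^ N) (z i)) \<le> exp (t * c)"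
    "\<bar>\<Prod>i<(2::nat) ^ N. mult_op W K (t / 2 ^ N) (z i)\<bar> \<le> exp (t * c)"
proof -
  show 1: "0 \<le> (\<Prod>i<(2::nat) ^ N. mult_op W K (t / 2 ^ N) (z i))"
    using assms by (intro prod_nonneg ballI mult_op_bounds(1)) auto
  have "(\<Prod>i<(2::nat) ^ N. mult_op W K (t / 2 ^ N) (z i)) \<le> (\<Prod>i<(2::nat) ^ N. exp ((t / 2 ^ N) * c))"
    using assms by (intro prod_mono conjI mult_op_bounds) auto
  also have "\<dots> = exp (t * c)" by (simp add: exp_of_nat_mult[symmetric])
  finally show 2: "(\<Prod>i<(2::nat) ^ N. mult_op W K (t / 2 ^ N) (z i)) \<le> exp (t * c)" .
  show "\<bar>\<Prod>i<(2::nat) ^ N. mult_op W K (t / 2 ^ N) (z i)\<bar> \<le> exp (t * c)"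
    using 1 2 by (simp only: abs_of_nonneg)
qed

lemma fk_kill_bounds:
  assumes "continuous_on UNIV W" "\<And>y. \<bar>W y\<bar> \<le> c" "closed K" "0 \<le> a" "0 < t"
  shows "0 \<le> fk_kill W K a t x \<omega>" "fk_kill W K a t x \<omega> \<le> exp (t * c)"
proof -
  show "0 \<le> fk_kill W K a t x \<omega>"
    by (rule LIMSEQ_le_const[OF fk_kill_limit[OF assms]]) (intro exI allI impI mult_prod_bounds(1)[OF assms(2,5)])
  show "fk_kill W K a t x \<omega> \<le> exp (t * c)"
    by (rule LIMSEQ_le_const2[OF fk_kill_limit[OF assms]]) (intro exI allI impI mult_prod_bounds(2)[OF assms(2,5)])
qed

lemma fk_kill_measurable:
  assumes "continuous_on UNIV W" "\<And>y. \<bar>W y\<bar> \<le> c" "closed K" "0 \<le> a" "0 < t"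
  shows "random_variable borel (fk_kill W K a t x)"
proof (rule borel_measurable_LIMSEQ_real[OF fk_kill_limit[OF assms]])
  fix N
  have [measurable]: "mult_op W K (t / 2 ^ N) \<in> borel_measurable borel"
    using mult_op_bounded_borel[OF assms(1,2) _ assms(3), of "t / 2 ^ N"] assms(5) by (auto simp: bounded_borel_def)
  show "random_variable borel (\<lambda>\<omega>. \<Prod>i<2 ^ N. mult_op W K (t / 2 ^ N) (x + X (a + real (Suc i) * (t / 2 ^ N)) \<omega>))"
    by measurable
qed

lemma fk_kill_add:
  assumes W: "continuous_on UNIV W" "\<And>y. \<bar>W y\<bar> \<le> c" and t: "0 < t" and s: "0 < s"
  shows "fk_kill W K 0 t x \<omega> * fk_kill W K t s x \<omega> = fk_kill W K 0 (t + s) x \<omega>"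
proof -
  have split: "{0<..0 + (t + s)} = {0<..0 + t} \<union> {t<..t + s}" using t s by auto
  have "(LINT u:{0<..0 + (t + s)}|lborel. W (x + X u \<omega>)) =
     (LINT u:{0<..0 + t}|lborel. W (x + X u \<omega>)) + (LINT u:{t<..t + s}|lborel. W (x + X u \<omega>))"
    unfolding split using riemann_limit[OF X_right_cont W _ t, of 0 x \<omega>] riemann_limit[OF X_right_cont W _ s, of t x \<omega>] t
    by (intro set_integral_Un) auto
  then show ?thesis
    unfolding fk_kill_def split by (auto simp: exp_diff exp_minus field_simps)
qed

text \<open>The function acted on may vary with the mesh: in the semigroup law it is itself the
  result of a discrete operator.\<close>

lemma Q_limit:
  assumes W: "continuous_on UNIV W" "\<And>y. \<bar>W y\<bar> \<le> c" and K: "closed K" and t: "0 < t"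
    and u: "\<And>N. u N \<in> borel_measurable borel" "\<And>N y. \<bar>u N y\<bar> \<le> B" "\<And>y. (\<lambda>N. u N y) \<longlonglongrightarrow> f y"
  shows "(\<lambda>N. Q (mult_op W K (t / 2 ^ N)) (t / 2 ^ N) (2 ^ N) (u N) x) \<longlonglongrightarrow> TK W K t f x"
proof -
  have [measurable]: "mult_op W K (t / 2 ^ N) \<in> borel_measurable borel" for N
    using mult_op_bounded_borel[OF W _ K, of "t / 2 ^ N"] t by (auto simp: bounded_borel_def)
  have [measurable]: "u N \<in> borel_measurable borel" for N by (rule u)
  have [measurable]: "f \<in> borel_measurable borel" by (rule borel_measurable_LIMSEQ_real[OF u(3)]) simp
  have km [measurable]: "random_variable borel (fk_kill W K 0 t x)" by (rule fk_kill_measurable[OF W K _ t]) simp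
  have "(\<lambda>N. Q (mult_op W K (t / 2 ^ N)) (t / 2 ^ N) (2 ^ N) (u N) x) = (\<lambda>N. LINT \<omega>|M.
      (\<Prod>i<2 ^ N. mult_op W K (t / 2 ^ N) (x + X (0 + real (Suc i) * (t / 2 ^ N)) \<omega>)) * u N (x + X t \<omega>))"
    unfolding Q_def by simp
  also have "\<dots> \<longlonglongrightarrow> (LINT \<omega>|M. fk_kill W K 0 t x \<omega> * f (x + X t \<omega>))"
  proof (rule integral_dominated_convergence[where w = "\<lambda>_. exp (t * c) * B"])
    show "AE \<omega> in M. (\<lambda>N. (\<Prod>i<2 ^ N. mult_op W K (t / 2 ^ N) (x + X (0 + real (Suc i) * (t / 2 ^ N)) \<omega>)) * u N (x + X t \<omega>))
        \<longlonglongrightarrow> fk_kill W K 0 t x \<omega> * f (x + X t \<omega>)"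
      by (intro AE_I2 tendsto_mult fk_kill_limit[OF W K _ t] u) simp
    show "AE \<omega> in M. norm ((\<Prod>i<2 ^ N. mult_op W K (t / 2 ^ N) (x + X (0 + real (Suc i) * (t / 2 ^ N)) \<omega>)) * u N (x + X t \<omega>)) \<le> exp (t * c) * B" for N
      unfolding real_norm_def abs_mult
      by (intro AE_I2 mult_mono u mult_prod_bounds(3)[OF W(2) t]) auto
  qed auto
  finally show ?thesis by (simp add: TK_def)
qed

lemma TK_bounded_borel:
  assumes W: "continuous_on UNIV W" "\<And>y. \<bar>W y\<bar> \<le> c" and K: "closed K" and t: "0 < t"
    and f: "f \<in> borel_measurable borel" "\<And>y. \<bar>f y\<bar> \<le> B"
  shows "TK W K t f \<in> borel_measurable borel" "\<bar>TK W K t f x\<bar> \<le> exp (t * c) * B"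
proof -
  have lim: "(\<lambda>N. Q (mult_op W K (t / 2 ^ N)) (t / 2 ^ N) (2 ^ N) f x) \<longlonglongrightarrow> TK W K t f x" for x
    by (rule Q_limit[OF W K t]) (use f in auto)
  have mb: "bounded_borel (mult_op W K (t / 2 ^ N))" for N
    using mult_op_bounded_borel[OF W _ K, of "t / 2 ^ N"] t by simp
  have "Q (mult_op W K (t / 2 ^ N)) (t / 2 ^ N) (2 ^ N) f \<in> borel_measurable borel" for N
    using Q_bounded_borel[OF mb bounded_borelI[OF f]] by (auto simp: bounded_borel_def)
  then show "TK W K t f \<in> borel_measurable borel" by (rule borel_measurable_LIMSEQ_real[OF lim])
  have [measurable]: "f \<in> borel_measurable borel" by (rule f)
  have km [measurable]: "random_variable borel (fk_kill W K 0 t x)" by (rule fk_kill_measurable[OF W K _ t]) simp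
  have b: "norm (fk_kill W K 0 t x \<omega> * f (x + X t \<omega>)) \<le> exp (t * c) * B" for \<omega>
    unfolding real_norm_def abs_mult using fk_kill_bounds[OF W K _ t, of 0 x \<omega>] f
    by (intro mult_mono) auto
  then show "\<bar>TK W K t f x\<bar> \<le> exp (t * c) * B"
    unfolding TK_def real_norm_def[symmetric]
    by (intro order_trans[OF integral_norm_bound integral_le_const] integrable_norm integrable_const_bound[where B = "exp (t * c) * B"]) auto
qed

lemma Q_mult_op_bound:
  assumes W: "continuous_on UNIV W" "\<And>y. \<bar>W y\<bar> \<le> c" and K: "closed K" and t: "0 < t"
    and f: "f \<in> borel_measurable borel" "\<And>y. \<bar>f y\<bar> \<le> B"
  shows "\<bar>Q (mult_op W K (t / 2 ^ N)) (t / 2 ^ N) (2 ^ N) f x\<bar> \<le> exp (t * c) * B"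
proof -
  have [measurable]: "mult_op W K (t / 2 ^ N) \<in> borel_measurable borel"
    using mult_op_bounded_borel[OF W _ K, of "t / 2 ^ N"] t by (auto simp: bounded_borel_def)
  have [measurable]: "f \<in> borel_measurable borel" by (rule f)
  have b: "norm ((\<Prod>i<2 ^ N. mult_op W K (t / 2 ^ N) (x + X (real (Suc i) * (t / 2 ^ N)) \<omega>)) * f (x + X (real (2 ^ N) * (t / 2 ^ N)) \<omega>)) \<le> exp (t * c) * B" for \<omega>
    unfolding real_norm_def abs_mult
    by (intro mult_mono f mult_prod_bounds(3)[OF W(2) t]) auto
  then show ?thesis
    unfolding Q_def real_norm_def[symmetric]
    by (intro order_trans[OF integral_norm_bound integral_le_const] integrable_norm integrable_const_bound[where B = "exp (t * c) * B"]) auto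
qed

text \<open>Both blocks are discretised with the same number of points and refined together; the
  limit of the inner block is absorbed by the varying function in \<open>Q_limit\<close>.\<close>

lemma TK_semigroup:
  assumes W: "continuous_on UNIV W" "\<And>y. \<bar>W y\<bar> \<le> c" and K: "closed K" and t: "0 < t" and s: "0 < s"
    and f: "f \<in> borel_measurable borel" "\<And>y. \<bar>f y\<bar> \<le> B"
  shows "TK W K (t + s) f x = TK W K t (TK W K s f) x"
proof -
  have mb: "bounded_borel (mult_op W K (r / 2 ^ N))" if "0 < r" for N r
    using mult_op_bounded_borel[OF W _ K, of "r / 2 ^ N"] that by simp
  have [measurable]: "mult_op W K (r / 2 ^ N) \<in> borel_measurable borel" if "0 < r" for N r
    using mb[OF that] by (auto simp: bounded_borel_def)
  have fm [measurable]: "f \<in> borel_measurable borel" by (rule f)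
  have [measurable]: "random_variable borel (fk_kill W K a r x)" if "0 \<le> a" "0 < r" for a r by (rule fk_kill_measurable[OF W K that])
  have fb: "bounded_borel f" by (rule bounded_borelI[OF f])
  let ?g = "\<lambda>N \<omega>. (\<Prod>i<2 ^ N. mult_op W K (t / 2 ^ N) (x + X (real (Suc i) * (t / 2 ^ N)) \<omega>)) *
      ((\<Prod>i<2 ^ N. mult_op W K (s / 2 ^ N) (x + X (real (2 ^ N) * (t / 2 ^ N) + real (Suc i) * (s / 2 ^ N)) \<omega>))
        * f (x + X (real (2 ^ N) * (t / 2 ^ N) + real (2 ^ N) * (s / 2 ^ N)) \<omega>))"
  let ?u = "\<lambda>N. Q (mult_op W K (s / 2 ^ N)) (s / 2 ^ N) (2 ^ N) f"
  have eq: "(LINT \<omega>|M. ?g N \<omega>) = Q (mult_op W K (t / 2 ^ N)) (t / 2 ^ N) (2 ^ N) (?u N) x" for N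
    by (rule Q_concat[OF mb[OF t] mb[OF s] fb]) (use t s in auto)
  have R: "(\<lambda>N. Q (mult_op W K (t / 2 ^ N)) (t / 2 ^ N) (2 ^ N) (?u N) x) \<longlonglongrightarrow> TK W K t (TK W K s f) x"
  proof (rule Q_limit[OF W K t])
    show "?u N \<in> borel_measurable borel" for N
      using Q_bounded_borel[OF mb[OF s] fb] by (auto simp: bounded_borel_def)
    show "\<bar>?u N y\<bar> \<le> exp (s * c) * B" for N y by (rule Q_mult_op_bound[OF W K s f])
    show "(\<lambda>N. ?u N y) \<longlonglongrightarrow> TK W K s f y" for y by (rule Q_limit[OF W K s]) (use f in auto)
  qed
  have g_eq: "?g N = (\<lambda>\<omega>. (\<Prod>i<2 ^ N. mult_op W K (t / 2 ^ N) (x + X (0 + real (Suc i) * (t / 2 ^ N)) \<omega>)) *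
      ((\<Prod>i<2 ^ N. mult_op W K (s / 2 ^ N) (x + X (t + real (Suc i) * (s / 2 ^ N)) \<omega>)) * f (x + X (t + s) \<omega>)))" for N
    by simp
  have "(\<lambda>N. LINT \<omega>|M. ?g N \<omega>) \<longlonglongrightarrow> (LINT \<omega>|M. fk_kill W K 0 t x \<omega> * (fk_kill W K t s x \<omega> * f (x + X (t + s) \<omega>)))"
    unfolding g_eq
  proof (rule integral_dominated_convergence[where w = "\<lambda>_. exp (t * c) * (exp (s * c) * B)"])
    show "AE \<omega> in M. (\<lambda>N. (\<Prod>i<2 ^ N. mult_op W K (t / 2 ^ N) (x + X (0 + real (Suc i) * (t / 2 ^ N)) \<omega>)) *
      ((\<Prod>i<2 ^ N. mult_op W K (s / 2 ^ N) (x + X (t + real (Suc i) * (s / 2 ^ N)) \<omega>)) * f (x + X (t + s) \<omega>)))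
       \<longlonglongrightarrow> fk_kill W K 0 t x \<omega> * (fk_kill W K t s x \<omega> * f (x + X (t + s) \<omega>))"
      by (intro AE_I2 tendsto_mult tendsto_const fk_kill_limit[OF W K _ t] fk_kill_limit[OF W K _ s]) (use t in auto)
    show "AE \<omega> in M. norm ((\<Prod>i<2 ^ N. mult_op W K (t / 2 ^ N) (x + X (0 + real (Suc i) * (t / 2 ^ N)) \<omega>)) *
      ((\<Prod>i<2 ^ N. mult_op W K (s / 2 ^ N) (x + X (t + real (Suc i) * (s / 2 ^ N)) \<omega>)) * f (x + X (t + s) \<omega>)))
        \<le> exp (t * c) * (exp (s * c) * B)" for N
      unfolding real_norm_def abs_mult
      by (intro AE_I2 mult_mono f mult_prod_bounds(3)[OF W(2) t] mult_prod_bounds(3)[OF W(2) s]) (use f(2)[of 0] in auto)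
  qed (use t s in auto)
  moreover have "(LINT \<omega>|M. fk_kill W K 0 t x \<omega> * (fk_kill W K t s x \<omega> * f (x + X (t + s) \<omega>))) = TK W K (t + s) f x"
    unfolding TK_def fk_kill_add[OF W t s, symmetric] by (simp add: mult.assoc)
  ultimately have "(\<lambda>N. LINT \<omega>|M. ?g N \<omega>) \<longlonglongrightarrow> TK W K (t + s) f x" by simp
  then have "(\<lambda>N. Q (mult_op W K (t / 2 ^ N)) (t / 2 ^ N) (2 ^ N) (?u N) x) \<longlonglongrightarrow> TK W K (t + s) f x"
    by (simp only: eq)
  then show ?thesis by (rule LIMSEQ_unique[OF _ R])
qed

text \<open>In the limit the extra multiplier of \<open>Q_symmetric\<close> loses its exponential
  factor, as the step tends to 0, and leaves the indicator of \<open>K\<close>.\<close>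

lemma TK_symmetric:
  assumes W: "continuous_on UNIV W" "\<And>y. \<bar>W y\<bar> \<le> c" and K: "compact K" and t: "0 < t"
    and f: "f \<in> borel_measurable borel" "\<And>y. \<bar>f y\<bar> \<le> A"
    and g: "g \<in> borel_measurable borel" "\<And>y. \<bar>g y\<bar> \<le> B"
  shows "(LINT x|lborel. indicator K x * (g x * TK W K t f x)) = (LINT x|lborel. indicator K x * (f x * TK W K t g x))"
proof -
  have cl: "closed K" using K by (rule compact_imp_closed)
  have [measurable]: "K \<in> sets borel" using cl by simp
  have mb: "bounded_borel (mult_op W K (t / 2 ^ N))" for N
    using mult_op_bounded_borel[OF W _ cl, of "t / 2 ^ N"] t by simp
  have mm [measurable]: "mult_op W K (t / 2 ^ N) \<in> borel_measurable borel" for N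
    using mb by (auto simp: bounded_borel_def)
  have lim: "(\<lambda>N. LINT x|lborel. g x * (mult_op W K (t / 2 ^ N) x * Q (mult_op W K (t / 2 ^ N)) (t / 2 ^ N) (2 ^ N) f x))
      \<longlonglongrightarrow> (LINT x|lborel. indicator K x * (g x * TK W K t f x))"
    if f: "f \<in> borel_measurable borel" "\<And>y. \<bar>f y\<bar> \<le> A" and g: "g \<in> borel_measurable borel" "\<And>y. \<bar>g y\<bar> \<le> B"
    for f g :: "'a \<Rightarrow> real" and A B
  proof -
    have [measurable]: "f \<in> borel_measurable borel" "g \<in> borel_measurable borel" by fact+
    have [measurable]: "Q (mult_op W K (t / 2 ^ N)) (t / 2 ^ N) (2 ^ N) f \<in> borel_measurable borel" for N
      using Q_bounded_borel[OF mb bounded_borelI[OF f]] by (auto simp: bounded_borel_def)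
    have [measurable]: "TK W K t f \<in> borel_measurable borel" by (rule TK_bounded_borel[OF W cl t f])
    have B0: "0 \<le> B" using g(2)[of 0] by linarith
    have A0: "0 \<le> A" using f(2)[of 0] by linarith
    have c0: "0 \<le> c" using W(2)[of 0] by linarith
    show ?thesis
    proof (rule integral_dominated_convergence[where w = "\<lambda>x. indicator K x * (B * (exp (t * c) * (exp (t * c) * A)))"])
      show "integrable lborel (\<lambda>x. indicator K x * (B * (exp (t * c) * (exp (t * c) * A))))"
        using emeasure_bounded_finite[OF compact_imp_bounded[OF K]] by (intro integrable_mult_left integrable_real_indicator) auto
      show "AE x in lborel. (\<lambda>N. g x * (mult_op W K (t / 2 ^ N) x * Q (mult_op W K (t / 2 ^ N)) (t / 2 ^ N) (2 ^ N) f x))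
          \<longlonglongrightarrow> indicator K x * (g x * TK W K t f x)"
      proof (rule AE_I2)
        fix x
        have "(\<lambda>N. t * (1 / 2) ^ N) \<longlonglongrightarrow> t * 0"
          by (intro tendsto_intros LIMSEQ_realpow_zero) auto
        then have h0: "(\<lambda>N. t / 2 ^ N) \<longlonglongrightarrow> 0" by (simp add: power_divide)
        have "(\<lambda>N. exp (- (t / 2 ^ N * W x)) * indicator K x) \<longlonglongrightarrow> exp (- (0 * W x)) * indicator K x"
          by (intro tendsto_intros h0)
        then have "(\<lambda>N. mult_op W K (t / 2 ^ N) x) \<longlonglongrightarrow> indicator K x" by (simp add: mult_op_def)
        then have "(\<lambda>N. g x * (mult_op W K (t / 2 ^ N) x * Q (mult_op W K (t / 2 ^ N)) (t / 2 ^ N) (2 ^ N) f x))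
          \<longlonglongrightarrow> g x * (indicator K x * TK W K t f x)"
          by (intro tendsto_mult tendsto_const Q_limit[OF W cl t]) (use f in auto)
        then show "(\<lambda>N. g x * (mult_op W K (t / 2 ^ N) x * Q (mult_op W K (t / 2 ^ N)) (t / 2 ^ N) (2 ^ N) f x))
          \<longlonglongrightarrow> indicator K x * (g x * TK W K t f x)" by (simp add: mult_ac)
      qed
      show "AE x in lborel. norm (g x * (mult_op W K (t / 2 ^ N) x * Q (mult_op W K (t / 2 ^ N)) (t / 2 ^ N) (2 ^ N) f x))
          \<le> indicator K x * (B * (exp (t * c) * (exp (t * c) * A)))" for N
      proof (rule AE_I2)
        fix x
        show "norm (g x * (mult_op W K (t / 2 ^ N) x * Q (mult_op W K (t / 2 ^ N)) (t / 2 ^ N) (2 ^ N) f x))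
          \<le> indicator K x * (B * (exp (t * c) * (exp (t * c) * A)))"
        proof (cases "x \<in> K")
          case True
          have "t / 2 ^ N \<le> t" using t by (simp add: field_simps)
          then have "t / 2 ^ N * c \<le> t * c" using c0 by (rule mult_right_mono)
          then have e: "exp (t / 2 ^ N * c) \<le> exp (t * c)" by (simp only: exp_le_cancel_iff)
          have "0 \<le> t / 2 ^ N" using t by simp
          from order_trans[OF mult_op_bounds(3)[where W = W, OF W(2) this] e]
          have "\<bar>mult_op W K (t / 2 ^ N) x\<bar> \<le> exp (t * c)" .
          then show ?thesis using True g(2)[of x] Q_mult_op_bound[OF W cl t f, of N x] B0
            unfolding real_norm_def abs_mult by (simp add: mult_mono)
        qed (simp add: mult_op_def)
      qed
    qed auto
  qed
  have eq: "(LINT x|lborel. g x * (mult_op W K (t / 2 ^ N) x * Q (mult_op W K (t / 2 ^ N)) (t / 2 ^ N) (2 ^ N) f x)) =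
    (LINT x|lborel. f x * (mult_op W K (t / 2 ^ N) x * Q (mult_op W K (t / 2 ^ N)) (t / 2 ^ N) (2 ^ N) g x))" for N
    by (rule Q_symmetric[OF mb _ compact_imp_bounded[OF K] _ _ bounded_borelI[OF f] bounded_borelI[OF g]])
       (use t in \<open>auto simp: mult_op_def\<close>)
  show ?thesis
    using LIMSEQ_unique[OF lim[OF f g, unfolded eq] lim[OF g f]] by simp
qed

end

section \<open>The killed Feynman-Kac semigroup\<close>

text \<open>Completeness makes functions of the exit time measurable as soon as they agree almost
  surely with measurable ones.\<close>

lemma (in complete_measure) borel_measurable_AE_eq:
  fixes f g :: "'a \<Rightarrow> 'b::topological_space"
  assumes g: "g \<in> borel_measurable M" and ae: "AE x in M. f x = g x"
  shows "f \<in> borel_measurable M"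
proof (rule measurableI)
  obtain N where N: "{x\<in>space M. \<not> f x = g x} \<subseteq> N" "emeasure M N = 0" "N \<in> sets M" using ae by (rule AE_E)
  fix A :: "'b set" assume A: "A \<in> sets borel"
  have "f -` A \<inter> space M = (g -` A \<inter> space M - N) \<union> (f -` A \<inter> N \<inter> space M)"
    using N(1) by auto
  moreover have "f -` A \<inter> N \<inter> space M \<in> sets M"
    by (rule complete[of _ N]) (use N in \<open>auto simp: null_sets_def\<close>)
  moreover have "g -` A \<inter> space M - N \<in> sets M" using g A N(3) by measurable
  ultimately show "f -` A \<inter> space M \<in> sets M" by simp
qed simp

lemma (in complete_measure) borel_measurable_AE_limit:
  fixes f :: "'a \<Rightarrow> real"
  assumes g: "\<And>n. g n \<in> borel_measurable M" and ae: "AE x in M. (\<lambda>n. g n x) \<longlonglongrightarrow> f x"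
  shows "f \<in> borel_measurable M"
proof (rule borel_measurable_AE_eq)
  show "(\<lambda>x. lim (\<lambda>n. g n x)) \<in> borel_measurable M" by (rule borel_measurable_lim_metric[OF g])
  show "AE x in M. f x = lim (\<lambda>n. g n x)" using ae by eventually_elim (simp add: limI)
qed

text \<open>A measurable function is an almost everywhere limit of continuous ones. Clamping them to
  the interval from \<open>- c\<close> to \<open>c\<close> preserves the limit where
  \<open>W\<close> obeys its bound, and makes the bound on the approximations hold
  everywhere.\<close>

lemma bounded_measurable_continuous_approx:
  fixes W :: "'a::euclidean_space \<Rightarrow> real"
  assumes W: "W \<in> borel_measurable borel" and c: "AE y in lborel. \<bar>W y\<bar> \<le> c" "0 \<le> c"
  shows "\<exists>Wn. (\<forall>n. continuous_on UNIV (Wn n)) \<and> (\<forall>n y. \<bar>Wn n y\<bar> \<le> c) \<and> (AE y in lborel. (\<lambda>n. Wn n y) \<longlonglongrightarrow> W y)"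
proof -
  have "W \<in> borel_measurable (lebesgue_on UNIV)"
    using W by (intro measurable_restrict_space1 measurable_completion) simp
  then have "W measurable_on UNIV"
    by (subst measurable_on_iff_borel_measurable) auto
  then obtain N g where N: "negligible N" and g: "\<And>n. continuous_on UNIV (g n)" "\<And>x. x \<notin> N \<Longrightarrow> (\<lambda>n. g n x) \<longlonglongrightarrow> W x"
    unfolding measurable_on_def by auto
  have "AE y in lebesgue. y \<notin> N"
    using N by (intro AE_not_in) (simp add: negligible_iff_null_sets)
  then have ae: "AE y in lborel. y \<notin> N" by (simp add: AE_completion_iff)
  define Wn where "Wn n y = max (- c) (min c (g n y))" for n y
  have "AE y in lborel. (\<lambda>n. Wn n y) \<longlonglongrightarrow> W y"
    using ae c(1)
  proof eventually_elim
    case (elim y)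
    have "(\<lambda>n. Wn n y) \<longlonglongrightarrow> max (- c) (min c (W y))"
      unfolding Wn_def using elim by (intro tendsto_max tendsto_min tendsto_const g)
    then show ?case using elim by (simp add: abs_le_iff max_def min_def split: if_splits)
  qed
  moreover have "continuous_on UNIV (Wn n)" for n
    unfolding Wn_def by (intro continuous_intros g)
  moreover have "\<bar>Wn n y\<bar> \<le> c" for n y using c(2) by (auto simp: Wn_def abs_le_iff)
  ultimately show ?thesis by (intro exI[of _ Wn]) auto
qed

context levy_paths
begin

text \<open>Grid times to the right of \<open>s\<close> take countably many values, and
  right-continuity gives the limit. The maximum with 0 confines the claim to the times at which
  paths are regular.\<close>

lemma X_joint [measurable]: "(\<lambda>(s, \<omega>). X (max s 0) \<omega>) \<in> borel_measurable (borel \<Otimes>\<^sub>M M)"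
proof -
  define G where "G N x = X (real (nat \<lceil>max (fst x :: real) 0 * 2 ^ N\<rceil>) / 2 ^ N) (snd x)" for N :: nat and x :: "real \<times> 'w"
  have G: "G N \<in> borel_measurable (borel \<Otimes>\<^sub>M M)" for N
    unfolding G_def
  proof (rule measurable_compose_countable'[where I = "UNIV :: nat set" and g = "\<lambda>x. nat \<lceil>max (fst x :: real) 0 * 2 ^ N\<rceil>"
        and f = "\<lambda>i x. X (real i / 2 ^ N) (snd x)"])
    show "(\<lambda>x. nat \<lceil>max (fst x :: real) 0 * 2 ^ N\<rceil>) \<in> measurable (borel \<Otimes>\<^sub>M M) (count_space UNIV)" by measurable
  qed auto
  have lim: "(\<lambda>N. G N x) \<longlonglongrightarrow> X (max (fst x) 0) (snd x)" for x
  proof -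
    define s where "s = max (fst x) 0"
    have s: "0 \<le> s" by (simp add: s_def)
    have c: "s \<le> real (nat \<lceil>s * 2 ^ N\<rceil>) / 2 ^ N" "real (nat \<lceil>s * 2 ^ N\<rceil>) / 2 ^ N \<le> s + 1 / 2 ^ N" for N :: nat
    proof -
      have r: "real (nat \<lceil>s * 2 ^ N\<rceil>) = of_int \<lceil>s * 2 ^ N\<rceil>" using s by simp
      have "s * 2 ^ N \<le> real (nat \<lceil>s * 2 ^ N\<rceil>)" "real (nat \<lceil>s * 2 ^ N\<rceil>) \<le> s * 2 ^ N + 1" unfolding r by linarith+
      then show "s \<le> real (nat \<lceil>s * 2 ^ N\<rceil>) / 2 ^ N" "real (nat \<lceil>s * 2 ^ N\<rceil>) / 2 ^ N \<le> s + 1 / 2 ^ N" by (auto simp: field_simps)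
    qed
    have "(\<lambda>N. s + (1 / 2) ^ N) \<longlonglongrightarrow> s + 0" by (intro tendsto_intros LIMSEQ_realpow_zero) auto
    then have "(\<lambda>N. s + 1 / 2 ^ N) \<longlonglongrightarrow> s" by (simp add: power_divide)
    then have "(\<lambda>N. real (nat \<lceil>s * 2 ^ N\<rceil>) / 2 ^ N) \<longlonglongrightarrow> s"
      by (rule tendsto_sandwich[OF _ _ tendsto_const, rotated 2]) (use c in auto)
    then have "(\<lambda>N. 0 + X (real (nat \<lceil>s * 2 ^ N\<rceil>) / 2 ^ N) (snd x)) \<longlonglongrightarrow> 0 + X s (snd x)"
      by (intro right_cont_seq[OF X_right_cont s]) (use c in auto)
    then show ?thesis by (simp add: G_def s_def)
  qed
  have "(\<lambda>x. X (max (fst x) 0) (snd x)) \<in> borel_measurable (borel \<Otimes>\<^sub>M M)"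
    by (rule borel_measurable_LIMSEQ_metric[OF G lim])
  then show ?thesis by (simp add: case_prod_beta)
qed

text \<open>The bound is uniform in the starting point, by translation invariance of Lebesgue
  measure.\<close>

lemma nn_integral_density_bound:
  assumes t: "0 < t" and g: "g \<in> borel_measurable borel"
  shows "(\<integral>\<^sup>+\<omega>. g (x + X t \<omega>) \<partial>M) \<le> ennreal (\<kappa> t) * (\<integral>\<^sup>+y. g y \<partial>lborel)"
proof -
  note [measurable] = g
  have le: "distr M borel (X t) \<le> density lborel (\<lambda>_. ennreal (\<kappa> t))"
  proof -
    have "emeasure (distr M borel (X t)) A \<le> emeasure (density lborel (\<lambda>_. ennreal (\<kappa> t))) A" for A
    proof (cases "A \<in> sets borel")
      case True
      then show ?thesis using X_density[OF t True] by (simp add: emeasure_density_const)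
    qed (simp add: emeasure_notin_sets)
    then show ?thesis by (simp add: le_measure_iff le_fun_def)
  qed
  have "(\<integral>\<^sup>+\<omega>. g (x + X t \<omega>) \<partial>M) = (\<integral>\<^sup>+z. g (x + z) \<partial>distr M borel (X t))"
    by (subst nn_integral_distr) auto
  also have "\<dots> \<le> (\<integral>\<^sup>+z. g (x + z) \<partial>density lborel (\<lambda>_. ennreal (\<kappa> t)))"
    by (rule nn_integral_mono_measure[OF _ le]) simp
  also have "\<dots> = ennreal (\<kappa> t) * (\<integral>\<^sup>+z. g (x + 1 *\<^sub>R z) \<partial>lborel)"
    by (simp add: nn_integral_density nn_integral_cmult)
  also have "\<dots> = ennreal (\<kappa> t) * (\<integral>\<^sup>+z. g z \<partial>lborel)"
    by (subst nn_integral_lborel_affine[where c = 1 and t = x and f = g]) auto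
  finally show ?thesis .
qed

text \<open>At each positive time the law charges no Lebesgue-null set, and Fubini exchanges the
  exceptional sets. This lets almost everywhere statements about the potential be used along
  paths.\<close>

lemma AE_time_avoid_null:
  assumes N: "N \<in> sets borel" "emeasure lborel N = 0"
  shows "AE \<omega> in M. AE s in lborel. 0 < s \<longrightarrow> x + X s \<omega> \<notin> N"
proof -
  interpret PP: pair_sigma_finite "lborel :: real measure" M ..
  note [measurable] = N(1)
  have "AE \<omega> in M. 0 < s \<longrightarrow> x + X (max s 0) \<omega> \<notin> N" for s
  proof (cases "0 < s")
    case True
    have "emeasure M {\<omega>\<in>space M. x + X s \<omega> \<in> N} = (\<integral>\<^sup>+\<omega>. indicator {\<omega>\<in>space M. x + X s \<omega> \<in> N} \<omega> \<partial>M)"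
      by (rule nn_integral_indicator[symmetric]) measurable
    also have "\<dots> = (\<integral>\<^sup>+\<omega>. indicator N (x + X s \<omega>) \<partial>M)"
      by (intro nn_integral_cong) (simp add: indicator_def)
    also have "\<dots> \<le> ennreal (\<kappa> s) * (\<integral>\<^sup>+y. indicator N y \<partial>lborel)"
      by (rule nn_integral_density_bound[OF True]) auto
    also have "\<dots> = 0" using N by simp
    finally have "emeasure M {\<omega>\<in>space M. x + X s \<omega> \<in> N} = 0" by simp
    then have "AE \<omega> in M. x + X s \<omega> \<notin> N"
      by (intro AE_I[of _ _ "{\<omega>\<in>space M. x + X s \<omega> \<in> N}"]) auto
    then show ?thesis using True by (simp add: max_def)
  qed simp
  then have "AE s in lborel. AE \<omega> in M. 0 < s \<longrightarrow> x + X (max s 0) \<omega> \<notin> N" by simp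
  moreover have "{z\<in>space (lborel \<Otimes>\<^sub>M M). 0 < fst z \<longrightarrow> x + X (max (fst z) 0) (snd z) \<notin> N} \<in> sets (lborel \<Otimes>\<^sub>M M)"
  proof -
    have [measurable]: "(\<lambda>z. X (max (fst z) 0) (snd z)) \<in> borel_measurable (lborel \<Otimes>\<^sub>M M)"
      using X_joint by (simp add: case_prod_beta)
    show ?thesis by measurable
  qed
  ultimately have "AE \<omega> in M. AE s in lborel. 0 < s \<longrightarrow> x + X (max s 0) \<omega> \<notin> N"
    by (subst (asm) PP.AE_commute) auto
  then show ?thesis by eventually_elim (auto elim!: AE_mp simp: max_def)
qed

end

section \<open>Passage to the open domain and the bounded measurable potential\<close>

locale killed_fk = levy_paths M X \<kappa>
  for M :: "'w measure" and X :: "real \<Rightarrow> 'w \<Rightarrow> 'a::euclidean_space" and \<kappa> +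
  fixes W :: "'a \<Rightarrow> real" and c :: real and D :: "'a set"
  assumes W_borel [measurable]: "W \<in> borel_measurable borel"
    and W_bound: "AE y in lborel. \<bar>W y\<bar> \<le> c" and c_nonneg: "0 \<le> c"
    and D_domain: "bounded_domain D"
begin

lemma D_props: "open D" "bounded D" "D \<noteq> {}" and D_borel [measurable]: "D \<in> sets borel"
  using D_domain by (auto simp: bounded_domain_def)

definition wt :: "real \<Rightarrow> 'a \<Rightarrow> 'w \<Rightarrow> real" where
  "wt t x \<omega> = fk_weight W (path_from X x \<omega>) t * of_bool (ereal t < exit_time D (path_from X x \<omega>))"

abbreviation T :: "real \<Rightarrow> ('a \<Rightarrow> real) \<Rightarrow> 'a \<Rightarrow> real" where
  "T \<equiv> fk_semigroup M X D W"

lemma T_eq: "T t f x = (LINT \<omega>|M. wt t x \<omega> * f (x + X t \<omega>))"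
  unfolding fk_semigroup_def wt_def path_from_def by (simp add: mult_ac)

lemma path_right_cont: "right_cont (path_from X x \<omega>)"
  using X_right_cont[of x \<omega>] by (simp add: path_from_def[abs_def])

lemma survive_iff: "0 < t \<Longrightarrow> ereal t < exit_time D (path_from X x \<omega>) \<longleftrightarrow> (\<forall>s\<in>{0<..t}. x + X s \<omega> \<in> D)"
  using less_exit_time_iff[OF path_right_cont D_props(1)] by (simp add: path_from_def)

lemma path_W_measurable [measurable]:
  "(\<lambda>s. W (x + X (max s 0) \<omega>)) \<in> borel_measurable borel" if "\<omega> \<in> space M"
proof -
  have "(\<lambda>s. (\<lambda>(s, \<omega>). X (max s 0) \<omega>) (s, \<omega>)) \<in> borel_measurable borel"
    using that by (intro measurable_compose[OF _ X_joint] measurable_Pair2')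
  then have [measurable]: "(\<lambda>s. X (max s 0) \<omega>) \<in> borel_measurable borel" by simp
  show ?thesis by measurable
qed

text \<open>The two intervals differ in the single point 0. The detour through
  \<open>max s 0\<close> serves measurability along the path.\<close>

lemma fk_weight_eq:
  assumes "0 < t" "\<omega> \<in> space M"
  shows "fk_weight W (path_from X x \<omega>) t = exp (- (LINT s:{0<..t}|lborel. W (x + X s \<omega>)))"
proof -
  note [measurable] = path_W_measurable[OF assms(2)]
  have *: "(LINT s:A|lborel. W (x + X s \<omega>)) = (LINT s:A|lborel. W (x + X (max s 0) \<omega>))" if "A \<subseteq> {0..}" "A \<in> sets borel" for A
    using that by (intro set_lebesgue_integral_cong) (auto simp: max_def)
  have "(LINT s:{0<..t}|lborel. W (x + X (max s 0) \<omega>)) = (LINT s:{0..t}|lborel. W (x + X (max s 0) \<omega>))"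
  proof (rule set_integral_cong_set)
    show "AE s in lborel. (s \<in> {0..t}) = (s \<in> {0<..t})"
      using AE_lborel_singleton[of "0::real"] by eventually_elim auto
  qed (auto simp: set_borel_measurable_def)
  then show ?thesis
  proof -
    assume eq: "(LINT s:{0<..t}|lborel. W (x + X (max s 0) \<omega>)) = (LINT s:{0..t}|lborel. W (x + X (max s 0) \<omega>))"
    have "(LINT s:{0..t}|lborel. W (x + X s \<omega>)) = (LINT s:{0..t}|lborel. W (x + X (max s 0) \<omega>))" by (rule *) auto
    moreover have "(LINT s:{0<..t}|lborel. W (x + X s \<omega>)) = (LINT s:{0<..t}|lborel. W (x + X (max s 0) \<omega>))" by (rule *) auto
    ultimately show ?thesis unfolding fk_weight_def path_from_def using eq by simp
  qed
qed

definition W_approx :: "nat \<Rightarrow> 'a \<Rightarrow> real" where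
  "W_approx = (SOME Wn. (\<forall>n. continuous_on UNIV (Wn n)) \<and> (\<forall>n y. \<bar>Wn n y\<bar> \<le> c) \<and> (AE y in lborel. (\<lambda>n. Wn n y) \<longlonglongrightarrow> W y))"

lemma W_approx: "continuous_on UNIV (W_approx n)" "\<And>y. \<bar>W_approx n y\<bar> \<le> c" "AE y in lborel. (\<lambda>n. W_approx n y) \<longlonglongrightarrow> W y"
  using someI_ex[OF bounded_measurable_continuous_approx[OF W_borel W_bound c_nonneg]]
  unfolding W_approx_def[symmetric] by auto

definition K_approx :: "nat \<Rightarrow> 'a set" where
  "K_approx = (SOME K. (\<forall>n. compact (K n)) \<and> (\<forall>n. K n \<subseteq> interior (K (Suc n))) \<and> (\<Union>n. K n) = D)"

lemma K_approx: "compact (K_approx n)" "\<And>n. K_approx n \<subseteq> interior (K_approx (Suc n))" "(\<Union>n. K_approx n) = D"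
proof -
  have "\<exists>K. (\<forall>n. compact (K n)) \<and> (\<forall>n. K n \<subseteq> interior (K (Suc n))) \<and> (\<Union>n. K n) = D"
    by (rule open_Union_compact_subsets[OF D_props(1)]) blast
  from someI_ex[OF this] show "compact (K_approx n)" "\<And>n. K_approx n \<subseteq> interior (K_approx (Suc n))" "(\<Union>n. K_approx n) = D"
    unfolding K_approx_def[symmetric] by auto
qed

lemma K_approx_closed: "closed (K_approx n)"
  using K_approx(1) by (rule compact_imp_closed)

lemma K_approx_mono: "m \<le> n \<Longrightarrow> K_approx m \<subseteq> K_approx n"
  by (rule lift_Suc_mono_le[of K_approx, OF subset_trans[OF K_approx(2) interior_subset]])

lemma K_approx_sub: "K_approx n \<subseteq> D"
  using K_approx(3) by auto

text \<open>The approximations converge only off a null set, but almost every path spends no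
  positive amount of time there.\<close>

lemma AE_integral_limit:
  assumes t: "0 < t"
  shows "AE \<omega> in M. (\<lambda>n. LINT s:{0<..t}|lborel. W_approx n (x + X s \<omega>)) \<longlonglongrightarrow> (LINT s:{0<..t}|lborel. W (x + X s \<omega>))"
proof -
  obtain N where N: "{y\<in>space lborel. \<not> (\<lambda>n. W_approx n y) \<longlonglongrightarrow> W y} \<subseteq> N" "emeasure lborel N = 0" "N \<in> sets lborel"
    using W_approx(3) by (rule AE_E)
  have "AE \<omega> in M. AE s in lborel. 0 < s \<longrightarrow> x + X s \<omega> \<notin> N"
    by (rule AE_time_avoid_null) (use N in auto)
  then show ?thesis
    using AE_space
  proof eventually_elim
    case (elim \<omega>)
    note [measurable] = path_W_measurable[OF elim(2)]
    have m: "(\<lambda>s. indicator {0<..t} s *\<^sub>R W (x + X s \<omega>)) \<in> borel_measurable lborel"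
    proof -
      have "(\<lambda>s. indicator {0<..t} s *\<^sub>R W (x + X s \<omega>)) = (\<lambda>s. indicator {0<..t} s *\<^sub>R W (x + X (max s 0) \<omega>))"
        by (auto simp: fun_eq_iff indicator_def max_def)
      then show ?thesis by simp
    qed
    have i: "integrable lborel (\<lambda>s. indicator {0<..t} s *\<^sub>R W_approx n (x + X s \<omega>))" for n
      using riemann_limit[OF X_right_cont[of x \<omega>] W_approx(1)[of n] W_approx(2)[of n] _ t, of 0] by (simp add: set_integrable_def)
    show ?case
      unfolding set_lebesgue_integral_def
    proof (rule integral_dominated_convergence[where w = "\<lambda>s. indicator {0<..t} s * c"])
      show "integrable lborel (\<lambda>s. indicator {0<..t} s * c)" using integrable_indicator_Ioc by simp
      show "AE s in lborel. (\<lambda>n. indicator {0<..t} s *\<^sub>R W_approx n (x + X s \<omega>)) \<longlonglongrightarrow> indicator {0<..t} s *\<^sub>R W (x + X s \<omega>)"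
        using elim(1)
      proof eventually_elim
        case (elim s)
        show ?case
        proof (cases "s \<in> {0<..t}")
          case True
          then have "(\<lambda>n. W_approx n (x + X s \<omega>)) \<longlonglongrightarrow> W (x + X s \<omega>)" using elim N(1) by auto
          then show ?thesis using True by simp
        qed simp
      qed
      show "AE s in lborel. norm (indicator {0<..t} s *\<^sub>R W_approx n (x + X s \<omega>)) \<le> indicator {0<..t} s * c" for n
        using W_approx(2) by (intro AE_I2) (auto simp: indicator_def)
    qed (use m i borel_measurable_integrable in blast)+
  qed
qed

text \<open>Potential and set are approximated simultaneously. For the indicator,
  quasi-left-continuity puts a surviving path into one \<open>K_approx n\<close>, while a path that
  leaves \<open>D\<close> leaves all of them.\<close>

lemma AE_weight_limit:
  assumes t: "0 < t" and x: "x \<in> D"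
  shows "AE \<omega> in M. (\<lambda>n. fk_kill (W_approx n) (K_approx n) 0 t x \<omega>) \<longlonglongrightarrow> wt t x \<omega>"
  using AE_integral_limit[OF t, of x] quasi_left_continuity[OF K_approx x, of t] AE_space
proof eventually_elim
  case (elim \<omega>)
  have "(\<lambda>n. of_bool (\<forall>s\<in>{0<..t}. x + X s \<omega> \<in> K_approx n) :: real) \<longlonglongrightarrow> of_bool (\<forall>s\<in>{0<..t}. x + X s \<omega> \<in> D)"
  proof (cases "\<forall>s\<in>{0<..t}. x + X s \<omega> \<in> D")
    case True
    then obtain n0 where "\<forall>s\<in>{0<..t}. x + X s \<omega> \<in> K_approx n0" using elim(2) by auto
    then have "\<forall>n\<ge>n0. \<forall>s\<in>{0<..t}. x + X s \<omega> \<in> K_approx n" using K_approx_mono by blast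
    then have "\<forall>\<^sub>F n in sequentially. of_bool (\<forall>s\<in>{0<..t}. x + X s \<omega> \<in> K_approx n) = (1::real)"
      unfolding eventually_sequentially by (auto intro!: exI[of _ n0])
    moreover have "of_bool (\<forall>s\<in>{0<..t}. x + X s \<omega> \<in> D) = (1::real)" using True by simp
    ultimately show ?thesis by (simp only: tendsto_eventually)
  next
    case False
    then have "\<not> (\<forall>s\<in>{0<..t}. x + X s \<omega> \<in> K_approx n)" for n using K_approx_sub by blast
    then have "of_bool (\<forall>s\<in>{0<..t}. x + X s \<omega> \<in> K_approx n) = (0::real)" for n by simp
    moreover have "of_bool (\<forall>s\<in>{0<..t}. x + X s \<omega> \<in> D) = (0::real)" using False by simp
    ultimately show ?thesis by (simp only: tendsto_const)
  qed
  then show ?case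
    unfolding wt_def fk_kill_def fk_weight_eq[OF t elim(3)] survive_iff[OF t] add_0_left
    by (intro tendsto_mult tendsto_exp tendsto_minus elim(1))
qed

text \<open>The exit time is an infimum over uncountably many times; measurability comes instead
  from an almost sure limit and completeness.\<close>

lemma wt_measurable [measurable]: "0 < t \<Longrightarrow> x \<in> D \<Longrightarrow> random_variable borel (wt t x)"
  by (rule borel_measurable_AE_limit[OF _ AE_weight_limit]) (auto intro: fk_kill_measurable W_approx K_approx_closed)

lemma wt_nonneg: "0 \<le> wt t x \<omega>"
  by (simp add: wt_def fk_weight_def)

lemma wt_le: "0 < t \<Longrightarrow> x \<in> D \<Longrightarrow> AE \<omega> in M. wt t x \<omega> \<le> exp (t * c)"
proof -
  assume t: "0 < t" and x: "x \<in> D"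
  show ?thesis using AE_weight_limit[OF t x]
  proof eventually_elim
    case (elim \<omega>)
    show ?case
      by (rule LIMSEQ_le_const2[OF elim])
         (intro exI allI impI fk_kill_bounds(2)[OF W_approx(1,2) K_approx_closed order_refl t])
  qed
qed

lemma wt_survive: "0 < t \<Longrightarrow> wt t x \<omega> \<noteq> 0 \<Longrightarrow> x + X t \<omega> \<in> D"
  by (auto simp: wt_def survive_iff)

text \<open>Convergence of \<open>u\<close> is needed on \<open>D\<close> only, since the weights
  vanish unless the path ends in \<open>D\<close>. A sequence in place of a fixed function serves
  the semigroup law.\<close>

lemma T_limit:
  assumes t: "0 < t" and x: "x \<in> D"
    and u: "\<And>n. u n \<in> borel_measurable borel" "\<And>n y. \<bar>u n y\<bar> \<le> B" "\<And>y. y \<in> D \<Longrightarrow> (\<lambda>n. u n y) \<longlonglongrightarrow> f y"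
  shows "(\<lambda>n. TK (W_approx n) (K_approx n) t (u n) x) \<longlonglongrightarrow> T t f x"
proof -
  have [measurable]: "u n \<in> borel_measurable borel" for n by (rule u)
  have [measurable]: "random_variable borel (fk_kill (W_approx n) (K_approx n) 0 t x)" for n
    by (rule fk_kill_measurable[OF W_approx(1,2) K_approx_closed _ t]) simp
  have lim: "AE \<omega> in M. (\<lambda>n. fk_kill (W_approx n) (K_approx n) 0 t x \<omega> * u n (x + X t \<omega>)) \<longlonglongrightarrow> wt t x \<omega> * f (x + X t \<omega>)"
    using AE_weight_limit[OF t x]
  proof eventually_elim
    case (elim \<omega>)
    show ?case
    proof (cases "x + X t \<omega> \<in> D")
      case True
      then show ?thesis using elim u(3) by (intro tendsto_mult)
    next
      case False
      have "fk_kill (W_approx n) (K_approx n) 0 t x \<omega> = 0" for n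
      proof -
        have "x + X t \<omega> \<notin> K_approx n" using False K_approx_sub by blast
        then have "\<not> (\<forall>s\<in>{0<..0 + t}. x + X s \<omega> \<in> K_approx n)" using t by force
        then show ?thesis unfolding fk_kill_def by simp
      qed
      moreover have "wt t x \<omega> = 0" using False wt_survive[OF t] by blast
      ultimately show ?thesis by simp
    qed
  qed
  show ?thesis
    unfolding TK_def T_eq
  proof (rule integral_dominated_convergence[where w = "\<lambda>_. exp (t * c) * B"])
    show "random_variable borel (\<lambda>\<omega>. wt t x \<omega> * f (x + X t \<omega>))"
      by (rule borel_measurable_AE_limit[OF _ lim]) measurable
    show "AE \<omega> in M. norm (fk_kill (W_approx n) (K_approx n) 0 t x \<omega> * u n (x + X t \<omega>)) \<le> exp (t * c) * B" for n
      unfolding real_norm_def abs_mult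
      using fk_kill_bounds[OF W_approx(1,2) K_approx_closed _ t, of 0 n n x]
      by (intro AE_I2 mult_mono u) auto
  qed (use lim in auto)
qed

lemma T_bounded:
  assumes t: "0 < t" and f: "f \<in> borel_measurable borel" "\<And>y. \<bar>f y\<bar> \<le> B"
  shows "(\<lambda>x. indicator D x * T t f x) \<in> borel_measurable borel" "x \<in> D \<Longrightarrow> \<bar>T t f x\<bar> \<le> exp (t * c) * B"
    "x \<in> D \<Longrightarrow> (\<lambda>n. TK (W_approx n) (K_approx n) t f x) \<longlonglongrightarrow> T t f x"
proof -
  show lim: "(\<lambda>n. TK (W_approx n) (K_approx n) t f x) \<longlonglongrightarrow> T t f x" if "x \<in> D" for x
    by (rule T_limit[OF t that]) (use f in auto)
  have [measurable]: "TK (W_approx n) (K_approx n) t f \<in> borel_measurable borel" for n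
    by (rule TK_bounded_borel[OF W_approx(1,2) K_approx_closed t f])
  show "(\<lambda>x. indicator D x * T t f x) \<in> borel_measurable borel"
  proof (rule borel_measurable_LIMSEQ_real[where u = "\<lambda>n x. indicator D x * TK (W_approx n) (K_approx n) t f x"])
    show "(\<lambda>n. indicator D x * TK (W_approx n) (K_approx n) t f x) \<longlonglongrightarrow> indicator D x * T t f x" for x
      using lim[of x] by (cases "x \<in> D") auto
  qed measurable
  show "\<bar>T t f x\<bar> \<le> exp (t * c) * B" if "x \<in> D"
    by (rule LIMSEQ_le_const2[OF tendsto_rabs[OF lim[OF that]]])
       (intro exI allI impI TK_bounded_borel(2)[OF W_approx(1,2) K_approx_closed t f])
qed

lemma T_semigroup_bounded:
  assumes t: "0 < t" and s: "0 < s" and x: "x \<in> D" and f: "f \<in> borel_measurable borel" "\<And>y. \<bar>f y\<bar> \<le> B"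
  shows "T (t + s) f x = T t (T s f) x"
proof -
  have "(\<lambda>n. TK (W_approx n) (K_approx n) t (TK (W_approx n) (K_approx n) s f) x) \<longlonglongrightarrow> T t (T s f) x"
    by (rule T_limit[OF t x]) (use TK_bounded_borel[OF W_approx(1,2) K_approx_closed s f] T_bounded(3)[OF s f] in auto)
  moreover have "(\<lambda>n. TK (W_approx n) (K_approx n) (t + s) f x) \<longlonglongrightarrow> T (t + s) f x"
    using t s x by (intro T_bounded(3)[OF _ f]) auto
  ultimately show ?thesis
    unfolding TK_semigroup[OF W_approx(1,2) K_approx_closed t s f] by (blast intro: LIMSEQ_unique)
qed

lemma integrable_indicator_D: "integrable lborel (indicator D :: 'a \<Rightarrow> real)"
  by (intro integrable_real_indicator emeasure_bounded_finite D_props) simp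

lemma T_symmetric_bounded:
  assumes t: "0 < t" and f: "f \<in> borel_measurable borel" "\<And>y. \<bar>f y\<bar> \<le> A" and g: "g \<in> borel_measurable borel" "\<And>y. \<bar>g y\<bar> \<le> B"
  shows "(LINT x|lborel. indicator D x * (g x * T t f x)) = (LINT x|lborel. indicator D x * (f x * T t g x))"
proof -
  have lim: "(\<lambda>n. LINT x|lborel. indicator (K_approx n) x * (g x * TK (W_approx n) (K_approx n) t f x))
      \<longlonglongrightarrow> (LINT x|lborel. indicator D x * (g x * T t f x))"
    if f: "f \<in> borel_measurable borel" "\<And>y. \<bar>f y\<bar> \<le> A" and g: "g \<in> borel_measurable borel" "\<And>y. \<bar>g y\<bar> \<le> B"
    for f g :: "'a \<Rightarrow> real" and A B
  proof -
    have [measurable]: "f \<in> borel_measurable borel" "g \<in> borel_measurable borel" by fact+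
    have [measurable]: "K_approx n \<in> sets borel" for n using K_approx_closed by simp
    have [measurable]: "TK (W_approx n) (K_approx n) t f \<in> borel_measurable borel" for n
      by (rule TK_bounded_borel[OF W_approx(1,2) K_approx_closed t f])
    have [measurable]: "(\<lambda>x. indicator D x * T t f x) \<in> borel_measurable borel" by (rule T_bounded(1)[OF t f])
    have "(\<lambda>x. g x * (indicator D x * T t f x)) \<in> borel_measurable borel" by measurable
    then have m: "(\<lambda>x. indicator D x * (g x * T t f x)) \<in> borel_measurable lborel" by (simp add: mult.left_commute)
    have B0: "0 \<le> B" using g(2)[of 0] by linarith
    show ?thesis
    proof (rule integral_dominated_convergence[where w = "\<lambda>x. indicator D x * (B * (exp (t * c) * A))"])
      show "integrable lborel (\<lambda>x. indicator D x * (B * (exp (t * c) * A)))"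
        using integrable_indicator_D by simp
      show "AE x in lborel. (\<lambda>n. indicator (K_approx n) x * (g x * TK (W_approx n) (K_approx n) t f x)) \<longlonglongrightarrow> indicator D x * (g x * T t f x)"
      proof (rule AE_I2)
        fix x
        show "(\<lambda>n. indicator (K_approx n) x * (g x * TK (W_approx n) (K_approx n) t f x)) \<longlonglongrightarrow> indicator D x * (g x * T t f x)"
        proof (cases "x \<in> D")
          case True
          then obtain n0 where "x \<in> K_approx n0" using K_approx(3) by blast
          then have "\<forall>n\<ge>n0. indicator (K_approx n) x = (1::real)" using K_approx_mono by (auto simp: indicator_def)
          then have "\<forall>\<^sub>F n in sequentially. indicator (K_approx n) x = (1::real)"
            by (auto simp: eventually_sequentially)
          then have "(\<lambda>n. indicator (K_approx n) x :: real) \<longlonglongrightarrow> 1" by (rule tendsto_eventually)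
          then have "(\<lambda>n. indicator (K_approx n) x * (g x * TK (W_approx n) (K_approx n) t f x)) \<longlonglongrightarrow> 1 * (g x * T t f x)"
            by (intro tendsto_mult tendsto_const T_bounded(3)[OF t f True])
          then show ?thesis using True by simp
        next
          case False
          then have "x \<notin> K_approx n" for n using K_approx_sub by blast
          then show ?thesis using False by simp
        qed
      qed
      show "AE x in lborel. norm (indicator (K_approx n) x * (g x * TK (W_approx n) (K_approx n) t f x)) \<le> indicator D x * (B * (exp (t * c) * A))" for n
      proof (rule AE_I2)
        fix x
        have "\<bar>g x\<bar> * \<bar>TK (W_approx n) (K_approx n) t f x\<bar> \<le> B * (exp (t * c) * A)"
          by (intro mult_mono g B0 abs_ge_zero TK_bounded_borel(2)[OF W_approx(1,2) K_approx_closed t f])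
        moreover have "0 \<le> B * (exp (t * c) * A)" using B0 f(2)[of 0] by simp
        moreover have "x \<in> D" if "x \<in> K_approx n" using K_approx_sub that by blast
        ultimately show "norm (indicator (K_approx n) x * (g x * TK (W_approx n) (K_approx n) t f x)) \<le> indicator D x * (B * (exp (t * c) * A))"
          by (auto simp: indicator_def abs_mult)
      qed
    qed (use m in auto)
  qed
  show ?thesis
    using LIMSEQ_unique[OF lim[OF f g, unfolded TK_symmetric[OF W_approx(1,2) K_approx(1) t f g]] lim[OF g f]] by simp
qed

abbreviation ND :: "'a measure" where "ND \<equiv> restrict_space lborel D"

lemma ND_space [simp]: "space ND = D"
  by (simp add: space_restrict_space)

lemma ND_integral: "(LINT x|ND. f x :: real) = (LINT x|lborel. indicator D x * f x)"
  by (subst integral_restrict_space) auto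

lemma ND_integrable: "integrable ND (f :: 'a \<Rightarrow> real) \<longleftrightarrow> integrable lborel (\<lambda>x. indicator D x * f x)"
  by (subst integrable_restrict_space) auto

lemma ND_measurable: "(f :: 'a \<Rightarrow> real) \<in> borel_measurable ND \<longleftrightarrow> (\<lambda>x. indicator D x * f x) \<in> borel_measurable borel"
  by (subst borel_measurable_restrict_space_iff) auto

lemma ND_finite: "finite_measure ND"
  by (rule finite_measureI)
     (use emeasure_bounded_finite[OF D_props(2)] in \<open>simp add: emeasure_restrict_space\<close>)

lemma density_integrable:
  assumes t: "0 < t" and F: "integrable lborel (F :: 'a \<Rightarrow> real)"
  shows "integrable M (\<lambda>\<omega>. F (x + X t \<omega>))" "(LINT \<omega>|M. \<bar>F (x + X t \<omega>)\<bar>) \<le> \<kappa> t * (LINT y|lborel. \<bar>F y\<bar>)"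
proof -
  have [measurable]: "F \<in> borel_measurable borel" using F by auto
  have "(\<integral>\<^sup>+\<omega>. ennreal \<bar>F (x + X t \<omega>)\<bar> \<partial>M) \<le> ennreal (\<kappa> t) * (\<integral>\<^sup>+y. ennreal \<bar>F y\<bar> \<partial>lborel)"
    by (rule nn_integral_density_bound[OF t]) measurable
  also have "(\<integral>\<^sup>+y. ennreal \<bar>F y\<bar> \<partial>lborel) = ennreal (LINT y|lborel. \<bar>F y\<bar>)"
    using F by (intro nn_integral_eq_integral) auto
  also have "ennreal (\<kappa> t) * ennreal (LINT y|lborel. \<bar>F y\<bar>) = ennreal (\<kappa> t * (LINT y|lborel. \<bar>F y\<bar>))"
    using \<kappa>_nonneg by (simp add: ennreal_mult')
  finally have le: "(\<integral>\<^sup>+\<omega>. ennreal \<bar>F (x + X t \<omega>)\<bar> \<partial>M) \<le> ennreal (\<kappa> t * (LINT y|lborel. \<bar>F y\<bar>))" .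
  then have "(\<integral>\<^sup>+\<omega>. ennreal (norm (F (x + X t \<omega>))) \<partial>M) < \<infinity>" by (simp add: le_less_trans)
  then show i: "integrable M (\<lambda>\<omega>. F (x + X t \<omega>))" by (intro integrableI_bounded) auto
  have "ennreal (LINT \<omega>|M. \<bar>F (x + X t \<omega>)\<bar>) = (\<integral>\<^sup>+\<omega>. ennreal \<bar>F (x + X t \<omega>)\<bar> \<partial>M)"
    using i by (intro nn_integral_eq_integral[symmetric]) auto
  then have "ennreal (LINT \<omega>|M. \<bar>F (x + X t \<omega>)\<bar>) \<le> ennreal (\<kappa> t * (LINT y|lborel. \<bar>F y\<bar>))" using le by simp
  moreover have "0 \<le> \<kappa> t * (LINT y|lborel. \<bar>F y\<bar>)" using \<kappa>_nonneg by simp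
  ultimately show "(LINT \<omega>|M. \<bar>F (x + X t \<omega>)\<bar>) \<le> \<kappa> t * (LINT y|lborel. \<bar>F y\<bar>)"
    by (simp only: ennreal_le_iff)
qed

lemma wt_indicator: "0 < t \<Longrightarrow> wt t x \<omega> * f (x + X t \<omega>) = wt t x \<omega> * (indicator D (x + X t \<omega>) * f (x + X t \<omega>))"
  using wt_survive[of t x \<omega>] by (cases "wt t x \<omega> = 0") auto

text \<open>The weight is almost surely at most \<open>exp (t * c)\<close>, and the density at most
  \<open>\<kappa> t\<close>; their product becomes the constant \<open>C t\<close> of the abstract
  semigroup.\<close>

lemma T_integrable:
  assumes t: "0 < t" and x: "x \<in> D" and f: "integrable ND f"
  shows "integrable M (\<lambda>\<omega>. wt t x \<omega> * f (x + X t \<omega>))"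
    "\<bar>T t f x\<bar> \<le> exp (t * c) * \<kappa> t * (LINT y|ND. \<bar>f y\<bar>)"
proof -
  let ?F = "\<lambda>y. indicator D y * f y"
  have F: "integrable lborel ?F" using f by (simp add: ND_integrable)
  then have [measurable]: "?F \<in> borel_measurable borel" by auto
  note [measurable] = wt_measurable[OF t x]
  have le: "AE \<omega> in M. norm (wt t x \<omega> * ?F (x + X t \<omega>)) \<le> norm (exp (t * c) * \<bar>?F (x + X t \<omega>)\<bar>)"
    using wt_le[OF t x] by eventually_elim (auto simp: abs_mult wt_nonneg intro!: mult_right_mono)
  have i: "integrable M (\<lambda>\<omega>. exp (t * c) * \<bar>?F (x + X t \<omega>)\<bar>)"
    using density_integrable(1)[OF t F] by (intro integrable_mult_right integrable_abs)
  have "(\<lambda>\<omega>. wt t x \<omega> * ?F (x + X t \<omega>)) \<in> borel_measurable M"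
    using measurable_compose[of "\<lambda>\<omega>. x + X t \<omega>" M borel ?F borel] by measurable
  then have int: "integrable M (\<lambda>\<omega>. wt t x \<omega> * ?F (x + X t \<omega>))"
    by (rule Bochner_Integration.integrable_bound[OF i _ le])
  then show "integrable M (\<lambda>\<omega>. wt t x \<omega> * f (x + X t \<omega>))"
    by (simp only: wt_indicator[OF t, symmetric])
  have "\<bar>T t f x\<bar> = norm (LINT \<omega>|M. wt t x \<omega> * ?F (x + X t \<omega>))"
    unfolding T_eq by (simp only: wt_indicator[OF t, symmetric] real_norm_def)
  also have "\<dots> \<le> (LINT \<omega>|M. norm (wt t x \<omega> * ?F (x + X t \<omega>)))" by (rule integral_norm_bound)
  also have "\<dots> \<le> (LINT \<omega>|M. exp (t * c) * \<bar>?F (x + X t \<omega>)\<bar>)"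
    using le by (intro integral_mono_AE integrable_norm int i) auto
  also have "\<dots> \<le> exp (t * c) * (\<kappa> t * (LINT y|lborel. \<bar>?F y\<bar>))"
    using density_integrable(2)[OF t F, of x] by simp
  also have "(LINT y|lborel. \<bar>?F y\<bar>) = (LINT y|ND. \<bar>f y\<bar>)"
    by (simp add: ND_integral abs_mult)
  finally show "\<bar>T t f x\<bar> \<le> exp (t * c) * \<kappa> t * (LINT y|ND. \<bar>f y\<bar>)" by (simp add: mult.assoc)
qed

lemma T_dominated:
  assumes t: "0 < t" and x: "x \<in> D" and F: "integrable ND F"
    and f: "\<And>n. f n \<in> borel_measurable ND" "\<And>n y. y \<in> D \<Longrightarrow> \<bar>f n y\<bar> \<le> F y" "\<And>y. y \<in> D \<Longrightarrow> (\<lambda>n. f n y) \<longlonglongrightarrow> g y"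
  shows "(\<lambda>n. T t (f n) x) \<longlonglongrightarrow> T t g x"
proof -
  have fi: "integrable ND (f n)" for n
    by (rule Bochner_Integration.integrable_bound[OF F f(1)]) (use f(2) in \<open>auto intro!: AE_I2 order_trans[OF _ abs_ge_self]\<close>)
  have gm: "g \<in> borel_measurable ND"
    by (rule borel_measurable_LIMSEQ_real[OF _ f(1)]) (use f(3) in auto)
  have "\<bar>g y\<bar> \<le> F y" if "y \<in> D" for y
    by (rule LIMSEQ_le_const2[OF tendsto_rabs[OF f(3)[OF that]]]) (use f(2)[OF that] in auto)
  then have gi: "integrable ND g"
    by (intro Bochner_Integration.integrable_bound[OF F gm]) (auto intro!: AE_I2 order_trans[OF _ abs_ge_self])
  show ?thesis
    unfolding T_eq
  proof (rule integral_dominated_convergence[where w = "\<lambda>\<omega>. exp (t * c) * \<bar>indicator D (x + X t \<omega>) * F (x + X t \<omega>)\<bar>"])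
    show "integrable M (\<lambda>\<omega>. exp (t * c) * \<bar>indicator D (x + X t \<omega>) * F (x + X t \<omega>)\<bar>)"
      using density_integrable(1)[OF t F[unfolded ND_integrable]] by (intro integrable_mult_right integrable_abs)
    show "AE \<omega> in M. (\<lambda>n. wt t x \<omega> * f n (x + X t \<omega>)) \<longlonglongrightarrow> wt t x \<omega> * g (x + X t \<omega>)"
    proof (rule AE_I2)
      fix \<omega>
      show "(\<lambda>n. wt t x \<omega> * f n (x + X t \<omega>)) \<longlonglongrightarrow> wt t x \<omega> * g (x + X t \<omega>)"
        using wt_survive[OF t, of x \<omega>] f(3) by (cases "wt t x \<omega> = 0") (auto intro!: tendsto_intros)
    qed
    show "AE \<omega> in M. norm (wt t x \<omega> * f n (x + X t \<omega>)) \<le> exp (t * c) * \<bar>indicator D (x + X t \<omega>) * F (x + X t \<omega>)\<bar>" for n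
      using wt_le[OF t x]
    proof eventually_elim
      case (elim \<omega>)
      show ?case
      proof (cases "x + X t \<omega> \<in> D")
        case True
        then have "\<bar>f n (x + X t \<omega>)\<bar> \<le> \<bar>F (x + X t \<omega>)\<bar>" using f(2) by (meson abs_ge_self order_trans)
        then show ?thesis using True elim wt_nonneg[of t x \<omega>] by (simp add: abs_mult mult_mono)
      qed (use wt_survive[OF t, of x \<omega>] in auto)
    qed
    show "(\<lambda>\<omega>. wt t x \<omega> * f n (x + X t \<omega>)) \<in> borel_measurable M" for n
      using T_integrable(1)[OF t x fi] by auto
    show "(\<lambda>\<omega>. wt t x \<omega> * g (x + X t \<omega>)) \<in> borel_measurable M"
      using T_integrable(1)[OF t x gi] by auto
  qed
qed

text \<open>Truncation reduces integrable functions to bounded ones, for which the approximation by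
  compact sets is available; the indicator makes the result Borel on the whole space.\<close>

definition clampD :: "nat \<Rightarrow> ('a \<Rightarrow> real) \<Rightarrow> 'a \<Rightarrow> real" where
  "clampD k f y = max (- real k) (min (real k) (indicator D y * f y))"

lemma clampD:
  assumes "f \<in> borel_measurable ND"
  shows "clampD k f \<in> borel_measurable borel" "\<bar>clampD k f y\<bar> \<le> real k" "\<bar>clampD k f y\<bar> \<le> \<bar>f y\<bar>"
    "y \<in> D \<Longrightarrow> (\<lambda>k. clampD k f y) \<longlonglongrightarrow> f y"
proof -
  show "clampD k f \<in> borel_measurable borel"
    unfolding clampD_def[abs_def] using assms unfolding ND_measurable by measurable
  show "\<bar>clampD k f y\<bar> \<le> real k" by (auto simp: clampD_def abs_le_iff)
  show "\<bar>clampD k f y\<bar> \<le> \<bar>f y\<bar>" by (cases "y \<in> D") (auto simp: clampD_def max_def min_def abs_if)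
  assume y: "y \<in> D"
  obtain k0 :: nat where k0: "\<bar>f y\<bar> \<le> real k0" using real_arch_simple by blast
  have "clampD k f y = f y" if "k \<ge> k0" for k
  proof -
    have "\<bar>f y\<bar> \<le> real k" using k0 that by linarith
    then show ?thesis using y by (simp add: clampD_def max_def min_def abs_le_iff)
  qed
  then have "\<forall>\<^sub>F k in sequentially. clampD k f y = f y"
    by (auto simp: eventually_sequentially)
  then show "(\<lambda>k. clampD k f y) \<longlonglongrightarrow> f y" by (rule tendsto_eventually)
qed

lemma borel_imp_ND: "f \<in> borel_measurable borel \<Longrightarrow> f \<in> borel_measurable ND"
  by (intro measurable_restrict_space1) simp

lemma T_clamp_limit:
  assumes t: "0 < t" and x: "x \<in> D" and f: "integrable ND f"
  shows "(\<lambda>k. T t (clampD k f) x) \<longlonglongrightarrow> T t f x"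
proof (rule T_dominated[OF t x integrable_abs[OF f]])
  have fm: "f \<in> borel_measurable ND" using f by auto
  show "clampD k f \<in> borel_measurable ND" for k by (intro borel_imp_ND clampD(1)[OF fm])
  show "\<bar>clampD k f y\<bar> \<le> \<bar>f y\<bar>" for k y by (rule clampD(3)[OF fm])
  show "y \<in> D \<Longrightarrow> (\<lambda>k. clampD k f y) \<longlonglongrightarrow> f y" for y by (rule clampD(4)[OF fm])
qed

lemma T_bounded_ND:
  assumes t: "0 < t" and f: "f \<in> borel_measurable borel" "\<And>y. \<bar>f y\<bar> \<le> B"
  shows "T t f \<in> borel_measurable ND"
  unfolding ND_measurable by (rule T_bounded(1)[OF t f])

lemma T_measurable:
  assumes t: "0 < t" and f: "integrable ND f"
  shows "T t f \<in> borel_measurable ND"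
proof (rule borel_measurable_LIMSEQ_real)
  have fm: "f \<in> borel_measurable ND" using f by auto
  show "(\<lambda>k. T t (clampD k f) x) \<longlonglongrightarrow> T t f x" if "x \<in> space ND" for x
    using that by (intro T_clamp_limit[OF t _ f]) simp
  show "T t (clampD k f) \<in> borel_measurable ND" for k by (rule T_bounded_ND[OF t clampD(1,2)[OF fm]])
qed

lemma T_clamp_bound:
  assumes t: "0 < t" and x: "x \<in> D" and f: "integrable ND f"
  shows "\<bar>T t (clampD k f) x\<bar> \<le> exp (t * c) * \<kappa> t * (LINT y|ND. \<bar>f y\<bar>)"
proof -
  have fm: "f \<in> borel_measurable ND" using f by auto
  have i: "integrable ND (clampD k f)"
    by (rule Bochner_Integration.integrable_bound[OF f borel_imp_ND[OF clampD(1)[OF fm]]]) (use clampD(3)[OF fm] in auto)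
  have "\<bar>T t (clampD k f) x\<bar> \<le> exp (t * c) * \<kappa> t * (LINT y|ND. \<bar>clampD k f y\<bar>)" by (rule T_integrable(2)[OF t x i])
  also have "\<dots> \<le> exp (t * c) * \<kappa> t * (LINT y|ND. \<bar>f y\<bar>)"
    using \<kappa>_nonneg[of t] f i clampD(3)[OF fm] by (intro mult_left_mono integral_mono) auto
  finally show ?thesis .
qed

text \<open>Symmetry for the truncations passes to the limit: the truncated images share a constant
  bound on \<open>D\<close>, and the other factor is integrable.\<close>

lemma T_symmetric:
  assumes t: "0 < t" and f: "square_integrable ND f" and g: "square_integrable ND g"
  shows "(LINT x|ND. g x * T t f x) = (LINT x|ND. f x * T t g x)"
proof -
  interpret ND: finite_measure ND by (rule ND_finite)
  have lim: "(\<lambda>k. LINT x|ND. clampD k g x * T t (clampD k f) x) \<longlonglongrightarrow> (LINT x|ND. g x * T t f x)"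
    if f: "square_integrable ND f" and g: "square_integrable ND g" for f g
  proof -
    have fi: "integrable ND f" and gi: "integrable ND g"
      by (intro ND.square_integrable_integrable f g)+
    have fm: "f \<in> borel_measurable ND" and gm: "g \<in> borel_measurable ND" using fi gi by auto
    let ?C = "exp (t * c) * \<kappa> t * (LINT y|ND. \<bar>f y\<bar>)"
    show ?thesis
    proof (rule integral_dominated_convergence[where w = "\<lambda>x. \<bar>g x\<bar> * ?C"])
      show "(\<lambda>x. g x * T t f x) \<in> borel_measurable ND" using gm T_measurable[OF t fi] by measurable
      show "(\<lambda>x. clampD k g x * T t (clampD k f) x) \<in> borel_measurable ND" for k
        using borel_imp_ND[OF clampD(1)[OF gm]] T_bounded_ND[OF t clampD(1,2)[OF fm]] by measurable
      show "integrable ND (\<lambda>x. \<bar>g x\<bar> * ?C)" using gi by simp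
      show "AE x in ND. (\<lambda>k. clampD k g x * T t (clampD k f) x) \<longlonglongrightarrow> g x * T t f x"
        by (intro AE_I2 tendsto_mult clampD(4)[OF gm] T_clamp_limit[OF t _ fi]) auto
      show "AE x in ND. norm (clampD k g x * T t (clampD k f) x) \<le> \<bar>g x\<bar> * ?C" for k
        unfolding real_norm_def abs_mult
        by (intro AE_I2 mult_mono clampD(3)[OF gm] T_clamp_bound[OF t _ fi]) auto
    qed
  qed
  have fm: "f \<in> borel_measurable ND" and gm: "g \<in> borel_measurable ND" using f g by (auto simp: square_integrable_def)
  have "(LINT x|ND. clampD k g x * T t (clampD k f) x) = (LINT x|ND. clampD k f x * T t (clampD k g) x)" for k
    unfolding ND_integral by (rule T_symmetric_bounded[OF t clampD(1,2)[OF fm] clampD(1,2)[OF gm]])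
  then show ?thesis using LIMSEQ_unique[OF lim[OF f g]] lim[OF g f] by simp
qed

lemma T_semigroup:
  assumes s: "0 < s" and t: "0 < t" and f: "integrable ND f" and x: "x \<in> D"
  shows "T (s + t) f x = T s (T t f) x"
proof -
  interpret ND: finite_measure ND by (rule ND_finite)
  have fm: "f \<in> borel_measurable ND" using f by auto
  let ?C = "exp (t * c) * \<kappa> t * (LINT y|ND. \<bar>f y\<bar>)"
  have "(\<lambda>k. T s (T t (clampD k f)) x) \<longlonglongrightarrow> T s (T t f) x"
  proof (rule T_dominated[OF s x])
    show "integrable ND (\<lambda>_. ?C)" by simp
    show "T t (clampD k f) \<in> borel_measurable ND" for k by (rule T_bounded_ND[OF t clampD(1,2)[OF fm]])
    show "\<bar>T t (clampD k f) y\<bar> \<le> ?C" if "y \<in> D" for k y by (rule T_clamp_bound[OF t that f])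
    show "(\<lambda>k. T t (clampD k f) y) \<longlonglongrightarrow> T t f y" if "y \<in> D" for y by (rule T_clamp_limit[OF t that f])
  qed
  moreover have "(\<lambda>k. T (s + t) (clampD k f) x) \<longlonglongrightarrow> T (s + t) f x"
    using s t by (intro T_clamp_limit x f) simp
  ultimately show ?thesis
    unfolding T_semigroup_bounded[OF s t x clampD(1,2)[OF fm]] by (blast intro: LIMSEQ_unique)
qed

lemma D_measure_pos: "0 < measure lborel D"
proof -
  obtain x where x: "x \<in> D" using D_props(3) by auto
  then obtain e where e: "e > 0" "ball x e \<subseteq> D" using D_props(1) open_contains_ball by blast
  have "0 < measure lborel (ball x e)" using content_ball_pos[OF e(1), of x] by simp
  also have "\<dots> \<le> measure lborel D"
    using e(2) emeasure_bounded_finite[OF D_props(2)]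
    by (intro measure_mono_fmeasurable) (auto simp: fmeasurable_def)
  finally show ?thesis .
qed

lemma AE_weight_bounds:
  assumes t: "0 < t"
  shows "AE \<omega> in M. exp (- (t * c)) \<le> fk_weight W (path_from X x \<omega>) t"
  using AE_integral_limit[OF t, of x] AE_space
proof eventually_elim
  case (elim \<omega>)
  have "(LINT s:{0<..t}|lborel. W_approx n (x + X s \<omega>)) \<le> t * c" for n
  proof -
    have "(LINT s:{0<..t}|lborel. W_approx n (x + X s \<omega>)) \<le> (LINT s:{0<..t}|lborel. c)"
    proof (rule set_integral_mono)
      show "set_integrable lborel {0<..t} (\<lambda>s. W_approx n (x + X s \<omega>))"
        using riemann_limit[OF X_right_cont[of x \<omega>] W_approx(1)[of n] W_approx(2)[of n] _ t, of 0] by simp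
      show "set_integrable lborel {0<..t} (\<lambda>s. c)"
        using integrable_indicator_Ioc by (simp add: set_integrable_def)
      show "W_approx n (x + X s \<omega>) \<le> c" for s using W_approx(2)[of n "x + X s \<omega>"] by (simp add: abs_le_iff)
    qed
    then show ?thesis using t by (simp add: set_lebesgue_integral_def)
  qed
  then have "(LINT s:{0<..t}|lborel. W (x + X s \<omega>)) \<le> t * c"
    by (intro LIMSEQ_le_const2[OF elim(1)]) auto
  then show ?case unfolding fk_weight_eq[OF t elim(2)] by simp
qed

text \<open>As time shrinks, \<open>T t 1\<close> tends to 1 on \<open>D\<close>: the path starts in
  an open set and remains there for a while by right-continuity, and the exponential weight tends to
  1.\<close>

lemma T_nontrivial: "\<exists>t>0. 0 < (LINT x|ND. T t (\<lambda>_. 1) x)"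
proof -
  interpret ND: finite_measure ND by (rule ND_finite)
  define r where "r n = 1 / real (Suc n)" for n
  have r: "0 < r n" for n by (simp add: r_def)
  have r0: "r \<longlonglongrightarrow> 0" unfolding r_def by (intro LIMSEQ_Suc lim_1_over_n)
  have lim: "(\<lambda>n. T (r n) (\<lambda>_. 1) x) \<longlonglongrightarrow> 1" if x: "x \<in> D" for x
  proof -
    have "(\<lambda>n. LINT \<omega>|M. wt (r n) x \<omega> * 1) \<longlonglongrightarrow> (LINT \<omega>|M. 1)"
    proof (rule integral_dominated_convergence[where w = "\<lambda>_. exp c"])
      show "random_variable borel (\<lambda>\<omega>. wt (r n) x \<omega> * 1)" for n using wt_measurable[OF r x, of n] by simp
      show "AE \<omega> in M. norm (wt (r n) x \<omega> * 1) \<le> exp c" for n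
        using wt_le[OF r x, of n]
      proof eventually_elim
        case (elim \<omega>)
        have "r n \<le> 1" by (simp add: r_def)
        then have "exp (r n * c) \<le> exp c" using c_nonneg by (simp add: mult_left_le_one_le r less_imp_le)
        then have "wt (r n) x \<omega> \<le> exp c" by (rule order_trans[OF elim])
        then show ?case using wt_nonneg[of "r n" x \<omega>] by simp
      qed
      have "AE \<omega> in M. \<forall>n. exp (- (r n * c)) \<le> fk_weight W (path_from X x \<omega>) (r n)"
        unfolding AE_all_countable using AE_weight_bounds[OF r] by blast
      moreover have "AE \<omega> in M. \<forall>n. wt (r n) x \<omega> \<le> exp (r n * c)"
        unfolding AE_all_countable using wt_le[OF r x] by blast
      ultimately show "AE \<omega> in M. (\<lambda>n. wt (r n) x \<omega> * 1) \<longlonglongrightarrow> 1"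
      proof eventually_elim
        case (elim \<omega>)
        obtain b where b: "b > 0" "\<And>y. 0 \<le> y \<Longrightarrow> y < b \<Longrightarrow> x + X y \<omega> \<in> D"
          using right_contD[OF X_right_cont[of x \<omega>] order_refl D_props(1)] x by auto
        have "\<forall>\<^sub>F n in sequentially. r n < b" using r0 b(1) by (rule order_tendstoD)
        then have ev: "\<forall>\<^sub>F n in sequentially. exp (- (r n * c)) \<le> wt (r n) x \<omega>"
        proof eventually_elim
          case (elim n)
          then have "ereal (r n) < exit_time D (path_from X x \<omega>)" unfolding survive_iff[OF r] using b(2) by auto
          then show ?case using \<open>\<forall>n. exp (- (r n * c)) \<le> fk_weight W (path_from X x \<omega>) (r n)\<close> by (simp add: wt_def)
        qed
        have "(\<lambda>n. exp (- (r n * c))) \<longlonglongrightarrow> exp (- (0 * c))" by (intro tendsto_intros r0)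
        moreover have "(\<lambda>n. exp (r n * c)) \<longlonglongrightarrow> exp (0 * c)" by (intro tendsto_intros r0)
        ultimately show ?case
          using tendsto_sandwich[OF ev, of "\<lambda>n. exp (r n * c)" 1] elim(2) by simp
      qed
    qed auto
    then show ?thesis by (simp add: T_eq prob_space)
  qed
  have Tm: "T (r n) (\<lambda>_. 1) \<in> borel_measurable ND" for n by (rule T_bounded_ND[OF r, where B = 1]) auto
  have "(\<lambda>n. LINT x|ND. T (r n) (\<lambda>_. 1) x) \<longlonglongrightarrow> (LINT x|ND. 1)"
  proof (rule integral_dominated_convergence[where w = "\<lambda>_. exp c"])
    show "AE x in ND. norm (T (r n) (\<lambda>_. 1) x) \<le> exp c" for n
    proof (rule AE_I2)
      fix x assume "x \<in> space ND"
      then have "\<bar>T (r n) (\<lambda>_. 1) x\<bar> \<le> exp (r n * c) * 1" by (intro T_bounded(2)[OF r]) auto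
      moreover have "r n \<le> 1" by (simp add: r_def)
      ultimately show "norm (T (r n) (\<lambda>_. 1) x) \<le> exp c"
        using c_nonneg r[of n] by (simp add: order_trans[OF _ exp_le_cancel_iff[THEN iffD2]] mult_left_le_one_le less_imp_le)
    qed
  qed (use lim Tm in auto)
  moreover have "0 < (LINT x|ND. (1::real))"
    using D_measure_pos by (simp add: measure_restrict_space)
  ultimately have "\<forall>\<^sub>F n in sequentially. 0 < (LINT x|ND. T (r n) (\<lambda>_. 1) x)" by (rule order_tendstoD)
  then obtain n where "0 < (LINT x|ND. T (r n) (\<lambda>_. 1) x)" by (auto simp: eventually_sequentially)
  then show ?thesis using r[of n] by blast
qed

sublocale semigroup: symmetric_semigroup ND T c "\<lambda>t. exp (t * c) * \<kappa> t"
proof -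
  interpret ND: finite_measure ND by (rule ND_finite)
  show "symmetric_semigroup ND T c (\<lambda>t. exp (t * c) * \<kappa> t)"
  proof unfold_locales
    show "\<exists>t>0. 0 < (LINT x|ND. T t (\<lambda>_. 1) x)" by (rule T_nontrivial)
    show "0 \<le> c" by (rule c_nonneg)
    fix t :: real
    show "0 \<le> exp (t * c) * \<kappa> t" using \<kappa>_nonneg by simp
    assume t: "0 < t"
    show "T t (\<lambda>_. 1) x \<le> exp (c * t)" if "x \<in> space ND" for x
      using T_bounded(2)[OF t, of "\<lambda>_. 1" 1 x] that by (simp add: mult.commute abs_le_iff)
    fix f :: "'a \<Rightarrow> real" assume f: "square_integrable ND f"
    then have fi: "integrable ND f" by (rule ND.square_integrable_integrable)
    show "T t f \<in> borel_measurable ND" by (rule T_measurable[OF t fi])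
    show "(LINT x|ND. g x * T t f x) = (LINT x|ND. f x * T t g x)" if "square_integrable ND g" for g
      by (rule T_symmetric[OF t f that])
    fix x assume "x \<in> space ND"
    then have x: "x \<in> D" by simp
    show "\<bar>T t f x\<bar> \<le> exp (t * c) * \<kappa> t * (LINT y|ND. \<bar>f y\<bar>)" by (rule T_integrable(2)[OF t x fi])
    show "T t (\<lambda>y. a * f y) x = a * T t f x" for a
      unfolding T_eq by (simp add: mult.left_commute)
    show "T t (\<lambda>y. f y + g y) x = T t f x + T t g x" if "square_integrable ND g" for g
      unfolding T_eq using T_integrable(1)[OF t x fi] T_integrable(1)[OF t x ND.square_integrable_integrable[OF that]]
      by (simp add: distrib_left)
    show "0 \<le> T t f x" if "\<And>y. y \<in> space ND \<Longrightarrow> 0 \<le> f y"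
    proof -
      have "0 \<le> wt t x \<omega> * f (x + X t \<omega>)" for \<omega>
        using that wt_survive[OF t, of x \<omega>] wt_nonneg[of t x \<omega>] by (cases "wt t x \<omega> = 0") auto
      then show ?thesis unfolding T_eq by (intro Bochner_Integration.integral_nonneg) auto
    qed
    show "T (s + t) f x = T s (T t f) x" if "0 < s" for s by (rule T_semigroup[OF that t fi x])
  qed
qed

end

section \<open>The principal eigenvalue and the stopped representation\<close>

lemma exp_difference_quotient: "((\<lambda>t. (1 - exp (- l * t)) / t) \<longlongrightarrow> l) (at_right (0::real))"
proof -
  have "((\<lambda>t. exp (- l * t)) has_real_derivative - l) (at_right 0)"
    by (auto intro!: derivative_eq_intros)
  then have "((\<lambda>t. - ((exp (- l * t) - 1) / t)) \<longlongrightarrow> - (- l)) (at_right 0)"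
    by (intro tendsto_minus) (simp add: has_field_derivative_iff)
  then show ?thesis by (simp add: minus_divide_left)
qed

context killed_fk
begin

lemma Lp2_iff: "f \<in> Lp 2 D \<longleftrightarrow> square_integrable ND f"
proof -
  have "set_borel_measurable lborel D f \<longleftrightarrow> f \<in> borel_measurable ND"
    unfolding set_borel_measurable_def ND_measurable by simp
  moreover have "set_integrable lborel D (\<lambda>x. \<bar>f x\<bar> powr 2) \<longleftrightarrow> integrable ND (\<lambda>x. (f x)\<^sup>2)"
    unfolding set_integrable_def ND_integrable by simp
  ultimately show ?thesis by (simp add: Lp_def square_integrable_def)
qed

lemma Lp2_norm: "Lp_norm 2 D f = sqrt (LINT x|ND. (f x)\<^sup>2)"
  unfolding Lp_norm_def set_lebesgue_integral_def ND_integral by (simp add: powr_half_sqrt Bochner_Integration.integral_nonneg)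

lemma AE_D_iff: "(AE x in lborel. x \<in> D \<longrightarrow> P x) \<longleftrightarrow> (AE x in ND. P x)"
  by (subst AE_restrict_space_iff) auto

text \<open>The difference quotient acts on the eigenfunction as multiplication by a number that
  tends to \<open>top_rate\<close>. Only small times matter, so the range \<open>t \<le> 1\<close>
  of \<open>top_eigenfunction\<close> suffices.\<close>

lemma top_rate_eigenvalue: "schroedinger_eigenvalue M X D W semigroup.top_rate"
proof -
  let ?l = "semigroup.top_rate"
  obtain \<phi> B where phi: "\<phi> \<in> borel_measurable ND" "\<And>x. x \<in> D \<Longrightarrow> \<bar>\<phi> x\<bar> \<le> B" "0 < (LINT x|ND. (\<phi> x)\<^sup>2)"
     "\<And>t. 0 < t \<Longrightarrow> t \<le> 1 \<Longrightarrow> AE x in ND. T t \<phi> x = exp (- ?l * t) * \<phi> x"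
    using semigroup.top_eigenfunction by auto
  have L2: "square_integrable ND \<phi>" by (rule semigroup.square_integrable_bounded) (use phi in auto)
  have "\<phi> \<in> Lp 2 D" "(\<lambda>x. ?l * \<phi> x) \<in> Lp 2 D"
    unfolding Lp2_iff using L2 square_integrable_scale[OF L2] by auto
  moreover have "((\<lambda>t. Lp_norm 2 D (\<lambda>x. (\<phi> x - T t \<phi> x) / t - ?l * \<phi> x)) \<longlongrightarrow> 0) (at_right 0)"
  proof (rule Lim_transform_eventually)
    have "((\<lambda>t. (1 - exp (- ?l * t)) / t - ?l) \<longlongrightarrow> 0) (at_right 0)"
      using tendsto_diff[OF exp_difference_quotient[of ?l] tendsto_const[of ?l]] by simp
    then have "((\<lambda>t. \<bar>(1 - exp (- ?l * t)) / t - ?l\<bar> * sqrt (LINT x|ND. (\<phi> x)\<^sup>2)) \<longlongrightarrow> 0) (at_right 0)"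
      by (intro tendsto_mult_left_zero tendsto_rabs_zero)
    then show "((\<lambda>t. \<bar>(1 - exp (- ?l * t)) / t - ?l\<bar> * sqrt (LINT x|ND. (\<phi> x)\<^sup>2)) \<longlongrightarrow> 0) (at_right 0)" .
    have "\<forall>\<^sub>F t in at_right (0::real). 0 < t \<and> t \<le> 1"
      by (auto simp: eventually_at_right_field intro!: exI[of _ 1])
    then show "\<forall>\<^sub>F t in at_right 0. \<bar>(1 - exp (- ?l * t)) / t - ?l\<bar> * sqrt (LINT x|ND. (\<phi> x)\<^sup>2) =
        Lp_norm 2 D (\<lambda>x. (\<phi> x - T t \<phi> x) / t - ?l * \<phi> x)"
    proof eventually_elim
      case (elim t)
      then have t: "0 < t" by simp
      let ?k = "(1 - exp (- ?l * t)) / t - ?l"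
      have Tm: "T t \<phi> \<in> borel_measurable ND" using semigroup.T_measurable[of t \<phi>] elim L2 by auto
      have "(LINT x|ND. ((\<phi> x - T t \<phi> x) / t - ?l * \<phi> x)\<^sup>2) = (LINT x|ND. ?k\<^sup>2 * (\<phi> x)\<^sup>2)"
      proof (rule integral_cong_AE)
        show "AE x in ND. ((\<phi> x - T t \<phi> x) / t - ?l * \<phi> x)\<^sup>2 = ?k\<^sup>2 * (\<phi> x)\<^sup>2"
          using phi(4)[OF conjunct1[OF elim] conjunct2[OF elim]]
        proof eventually_elim
          case (elim x)
          have "(\<phi> x - T t \<phi> x) / t - ?l * \<phi> x = ?k * \<phi> x"
            unfolding elim using t by (simp add: field_simps)
          then show ?case by (simp add: power_mult_distrib)
        qed
      qed (use phi(1) Tm in measurable)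
      then show ?case unfolding Lp2_norm by (simp add: real_sqrt_mult)
    qed
  qed
  ultimately have "(\<phi>, \<lambda>x. ?l * \<phi> x) \<in> schroedinger_graph M X D W"
    by (simp add: schroedinger_graph_def)
  moreover have "\<not> (AE x in lborel. x \<in> D \<longrightarrow> \<phi> x = 0)"
  proof
    assume "AE x in lborel. x \<in> D \<longrightarrow> \<phi> x = 0"
    then have "AE x in ND. (\<phi> x)\<^sup>2 = 0" unfolding AE_D_iff by eventually_elim simp
    then have "(LINT x|ND. (\<phi> x)\<^sup>2) = (LINT x|ND. 0)" using phi(1) by (intro integral_cong_AE) auto
    then show False using phi(3) by simp
  qed
  ultimately show ?thesis unfolding schroedinger_eigenvalue_def by blast
qed

text \<open>Pairing the difference quotient with the given eigenfunction, the decay of the quadratic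
  form bounds the eigenvalue from below; Cauchy-Schwarz controls the remainder, which tends to 0 in
  mean square.\<close>

lemma top_rate_least:
  assumes "schroedinger_eigenvalue M X D W k"
  shows "semigroup.top_rate \<le> k"
proof -
  let ?l = "semigroup.top_rate"
  obtain \<xi> where xi: "(\<xi>, \<lambda>x. k * \<xi> x) \<in> schroedinger_graph M X D W" "\<not> (AE x in lborel. x \<in> D \<longrightarrow> \<xi> x = 0)"
    using assms unfolding schroedinger_eigenvalue_def by blast
  have L2: "square_integrable ND \<xi>" and lim: "((\<lambda>t. Lp_norm 2 D (\<lambda>x. (\<xi> x - T t \<xi> x) / t - k * \<xi> x)) \<longlongrightarrow> 0) (at_right 0)"
    using xi(1) by (auto simp: schroedinger_graph_def Lp2_iff)
  define n2 where "n2 = (LINT x|ND. (\<xi> x)\<^sup>2)"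
  have I2: "integrable ND (\<lambda>x. (\<xi> x)\<^sup>2)" using L2 by (auto simp: square_integrable_def)
  have "n2 \<noteq> 0"
  proof
    assume "n2 = 0"
    then have "AE x in ND. (\<xi> x)\<^sup>2 = 0"
      unfolding n2_def using I2 by (subst (asm) integral_nonneg_eq_0_iff_AE) auto
    then have "AE x in ND. \<xi> x = 0" by eventually_elim simp
    then show False using xi(2) by (simp add: AE_D_iff)
  qed
  moreover have "0 \<le> n2" unfolding n2_def by (intro Bochner_Integration.integral_nonneg) auto
  ultimately have n2: "0 < n2" by simp
  have ineq: "((1 - exp (- ?l * t)) / t - k) * n2 \<le> sqrt n2 * Lp_norm 2 D (\<lambda>x. (\<xi> x - T t \<xi> x) / t - k * \<xi> x)" if t: "0 < t" for t
  proof -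
    have LT: "square_integrable ND (T t \<xi>)" using t L2 by simp
    have Lq: "square_integrable ND (\<lambda>x. (\<xi> x - T t \<xi> x) / t - k * \<xi> x)"
      using square_integrable_diff[OF square_integrable_scale[OF square_integrable_diff[OF L2 LT], of "1 / t"] square_integrable_scale[OF L2, of k]]
      by simp
    have Ix: "integrable ND (\<lambda>x. \<xi> x * T t \<xi> x)" by (rule square_integrable_mult[OF L2 LT])
    have "((1 - exp (- ?l * t)) / t - k) * n2 = (n2 - exp (- ?l * t) * n2) / t - k * n2"
      by (simp add: field_simps)
    also have "\<dots> \<le> (n2 - (LINT x|ND. \<xi> x * T t \<xi> x)) / t - k * n2"
      using semigroup.top_rate_quadratic_form[OF L2 t] t
      by (intro diff_right_mono divide_right_mono diff_left_mono) (auto simp: n2_def)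
    also have "\<dots> = (LINT x|ND. \<xi> x * ((\<xi> x - T t \<xi> x) / t - k * \<xi> x))"
    proof -
      have "(LINT x|ND. \<xi> x * ((\<xi> x - T t \<xi> x) / t - k * \<xi> x)) = (LINT x|ND. ((\<xi> x)\<^sup>2 - \<xi> x * T t \<xi> x) / t - k * (\<xi> x)\<^sup>2)"
        by (intro Bochner_Integration.integral_cong) (auto simp: power2_eq_square algebra_simps diff_divide_distrib)
      then show ?thesis using I2 Ix by (simp add: n2_def)
    qed
    also have "\<dots> \<le> \<bar>\<dots>\<bar>" by simp
    also have "\<dots> \<le> sqrt (n2 * (LINT x|ND. ((\<xi> x - T t \<xi> x) / t - k * \<xi> x)\<^sup>2))"
      using Cauchy_Schwarz_integral[OF L2 Lq] unfolding n2_def by (intro real_le_rsqrt) simp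
    finally show ?thesis by (simp add: Lp2_norm real_sqrt_mult)
  qed
  have "((\<lambda>t. ((1 - exp (- ?l * t)) / t - k) * n2) \<longlongrightarrow> (?l - k) * n2) (at_right 0)"
  proof -
    have "((\<lambda>t. (1 - exp (- ?l * t)) / t) \<longlongrightarrow> ?l) (at_right 0)" by (rule exp_difference_quotient)
    then show ?thesis by (intro tendsto_intros)
  qed
  moreover have "((\<lambda>t. sqrt n2 * Lp_norm 2 D (\<lambda>x. (\<xi> x - T t \<xi> x) / t - k * \<xi> x)) \<longlongrightarrow> sqrt n2 * 0) (at_right 0)"
    by (intro tendsto_mult tendsto_const lim)
  moreover have "\<forall>\<^sub>F t in at_right 0. ((1 - exp (- ?l * t)) / t - k) * n2 \<le> sqrt n2 * Lp_norm 2 D (\<lambda>x. (\<xi> x - T t \<xi> x) / t - k * \<xi> x)"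
    using ineq by (auto simp: eventually_at_right_field intro!: exI[of _ 1])
  ultimately have "(?l - k) * n2 \<le> sqrt n2 * 0" by (intro tendsto_le[of "at_right 0"]) auto
  then show ?thesis using n2 by (simp add: mult_le_0_iff)
qed

theorem principal_eigenvalue_eq: "principal_eigenvalue M X D W = semigroup.top_rate"
  unfolding principal_eigenvalue_def by (rule Least_equality[of "schroedinger_eigenvalue M X D W", OF top_rate_eigenvalue top_rate_least])

section \<open>Stopping at the exit from the domain\<close>

lemma sets_survive [measurable]:
  assumes x: "x \<in> D" and q: "0 < q"
  shows "{\<omega>\<in>space M. ereal q < exit_time D (path_from X x \<omega>)} \<in> sets M"
proof -
  note [measurable] = wt_measurable[OF q x]
  \<comment> \<open>The exponential factor never vanishes, so the measurable weight detects
    survival.\<close>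
  have "{\<omega>\<in>space M. ereal q < exit_time D (path_from X x \<omega>)} = {\<omega>\<in>space M. wt q x \<omega> \<noteq> 0}"
    by (auto simp: wt_def fk_weight_def)
  then show ?thesis by simp
qed

lemma exit_time_pos: "x \<in> D \<Longrightarrow> 0 < exit_time D (path_from X x \<omega>)"
proof -
  assume x: "x \<in> D"
  obtain b where b: "b > 0" "\<And>y. 0 \<le> y \<Longrightarrow> y < b \<Longrightarrow> x + X y \<omega> \<in> D"
    using right_contD[OF X_right_cont[of x \<omega>] order_refl D_props(1)] x by auto
  have "ereal (b / 2) < exit_time D (path_from X x \<omega>)" using b by (subst survive_iff) auto
  then show ?thesis using b(1) by (metis ereal_less(2) half_gt_zero less_trans)
qed

text \<open>If the path were in \<open>D\<close> at the exit time, openness and right-continuity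
  would let it survive beyond that time.\<close>

lemma exit_position:
  assumes x: "x \<in> D" and \<tau>: "exit_time D (path_from X x \<omega>) = ereal r"
  shows "path_from X x \<omega> r \<notin> D"
proof
  assume in_D: "path_from X x \<omega> r \<in> D"
  have r: "0 < r" using exit_time_pos[OF x, of \<omega>] \<tau> by simp
  have "\<forall>s\<in>{0<..r}. x + X s \<omega> \<in> D"
  proof
    fix s assume s: "s \<in> {0<..r}"
    show "x + X s \<omega> \<in> D"
    proof (cases "s = r")
      case True then show ?thesis using in_D by (simp add: path_from_def)
    next
      case False
      then have "ereal s < exit_time D (path_from X x \<omega>)" using s \<tau> by simp
      then show ?thesis using s survive_iff[of s x \<omega>] by auto
    qed
  qed
  then have "ereal r < exit_time D (path_from X x \<omega>)" using survive_iff[OF r] by blast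
  then show False using \<tau> by simp
qed

lemma stopped_time_cases:
  assumes x: "x \<in> D" and t: "0 < t"
  shows "(ereal t < exit_time D (path_from X x \<omega>) \<and> stopped_time D (path_from X x \<omega>) t = t) \<or>
    (exit_time D (path_from X x \<omega>) = ereal (stopped_time D (path_from X x \<omega>) t) \<and> stopped_time D (path_from X x \<omega>) t \<le> t
      \<and> 0 < stopped_time D (path_from X x \<omega>) t)"
  using exit_time_pos[OF x, of \<omega>] t
  by (cases "exit_time D (path_from X x \<omega>)") (auto simp: stopped_time_def min_def not_le)

text \<open>At the exit the path is outside \<open>D\<close>, where \<open>\<phi>\<close> vanishes.
  Only survival beyond \<open>t\<close> contributes, and there stopping has no effect.\<close>

lemma stopped_expectation:
  assumes x: "x \<in> D" and t: "0 < t" and \<phi>: "\<And>y. y \<notin> D \<Longrightarrow> \<phi> y = 0"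
  shows "(LINT \<omega>|M. (let w = path_from X x \<omega>; S = stopped_time D w t in fk_weight W w S * \<phi> (w S))) = T t \<phi> x"
  unfolding fk_semigroup_def Let_def
proof (intro Bochner_Integration.integral_cong refl)
  fix \<omega>
  show "fk_weight W (path_from X x \<omega>) (stopped_time D (path_from X x \<omega>) t) * \<phi> (path_from X x \<omega> (stopped_time D (path_from X x \<omega>) t)) =
    fk_weight W (path_from X x \<omega>) t * \<phi> (path_from X x \<omega> t) * of_bool (ereal t < exit_time D (path_from X x \<omega>))"
    using stopped_time_cases[OF x t, of \<omega>]
  proof
    assume "ereal t < exit_time D (path_from X x \<omega>) \<and> stopped_time D (path_from X x \<omega>) t = t"
    then show ?thesis by simp
  next
    assume a: "exit_time D (path_from X x \<omega>) = ereal (stopped_time D (path_from X x \<omega>) t) \<and> stopped_time D (path_from X x \<omega>) t \<le> t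
      \<and> 0 < stopped_time D (path_from X x \<omega>) t"
    then have "\<phi> (path_from X x \<omega> (stopped_time D (path_from X x \<omega>) t)) = 0" using exit_position[OF x] \<phi> by blast
    moreover have "\<not> ereal t < exit_time D (path_from X x \<omega>)" using a by (metis ereal_less_eq(3) leD)
    ultimately show ?thesis by simp
  qed
qed

text \<open>Tonelli requires joint measurability in time and sample. Survival beyond
  \<open>s\<close> is a countable union over rational \<open>q > s\<close> of events with
  \<open>q\<close> fixed; the other factors inherit joint measurability from the process.\<close>

lemma wt_joint_measurable:
  assumes x: "x \<in> D" and f: "(\<lambda>y. indicator D y * f y :: real) \<in> borel_measurable borel"
  shows "(\<lambda>z. indicator {0<..} (fst z) * ennreal (wt (fst z) x (snd z) * \<bar>f (x + X (fst z) (snd z))\<bar>)) \<in> borel_measurable (lborel \<Otimes>\<^sub>M M)"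
proof -
  let ?P = "lborel \<Otimes>\<^sub>M M :: (real \<times> 'w) measure"
  define F where "F y = indicator D y * f y" for y
  have [measurable]: "F \<in> borel_measurable borel" using f unfolding F_def .
  have Xj [measurable]: "(\<lambda>z. X (max (fst z) 0) (snd z)) \<in> borel_measurable ?P"
    using X_joint by (simp add: case_prod_beta)
  have Xj2: "(\<lambda>z. X (max (snd z) 0) (snd (fst z))) \<in> borel_measurable (?P \<Otimes>\<^sub>M lborel)"
    using measurable_compose[of "\<lambda>z. (snd z, snd (fst z))" "?P \<Otimes>\<^sub>M lborel" "borel \<Otimes>\<^sub>M M", OF _ X_joint] by simp
  have Im [measurable]: "(\<lambda>z. LINT u|lborel. (if 0 < u \<and> u \<le> fst z then W (x + X (max u 0) (snd z)) else 0)) \<in> borel_measurable ?P"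
  proof -
    have "(\<lambda>(z, u). if 0 < u \<and> u \<le> fst z then W (x + X (max u 0) (snd z)) else 0) \<in> borel_measurable (?P \<Otimes>\<^sub>M lborel)"
      using Xj2 unfolding case_prod_beta by measurable
    then show ?thesis by (rule lborel.borel_measurable_lebesgue_integral)
  qed
  define E where "E = (\<Union>q\<in>{q\<in>\<rat>. 0 < q}. {..<q} \<times> {\<omega>\<in>space M. ereal q < exit_time D (path_from X x \<omega>)})"
  have E [measurable]: "E \<in> sets ?P"
    unfolding E_def
  proof (rule sets.countable_UN')
    show "countable {q\<in>\<rat>. (0::real) < q}" using countable_rat by (rule countable_subset[rotated]) auto
    show "(\<lambda>q. {..<q} \<times> {\<omega>\<in>space M. ereal q < exit_time D (path_from X x \<omega>)}) ` {q\<in>\<rat>. 0 < q} \<subseteq> sets ?P"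
      using sets_survive[OF x] by (auto intro!: pair_measureI)
  qed
  have E_iff: "z \<in> E \<longleftrightarrow> ereal (fst z) < exit_time D (path_from X x (snd z))" if z: "0 < fst z" "snd z \<in> space M" for z
  proof
    assume "z \<in> E"
    then obtain q where "fst z < q" "ereal q < exit_time D (path_from X x (snd z))" by (auto simp: E_def)
    then show "ereal (fst z) < exit_time D (path_from X x (snd z))" by (metis ereal_less_eq(3) le_less_trans less_imp_le)
  next
    assume a: "ereal (fst z) < exit_time D (path_from X x (snd z))"
    obtain r where r: "fst z < r" "ereal r < exit_time D (path_from X x (snd z))"
      using ereal_dense2[OF a] by auto
    obtain q where q: "q \<in> \<rat>" "fst z < q" "q < r" using Rats_dense_in_real[OF r(1)] by auto
    have "ereal q < exit_time D (path_from X x (snd z))" using q(3) r(2) by (metis ereal_less(2) less_ereal.simps(1) less_trans)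
    then show "z \<in> E" using q z by (cases z) (auto simp: E_def)
  qed
  have "(\<lambda>z. indicator {0<..} (fst z) * ennreal (exp (- (LINT u|lborel. (if 0 < u \<and> u \<le> fst z then W (x + X (max u 0) (snd z)) else 0))) *
      indicator E z * \<bar>F (x + X (max (fst z) 0) (snd z))\<bar>)) \<in> borel_measurable ?P"
    by measurable
  moreover have "indicator {0<..} (fst z) * ennreal (exp (- (LINT u|lborel. (if 0 < u \<and> u \<le> fst z then W (x + X (max u 0) (snd z)) else 0))) *
      indicator E z * \<bar>F (x + X (max (fst z) 0) (snd z))\<bar>) =
     indicator {0<..} (fst z) * ennreal (wt (fst z) x (snd z) * \<bar>f (x + X (fst z) (snd z))\<bar>)" if "z \<in> space ?P" for z
  proof (cases "0 < fst z")
    case True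
    have w: "snd z \<in> space M" using that by (auto simp: space_pair_measure)
    have e1: "(LINT u|lborel. (if 0 < u \<and> u \<le> fst z then W (x + X (max u 0) (snd z)) else 0)) = (LINT u:{0<..fst z}|lborel. W (x + X u (snd z)))"
      unfolding set_lebesgue_integral_def by (intro Bochner_Integration.integral_cong refl) (auto simp: indicator_def max_def)
    have e2: "exp (- (LINT u|lborel. (if 0 < u \<and> u \<le> fst z then W (x + X (max u 0) (snd z)) else 0))) * indicator E z = wt (fst z) x (snd z)"
      unfolding e1 wt_def fk_weight_eq[OF True w] using E_iff[OF True w] by (simp add: indicator_def of_bool_def)
    have "wt (fst z) x (snd z) * \<bar>F (x + X (fst z) (snd z))\<bar> = wt (fst z) x (snd z) * \<bar>f (x + X (fst z) (snd z))\<bar>"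
      using wt_survive[OF True, of x "snd z"] by (cases "wt (fst z) x (snd z) = 0") (auto simp: F_def)
    then have e3: "wt (fst z) x (snd z) * \<bar>F (x + X (max (fst z) 0) (snd z))\<bar> = wt (fst z) x (snd z) * \<bar>f (x + X (fst z) (snd z))\<bar>"
      using True by (simp add: max_def)
    show ?thesis unfolding e2 e3 ..
  qed simp
  ultimately show ?thesis by (simp cong: measurable_cong)
qed

text \<open>Up to the stopping time the surviving weight is the full weight, so Tonelli turns the running
  cost into a time integral of the killed semigroup.\<close>

lemma running_cost_le:
  assumes x: "x \<in> D" and t: "0 < t" and f: "(\<lambda>y. indicator D y * f y :: real) \<in> borel_measurable borel"
    and h: "\<And>s. 0 < s \<Longrightarrow> (\<integral>\<^sup>+\<omega>. ennreal (wt s x \<omega> * \<bar>f (x + X s \<omega>)\<bar>) \<partial>M) \<le> h s"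
    and C: "(\<integral>\<^sup>+s. indicator {0<..} s * h s \<partial>lborel) \<le> ennreal C" "0 \<le> C"
  shows "(LINT \<omega>|M. (let w = path_from X x \<omega>; S = stopped_time D w t in (LINT s:{0..S}|lborel. fk_weight W w s * f (w s)))) \<le> C"
proof -
  interpret PP: pair_sigma_finite "lborel :: real measure" M ..
  define I where "I \<omega> = (let w = path_from X x \<omega>; S = stopped_time D w t in (LINT s:{0..S}|lborel. fk_weight W w s * f (w s)))" for \<omega>
  define G where "G z = indicator {0<..} (fst z) * ennreal (wt (fst z) x (snd z) * \<bar>f (x + X (fst z) (snd z))\<bar>)" for z
  have Gm [measurable]: "G \<in> borel_measurable (lborel \<Otimes>\<^sub>M M)" unfolding G_def by (rule wt_joint_measurable[OF x f])
  \<comment> \<open>Non-integrable functions have integral 0, so the bound holds for both the inner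
    and the outer integral without an integrability proof.\<close>
  have norm_le: "ennreal (norm (integral\<^sup>L N g)) \<le> (\<integral>\<^sup>+y. ennreal (norm (g y)) \<partial>N)" for N :: "'c measure" and g :: "'c \<Rightarrow> real"
  proof (cases "integrable N g")
    case True
    then show ?thesis by (rule integral_norm_bound_ennreal)
  next
    case False
    then have "integral\<^sup>L N g = 0" by (rule not_integrable_integral_eq)
    then show ?thesis by (simp only: norm_zero ennreal_0 zero_le)
  qed
  have I_le: "ennreal (norm (I \<omega>)) \<le> (\<integral>\<^sup>+s. G (s, \<omega>) \<partial>lborel)" for \<omega>
  proof -
    let ?w = "path_from X x \<omega>" and ?S = "stopped_time D (path_from X x \<omega>) t"
    have "ennreal (norm (I \<omega>)) \<le> (\<integral>\<^sup>+s. ennreal (norm (indicator {0..?S} s *\<^sub>R (fk_weight W ?w s * f (?w s)))) \<partial>lborel)"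
      unfolding I_def Let_def set_lebesgue_integral_def by (rule norm_le)
    also have "\<dots> \<le> (\<integral>\<^sup>+s. G (s, \<omega>) \<partial>lborel)"
    proof (rule nn_integral_mono_AE)
      \<comment> \<open>The time 0 and the stopping time itself form a null set; strictly between
        them the path has survived.\<close>
      show "AE s in lborel. ennreal (norm (indicator {0..?S} s *\<^sub>R (fk_weight W ?w s * f (?w s)))) \<le> G (s, \<omega>)"
        using AE_lborel_singleton[of "0::real"] AE_lborel_singleton[of "?S"]
      proof eventually_elim
        case (elim s)
        show ?case
        proof (cases "s \<in> {0..?S}")
          case True
          then have s: "0 < s" "s < ?S" using elim by auto
          have "ereal s < exit_time D ?w"
            using stopped_time_cases[OF x t, of \<omega>]
          proof
            assume "ereal t < exit_time D ?w \<and> ?S = t"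
            then show ?thesis using s by (metis less_ereal.simps(1) less_trans)
          next
            assume "exit_time D ?w = ereal ?S \<and> ?S \<le> t \<and> 0 < ?S"
            then show ?thesis using s by simp
          qed
          then show ?thesis using True s
            by (simp add: G_def wt_def abs_mult fk_weight_def path_from_def)
        qed simp
      qed
    qed
    finally show ?thesis .
  qed
  have "ennreal (norm (integral\<^sup>L M I)) \<le> (\<integral>\<^sup>+\<omega>. ennreal (norm (I \<omega>)) \<partial>M)" by (rule norm_le)
  also have "\<dots> \<le> (\<integral>\<^sup>+\<omega>. \<integral>\<^sup>+s. G (s, \<omega>) \<partial>lborel \<partial>M)" by (intro nn_integral_mono I_le)
  also have "\<dots> = (\<integral>\<^sup>+s. \<integral>\<^sup>+\<omega>. G (s, \<omega>) \<partial>M \<partial>lborel)" by (rule PP.Fubini[OF Gm])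
  also have "\<dots> \<le> (\<integral>\<^sup>+s. indicator {0<..} s * h s \<partial>lborel)"
  proof (rule nn_integral_mono)
    fix s :: real
    show "(\<integral>\<^sup>+\<omega>. G (s, \<omega>) \<partial>M) \<le> indicator {0<..} s * h s"
      using h[of s] by (cases "0 < s") (auto simp: G_def)
  qed
  also note C(1)
  finally have "norm (integral\<^sup>L M I) \<le> C" using C(2) by (simp add: ennreal_le_iff)
  then show ?thesis unfolding I_def by (simp add: abs_le_iff)
qed

end

text \<open>Hoelder and Jensen before integration. \<open>A\<close> and \<open>B\<close> stand for
  the expected sizes of \<open>a\<close> and \<open>b\<close>: once the expectations of the two
  normalised powers are at most 1, the expectation of the bracket is at most 1.\<close>

lemma young_three:
  fixes a b A B \<rho> q p :: real
  assumes "1 < \<rho>" "1 < q" "1 / \<rho> + 1 / q = 1" "1 \<le> p" "0 \<le> a" "0 \<le> b" "0 < A" "0 < B"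
  shows "a * b \<le> A * B * (1 / \<rho> * (a powr \<rho> / A powr \<rho>) + 1 / q * (1 / p * (b powr (q * p) / B powr (q * p)) + (1 - 1 / p)))"
proof -
  \<comment> \<open>The tangent-line inequality for the power \<open>p\<close> at the point 1, the
    pointwise form of Jensen's inequality. For \<open>p > 1\<close> it is Young's inequality against
    the constant 1.\<close>
  have bern: "y \<le> 1 / p * y powr p + (1 - 1 / p)" if "0 \<le> y" for y
  proof (cases "p = 1")
    case False
    then have p: "p > 1" using assms(4) by simp
    have "y * 1 \<le> y powr p / p + 1 powr (p / (p - 1)) / (p / (p - 1))"
      using p that by (intro Youngs_inequality) (auto simp: field_simps)
    also have "\<dots> = 1 / p * y powr p + (1 - 1 / p)" using p by (simp add: field_simps)
    finally show ?thesis by simp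
  qed (use that in simp)
  have "(a / A) * (b / B) \<le> (a / A) powr \<rho> / \<rho> + (b / B) powr q / q"
    using assms by (intro Youngs_inequality) auto
  also have "(b / B) powr q \<le> 1 / p * ((b / B) powr q) powr p + (1 - 1 / p)"
    by (rule bern) simp
  then have "(a / A) powr \<rho> / \<rho> + (b / B) powr q / q \<le> (a / A) powr \<rho> / \<rho> + (1 / p * ((b / B) powr q) powr p + (1 - 1 / p)) / q"
    using assms by (intro add_left_mono divide_right_mono) auto
  also have "\<dots> = 1 / \<rho> * (a powr \<rho> / A powr \<rho>) + 1 / q * (1 / p * (b powr (q * p) / B powr (q * p)) + (1 - 1 / p))"
    using assms by (simp add: powr_powr powr_divide)
  finally have "A * B * ((a / A) * (b / B)) \<le> A * B * (1 / \<rho> * (a powr \<rho> / A powr \<rho>) + 1 / q * (1 / p * (b powr (q * p) / B powr (q * p)) + (1 - 1 / p)))"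
    using assms by (intro mult_left_mono) auto
  then show ?thesis using assms by simp
qed

text \<open>On \<open>{0..1}\<close> the power is integrable since \<open>b < 1\<close>, and beyond
  1 it is at most 1. Twice the exponential, a multiple of the exponential density, covers what
  remains.\<close>

lemma exp_powr_integral_finite:
  assumes k: "0 < k" and b: "0 \<le> b" "b < 1"
  shows "\<exists>C\<ge>0. (\<integral>\<^sup>+s. indicator {0<..} s * ennreal (exp (- k * s) * (1 + s powr (- b))) \<partial>lborel) \<le> ennreal C"
proof -
  have i1: "(\<integral>\<^sup>+s. ennreal (s powr (- b)) * indicator {0..1} s \<partial>lborel) = ennreal (1 / (1 - b))"
    using nn_integral_has_integral_lebesgue'[OF _ has_integral_powr_from_0[of "- b" 1]] b by simp
  have i2: "(\<integral>\<^sup>+s. ennreal (exponential_density k s) \<partial>lborel) = 1"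
    using prob_space.emeasure_space_1[OF prob_space_exponential_density[OF k]] by (simp add: emeasure_density)
  have "(\<integral>\<^sup>+s. indicator {0<..} s * ennreal (exp (- k * s) * (1 + s powr (- b))) \<partial>lborel)
     \<le> (\<integral>\<^sup>+s. ennreal (s powr (- b)) * indicator {0..1} s + ennreal (2 / k) * ennreal (exponential_density k s) \<partial>lborel)"
  proof (rule nn_integral_mono)
    fix s :: real
    show "indicator {0<..} s * ennreal (exp (- k * s) * (1 + s powr (- b))) \<le>
        ennreal (s powr (- b)) * indicator {0..1} s + ennreal (2 / k) * ennreal (exponential_density k s)"
    proof (cases "0 < s")
      case True
      have e1: "exp (- k * s) \<le> 1" using True k by simp
      have d: "2 / k * exponential_density k s = 2 * exp (- k * s)"
        using True k by (simp add: exponential_density_def mult.commute)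
      have "exp (- k * s) * (1 + s powr (- b)) \<le> s powr (- b) * indicator {0..1} s + 2 * exp (- k * s)"
      proof (cases "s \<le> 1")
        case le: True
        have "exp (- k * s) * s powr (- b) \<le> 1 * s powr (- b)" using e1 by (intro mult_right_mono) auto
        moreover have "0 \<le> exp (- k * s)" by simp
        moreover have "indicator {0..1} s = (1::real)" using le True by simp
        ultimately show ?thesis by (simp only: distrib_left)
      next
        case False
        then have "s powr (- b) \<le> 1" using powr_mono[of "- b" 0 s] b by simp
        then have "exp (- k * s) * s powr (- b) \<le> exp (- k * s) * 1" by (intro mult_left_mono) auto
        then show ?thesis using False by (simp add: distrib_left)
      qed
      then have "ennreal (exp (- k * s) * (1 + s powr (- b))) \<le> ennreal (s powr (- b) * indicator {0..1} s + 2 / k * exponential_density k s)"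
        unfolding d by (rule ennreal_leI)
      also have "\<dots> = ennreal (s powr (- b)) * indicator {0..1} s + ennreal (2 / k) * ennreal (exponential_density k s)"
      proof -
        have "ennreal (2 / k * exponential_density k s) = ennreal (2 / k) * ennreal (exponential_density k s)"
          using k by (intro ennreal_mult') simp
        moreover have "ennreal (s powr (- b) * indicator {0..1} s) = ennreal (s powr (- b)) * indicator {0..1} s"
          by (simp add: ennreal_mult' ennreal_indicator)
        moreover have "ennreal (s powr (- b) * indicator {0..1} s + 2 / k * exponential_density k s) =
            ennreal (s powr (- b) * indicator {0..1} s) + ennreal (2 / k * exponential_density k s)"
          using k by (intro ennreal_plus mult_nonneg_nonneg exponential_density_nonneg) auto
        ultimately show ?thesis by (simp only:)
      qed
      finally show ?thesis using True by simp
    qed simp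
  qed
  also have "\<dots> = ennreal (1 / (1 - b)) + ennreal (2 / k)"
    by (subst nn_integral_add) (auto simp: i1 i2 nn_integral_cmult)
  also have "\<dots> = ennreal (1 / (1 - b) + 2 / k)" using k b by (subst ennreal_plus) auto
  finally show ?thesis using k b by (intro exI[of _ "1 / (1 - b) + 2 / k"]) auto
qed

section \<open>The estimate\<close>

lemma one_plus_powr_le:
  fixes u r :: real
  assumes "0 \<le> u" "0 \<le> r" "r \<le> 1"
  shows "(1 + u) powr r \<le> 2 * (1 + u powr r)"
proof -
  have "(1 + u) powr r \<le> (2 * max 1 u) powr r"
    using assms by (intro powr_mono2) auto
  also have "\<dots> = 2 powr r * max 1 u powr r" by (simp add: powr_mult)
  also have "\<dots> \<le> 2 * (1 + u powr r)"
  proof (rule mult_mono)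
    show "2 powr r \<le> (2::real)" using powr_mono[of r 1 2] assms by simp
    show "max 1 u powr r \<le> 1 + u powr r" by (cases "u \<le> 1") (auto simp: max_def)
  qed auto
  finally show ?thesis .
qed

context killed_fk
begin

text \<open>Hoelder's inequality raises the weight to the power \<open>\<rho>\<close>; this makes
  the semigroup results available for the resulting potential.\<close>

lemma killed_fk_scale:
  assumes "0 \<le> \<rho>"
  shows "killed_fk M X \<kappa> (\<lambda>x. \<rho> * W x) (\<rho> * c) D"
proof
  show "AE y in lborel. \<bar>\<rho> * W y\<bar> \<le> \<rho> * c"
    using W_bound by eventually_elim (use assms in \<open>auto simp: abs_mult intro: mult_left_mono\<close>)
qed (use assms c_nonneg D_domain in auto)

text \<open>A power multiplies the exponent by \<open>\<rho>\<close> and leaves the survival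
  indicator as it is.\<close>

lemma wt_powr:
  assumes "0 \<le> \<rho>"
  shows "wt s x \<omega> powr \<rho> \<le> killed_fk.wt X (\<lambda>x. \<rho> * W x) D s x \<omega>"
proof -
  interpret R: killed_fk M X \<kappa> "\<lambda>x. \<rho> * W x" "\<rho> * c" D by (rule killed_fk_scale[OF assms])
  have "(LINT u:{0..s}|lborel. \<rho> * W (path_from X x \<omega> u)) = \<rho> * (LINT u:{0..s}|lborel. W (path_from X x \<omega> u))"
    unfolding set_lebesgue_integral_def by (simp add: mult.left_commute)
  then show ?thesis
    by (simp add: wt_def R.wt_def fk_weight_def exp_powr_real of_bool_def mult.commute)
qed

text \<open>Hoelder's inequality for the conjugate exponents \<open>\<rho>\<close> and \<open>q\<close>, applied to the weight and
  the cost; the \<open>\<rho>\<close>-th power of the weight is the weight of the potential \<open>\<rho> W\<close>.\<close>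

lemma weighted_cost_le:
  assumes \<rho>: "1 < \<rho>" and p: "1 \<le> p" and p': "p' = \<rho> * p / (\<rho> - 1)" and x: "x \<in> D" and s: "0 < s"
    and f: "f \<in> Lp p' D" and A: "0 < A" "fk_semigroup M X D (\<lambda>x. \<rho> * W x) s (\<lambda>_. 1) x \<le> A powr \<rho>"
    and B: "0 < B" "\<kappa> s * (LINT x:D|lborel. \<bar>f x\<bar> powr p') \<le> B powr p'"
  shows "(\<integral>\<^sup>+\<omega>. ennreal (wt s x \<omega> * \<bar>f (x + X s \<omega>)\<bar>) \<partial>M) \<le> ennreal (A * B)"
proof -
  interpret R: killed_fk M X \<kappa> "\<lambda>x. \<rho> * W x" "\<rho> * c" D by (rule killed_fk_scale) (use \<rho> in simp)
  \<comment> \<open>The exponent conjugate to \<open>\<rho>\<close>; the exponent \<open>p'\<close>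
    of the estimate is exactly \<open>q * p\<close>.\<close>
  define q where "q = \<rho> / (\<rho> - 1)"
  have q: "1 < q" "1 / \<rho> + 1 / q = 1" "q * p = p'" using \<rho> by (auto simp: q_def p' field_simps)
  have p'0: "0 < p'" using q p by (metis less_le_trans mult_pos_pos zero_less_one less_trans)
  define G where "G y = indicator D y * \<bar>f y\<bar> powr p'" for y
  have G: "integrable lborel G" using f by (simp add: Lp_def set_integrable_def G_def[abs_def])
  define I where "I = (LINT y|lborel. \<bar>G y\<bar>)"
  have I: "I = (LINT x:D|lborel. \<bar>f x\<bar> powr p')"
    unfolding I_def set_lebesgue_integral_def by (intro Bochner_Integration.integral_cong refl) (simp add: G_def)
  have E1: "(LINT \<omega>|M. R.wt s x \<omega>) \<le> A powr \<rho>" using A(2) unfolding R.T_eq by simp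
  have i1: "integrable M (R.wt s x)"
    using R.T_integrable(1)[OF s x, of "\<lambda>_. 1"] finite_measure.integrable_const[OF R.ND_finite, of 1] by simp
  have i2: "integrable M (\<lambda>\<omega>. G (x + X s \<omega>))" by (rule density_integrable(1)[OF s G])
  have "(LINT \<omega>|M. G (x + X s \<omega>)) = (LINT \<omega>|M. \<bar>G (x + X s \<omega>)\<bar>)"
    by (intro Bochner_Integration.integral_cong refl) (simp add: G_def)
  also have "\<dots> \<le> \<kappa> s * I" unfolding I_def by (rule density_integrable(2)[OF s G])
  finally have E2: "(LINT \<omega>|M. G (x + X s \<omega>)) \<le> B powr p'" using B(2) by (simp add: I)
  \<comment> \<open>A pointwise majorant of the weighted cost in which the weight and the cost
    appear in separate summands, so that its expectation uses only the two assumed bounds.\<close>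
  define g where "g \<omega> = A * B * (1 / \<rho> * (R.wt s x \<omega> / A powr \<rho>) + 1 / q * (1 / p * (G (x + X s \<omega>) / B powr p') + (1 - 1 / p)))" for \<omega>
  have gi: "integrable M g" unfolding g_def[abs_def] using i1 i2 by simp
  have le: "wt s x \<omega> * \<bar>f (x + X s \<omega>)\<bar> \<le> g \<omega>" for \<omega>
  proof -
    have "wt s x \<omega> * \<bar>f (x + X s \<omega>)\<bar> = wt s x \<omega> * (indicator D (x + X s \<omega>) * \<bar>f (x + X s \<omega>)\<bar>)"
      using wt_survive[OF s, of x \<omega>] by (cases "wt s x \<omega> = 0") auto
    also have "\<dots> \<le> A * B * (1 / \<rho> * (wt s x \<omega> powr \<rho> / A powr \<rho>) +
        1 / q * (1 / p * ((indicator D (x + X s \<omega>) * \<bar>f (x + X s \<omega>)\<bar>) powr (q * p) / B powr (q * p)) + (1 - 1 / p)))"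
      using \<rho> q p A B wt_nonneg by (intro young_three) auto
    also have "\<dots> \<le> g \<omega>"
    proof -
      have "wt s x \<omega> powr \<rho> / A powr \<rho> \<le> R.wt s x \<omega> / A powr \<rho>" by (intro divide_right_mono wt_powr) (use \<rho> in auto)
      then have m: "1 / \<rho> * (wt s x \<omega> powr \<rho> / A powr \<rho>) \<le> 1 / \<rho> * (R.wt s x \<omega> / A powr \<rho>)"
        using \<rho> by (intro mult_left_mono) auto
      have e: "(indicator D (x + X s \<omega>) * \<bar>f (x + X s \<omega>)\<bar>) powr (q * p) = G (x + X s \<omega>)"
        unfolding q(3) using p'0 by (simp add: G_def indicator_def)
      have AB: "0 \<le> A * B" using A B by simp
      show ?thesis
        unfolding g_def e unfolding q(3) by (rule mult_left_mono[OF add_right_mono[OF m] AB])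
    qed
    finally show ?thesis .
  qed
  have "(\<integral>\<^sup>+\<omega>. ennreal (wt s x \<omega> * \<bar>f (x + X s \<omega>)\<bar>) \<partial>M) \<le> (\<integral>\<^sup>+\<omega>. ennreal (g \<omega>) \<partial>M)"
    by (intro nn_integral_mono ennreal_leI le)
  also have "\<dots> = ennreal (LINT \<omega>|M. g \<omega>)"
  proof (rule nn_integral_eq_integral[OF gi AE_I2])
    show "0 \<le> g \<omega>" for \<omega> using le[of \<omega>] wt_nonneg[of s x \<omega>] by (meson abs_ge_zero mult_nonneg_nonneg order_trans)
  qed
  also have "(LINT \<omega>|M. g \<omega>) = A * B * (1 / \<rho> * ((LINT \<omega>|M. R.wt s x \<omega>) / A powr \<rho>) + 1 / q * (1 / p * ((LINT \<omega>|M. G (x + X s \<omega>)) / B powr p') + (1 - 1 / p)))"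
    unfolding g_def[abs_def] using i1 i2 prob_space by simp
  also have "\<dots> \<le> A * B * (1 / \<rho> * 1 + 1 / q * (1 / p * 1 + (1 - 1 / p)))"
  proof (intro mult_left_mono add_mono)
    show "(LINT \<omega>|M. R.wt s x \<omega>) / A powr \<rho> \<le> 1" using E1 A by (simp add: divide_le_eq_1)
    show "(LINT \<omega>|M. G (x + X s \<omega>)) / B powr p' \<le> 1" using E2 B by (simp add: divide_le_eq_1)
  qed (use A B \<rho> q p in auto)
  also have "\<dots> = A * B" using q(2) by simp
  finally show ?thesis by (simp add: ennreal_leI)
qed

text \<open>Comparison with the constant \<open>K\<close> shows that \<open>T t \<phi> x\<close> has
  an upper bound decaying exponentially; letting time grow leaves only the cost.\<close>

lemma subsolution_decay:
  assumes rate: "0 < semigroup.top_rate" and x: "x \<in> D"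
    and \<phi>: "\<phi> \<in> borel_measurable borel" "\<And>y. \<bar>\<phi> y\<bar> \<le> K"
    and le: "\<And>t. 0 < t \<Longrightarrow> \<phi> x \<le> T t \<phi> x + C"
  shows "\<phi> x \<le> C"
proof -
  obtain A where A: "0 \<le> A" "\<And>t y. 0 < t \<Longrightarrow> y \<in> D \<Longrightarrow> T t (\<lambda>_. 1) y \<le> A * exp (- semigroup.top_rate * t)"
    using semigroup.T_one_decay by auto
  have K: "0 \<le> K" using \<phi>(2)[of x] by linarith
  have L: "square_integrable ND \<phi>" "square_integrable ND (\<lambda>_. K)" "square_integrable ND (\<lambda>_. 1)"
    using semigroup.square_integrable_bounded[of \<phi> K] semigroup.square_integrable_bounded[of "\<lambda>_. K" K]
      semigroup.square_integrable_bounded[of "\<lambda>_. 1" 1] borel_imp_ND[OF \<phi>(1)] \<phi>(2) K by auto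
  have bound: "\<phi> x \<le> K * (A * exp (- semigroup.top_rate * t)) + C" if t: "0 < t" for t
  proof -
    have "T t \<phi> x \<le> T t (\<lambda>_. K) x"
      by (rule semigroup.T_mono[OF t L(1,2)]) (use \<phi>(2) x in \<open>auto simp: abs_le_iff\<close>)
    also have "\<dots> = K * T t (\<lambda>_. 1) x" using semigroup.T_scale[OF t L(3), of x K] x by simp
    also have "\<dots> \<le> K * (A * exp (- semigroup.top_rate * t))" by (intro mult_left_mono A K t x)
    finally show ?thesis using le[OF t] by linarith
  qed
  have "((\<lambda>t. exp (- semigroup.top_rate * t)) \<longlongrightarrow> 0) at_top"
  proof -
    have "filterlim (\<lambda>t. - semigroup.top_rate * t) at_bot at_top"
      using rate by (intro filterlim_tendsto_neg_mult_at_bot[OF tendsto_const]) (auto intro: filterlim_ident)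
    then show ?thesis by (rule filterlim_compose[OF exp_at_bot])
  qed
  then have "((\<lambda>t. K * (A * exp (- semigroup.top_rate * t)) + C) \<longlongrightarrow> K * (A * 0) + C) at_top"
    by (intro tendsto_intros)
  then have "\<phi> x \<le> K * (A * 0) + C"
    by (rule tendsto_lowerbound) (use bound in \<open>auto intro: eventually_mono[OF eventually_gt_at_top[of 0]]\<close>)
  then show ?thesis by simp
qed

text \<open>The constant is assembled before \<open>f\<close>, \<open>\<phi>\<close> and
  \<open>x\<close> are chosen, from the decay of the semigroup with potential
  \<open>\<rho> * W\<close>, the density bound and a time integral. Positivity of the eigenvalue for
  \<open>W\<close> itself removes the term \<open>T t \<phi> x\<close> as time grows.\<close>

theorem subsolution_bound:
  assumes growth: "\<And>t. 0 < t \<Longrightarrow> \<kappa> t \<le> A * (1 + t powr (- a))" and a: "0 \<le> a" "a < p"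
    and \<rho>: "1 < \<rho>" and p: "1 \<le> p" and p': "p' = \<rho> * p / (\<rho> - 1)"
    and rates: "0 < principal_eigenvalue M X D W" "0 < principal_eigenvalue M X D (\<lambda>x. \<rho> * W x)"
  shows "\<exists>C\<ge>0. \<forall>f \<phi>. f \<in> Lp p' D \<longrightarrow> bounded (range \<phi>) \<longrightarrow> weak_subsolution M X D W f \<phi> \<longrightarrow>
           (\<forall>x. x \<notin> D \<longrightarrow> \<phi> x = 0) \<longrightarrow> (\<forall>x\<in>D. \<phi> x \<le> C * Lp_norm p' D f)"
proof -
  interpret R: killed_fk M X \<kappa> "\<lambda>x. \<rho> * W x" "\<rho> * c" D by (rule killed_fk_scale) (use \<rho> in simp)
  let ?l = "R.semigroup.top_rate"
  have l: "0 < ?l" using rates(2) by (simp add: R.principal_eigenvalue_eq)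
  have l1: "0 < semigroup.top_rate" using rates(1) by (simp add: principal_eigenvalue_eq)
  have "p * (\<rho> - 1) \<le> p * \<rho>" using p by (intro mult_left_mono) auto
  \<comment> \<open>With \<open>a < p\<close> this yields \<open>a / p' < 1\<close>, the
    integrability of the time singularity at 0.\<close>
  then have pp: "p \<le> p'" using \<rho> by (simp add: p' field_simps)
  then have p'1: "1 \<le> p'" "0 < p'" using p by auto
  have A0: "0 \<le> A" using order_trans[OF \<kappa>_nonneg growth[of 1]] by simp
  obtain E where E: "0 \<le> E" "\<And>t y. 0 < t \<Longrightarrow> y \<in> D \<Longrightarrow> R.T t (\<lambda>_. 1) y \<le> E * exp (- ?l * t)"
    using R.semigroup.T_one_decay by auto
  have "0 \<le> a / p'" "a / p' < 1" "0 < ?l / \<rho>" using a pp p'1 l \<rho> by auto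
  then obtain C1 where C1: "0 \<le> C1"
      "(\<integral>\<^sup>+s. indicator {0<..} s * ennreal (exp (- (?l / \<rho>) * s) * (1 + s powr (- (a / p')))) \<partial>lborel) \<le> ennreal C1"
    using exp_powr_integral_finite[of "?l / \<rho>" "a / p'"] by blast
  \<comment> \<open>Adding 1 keeps the normalising constants positive, as Young's inequality divides
    by them.\<close>
  define E1 A1 where "E1 = (E + 1) powr (1 / \<rho>)" and "A1 = (A + 1) powr (1 / p')"
  have pos: "0 < E1" "0 < A1" using E(1) A0 by (auto simp: E1_def A1_def)
  define C where "C = E1 * A1 * 2 * C1"
  have C0: "0 \<le> C" using pos C1 by (simp add: C_def)
  have "\<phi> x \<le> C * Lp_norm p' D f"
    if f: "f \<in> Lp p' D" and b: "bounded (range \<phi>)" and sub: "weak_subsolution M X D W f \<phi>"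
      and out: "\<And>x. x \<notin> D \<Longrightarrow> \<phi> x = 0" and x: "x \<in> D" for f \<phi> x
  proof (rule field_le_epsilon)
    fix \<epsilon> :: real assume \<epsilon>: "0 < \<epsilon>"
    \<comment> \<open>The norm of \<open>f\<close> may be 0, while the normalisation by
      \<open>B\<close> needs a positive number; \<open>n\<close> is a slightly larger substitute.
      The surplus \<open>\<epsilon> / (C + 1)\<close> costs at most \<open>\<epsilon>\<close> after
      multiplication by \<open>C\<close>.\<close>
    define n where "n = Lp_norm p' D f + \<epsilon> / (C + 1)"
    define I where "I = (LINT x:D|lborel. \<bar>f x\<bar> powr p')"
    have I0: "0 \<le> I" unfolding I_def set_lebesgue_integral_def by (intro Bochner_Integration.integral_nonneg) auto
    have n: "0 < n" using \<epsilon> C0 by (auto simp: n_def Lp_norm_def intro!: add_nonneg_pos)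
    have "I = (I powr (1 / p')) powr p'" using I0 p'1 by (simp add: powr_powr)
    also have "\<dots> \<le> n powr p'"
      using \<epsilon> C0 p'1 by (intro powr_mono2) (auto simp: n_def Lp_norm_def I_def)
    finally have In: "I \<le> n powr p'" .
    have f_borel: "(\<lambda>y. indicator D y * f y) \<in> borel_measurable borel"
      using f by (simp add: Lp_def set_borel_measurable_def)
    \<comment> \<open>\<open>AA s\<close> to the power \<open>\<rho>\<close> dominates the semigroup
      of \<open>\<rho> * W\<close> applied to 1, and \<open>BB s\<close> to the power
      \<open>p'\<close> dominates \<open>\<kappa> s * I\<close>.\<close>
    define AA BB where "AA s = E1 * exp (- (?l / \<rho>) * s)" and "BB s = A1 * (1 + s powr (- a)) powr (1 / p') * n" for s
    have cost: "(\<integral>\<^sup>+\<omega>. ennreal (wt s x \<omega> * \<bar>f (x + X s \<omega>)\<bar>) \<partial>M) \<le> ennreal (AA s * BB s)" if s: "0 < s" for s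
    proof (rule weighted_cost_le[OF \<rho> p p' x s f])
      have pos': "0 < 1 + s powr (- a)" by (simp add: add_pos_nonneg)
      show "0 < AA s" "0 < BB s" using pos pos' n by (auto simp: AA_def BB_def)
      have "E1 powr \<rho> = E + 1" using E(1) \<rho> by (simp add: E1_def powr_powr)
      moreover have "exp (- (?l / \<rho>) * s) powr \<rho> = exp (- ?l * s)" using \<rho> by (simp add: exp_powr_real)
      ultimately have "AA s powr \<rho> = (E + 1) * exp (- ?l * s)"
        using pos by (simp add: AA_def powr_mult)
      moreover have "R.T s (\<lambda>_. 1) x \<le> (E + 1) * exp (- ?l * s)"
        using E(2)[OF s x] by (simp add: distrib_right add_increasing2)
      ultimately show "R.T s (\<lambda>_. 1) x \<le> AA s powr \<rho>" by simp
      have "A1 powr p' = A + 1" using A0 p'1 by (simp add: A1_def powr_powr)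
      moreover have "((1 + s powr (- a)) powr (1 / p')) powr p' = 1 + s powr (- a)"
        using pos' p'1 by (simp add: powr_powr)
      ultimately have "BB s powr p' = (A + 1) * (1 + s powr (- a)) * n powr p'"
        using pos n by (simp add: BB_def powr_mult)
      moreover have "\<kappa> s \<le> (A + 1) * (1 + s powr (- a))"
        using growth[OF s] pos' by (simp add: distrib_right add_increasing2)
      then have "\<kappa> s * I \<le> (A + 1) * (1 + s powr (- a)) * n powr p'"
        using In I0 A0 pos' by (intro mult_mono) auto
      ultimately show "\<kappa> s * (LINT x:D|lborel. \<bar>f x\<bar> powr p') \<le> BB s powr p'" by (simp add: I_def)
    qed
    have le: "AA s * BB s \<le> E1 * A1 * 2 * n * (exp (- (?l / \<rho>) * s) * (1 + s powr (- (a / p'))))" if s: "0 < s" for s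
    proof -
      have "(1 + s powr (- a)) powr (1 / p') \<le> 2 * (1 + (s powr (- a)) powr (1 / p'))"
        by (rule one_plus_powr_le) (use p'1 in auto)
      also have "(s powr (- a)) powr (1 / p') = s powr (- (a / p'))" by (simp add: powr_powr)
      finally have *: "(1 + s powr (- a)) powr (1 / p') \<le> 2 * (1 + s powr (- (a / p')))" .
      have "AA s * BB s = (E1 * A1 * n * exp (- (?l / \<rho>) * s)) * (1 + s powr (- a)) powr (1 / p')"
        by (simp only: AA_def BB_def mult_ac)
      also have "\<dots> \<le> (E1 * A1 * n * exp (- (?l / \<rho>) * s)) * (2 * (1 + s powr (- (a / p'))))"
        using pos n by (intro mult_left_mono *) auto
      also have "\<dots> = E1 * A1 * 2 * n * (exp (- (?l / \<rho>) * s) * (1 + s powr (- (a / p'))))"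
        by (simp only: mult_ac)
      finally show ?thesis .
    qed
    have total: "(\<integral>\<^sup>+s. indicator {0<..} s * ennreal (AA s * BB s) \<partial>lborel) \<le> ennreal (C * n)"
    proof -
      have "(\<integral>\<^sup>+s. indicator {0<..} s * ennreal (AA s * BB s) \<partial>lborel) \<le>
          (\<integral>\<^sup>+s. ennreal (E1 * A1 * 2 * n) * (indicator {0<..} s * ennreal (exp (- (?l / \<rho>) * s) * (1 + s powr (- (a / p'))))) \<partial>lborel)"
      proof (rule nn_integral_mono)
        fix s :: real
        show "indicator {0<..} s * ennreal (AA s * BB s) \<le>
          ennreal (E1 * A1 * 2 * n) * (indicator {0<..} s * ennreal (exp (- (?l / \<rho>) * s) * (1 + s powr (- (a / p')))))"
        proof (cases "0 < s")
          case True
          have "ennreal (AA s * BB s) \<le> ennreal (E1 * A1 * 2 * n * (exp (- (?l / \<rho>) * s) * (1 + s powr (- (a / p')))))"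
            by (rule ennreal_leI[OF le[OF True]])
          also have "\<dots> = ennreal (E1 * A1 * 2 * n) * ennreal (exp (- (?l / \<rho>) * s) * (1 + s powr (- (a / p'))))"
            using pos n by (intro ennreal_mult') simp
          finally show ?thesis using True by (simp only: indicator_simps greaterThan_iff mult_1)
        qed simp
      qed
      also have "\<dots> = ennreal (E1 * A1 * 2 * n) * (\<integral>\<^sup>+s. indicator {0<..} s * ennreal (exp (- (?l / \<rho>) * s) * (1 + s powr (- (a / p')))) \<partial>lborel)"
        by (rule nn_integral_cmult) measurable
      also have "\<dots> \<le> ennreal (E1 * A1 * 2 * n) * ennreal C1" by (intro mult_left_mono C1) simp
      also have "\<dots> = ennreal (E1 * A1 * 2 * n * C1)" using pos n by (intro ennreal_mult'[symmetric]) simp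
      finally show ?thesis by (simp add: C_def mult_ac)
    qed
    obtain K where K: "\<And>y. \<bar>\<phi> y\<bar> \<le> K" using b by (auto simp: bounded_iff)
    have \<phi>m: "\<phi> \<in> borel_measurable borel"
      using sub by (intro borel_measurable_continuous_onI) (simp add: weak_subsolution_def)
    have "\<phi> x \<le> C * n"
    proof (rule subsolution_decay[OF l1 x \<phi>m K])
      fix t :: real assume t: "0 < t"
      have "\<phi> x \<le> (LINT \<omega>|M. (let w = path_from X x \<omega>; S = stopped_time D w t in fk_weight W w S * \<phi> (w S)))
        + (LINT \<omega>|M. (let w = path_from X x \<omega>; S = stopped_time D w t in (LINT s:{0..S}|lborel. fk_weight W w s * f (w s))))"
        using sub t x unfolding weak_subsolution_def by blast
      also have "\<dots> \<le> T t \<phi> x + C * n"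
        using stopped_expectation[where \<phi> = \<phi>, OF x t out] running_cost_le[OF x t f_borel cost total] C0 n by simp
      finally show "\<phi> x \<le> T t \<phi> x + C * n" .
    qed
    also have "C * n \<le> C * Lp_norm p' D f + \<epsilon>"
    proof -
      have "C * (\<epsilon> / (C + 1)) \<le> \<epsilon>" using C0 \<epsilon> by (simp add: field_simps)
      then show ?thesis by (simp add: n_def distrib_left)
    qed
    finally show "\<phi> x \<le> C * Lp_norm p' D f + \<epsilon>" .
  qed
  then show ?thesis using C0 by (intro exI[of _ C]) blast
qed

end

section \<open>Transfer from the modification to the given process\<close>

lemma (in complete_measure) integral_cong_AE_complete:
  fixes f g :: "'a \<Rightarrow> real"
  assumes ae: "AE x in M. f x = g x"
  shows "integral\<^sup>L M f = integral\<^sup>L M g"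
proof (cases "f \<in> borel_measurable M")
  case True
  moreover have "g \<in> borel_measurable M"
    by (rule borel_measurable_AE_eq[OF True]) (use ae in eventually_elim, simp)
  ultimately show ?thesis using ae by (intro integral_cong_AE)
next
  case False
  \<comment> \<open>By completeness both functions fail to be measurable together, and both
    integrals take the default value 0.\<close>
  moreover have "g \<notin> borel_measurable M"
    using borel_measurable_AE_eq[of g f] ae False by blast
  ultimately have "\<not> integrable M f" "\<not> integrable M g" by auto
  then show ?thesis by (simp add: not_integrable_integral_eq)
qed

lemma exit_time_cong:
  assumes "\<And>t. 0 \<le> t \<Longrightarrow> w t = w' t"
  shows "exit_time D w = exit_time D w'"
proof -
  have "{t. 0 < t \<and> w t \<notin> D} = {t. 0 < t \<and> w' t \<notin> D}" using assms by auto
  then show ?thesis by (simp add: exit_time_def)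
qed

lemma fk_weight_cong:
  assumes "\<And>t. 0 \<le> t \<Longrightarrow> w t = w' t"
  shows "fk_weight W w t = fk_weight W w' t"
proof -
  have "(LINT s:{0..t}|lborel. W (w s)) = (LINT s:{0..t}|lborel. W (w' s))"
    unfolding set_lebesgue_integral_def using assms
    by (intro Bochner_Integration.integral_cong refl) (auto simp: indicator_def)
  then show ?thesis by (simp add: fk_weight_def)
qed

lemma stopped_time_nonneg: "0 \<le> t \<Longrightarrow> 0 \<le> stopped_time D w t"
proof -
  assume "0 \<le> t"
  moreover have "0 \<le> exit_time D w" unfolding exit_time_def by (rule Inf_greatest) auto
  ultimately show ?thesis by (simp add: stopped_time_def real_of_ereal_pos)
qed

context subordinate_brownian_motion
begin

lemma path_from_Xn: "\<omega> \<in> good \<Longrightarrow> 0 \<le> t \<Longrightarrow> path_from X x \<omega> t = path_from Xn x \<omega> t"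
  by (simp add: path_from_def Xn_eq)

lemma fk_semigroup_Xn:
  assumes t: "0 \<le> t"
  shows "fk_semigroup M X D W t f x = fk_semigroup M Xn D W t f x"
  unfolding fk_semigroup_def
proof (rule integral_cong_AE_complete, use good(2) in eventually_elim)
  case (elim \<omega>)
  note eq = path_from_Xn[OF elim]
  show ?case
    using exit_time_cong[of "path_from X x \<omega>" "path_from Xn x \<omega>" D, OF eq]
      fk_weight_cong[of "path_from X x \<omega>" "path_from Xn x \<omega>" W t, OF eq] eq[OF t, of x] by simp
qed

text \<open>The graph sees the process only through the semigroup at small positive times, where
  both processes give the same function.\<close>

lemma principal_eigenvalue_Xn: "principal_eigenvalue M X D W = principal_eigenvalue M Xn D W"
proof -
  have "((\<lambda>t. Lp_norm 2 D (\<lambda>x. (\<xi> x - fk_semigroup M X D W t \<xi> x) / t - \<eta> x)) \<longlongrightarrow> 0) (at_right 0) \<longleftrightarrow>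
    ((\<lambda>t. Lp_norm 2 D (\<lambda>x. (\<xi> x - fk_semigroup M Xn D W t \<xi> x) / t - \<eta> x)) \<longlongrightarrow> 0) (at_right 0)" for \<xi> \<eta>
    by (intro tendsto_cong) (auto simp: eventually_at_right_field fk_semigroup_Xn intro!: exI[of _ 1])
  then have "schroedinger_graph M X D W = schroedinger_graph M Xn D W"
    by (simp add: schroedinger_graph_def)
  then show ?thesis by (simp add: principal_eigenvalue_def schroedinger_eigenvalue_def)
qed

text \<open>The definition asks for no integrability of \<open>f\<close> along paths, so the
  expectations must agree including default values; this is why the congruence without measurability
  assumptions is used.\<close>

lemma weak_subsolution_Xn: "weak_subsolution M X D V f \<phi> \<longleftrightarrow> weak_subsolution M Xn D V f \<phi>"
proof -
  have
    "(LINT \<omega>|M. (let w = path_from X x \<omega>; T = stopped_time D w t in fk_weight V w T * \<phi> (w T))) =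
     (LINT \<omega>|M. (let w = path_from Xn x \<omega>; T = stopped_time D w t in fk_weight V w T * \<phi> (w T)))" (is ?A)
    "(LINT \<omega>|M. (let w = path_from X x \<omega>; T = stopped_time D w t in (LINT s:{0..T}|lborel. fk_weight V w s * f (w s)))) =
     (LINT \<omega>|M. (let w = path_from Xn x \<omega>; T = stopped_time D w t in (LINT s:{0..T}|lborel. fk_weight V w s * f (w s))))" (is ?B)
    if t: "0 < t" for t x
  proof -
    have eqs: "stopped_time D (path_from X x \<omega>) t = stopped_time D (path_from Xn x \<omega>) t"
      "fk_weight V (path_from X x \<omega>) s = fk_weight V (path_from Xn x \<omega>) s" if "\<omega> \<in> good" for \<omega> s
      using exit_time_cong[of "path_from X x \<omega>" "path_from Xn x \<omega>" D, OF path_from_Xn[OF that]]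
        fk_weight_cong[of "path_from X x \<omega>" "path_from Xn x \<omega>" V, OF path_from_Xn[OF that]]
      by (auto simp: stopped_time_def)
    show ?A
    proof (rule integral_cong_AE_complete, use good(2) in eventually_elim)
      case (elim \<omega>)
      show ?case using path_from_Xn[OF elim] stopped_time_nonneg[of t D] t by (simp add: eqs[OF elim] Let_def)
    qed
    show ?B
    proof (rule integral_cong_AE_complete, use good(2) in eventually_elim)
      case (elim \<omega>)
      have "(LINT s:{0..T}|lborel. fk_weight V (path_from X x \<omega>) s * f (path_from X x \<omega> s)) =
          (LINT s:{0..T}|lborel. fk_weight V (path_from Xn x \<omega>) s * f (path_from Xn x \<omega> s))" for T
        unfolding set_lebesgue_integral_def
        by (intro Bochner_Integration.integral_cong refl) (auto simp: indicator_def eqs[OF elim] path_from_Xn[OF elim])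
      then show ?case by (simp add: eqs(1)[OF elim] Let_def)
    qed
  qed
  then show ?thesis unfolding weak_subsolution_def by simp
qed

end

theorem theorem4p7:
  fixes M :: "'w measure"
    and \<Psi> :: "real \<Rightarrow> real"
    and B :: "real \<Rightarrow> 'w \<Rightarrow> 'a::euclidean_space"
    and S :: "real \<Rightarrow> 'w \<Rightarrow> real"
    and X :: "real \<Rightarrow> 'w \<Rightarrow> 'a"
    and V :: "'a \<Rightarrow> real"
    and D :: "'a set"
    and \<Lambda> :: "real \<Rightarrow> real"
    and \<mu> c \<theta> \<rho> p p' :: real
    and \<rho>' :: ereal
  assumes Psi: "bernstein0 \<Psi>" "strict_mono_on {0<..} \<Psi>"
    and scaling: "\<mu> > 0" "c \<in> {0<..1}" "\<theta> \<ge> 0" "weak_lower_scaling \<mu> c \<theta> \<Psi>"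
    and process: "subordinate_brownian_motion M \<Psi> B S X"
    and V: "V \<in> Linfty"
    and D: "bounded_domain D" "regular_boundary M X D" "exterior_approximable M X D"
    and Lambda: "\<And>s. \<Lambda> s = principal_eigenvalue M X D (\<lambda>x. s * V x)"
    and pos: "\<Lambda> 1 > 0"
    and rho': "\<rho>' = Inf (ereal ` {s. s \<ge> 1 \<and> \<Lambda> s \<le> 0})"
    and rho: "1 < \<rho>" "ereal \<rho> < \<rho>'"
    and p: "p \<ge> 1" "p > real DIM('a) / (2 * \<mu>)"
    and p': "p' = \<rho> * p / (\<rho> - 1)"
  shows "\<exists>C::real. \<forall>f \<phi>.
           f \<in> Lp p' D \<longrightarrow> bounded (range \<phi>) \<longrightarrow> weak_subsolution M X D V f \<phi> \<longrightarrow>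
           (\<forall>x. x \<notin> D \<longrightarrow> \<phi> x = 0) \<longrightarrow>
           (SUP x\<in>D. max (\<phi> x) 0) \<le> C * Lp_norm p' D f"
proof -
  interpret subordinate_brownian_motion M \<Psi> B S X by (rule process)
  obtain A where A: "levy_paths M Xn (\<lambda>t. A * (1 + t powr (- (real DIM('a) / (2 * \<mu>)))))"
    using levy_paths_Xn[OF Psi scaling] by blast
  obtain K where K: "AE y in lborel. \<bar>V y\<bar> \<le> K" and V_borel: "V \<in> borel_measurable borel"
    using V by (auto simp: Linfty_def)
  interpret killed_fk M Xn "\<lambda>t. A * (1 + t powr (- (real DIM('a) / (2 * \<mu>))))" V "\<bar>K\<bar>" D
  proof (intro killed_fk.intro A killed_fk_axioms.intro V_borel D)
    show "AE y in lborel. \<bar>V y\<bar> \<le> \<bar>K\<bar>" using K by eventually_elim simp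
  qed simp
  \<comment> \<open>\<open>\<rho>\<close> exceeds 1 and lies below the infimum of the parameters
    with nonpositive eigenvalue, so it cannot be one of them.\<close>
  have "\<Lambda> \<rho> > 0"
  proof (rule ccontr)
    assume "\<not> \<Lambda> \<rho> > 0"
    then have "ereal \<rho> \<in> ereal ` {s. s \<ge> 1 \<and> \<Lambda> s \<le> 0}" using rho(1) by auto
    then have "\<rho>' \<le> ereal \<rho>" unfolding rho' by (rule Inf_lower)
    then show False using rho(2) by simp
  qed
  then have rates: "0 < principal_eigenvalue M Xn D V" "0 < principal_eigenvalue M Xn D (\<lambda>x. \<rho> * V x)"
    using pos by (simp_all add: Lambda principal_eigenvalue_Xn)
  have "0 \<le> real DIM('a) / (2 * \<mu>)" using scaling(1) by simp
  then obtain C where C: "0 \<le> C" "\<And>f \<phi> x. f \<in> Lp p' D \<Longrightarrow> bounded (range \<phi>) \<Longrightarrow> weak_subsolution M Xn D V f \<phi> \<Longrightarrow>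
      (\<forall>x. x \<notin> D \<longrightarrow> \<phi> x = 0) \<Longrightarrow> x \<in> D \<Longrightarrow> \<phi> x \<le> C * Lp_norm p' D f"
    using subsolution_bound[OF order_refl _ p(2) rho(1) p(1) p' rates] by blast
  have "(SUP x\<in>D. max (\<phi> x) 0) \<le> C * Lp_norm p' D f"
    if "f \<in> Lp p' D" "bounded (range \<phi>)" "weak_subsolution M X D V f \<phi>" "\<forall>x. x \<notin> D \<longrightarrow> \<phi> x = 0" for f \<phi>
  proof (rule cSUP_least)
    show "D \<noteq> {}" by (rule D_props)
    \<comment> \<open>Nonnegativity of the right side turns the bound on \<open>\<phi>\<close> into
      one on its positive part.\<close>
    have "0 \<le> C * Lp_norm p' D f" using C(1) by (simp add: Lp_norm_def)
    then show "max (\<phi> x) 0 \<le> C * Lp_norm p' D f" if "x \<in> D" for x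
      using C(2)[of f \<phi> x] that \<open>f \<in> Lp p' D\<close> \<open>bounded (range \<phi>)\<close> \<open>weak_subsolution M X D V f \<phi>\<close>
        \<open>\<forall>x. x \<notin> D \<longrightarrow> \<phi> x = 0\<close> by (simp add: weak_subsolution_Xn)
  qed
  then show ?thesis by blast
qed

end
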